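(* Let $\mathsf{Rel}$ be a $p$-dimensional parametric model of System F (with respect to a class $M$ of good isomorphisms). Then $\mathsf{Rel}$ gives a sound model of System F in which (i) every type $\Gamma\vdash T$ is interpreted as a face map- and degeneracy-preserving cubical functor $[\![\Gamma\vdash T]\!]:|\mathsf{Rel}|^{|\Gamma|}\to\mathsf{Rel}$, where $|\Gamma|$ is the number of type variables in $\Gamma$; (ii) every term $\Gamma;\Delta\vdash t:T$ is interpreted as a face map- and degeneracy-preserving cubical natural transformation $[\![\Gamma;\Delta\vdash t:T]\!]:[\![\Gamma\vdash\Delta]\!]\to[\![\Gamma\vdash T]\!]$, where $[\![\Gamma\vdash\Delta]\!]$ is the interpretation of the term context. Soundness means: whenever $\Gamma;\Delta\vdash s=_{\beta\eta}t:T$, then $[\![\Gamma;\Delta\vdash s:T]\!]=[\![\Gamma;\Delta\vdash t:T]\!]$.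
   Context: Fix a finitely complete, locally small category $\mathcal{C}$; $\mathsf{Cat}(\mathcal{C})$ is the category of categories internal to $\mathcal{C}$, and all categories, functors, natural transformations, terminal objects, products and exponentials below are internal to $\mathcal{C}$ (for an internal category $\mathcal{X}$, $\mathcal{X}_0,\mathcal{X}_1$ are its objects of objects and of morphisms). Fix $p\in\mathbb{N}\cup\{\infty\}$. The category $\square$ has as objects the levels $l=\{0,\dots,l-1\}$ ($l\in\mathbb{N}$); a morphism $l_1\to l_2$ is a function $l_1\to l_2+\{\top,\bot\}$; identities are inclusions; $(g\circ f)(i)=\star$ if $f(i)=\star\in\{\top,\bot\}$ and $=g(j)$ if $f(i)=j\in\mathbb{N}$. For $\star\in\{\top,\bot\}$ and $k\le l$ the face map $\mathbf{f}_\star(l,k):l+1\to l$ sends $i\mapsto i$ ($i<k$), $k\mapsto\star$, $i\mapsto i-1$ ($i>k$); the degeneracy $\mathbf{d}(l,k):l\to l+1$ sends $i\mapsto i$ ($i<k$), $i\mapsto i+1$ ($i\ge k$). $\square_p$ is the subcategory of $\square$ generated by the levels $l\le p$ and the face maps and degeneracies with $l<p$. A ($p$-dimensional) cubical category is a functor $\mathcal{X}:\square_p\to\mathsf{Cat}(\mathcal{C})$; $|\mathcal{X}|$ is its levelwise discrete version and $\mathcal{X}^n$ its levelwise $n$-fold product. A cubical functor $\mathcal{F}:\mathcal{X}\to\mathcal{Y}$ is a family of functors $\mathcal{F}(l):\mathcal{X}(l)\to\mathcal{Y}(l)$, $l\le p$; it is face map-preserving if $\mathcal{Y}(h)\circ\mathcal{F}(l_1)=\mathcal{F}(l_2)\circ\mathcal{X}(h)$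 for each face map $h:l_1\to l_2$ of $\square_p$, and degeneracy-preserving if for each degeneracy $h:l_1\to l_2$ of $\square_p$ it comes with a chosen natural isomorphism $\varepsilon_\mathcal{F}(h):\mathcal{Y}(h)\circ\mathcal{F}(l_1)\to\mathcal{F}(l_2)\circ\mathcal{X}(h)$. A cubical natural transformation $\eta:\mathcal{F}\to\mathcal{G}$ is a family of natural transformations $\eta(l):\mathcal{F}(l)\to\mathcal{G}(l)$; it is face map-preserving if $\mathcal{F},\mathcal{G}$ are and $\mathcal{Y}(h)(\eta(l_1)X)=\eta(l_2)(\mathcal{X}(h)X)$ for every face map $h:l_1\to l_2$ and object $X$ of $\mathcal{X}(l_1)$; it is degeneracy-preserving if $\mathcal{F},\mathcal{G}$ are and $\eta(l_2)(\mathcal{X}(h)X)\circ\varepsilon_\mathcal{F}(h)X=\varepsilon_\mathcal{G}(h)X\circ\mathcal{Y}(h)(\eta(l_1)X)$ for every degeneracy $h:l_1\to l_2$ and object $X$ of $\mathcal{X}(l_1)$. $\mathsf{Rel}$ is a $p$-dimensional cubical category equipped with a class $M=\sum_{l\le p}M(l)$ of good isomorphisms: $M(l)$ consists of morphisms $J\to\mathsf{Rel}(l)_1$ in $\mathcal{C}$ that are isomorphisms of $\mathsf{Rel}(l)$, contains all identities, and is closed under composition, inverses and reindexing by morphisms of $\mathcal{C}$. The category $|\mathsf{Rel}|^n\to\mathsf{Rel}$ has objects triples $(\mathcal{F},\varepsilon_\mathcal{F},\upsilon_\mathcal{F})$: $\mathcal{F}$ a face map-preserving cubical functor $|\mathsf{Rel}|^n\to\mathsf{Rel}$;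 $\varepsilon_\mathcal{F}$ natural isomorphisms witnessing degeneracy-preservation with $\varepsilon_\mathcal{F}(h)\in M(l_2)$ for each degeneracy $h:l_1\to l_2$; $\upsilon_\mathcal{F}$ assigns to each isomorphism $f:\mathsf{Rel}(l)_0^m\to\mathsf{Rel}(l)_1^n$ with all $\pi_k\circ f\in M(l)$ an isomorphism $\upsilon_\mathcal{F}(f):\mathsf{Rel}(l)_0^m\to\mathsf{Rel}(l)_1$ in $M(l)$, respecting source, target, identities, composition and reindexing. Its morphisms are face map- and degeneracy-preserving cubical natural transformations. $\mathsf{Ctx}(\mathsf{Rel})$ has natural numbers as objects; morphisms $n\to m$ are $m$-tuples of objects of $|\mathsf{Rel}|^n\to\mathsf{Rel}$ (composition by substitution). $\int_n|\mathsf{Rel}|^n\to\mathsf{Rel}$ has objects pairs $(n,\mathcal{F})$ with $\mathcal{F}$ an object of $|\mathsf{Rel}|^n\to\mathsf{Rel}$, and morphisms $(n,\mathcal{F})\to(m,\mathcal{G})$ pairs $(\mathbf{F},\eta)$ with $\mathbf{F}:n\to m$ in $\mathsf{Ctx}(\mathsf{Rel})$ and $\eta:\mathcal{F}\to\mathcal{G}\circ\mathbf{F}$ in $|\mathsf{Rel}|^n\to\mathsf{Rel}$. $\mathsf{Rel}$ has terminal objects stable under face maps and degeneracies if there are chosen terminal objects $1_l$ of $\mathsf{Rel}(l)$ with $\mathsf{Rel}(h)1_{l_1}=1_{l_2}$ for face maps $h$, and up to an isomorphism in $M(l_2)$ for degeneracies $h$. It has products stable under face maps and degeneracies if there are chosen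 products $(\times_l,\mathsf{fst}_l,\mathsf{snd}_l)$ in each $\mathsf{Rel}(l)$, each $M(l)$ closed under products, such that for face maps $h:l_1\to l_2$: $\mathsf{Rel}(h)(A\times_{l_1}B)=\mathsf{Rel}(h)A\times_{l_2}\mathsf{Rel}(h)B$, $\mathsf{Rel}(h)(\mathsf{fst}_{l_1}[A,B])=\mathsf{fst}_{l_2}[\mathsf{Rel}(h)A,\mathsf{Rel}(h)B]$ and likewise for $\mathsf{snd}$; and for degeneracies $h$ the first equation holds up to an isomorphism $\varepsilon(h,A,B)\in M(l_2)$ with $\mathsf{fst}_{l_2}[\ldots]\circ\varepsilon(h,A,B)=\mathsf{Rel}(h)(\mathsf{fst}_{l_1}[A,B])$ and likewise for $\mathsf{snd}$. It has exponentials stable under face maps and degeneracies if additionally there are chosen exponentials $(\Rightarrow_l,\mathsf{eval}_l)$ in each $\mathsf{Rel}(l)$, each $M(l)$ closed under exponentials, with $\mathsf{Rel}(h)(A\Rightarrow_{l_1}B)=\mathsf{Rel}(h)A\Rightarrow_{l_2}\mathsf{Rel}(h)B$ and $\mathsf{Rel}(h)(\mathsf{eval}_{l_1}[A,B])=\mathsf{eval}_{l_2}[\mathsf{Rel}(h)A,\mathsf{Rel}(h)B]$ for face maps $h$, and for degeneracies $h$ the first equation holding up to an isomorphism $\upsilon(h,A,B)\in M(l_2)$ with $\mathsf{eval}_{l_2}[\mathsf{Rel}(h)A,\mathsf{Rel}(h)B]\circ(\upsilon(h,A,B)\times_{l_2}1)\circ\varepsilon(h,A\Rightarrow_{l_1}B,A)=\mathsf{Rel}(h)(\mathsf{eval}_{l_1}[A,B])$.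 A split fibration $U:\mathcal{E}\to\mathcal{B}$ with distinguished object $\Omega$ and chosen products $(-)\times\Omega$ in $\mathcal{B}$ has split simple $\Omega$-products if there are chosen right adjoints $\forall_A:\mathcal{E}_{A\times\Omega}\to\mathcal{E}_A$ to the weakening functors $\mathsf{fst}[A,\Omega]^*$, with units $\eta_A$ and counits $\varepsilon_A$, such that for every $f:A\to B$: $f^*\circ\forall_B=\forall_A\circ(f\times1)^*$, $f^*(\eta_B(X))=\eta_A(f^*X)$, and $(f\times1)^*(\varepsilon_B(X))=\varepsilon_A((f\times1)^*X)$. $\mathsf{Rel}$ is a $p$-dimensional parametric model of System F if it has terminal objects, products and exponentials, all stable under face maps and degeneracies, and the forgetful functor $\int_n|\mathsf{Rel}|^n\to\mathsf{Rel}\ \longrightarrow\ \mathsf{Ctx}(\mathsf{Rel})$ has split simple $1$-products (with $m\times1=m+1$ in $\mathsf{Ctx}(\mathsf{Rel})$). *)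

theory Defs
  imports Main "HOL-Library.FuncSet" "HOL-Library.Extended_Nat"
begin

section \<open>Categories, functors, finite limits\<close>

text \<open>Hom-collections are sets of elements of a HOL type, so every category in this sense is
  locally small.\<close>

record ('o, 'a) category =
  Obj :: "'o set"
  Arr :: "'a set"
  Dom :: "'a \<Rightarrow> 'o"
  Cod :: "'a \<Rightarrow> 'o"
  Ide :: "'o \<Rightarrow> 'a"
  Comp :: "'a \<Rightarrow> 'a \<Rightarrow> 'a"  (infixr "\<cdot>\<index>" 70)

definition hom :: "('o, 'a) category \<Rightarrow> 'o \<Rightarrow> 'o \<Rightarrow> 'a set" where
  "hom C a b = {f \<in> Arr C. Dom C f = a \<and> Cod C f = b}"

locale category =
  fixes C :: "('o, 'a) category" (structure)
  assumes Dom_Obj: "f \<in> Arr C \<Longrightarrow> Dom C f \<in> Obj C"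
    and Cod_Obj: "f \<in> Arr C \<Longrightarrow> Cod C f \<in> Obj C"
    and Ide_hom: "a \<in> Obj C \<Longrightarrow> Ide C a \<in> hom C a a"
    and Comp_hom: "\<lbrakk>f \<in> hom C a b; g \<in> hom C b c\<rbrakk> \<Longrightarrow> g \<cdot> f \<in> hom C a c"
    and Comp_Ide_right: "f \<in> hom C a b \<Longrightarrow> f \<cdot> Ide C a = f"
    and Comp_Ide_left: "f \<in> hom C a b \<Longrightarrow> Ide C b \<cdot> f = f"
    and Comp_assoc: "\<lbrakk>f \<in> hom C a b; g \<in> hom C b c; h \<in> hom C c d\<rbrakk>
      \<Longrightarrow> (h \<cdot> g) \<cdot> f = h \<cdot> (g \<cdot> f)"

record ('o1, 'a1, 'o2, 'a2) functr =
  on_obj :: "'o1 \<Rightarrow> 'o2"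
  on_arr :: "'a1 \<Rightarrow> 'a2"

definition is_functor ::
  "('o1, 'a1) category \<Rightarrow> ('o2, 'a2) category \<Rightarrow> ('o1, 'a1, 'o2, 'a2) functr \<Rightarrow> bool" where
  "is_functor A B F \<longleftrightarrow>
     (\<forall>x \<in> Obj A. on_obj F x \<in> Obj B) \<and>
     (\<forall>f \<in> Arr A. on_arr F f \<in> hom B (on_obj F (Dom A f)) (on_obj F (Cod A f))) \<and>
     (\<forall>x \<in> Obj A. on_arr F (Ide A x) = Ide B (on_obj F x)) \<and>
     (\<forall>f \<in> Arr A. \<forall>g \<in> Arr A. Dom A g = Cod A f \<longrightarrow>
        on_arr F (g \<cdot>\<^bsub>A\<^esub> f) = on_arr F g \<cdot>\<^bsub>B\<^esub> on_arr F f)"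

definition is_cone :: "('j, 'b) category \<Rightarrow> ('o, 'a) category \<Rightarrow> ('j, 'b, 'o, 'a) functr
    \<Rightarrow> 'o \<Rightarrow> ('j \<Rightarrow> 'a) \<Rightarrow> bool" where
  "is_cone J C D L \<pi> \<longleftrightarrow> L \<in> Obj C \<and> (\<forall>j \<in> Obj J. \<pi> j \<in> hom C L (on_obj D j)) \<and>
     (\<forall>a \<in> Arr J. on_arr D a \<cdot>\<^bsub>C\<^esub> \<pi> (Dom J a) = \<pi> (Cod J a))"

definition is_limit :: "('j, 'b) category \<Rightarrow> ('o, 'a) category \<Rightarrow> ('j, 'b, 'o, 'a) functr
    \<Rightarrow> 'o \<Rightarrow> ('j \<Rightarrow> 'a) \<Rightarrow> bool" where
  "is_limit J C D L \<pi> \<longleftrightarrow> is_cone J C D L \<pi> \<and>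
     (\<forall>K \<kappa>. is_cone J C D K \<kappa> \<longrightarrow>
        (\<exists>!h. h \<in> hom C K L \<and> (\<forall>j \<in> Obj J. \<pi> j \<cdot>\<^bsub>C\<^esub> h = \<kappa> j)))"

text \<open>Every finite category is isomorphic to one whose objects and arrows are natural numbers.\<close>

definition finitely_complete :: "('o, 'a) category \<Rightarrow> bool" where
  "finitely_complete C \<longleftrightarrow> category C \<and>
     (\<forall>(J :: (nat, nat) category) D.
        category J \<and> finite (Obj J) \<and> finite (Arr J) \<and> is_functor J C D \<longrightarrow>
        (\<exists>L \<pi>. is_limit J C D L \<pi>))"

definition is_terminal :: "('o, 'a) category \<Rightarrow> 'o \<Rightarrow> bool" where
  "is_terminal C T \<longleftrightarrow> T \<in> Obj C \<and> (\<forall>J \<in> Obj C. \<exists>!h. h \<in> hom C J T)"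

definition term_ob :: "('o, 'a) category \<Rightarrow> 'o" where
  "term_ob C = (SOME T. is_terminal C T)"

definition bang :: "('o, 'a) category \<Rightarrow> 'o \<Rightarrow> 'a" where
  "bang C J = (THE h. h \<in> hom C J (term_ob C))"

definition is_power :: "('o, 'a) category \<Rightarrow> 'o \<Rightarrow> nat \<Rightarrow> 'o \<times> (nat \<Rightarrow> 'a) \<Rightarrow> bool" where
  "is_power C X n c \<longleftrightarrow> fst c \<in> Obj C \<and> (\<forall>i<n. snd c i \<in> hom C (fst c) X) \<and>
     (\<forall>J \<in> Obj C. \<forall>f. (\<forall>i<n. f i \<in> hom C J X) \<longrightarrow>
        (\<exists>!h. h \<in> hom C J (fst c) \<and> (\<forall>i<n. snd c i \<cdot>\<^bsub>C\<^esub> h = f i)))"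

definition power_cone :: "('o, 'a) category \<Rightarrow> 'o \<Rightarrow> nat \<Rightarrow> 'o \<times> (nat \<Rightarrow> 'a)" where
  "power_cone C X n = (SOME c. is_power C X n c)"

definition pow :: "('o, 'a) category \<Rightarrow> 'o \<Rightarrow> nat \<Rightarrow> 'o" where
  "pow C X n = fst (power_cone C X n)"

definition proj :: "('o, 'a) category \<Rightarrow> 'o \<Rightarrow> nat \<Rightarrow> nat \<Rightarrow> 'a" where
  "proj C X n i = snd (power_cone C X n) i"

definition tup :: "('o, 'a) category \<Rightarrow> 'o \<Rightarrow> 'o \<Rightarrow> nat \<Rightarrow> (nat \<Rightarrow> 'a) \<Rightarrow> 'a" where
  "tup C J X n f = (THE h. h \<in> hom C J (pow C X n) \<and> (\<forall>i<n. proj C X n i \<cdot>\<^bsub>C\<^esub> h = f i))"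

definition pow_map :: "('o, 'a) category \<Rightarrow> nat \<Rightarrow> 'a \<Rightarrow> 'a" where
  "pow_map C n u =
     tup C (pow C (Dom C u) n) (Cod C u) n (\<lambda>i. u \<cdot>\<^bsub>C\<^esub> proj C (Dom C u) n i)"

definition pair :: "('o, 'a) category \<Rightarrow> 'a \<Rightarrow> 'a \<Rightarrow> 'a" where
  "pair C f g = tup C (Dom C f) (Cod C f) 2 (\<lambda>i. if i = 0 then f else g)"

definition is_pullback :: "('o, 'a) category \<Rightarrow> 'a \<Rightarrow> 'a \<Rightarrow> 'o \<times> 'a \<times> 'a \<Rightarrow> bool" where
  "is_pullback C f g c \<longleftrightarrow> (case c of (P, p, q) \<Rightarrow>
     p \<in> hom C P (Dom C f) \<and> q \<in> hom C P (Dom C g) \<and> f \<cdot>\<^bsub>C\<^esub> p = g \<cdot>\<^bsub>C\<^esub> q \<and>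
     (\<forall>J \<in> Obj C. \<forall>u \<in> hom C J (Dom C f). \<forall>v \<in> hom C J (Dom C g).
        f \<cdot>\<^bsub>C\<^esub> u = g \<cdot>\<^bsub>C\<^esub> v \<longrightarrow>
        (\<exists>!h. h \<in> hom C J P \<and> p \<cdot>\<^bsub>C\<^esub> h = u \<and> q \<cdot>\<^bsub>C\<^esub> h = v)))"

definition pb :: "('o, 'a) category \<Rightarrow> 'a \<Rightarrow> 'a \<Rightarrow> 'o \<times> 'a \<times> 'a" where
  "pb C f g = (SOME c. is_pullback C f g c)"

definition pb_pair :: "('o, 'a) category \<Rightarrow> 'a \<Rightarrow> 'a \<Rightarrow> 'a \<Rightarrow> 'a \<Rightarrow> 'a" where
  "pb_pair C f g u v = (THE h. h \<in> hom C (Dom C u) (fst (pb C f g)) \<and>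
     fst (snd (pb C f g)) \<cdot>\<^bsub>C\<^esub> h = u \<and> snd (snd (pb C f g)) \<cdot>\<^bsub>C\<^esub> h = v)"

section \<open>Internal categories\<close>

text \<open>The composition arrow \<open>cmp\<close> is defined on the chosen pullback of \<open>src\<close> along \<open>tgt\<close>,
  i.e. on pairs \<open>(g, f)\<close> with \<open>src g = tgt f\<close>.\<close>

record ('o, 'a) icat =
  Ob :: 'o
  Mor :: 'o
  src :: 'a
  tgt :: 'a
  idn :: 'a
  cmp :: 'a

definition cpairs :: "('o, 'a) category \<Rightarrow> ('o, 'a) icat \<Rightarrow> 'o" where
  "cpairs C X = fst (pb C (src X) (tgt X))"

definition cpair1 :: "('o, 'a) category \<Rightarrow> ('o, 'a) icat \<Rightarrow> 'a" where
  "cpair1 C X = fst (snd (pb C (src X) (tgt X)))"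

definition cpair2 :: "('o, 'a) category \<Rightarrow> ('o, 'a) icat \<Rightarrow> 'a" where
  "cpair2 C X = snd (snd (pb C (src X) (tgt X)))"

text \<open>Internal statements about objects and morphisms of an internal category \<open>X\<close> are read for
  generalised elements \<open>A : J \<rightarrow> Ob X\<close> and \<open>f : J \<rightarrow> Mor X\<close>, for an arbitrary stage \<open>J\<close>.\<close>

definition ihom :: "('o, 'a) category \<Rightarrow> ('o, 'a) icat \<Rightarrow> 'a \<Rightarrow> 'a \<Rightarrow> 'a set" where
  "ihom C X A B =
     {f \<in> hom C (Dom C A) (Mor X). src X \<cdot>\<^bsub>C\<^esub> f = A \<and> tgt X \<cdot>\<^bsub>C\<^esub> f = B}"

definition icomp :: "('o, 'a) category \<Rightarrow> ('o, 'a) icat \<Rightarrow> 'a \<Rightarrow> 'a \<Rightarrow> 'a" where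
  "icomp C X g f = cmp X \<cdot>\<^bsub>C\<^esub> pb_pair C (src X) (tgt X) g f"

definition internal_category :: "('o, 'a) category \<Rightarrow> ('o, 'a) icat \<Rightarrow> bool" where
  "internal_category C X \<longleftrightarrow>
     Ob X \<in> Obj C \<and> Mor X \<in> Obj C \<and>
     src X \<in> hom C (Mor X) (Ob X) \<and> tgt X \<in> hom C (Mor X) (Ob X) \<and>
     idn X \<in> hom C (Ob X) (Mor X) \<and> cmp X \<in> hom C (cpairs C X) (Mor X) \<and>
     src X \<cdot>\<^bsub>C\<^esub> idn X = Ide C (Ob X) \<and> tgt X \<cdot>\<^bsub>C\<^esub> idn X = Ide C (Ob X) \<and>
     src X \<cdot>\<^bsub>C\<^esub> cmp X = src X \<cdot>\<^bsub>C\<^esub> cpair2 C X \<and>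
     tgt X \<cdot>\<^bsub>C\<^esub> cmp X = tgt X \<cdot>\<^bsub>C\<^esub> cpair1 C X \<and>
     (\<forall>J \<in> Obj C. \<forall>f \<in> hom C J (Mor X).
        icomp C X (idn X \<cdot>\<^bsub>C\<^esub> (tgt X \<cdot>\<^bsub>C\<^esub> f)) f = f \<and>
        icomp C X f (idn X \<cdot>\<^bsub>C\<^esub> (src X \<cdot>\<^bsub>C\<^esub> f)) = f) \<and>
     (\<forall>J \<in> Obj C. \<forall>f \<in> hom C J (Mor X). \<forall>g \<in> hom C J (Mor X). \<forall>h \<in> hom C J (Mor X).
        src X \<cdot>\<^bsub>C\<^esub> g = tgt X \<cdot>\<^bsub>C\<^esub> f \<and> src X \<cdot>\<^bsub>C\<^esub> h = tgt X \<cdot>\<^bsub>C\<^esub> g \<longrightarrow>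
        icomp C X h (icomp C X g f) = icomp C X (icomp C X h g) f)"

definition iiso :: "('o, 'a) category \<Rightarrow> ('o, 'a) icat \<Rightarrow> 'a \<Rightarrow> bool" where
  "iiso C X f \<longleftrightarrow> f \<in> Arr C \<and> Cod C f = Mor X \<and>
     (\<exists>g \<in> ihom C X (tgt X \<cdot>\<^bsub>C\<^esub> f) (src X \<cdot>\<^bsub>C\<^esub> f).
        icomp C X g f = idn X \<cdot>\<^bsub>C\<^esub> (src X \<cdot>\<^bsub>C\<^esub> f) \<and>
        icomp C X f g = idn X \<cdot>\<^bsub>C\<^esub> (tgt X \<cdot>\<^bsub>C\<^esub> f))"

definition iinv :: "('o, 'a) category \<Rightarrow> ('o, 'a) icat \<Rightarrow> 'a \<Rightarrow> 'a" where
  "iinv C X f = (THE g. g \<in> ihom C X (tgt X \<cdot>\<^bsub>C\<^esub> f) (src X \<cdot>\<^bsub>C\<^esub> f) \<and>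
     icomp C X g f = idn X \<cdot>\<^bsub>C\<^esub> (src X \<cdot>\<^bsub>C\<^esub> f) \<and>
     icomp C X f g = idn X \<cdot>\<^bsub>C\<^esub> (tgt X \<cdot>\<^bsub>C\<^esub> f))"

record ('o, 'a) ifun =
  idom :: "('o, 'a) icat"
  icod :: "('o, 'a) icat"
  f0 :: 'a
  f1 :: 'a

definition internal_functor :: "('o, 'a) category \<Rightarrow> ('o, 'a) ifun \<Rightarrow> bool" where
  "internal_functor C F \<longleftrightarrow>
     f0 F \<in> hom C (Ob (idom F)) (Ob (icod F)) \<and> f1 F \<in> hom C (Mor (idom F)) (Mor (icod F)) \<and>
     src (icod F) \<cdot>\<^bsub>C\<^esub> f1 F = f0 F \<cdot>\<^bsub>C\<^esub> src (idom F) \<and>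
     tgt (icod F) \<cdot>\<^bsub>C\<^esub> f1 F = f0 F \<cdot>\<^bsub>C\<^esub> tgt (idom F) \<and>
     f1 F \<cdot>\<^bsub>C\<^esub> idn (idom F) = idn (icod F) \<cdot>\<^bsub>C\<^esub> f0 F \<and>
     f1 F \<cdot>\<^bsub>C\<^esub> cmp (idom F) =
       icomp C (icod F) (f1 F \<cdot>\<^bsub>C\<^esub> cpair1 C (idom F)) (f1 F \<cdot>\<^bsub>C\<^esub> cpair2 C (idom F))"

definition ifid :: "('o, 'a) category \<Rightarrow> ('o, 'a) icat \<Rightarrow> ('o, 'a) ifun" where
  "ifid C X = \<lparr>idom = X, icod = X, f0 = Ide C (Ob X), f1 = Ide C (Mor X)\<rparr>"

definition ifcomp :: "('o, 'a) category \<Rightarrow> ('o, 'a) ifun \<Rightarrow> ('o, 'a) ifun \<Rightarrow> ('o, 'a) ifun" where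
  "ifcomp C G F =
     \<lparr>idom = idom F, icod = icod G, f0 = f0 G \<cdot>\<^bsub>C\<^esub> f0 F, f1 = f1 G \<cdot>\<^bsub>C\<^esub> f1 F\<rparr>"

definition Cat :: "('o, 'a) category \<Rightarrow> (('o, 'a) icat, ('o, 'a) ifun) category" where
  "Cat C = \<lparr>Obj = {X. internal_category C X},
     Arr = {F. internal_category C (idom F) \<and> internal_category C (icod F) \<and> internal_functor C F},
     Dom = idom, Cod = icod, Ide = ifid C, Comp = ifcomp C\<rparr>"

definition inat :: "('o, 'a) category \<Rightarrow> ('o, 'a) ifun \<Rightarrow> ('o, 'a) ifun \<Rightarrow> 'a \<Rightarrow> bool" where
  "inat C F G \<eta> \<longleftrightarrow> idom F = idom G \<and> icod F = icod G \<and>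
     \<eta> \<in> ihom C (icod F) (f0 F) (f0 G) \<and>
     icomp C (icod F) (\<eta> \<cdot>\<^bsub>C\<^esub> tgt (idom F)) (f1 F) =
     icomp C (icod F) (f1 G) (\<eta> \<cdot>\<^bsub>C\<^esub> src (idom F))"

definition idisc :: "('o, 'a) category \<Rightarrow> ('o, 'a) icat \<Rightarrow> ('o, 'a) icat" where
  "idisc C X = \<lparr>Ob = Ob X, Mor = Ob X, src = Ide C (Ob X), tgt = Ide C (Ob X),
     idn = Ide C (Ob X), cmp = fst (snd (pb C (Ide C (Ob X)) (Ide C (Ob X))))\<rparr>"

definition idisc_map :: "('o, 'a) category \<Rightarrow> ('o, 'a) ifun \<Rightarrow> ('o, 'a) ifun" where
  "idisc_map C F =
     \<lparr>idom = idisc C (idom F), icod = idisc C (icod F), f0 = f0 F, f1 = f0 F\<rparr>"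

definition ipow :: "('o, 'a) category \<Rightarrow> nat \<Rightarrow> ('o, 'a) icat \<Rightarrow> ('o, 'a) icat" where
  "ipow C n X = (let c = pb C (pow_map C n (src X)) (pow_map C n (tgt X)) in
     \<lparr>Ob = pow C (Ob X) n, Mor = pow C (Mor X) n,
      src = pow_map C n (src X), tgt = pow_map C n (tgt X), idn = pow_map C n (idn X),
      cmp = tup C (fst c) (Mor X) n (\<lambda>i. icomp C X
        (proj C (Mor X) n i \<cdot>\<^bsub>C\<^esub> fst (snd c)) (proj C (Mor X) n i \<cdot>\<^bsub>C\<^esub> snd (snd c)))\<rparr>)"

definition ipow_map :: "('o, 'a) category \<Rightarrow> nat \<Rightarrow> ('o, 'a) ifun \<Rightarrow> ('o, 'a) ifun" where
  "ipow_map C n F = \<lparr>idom = ipow C n (idom F), icod = ipow C n (icod F),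
     f0 = pow_map C n (f0 F), f1 = pow_map C n (f1 F)\<rparr>"

section \<open>The category of cubes\<close>

datatype endpoint = Top | Bot
datatype cval = Lev nat | End endpoint

record cube_mor =
  cdom :: nat
  ccod :: nat
  cmap :: "nat \<Rightarrow> cval"

definition cube_id :: "nat \<Rightarrow> cube_mor" where
  "cube_id l = \<lparr>cdom = l, ccod = l, cmap = restrict Lev {..<l}\<rparr>"

definition cube_comp :: "cube_mor \<Rightarrow> cube_mor \<Rightarrow> cube_mor" where
  "cube_comp g f = \<lparr>cdom = cdom f, ccod = ccod g,
     cmap = restrict (\<lambda>i. case cmap f i of Lev j \<Rightarrow> cmap g j | End e \<Rightarrow> End e) {..<cdom f}\<rparr>"

definition cube :: "(nat, cube_mor) category" where
  "cube = \<lparr>Obj = UNIV,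
     Arr = {f. cmap f \<in> {..<cdom f} \<rightarrow>\<^sub>E (Lev ` {..<ccod f} \<union> range End)},
     Dom = cdom, Cod = ccod, Ide = cube_id, Comp = cube_comp\<rparr>"

definition face :: "endpoint \<Rightarrow> nat \<Rightarrow> nat \<Rightarrow> cube_mor" where
  "face e l k = \<lparr>cdom = l + 1, ccod = l,
     cmap = restrict (\<lambda>i. if i < k then Lev i else if i = k then End e else Lev (i - 1)) {..<l + 1}\<rparr>"

definition degen :: "nat \<Rightarrow> nat \<Rightarrow> cube_mor" where
  "degen l k = \<lparr>cdom = l, ccod = l + 1,
     cmap = restrict (\<lambda>i. if i < k then Lev i else Lev (i + 1)) {..<l}\<rparr>"

inductive_set cube_arr_upto :: "enat \<Rightarrow> cube_mor set" for p :: enat where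
  cid: "enat l \<le> p \<Longrightarrow> cube_id l \<in> cube_arr_upto p"
| cface: "\<lbrakk>enat l < p; k \<le> l\<rbrakk> \<Longrightarrow> face e l k \<in> cube_arr_upto p"
| cdegen: "\<lbrakk>enat l < p; k \<le> l\<rbrakk> \<Longrightarrow> degen l k \<in> cube_arr_upto p"
| ccomp: "\<lbrakk>f \<in> cube_arr_upto p; g \<in> cube_arr_upto p; ccod f = cdom g\<rbrakk>
    \<Longrightarrow> cube_comp g f \<in> cube_arr_upto p"

definition cube_upto :: "enat \<Rightarrow> (nat, cube_mor) category" where
  "cube_upto p = cube \<lparr>Obj := {l. enat l \<le> p}, Arr := cube_arr_upto p\<rparr>"

section \<open>Cubical categories, cubical functors, cubical natural transformations\<close>

type_synonym ('o, 'a) cubcat = "(nat, cube_mor, ('o, 'a) icat, ('o, 'a) ifun) functr"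

definition cubical_category :: "('o, 'a) category \<Rightarrow> enat \<Rightarrow> ('o, 'a) cubcat \<Rightarrow> bool" where
  "cubical_category C p X \<longleftrightarrow> is_functor (cube_upto p) (Cat C) X"

definition cdisc :: "('o, 'a) category \<Rightarrow> ('o, 'a) cubcat \<Rightarrow> ('o, 'a) cubcat" where
  "cdisc C X = \<lparr>on_obj = \<lambda>l. idisc C (on_obj X l), on_arr = \<lambda>h. idisc_map C (on_arr X h)\<rparr>"

definition cpow :: "('o, 'a) category \<Rightarrow> nat \<Rightarrow> ('o, 'a) cubcat \<Rightarrow> ('o, 'a) cubcat" where
  "cpow C n X = \<lparr>on_obj = \<lambda>l. ipow C n (on_obj X l), on_arr = \<lambda>h. ipow_map C n (on_arr X h)\<rparr>"

definition cubical_functor :: "('o, 'a) category \<Rightarrow> enat \<Rightarrow> ('o, 'a) cubcat \<Rightarrow> ('o, 'a) cubcat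
    \<Rightarrow> (nat \<Rightarrow> ('o, 'a) ifun) \<Rightarrow> bool" where
  "cubical_functor C p X Y F \<longleftrightarrow> (\<forall>l. enat l \<le> p \<longrightarrow>
     internal_functor C (F l) \<and> idom (F l) = on_obj X l \<and> icod (F l) = on_obj Y l)"

definition face_preserving :: "('o, 'a) category \<Rightarrow> enat \<Rightarrow> ('o, 'a) cubcat \<Rightarrow> ('o, 'a) cubcat
    \<Rightarrow> (nat \<Rightarrow> ('o, 'a) ifun) \<Rightarrow> bool" where
  "face_preserving C p X Y F \<longleftrightarrow> (\<forall>e l k. enat l < p \<and> k \<le> l \<longrightarrow>
     ifcomp C (on_arr Y (face e l k)) (F (l + 1)) = ifcomp C (F l) (on_arr X (face e l k)))"

text \<open>Families indexed by the degeneracies of the cube category are indexed by the pairs \<open>(l, k)\<close>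
  with \<open>l < p\<close> and \<open>k \<le> l\<close>; distinct such pairs give distinct maps \<open>degen l k\<close>.\<close>

definition degeneracy_witness :: "('o, 'a) category \<Rightarrow> enat \<Rightarrow> ('o, 'a) cubcat \<Rightarrow> ('o, 'a) cubcat
    \<Rightarrow> (nat \<Rightarrow> ('o, 'a) ifun) \<Rightarrow> (nat \<Rightarrow> nat \<Rightarrow> 'a) \<Rightarrow> bool" where
  "degeneracy_witness C p X Y F \<epsilon> \<longleftrightarrow> (\<forall>l k. enat l < p \<and> k \<le> l \<longrightarrow>
     inat C (ifcomp C (on_arr Y (degen l k)) (F l)) (ifcomp C (F (l + 1)) (on_arr X (degen l k)))
       (\<epsilon> l k) \<and>
     iiso C (on_obj Y (l + 1)) (\<epsilon> l k))"

definition cubical_nat :: "('o, 'a) category \<Rightarrow> enat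
    \<Rightarrow> (nat \<Rightarrow> ('o, 'a) ifun) \<Rightarrow> (nat \<Rightarrow> ('o, 'a) ifun) \<Rightarrow> (nat \<Rightarrow> 'a) \<Rightarrow> bool" where
  "cubical_nat C p F G \<eta> \<longleftrightarrow> (\<forall>l. enat l \<le> p \<longrightarrow> inat C (F l) (G l) (\<eta> l))"

definition face_preserving_nat :: "('o, 'a) category \<Rightarrow> enat \<Rightarrow> ('o, 'a) cubcat \<Rightarrow> ('o, 'a) cubcat
    \<Rightarrow> (nat \<Rightarrow> ('o, 'a) ifun) \<Rightarrow> (nat \<Rightarrow> ('o, 'a) ifun) \<Rightarrow> (nat \<Rightarrow> 'a) \<Rightarrow> bool" where
  "face_preserving_nat C p X Y F G \<eta> \<longleftrightarrow>
     face_preserving C p X Y F \<and> face_preserving C p X Y G \<and>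
     (\<forall>e l k. enat l < p \<and> k \<le> l \<longrightarrow>
        f1 (on_arr Y (face e l k)) \<cdot>\<^bsub>C\<^esub> \<eta> (l + 1) = \<eta> l \<cdot>\<^bsub>C\<^esub> f0 (on_arr X (face e l k)))"

definition degeneracy_preserving_nat :: "('o, 'a) category \<Rightarrow> enat
    \<Rightarrow> ('o, 'a) cubcat \<Rightarrow> ('o, 'a) cubcat
    \<Rightarrow> (nat \<Rightarrow> ('o, 'a) ifun) \<Rightarrow> (nat \<Rightarrow> nat \<Rightarrow> 'a)
    \<Rightarrow> (nat \<Rightarrow> ('o, 'a) ifun) \<Rightarrow> (nat \<Rightarrow> nat \<Rightarrow> 'a) \<Rightarrow> (nat \<Rightarrow> 'a) \<Rightarrow> bool" where
  "degeneracy_preserving_nat C p X Y F \<epsilon>\<^sub>F G \<epsilon>\<^sub>G \<eta> \<longleftrightarrow>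
     degeneracy_witness C p X Y F \<epsilon>\<^sub>F \<and> degeneracy_witness C p X Y G \<epsilon>\<^sub>G \<and>
     (\<forall>l k. enat l < p \<and> k \<le> l \<longrightarrow>
        icomp C (on_obj Y (l + 1)) (\<eta> (l + 1) \<cdot>\<^bsub>C\<^esub> f0 (on_arr X (degen l k))) (\<epsilon>\<^sub>F l k) =
        icomp C (on_obj Y (l + 1)) (\<epsilon>\<^sub>G l k) (f1 (on_arr Y (degen l k)) \<cdot>\<^bsub>C\<^esub> \<eta> l))"

section \<open>A cubical category with good isomorphisms\<close>

record ('o, 'a) cubical_data =
  Amb :: "('o, 'a) category"
  dimn :: enat
  Rel :: "('o, 'a) cubcat"
  Good :: "nat \<Rightarrow> 'a set"

abbreviation Lv :: "('o, 'a, 'z) cubical_data_scheme \<Rightarrow> nat \<Rightarrow> ('o, 'a) icat" where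
  "Lv R l \<equiv> on_obj (Rel R) l"
abbreviation R0 :: "('o, 'a, 'z) cubical_data_scheme \<Rightarrow> nat \<Rightarrow> 'o" where
  "R0 R l \<equiv> Ob (Lv R l)"
abbreviation R1 :: "('o, 'a, 'z) cubical_data_scheme \<Rightarrow> nat \<Rightarrow> 'o" where
  "R1 R l \<equiv> Mor (Lv R l)"
abbreviation act0 :: "('o, 'a, 'z) cubical_data_scheme \<Rightarrow> cube_mor \<Rightarrow> 'a" where
  "act0 R h \<equiv> f0 (on_arr (Rel R) h)"
abbreviation act1 :: "('o, 'a, 'z) cubical_data_scheme \<Rightarrow> cube_mor \<Rightarrow> 'a" where
  "act1 R h \<equiv> f1 (on_arr (Rel R) h)"
abbreviation acomp :: "('o, 'a, 'z) cubical_data_scheme \<Rightarrow> 'a \<Rightarrow> 'a \<Rightarrow> 'a" where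
  "acomp R g f \<equiv> g \<cdot>\<^bsub>Amb R\<^esub> f"
abbreviation lcomp :: "('o, 'a, 'z) cubical_data_scheme \<Rightarrow> nat \<Rightarrow> 'a \<Rightarrow> 'a \<Rightarrow> 'a" where
  "lcomp R l g f \<equiv> icomp (Amb R) (Lv R l) g f"
abbreviation lid :: "('o, 'a, 'z) cubical_data_scheme \<Rightarrow> nat \<Rightarrow> 'a \<Rightarrow> 'a" where
  "lid R l A \<equiv> acomp R (idn (Lv R l)) A"
abbreviation lsrc :: "('o, 'a, 'z) cubical_data_scheme \<Rightarrow> nat \<Rightarrow> 'a \<Rightarrow> 'a" where
  "lsrc R l f \<equiv> acomp R (src (Lv R l)) f"
abbreviation ltgt :: "('o, 'a, 'z) cubical_data_scheme \<Rightarrow> nat \<Rightarrow> 'a \<Rightarrow> 'a" where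
  "ltgt R l f \<equiv> acomp R (tgt (Lv R l)) f"
abbreviation lhom :: "('o, 'a, 'z) cubical_data_scheme \<Rightarrow> nat \<Rightarrow> 'a \<Rightarrow> 'a \<Rightarrow> 'a set" where
  "lhom R l A B \<equiv> ihom (Amb R) (Lv R l) A B"
abbreviation linv :: "('o, 'a, 'z) cubical_data_scheme \<Rightarrow> nat \<Rightarrow> 'a \<Rightarrow> 'a" where
  "linv R l f \<equiv> iinv (Amb R) (Lv R l) f"

definition good_class :: "('o, 'a, 'z) cubical_data_scheme \<Rightarrow> bool" where
  "good_class R \<longleftrightarrow> (\<forall>l. enat l \<le> dimn R \<longrightarrow>
     (\<forall>f \<in> Good R l. iiso (Amb R) (Lv R l) f) \<and>
     (\<forall>J \<in> Obj (Amb R). \<forall>A \<in> hom (Amb R) J (R0 R l). lid R l A \<in> Good R l) \<and>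
     (\<forall>f \<in> Good R l. \<forall>g \<in> Good R l.
        Dom (Amb R) f = Dom (Amb R) g \<and> lsrc R l g = ltgt R l f \<longrightarrow> lcomp R l g f \<in> Good R l) \<and>
     (\<forall>f \<in> Good R l. linv R l f \<in> Good R l) \<and>
     (\<forall>f \<in> Good R l. \<forall>u \<in> Arr (Amb R).
        Cod (Amb R) u = Dom (Amb R) f \<longrightarrow> acomp R f u \<in> Good R l))"

section \<open>The categories of functors out of powers of the discrete cubical category\<close>

abbreviation discpow :: "('o, 'a, 'z) cubical_data_scheme \<Rightarrow> nat \<Rightarrow> ('o, 'a) cubcat" where
  "discpow R n \<equiv> cpow (Amb R) n (cdisc (Amb R) (Rel R))"

text \<open>The isomorphisms \<open>f\<close> from some power of \<open>R0 R l\<close> to the \<open>n\<close>-th power of \<open>R1 R l\<close>, all of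
  whose components are good.\<close>

definition good_tuples :: "('o, 'a, 'z) cubical_data_scheme \<Rightarrow> nat \<Rightarrow> nat \<Rightarrow> 'a set" where
  "good_tuples R n l = {f.
     (\<exists>m. f \<in> hom (Amb R) (pow (Amb R) (R0 R l) m) (pow (Amb R) (R1 R l) n)) \<and>
     iiso (Amb R) (ipow (Amb R) n (Lv R l)) f \<and>
     (\<forall>k<n. acomp R (proj (Amb R) (R1 R l) n k) f \<in> Good R l)}"

text \<open>Components of the following records are \<open>undefined\<close> outside their intended domain, so that
  equality of records is equality of the intended data.\<close>

record ('o, 'a) relfun =
  rfun :: "nat \<Rightarrow> ('o, 'a) ifun"
  reps :: "nat \<Rightarrow> nat \<Rightarrow> 'a"
  rups :: "nat \<Rightarrow> 'a \<Rightarrow> 'a"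

record ('o, 'a) relnat =
  rdom :: "('o, 'a) relfun"
  rcod :: "('o, 'a) relfun"
  rnat :: "nat \<Rightarrow> 'a"

definition mk_relfun :: "('o, 'a, 'z) cubical_data_scheme \<Rightarrow> nat \<Rightarrow> (nat \<Rightarrow> ('o, 'a) ifun)
    \<Rightarrow> (nat \<Rightarrow> nat \<Rightarrow> 'a) \<Rightarrow> (nat \<Rightarrow> 'a \<Rightarrow> 'a) \<Rightarrow> ('o, 'a) relfun" where
  "mk_relfun R n F \<epsilon> \<upsilon> =
     \<lparr>rfun = \<lambda>l. if enat l \<le> dimn R then F l else undefined,
      reps = \<lambda>l k. if enat l < dimn R \<and> k \<le> l then \<epsilon> l k else undefined,
      rups = \<lambda>l f. if enat l \<le> dimn R \<and> f \<in> good_tuples R n l then \<upsilon> l f else undefined\<rparr>"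

definition mk_relnat :: "('o, 'a, 'z) cubical_data_scheme
    \<Rightarrow> ('o, 'a) relfun \<Rightarrow> ('o, 'a) relfun \<Rightarrow> (nat \<Rightarrow> 'a) \<Rightarrow> ('o, 'a) relnat" where
  "mk_relnat R F G \<eta> =
     \<lparr>rdom = F, rcod = G, rnat = \<lambda>l. if enat l \<le> dimn R then \<eta> l else undefined\<rparr>"

definition is_relfun :: "('o, 'a, 'z) cubical_data_scheme \<Rightarrow> nat \<Rightarrow> ('o, 'a) relfun \<Rightarrow> bool" where
  "is_relfun R n F \<longleftrightarrow>
     F = mk_relfun R n (rfun F) (reps F) (rups F) \<and>
     cubical_functor (Amb R) (dimn R) (discpow R n) (Rel R) (rfun F) \<and>
     face_preserving (Amb R) (dimn R) (discpow R n) (Rel R) (rfun F) \<and>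
     degeneracy_witness (Amb R) (dimn R) (discpow R n) (Rel R) (rfun F) (reps F) \<and>
     (\<forall>l k. enat l < dimn R \<and> k \<le> l \<longrightarrow> reps F l k \<in> Good R (l + 1)) \<and>
     (\<forall>l. enat l \<le> dimn R \<longrightarrow>
        (\<forall>f \<in> good_tuples R n l.
           rups F l f \<in> Good R l \<and>
           rups F l f \<in> lhom R l
             (acomp R (f0 (rfun F l)) (acomp R (src (ipow (Amb R) n (Lv R l))) f))
             (acomp R (f0 (rfun F l)) (acomp R (tgt (ipow (Amb R) n (Lv R l))) f))) \<and>
        (\<forall>m. \<forall>A \<in> hom (Amb R) (pow (Amb R) (R0 R l) m) (pow (Amb R) (R0 R l) n).
           rups F l (acomp R (idn (ipow (Amb R) n (Lv R l))) A) =
           lid R l (acomp R (f0 (rfun F l)) A)) \<and>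
        (\<forall>f \<in> good_tuples R n l. \<forall>g \<in> good_tuples R n l.
           Dom (Amb R) f = Dom (Amb R) g \<and>
           acomp R (src (ipow (Amb R) n (Lv R l))) g = acomp R (tgt (ipow (Amb R) n (Lv R l))) f \<longrightarrow>
           rups F l (icomp (Amb R) (ipow (Amb R) n (Lv R l)) g f) =
           lcomp R l (rups F l g) (rups F l f)) \<and>
        (\<forall>f \<in> good_tuples R n l. \<forall>m. \<forall>u \<in> hom (Amb R) (pow (Amb R) (R0 R l) m) (Dom (Amb R) f).
           rups F l (acomp R f u) = acomp R (rups F l f) u))"

definition is_relnat :: "('o, 'a, 'z) cubical_data_scheme \<Rightarrow> nat \<Rightarrow> ('o, 'a) relnat \<Rightarrow> bool" where
  "is_relnat R n \<eta> \<longleftrightarrow>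
     \<eta> = mk_relnat R (rdom \<eta>) (rcod \<eta>) (rnat \<eta>) \<and>
     is_relfun R n (rdom \<eta>) \<and> is_relfun R n (rcod \<eta>) \<and>
     cubical_nat (Amb R) (dimn R) (rfun (rdom \<eta>)) (rfun (rcod \<eta>)) (rnat \<eta>) \<and>
     face_preserving_nat (Amb R) (dimn R) (discpow R n) (Rel R)
       (rfun (rdom \<eta>)) (rfun (rcod \<eta>)) (rnat \<eta>) \<and>
     degeneracy_preserving_nat (Amb R) (dimn R) (discpow R n) (Rel R)
       (rfun (rdom \<eta>)) (reps (rdom \<eta>)) (rfun (rcod \<eta>)) (reps (rcod \<eta>)) (rnat \<eta>)"

definition rid :: "('o, 'a, 'z) cubical_data_scheme \<Rightarrow> ('o, 'a) relfun \<Rightarrow> ('o, 'a) relnat" where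
  "rid R F = mk_relnat R F F (\<lambda>l. lid R l (f0 (rfun F l)))"

definition rcomp :: "('o, 'a, 'z) cubical_data_scheme
    \<Rightarrow> ('o, 'a) relnat \<Rightarrow> ('o, 'a) relnat \<Rightarrow> ('o, 'a) relnat" where
  "rcomp R \<theta> \<eta> = mk_relnat R (rdom \<eta>) (rcod \<theta>) (\<lambda>l. lcomp R l (rnat \<theta> l) (rnat \<eta> l))"

definition FunCat :: "('o, 'a, 'z) cubical_data_scheme \<Rightarrow> nat
    \<Rightarrow> (('o, 'a) relfun, ('o, 'a) relnat) category" where
  "FunCat R n = \<lparr>Obj = {F. is_relfun R n F}, Arr = {\<eta>. is_relnat R n \<eta>},
     Dom = rdom, Cod = rcod, Ide = rid R, Comp = rcomp R\<rparr>"

section \<open>Contexts and substitution\<close>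

text \<open>An internal functor out of a discrete category is determined by its object part.\<close>

definition disc_fun :: "('o, 'a, 'z) cubical_data_scheme \<Rightarrow> nat \<Rightarrow> nat \<Rightarrow> 'a \<Rightarrow> ('o, 'a) ifun" where
  "disc_fun R n l u =
     \<lparr>idom = on_obj (discpow R n) l, icod = Lv R l, f0 = u, f1 = lid R l u\<rparr>"

definition rproj :: "('o, 'a, 'z) cubical_data_scheme \<Rightarrow> nat \<Rightarrow> nat \<Rightarrow> ('o, 'a) relfun" where
  "rproj R n i = mk_relfun R n
     (\<lambda>l. disc_fun R n l (proj (Amb R) (R0 R l) n i))
     (\<lambda>l k. lid R (l + 1) (acomp R (act0 R (degen l k)) (proj (Amb R) (R0 R l) n i)))
     (\<lambda>l f. acomp R (proj (Amb R) (R1 R l) n i) f)"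

definition objtup ::
  "('o, 'a, 'z) cubical_data_scheme \<Rightarrow> nat \<Rightarrow> ('o, 'a) relfun list \<Rightarrow> nat \<Rightarrow> 'a" where
  "objtup R n Fs l = tup (Amb R) (pow (Amb R) (R0 R l) n) (R0 R l) (length Fs)
     (\<lambda>i. f0 (rfun (Fs ! i) l))"

text \<open>Substitution of \<open>Fs\<close> into \<open>G\<close>. For a degeneracy \<open>d = degen l k\<close>, the witness for the
  composite is \<open>G (d X) \<rightarrow> \<dots>\<close> followed by the action \<open>\<upsilon>\<close> of \<open>G\<close> on the tuple of witnesses of
  the \<open>Fs\<close>. This tuple has domain \<open>R0 R l ^ n\<close> whereas \<open>\<upsilon>\<close> at level \<open>l + 1\<close> takes tuples
  defined on powers of \<open>R0 R (l + 1)\<close>. It is therefore first reindexed along a face map \<open>f\<close> with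
  \<open>f \<circ> d = 1\<close>, and the result is reindexed back along \<open>d\<close>; as \<open>\<upsilon>\<close> respects reindexing, the
  choice of \<open>f\<close> is irrelevant.\<close>

definition eps_tuple :: "('o, 'a, 'z) cubical_data_scheme \<Rightarrow> nat \<Rightarrow> ('o, 'a) relfun list
    \<Rightarrow> nat \<Rightarrow> nat \<Rightarrow> 'a" where
  "eps_tuple R n Fs l k = tup (Amb R) (pow (Amb R) (R0 R l) n) (R1 R (l + 1)) (length Fs)
     (\<lambda>i. reps (Fs ! i) l k)"

definition rsubst :: "('o, 'a, 'z) cubical_data_scheme \<Rightarrow> nat
    \<Rightarrow> ('o, 'a) relfun \<Rightarrow> ('o, 'a) relfun list \<Rightarrow> ('o, 'a) relfun" where
  "rsubst R n G Fs = mk_relfun R n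
     (\<lambda>l. disc_fun R n l (acomp R (f0 (rfun G l)) (objtup R n Fs l)))
     (\<lambda>l k. lcomp R (l + 1)
        (acomp R
          (rups G (l + 1)
            (acomp R (eps_tuple R n Fs l k) (pow_map (Amb R) n (act0 R (face Top l k)))))
          (pow_map (Amb R) n (act0 R (degen l k))))
        (acomp R (reps G l k) (objtup R n Fs l)))
     (\<lambda>l f. rups G l (tup (Amb R) (Dom (Amb R) f) (R1 R l) (length Fs) (\<lambda>i. rups (Fs ! i) l f)))"

definition rwhisker :: "('o, 'a, 'z) cubical_data_scheme \<Rightarrow> nat
    \<Rightarrow> ('o, 'a) relnat \<Rightarrow> ('o, 'a) relfun list \<Rightarrow> ('o, 'a) relnat" where
  "rwhisker R n \<theta> Fs = mk_relnat R (rsubst R n (rdom \<theta>) Fs) (rsubst R n (rcod \<theta>) Fs)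
     (\<lambda>l. acomp R (rnat \<theta> l) (objtup R n Fs l))"

text \<open>An arrow \<open>n \<rightarrow> m\<close> is a pair \<open>(n, Fs)\<close> with \<open>length Fs = m\<close>.\<close>

type_synonym ('o, 'a) ctxmap = "nat \<times> ('o, 'a) relfun list"

definition Ctx :: "('o, 'a, 'z) cubical_data_scheme \<Rightarrow> (nat, ('o, 'a) ctxmap) category" where
  "Ctx R = \<lparr>Obj = UNIV, Arr = {(n, Fs). \<forall>F \<in> set Fs. is_relfun R n F},
     Dom = fst, Cod = (\<lambda>f. length (snd f)),
     Ide = (\<lambda>n. (n, map (rproj R n) [0..<n])),
     Comp = (\<lambda>g f. (fst f, map (\<lambda>G. rsubst R (fst f) G (snd f)) (snd g)))\<rparr>"

record ('o, 'a) intmap =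
  int_dom :: "nat \<times> ('o, 'a) relfun"
  int_cod :: "nat \<times> ('o, 'a) relfun"
  int_base :: "('o, 'a) ctxmap"
  int_nat :: "('o, 'a) relnat"

definition IntCat :: "('o, 'a, 'z) cubical_data_scheme
    \<Rightarrow> (nat \<times> ('o, 'a) relfun, ('o, 'a) intmap) category" where
  "IntCat R = \<lparr>Obj = {(n, F). is_relfun R n F},
     Arr = {\<phi>. is_relfun R (fst (int_dom \<phi>)) (snd (int_dom \<phi>)) \<and>
       is_relfun R (fst (int_cod \<phi>)) (snd (int_cod \<phi>)) \<and>
       int_base \<phi> \<in> hom (Ctx R) (fst (int_dom \<phi>)) (fst (int_cod \<phi>)) \<and>
       int_nat \<phi> \<in> hom (FunCat R (fst (int_dom \<phi>))) (snd (int_dom \<phi>))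
         (rsubst R (fst (int_dom \<phi>)) (snd (int_cod \<phi>)) (snd (int_base \<phi>)))},
     Dom = int_dom, Cod = int_cod,
     Ide = (\<lambda>(n, F). \<lparr>int_dom = (n, F), int_cod = (n, F), int_base = Ide (Ctx R) n,
       int_nat = rid R F\<rparr>),
     Comp = (\<lambda>\<psi> \<phi>. \<lparr>int_dom = int_dom \<phi>, int_cod = int_cod \<psi>,
       int_base = int_base \<psi> \<cdot>\<^bsub>Ctx R\<^esub> int_base \<phi>,
       int_nat = rcomp R (rwhisker R (fst (int_dom \<phi>)) (int_nat \<psi>) (snd (int_base \<phi>)))
         (int_nat \<phi>)\<rparr>)\<rparr>"

definition forget :: "(nat \<times> ('o, 'a) relfun, ('o, 'a) intmap, nat, ('o, 'a) ctxmap) functr" where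
  "forget = \<lparr>on_obj = fst, on_arr = int_base\<rparr>"

definition int_lift :: "('o, 'a, 'z) cubical_data_scheme
    \<Rightarrow> ('o, 'a) ctxmap \<Rightarrow> nat \<times> ('o, 'a) relfun \<Rightarrow> ('o, 'a) intmap" where
  "int_lift R f X = (let F = rsubst R (fst f) (snd X) (snd f) in
     \<lparr>int_dom = (fst f, F), int_cod = X, int_base = f, int_nat = rid R F\<rparr>)"

section \<open>Split fibrations and split simple products\<close>

definition split_fibration :: "('e, 'f) category \<Rightarrow> ('b, 'c) category
    \<Rightarrow> ('e, 'f, 'b, 'c) functr \<Rightarrow> ('c \<Rightarrow> 'e \<Rightarrow> 'f) \<Rightarrow> bool" where
  "split_fibration E B U lft \<longleftrightarrow> category E \<and> category B \<and> is_functor E B U \<and>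
     (\<forall>f \<in> Arr B. \<forall>X \<in> Obj E. on_obj U X = Cod B f \<longrightarrow>
        lft f X \<in> Arr E \<and> Cod E (lft f X) = X \<and> on_arr U (lft f X) = f \<and>
        (\<forall>\<psi> \<in> Arr E. \<forall>g. Cod E \<psi> = X \<and> g \<in> hom B (on_obj U (Dom E \<psi>)) (Dom B f) \<and>
           on_arr U \<psi> = f \<cdot>\<^bsub>B\<^esub> g \<longrightarrow>
           (\<exists>!\<chi>. \<chi> \<in> hom E (Dom E \<psi>) (Dom E (lft f X)) \<and> on_arr U \<chi> = g \<and>
              lft f X \<cdot>\<^bsub>E\<^esub> \<chi> = \<psi>))) \<and>
     (\<forall>X \<in> Obj E. lft (Ide B (on_obj U X)) X = Ide E X) \<and>
     (\<forall>f \<in> Arr B. \<forall>g \<in> Arr B. \<forall>X \<in> Obj E. Cod B g = Dom B f \<and> on_obj U X = Cod B f \<longrightarrow>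
        lft (f \<cdot>\<^bsub>B\<^esub> g) X = lft f X \<cdot>\<^bsub>E\<^esub> lft g (Dom E (lft f X)))"

definition fibre :: "('e, 'f) category \<Rightarrow> ('b, 'c) category \<Rightarrow> ('e, 'f, 'b, 'c) functr \<Rightarrow> 'b
    \<Rightarrow> ('e, 'f) category" where
  "fibre E B U A = E \<lparr>Obj := {X \<in> Obj E. on_obj U X = A},
     Arr := {\<phi> \<in> Arr E. on_obj U (Dom E \<phi>) = A \<and> on_obj U (Cod E \<phi>) = A \<and> on_arr U \<phi> = Ide B A}\<rparr>"

definition reindex :: "('e, 'f) category \<Rightarrow> ('b, 'c) category \<Rightarrow> ('e, 'f, 'b, 'c) functr
    \<Rightarrow> ('c \<Rightarrow> 'e \<Rightarrow> 'f) \<Rightarrow> 'c \<Rightarrow> ('e, 'f, 'e, 'f) functr" where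
  "reindex E B U lft f = \<lparr>on_obj = \<lambda>X. Dom E (lft f X),
     on_arr = \<lambda>\<phi>. THE \<chi>. \<chi> \<in> hom E (Dom E (lft f (Dom E \<phi>))) (Dom E (lft f (Cod E \<phi>))) \<and>
       on_arr U \<chi> = Ide B (Dom B f) \<and>
       lft f (Cod E \<phi>) \<cdot>\<^bsub>E\<^esub> \<chi> = \<phi> \<cdot>\<^bsub>E\<^esub> lft f (Dom E \<phi>)\<rparr>"

text \<open>\<open>F : A \<rightarrow> B\<close> is left adjoint to \<open>G : B \<rightarrow> A\<close>.\<close>

definition is_adjunction :: "('o1, 'a1) category \<Rightarrow> ('o2, 'a2) category
    \<Rightarrow> ('o1, 'a1, 'o2, 'a2) functr \<Rightarrow> ('o2, 'a2, 'o1, 'a1) functr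
    \<Rightarrow> ('o1 \<Rightarrow> 'a1) \<Rightarrow> ('o2 \<Rightarrow> 'a2) \<Rightarrow> bool" where
  "is_adjunction A B F G \<eta> \<epsilon> \<longleftrightarrow> is_functor A B F \<and> is_functor B A G \<and>
     (\<forall>X \<in> Obj A. \<eta> X \<in> hom A X (on_obj G (on_obj F X))) \<and>
     (\<forall>f \<in> Arr A. \<eta> (Cod A f) \<cdot>\<^bsub>A\<^esub> f = on_arr G (on_arr F f) \<cdot>\<^bsub>A\<^esub> \<eta> (Dom A f)) \<and>
     (\<forall>Y \<in> Obj B. \<epsilon> Y \<in> hom B (on_obj F (on_obj G Y)) Y) \<and>
     (\<forall>g \<in> Arr B. g \<cdot>\<^bsub>B\<^esub> \<epsilon> (Dom B g) = \<epsilon> (Cod B g) \<cdot>\<^bsub>B\<^esub> on_arr F (on_arr G g)) \<and>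
     (\<forall>X \<in> Obj A. \<epsilon> (on_obj F X) \<cdot>\<^bsub>B\<^esub> on_arr F (\<eta> X) = Ide B (on_obj F X)) \<and>
     (\<forall>Y \<in> Obj B. on_arr G (\<epsilon> Y) \<cdot>\<^bsub>A\<^esub> \<eta> (on_obj G Y) = Ide A (on_obj G Y))"

record ('b, 'c) omega_products =
  Omega :: 'b
  xOmega :: "'b \<Rightarrow> 'b"
  ofst :: "'b \<Rightarrow> 'c"
  osnd :: "'b \<Rightarrow> 'c"

definition has_omega_products :: "('b, 'c) category \<Rightarrow> ('b, 'c) omega_products \<Rightarrow> bool" where
  "has_omega_products B P \<longleftrightarrow> Omega P \<in> Obj B \<and> (\<forall>A \<in> Obj B.
     ofst P A \<in> hom B (xOmega P A) A \<and> osnd P A \<in> hom B (xOmega P A) (Omega P) \<and>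
     (\<forall>D \<in> Obj B. \<forall>f \<in> hom B D A. \<forall>g \<in> hom B D (Omega P).
        \<exists>!h. h \<in> hom B D (xOmega P A) \<and> ofst P A \<cdot>\<^bsub>B\<^esub> h = f \<and> osnd P A \<cdot>\<^bsub>B\<^esub> h = g))"

definition times_omega :: "('b, 'c) category \<Rightarrow> ('b, 'c) omega_products \<Rightarrow> 'c \<Rightarrow> 'c" where
  "times_omega B P f = (THE h. h \<in> hom B (xOmega P (Dom B f)) (xOmega P (Cod B f)) \<and>
     ofst P (Cod B f) \<cdot>\<^bsub>B\<^esub> h = f \<cdot>\<^bsub>B\<^esub> ofst P (Dom B f) \<and>
     osnd P (Cod B f) \<cdot>\<^bsub>B\<^esub> h = osnd P (Dom B f))"

definition split_simple_products :: "('e, 'f) category \<Rightarrow> ('b, 'c) category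
    \<Rightarrow> ('e, 'f, 'b, 'c) functr \<Rightarrow> ('c \<Rightarrow> 'e \<Rightarrow> 'f) \<Rightarrow> ('b, 'c) omega_products
    \<Rightarrow> ('b \<Rightarrow> ('e, 'f, 'e, 'f) functr) \<Rightarrow> ('b \<Rightarrow> 'e \<Rightarrow> 'f) \<Rightarrow> ('b \<Rightarrow> 'e \<Rightarrow> 'f) \<Rightarrow> bool" where
  "split_simple_products E B U lft P al \<eta> \<epsilon> \<longleftrightarrow>
     split_fibration E B U lft \<and> has_omega_products B P \<and>
     (\<forall>A \<in> Obj B. is_adjunction (fibre E B U A) (fibre E B U (xOmega P A))
        (reindex E B U lft (ofst P A)) (al A) (\<eta> A) (\<epsilon> A)) \<and>
     (\<forall>f \<in> Arr B.
        (let A = Dom B f; A' = Cod B f; fx = times_omega B P f in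
         (\<forall>X \<in> Obj (fibre E B U (xOmega P A')).
            on_obj (reindex E B U lft f) (on_obj (al A') X) =
            on_obj (al A) (on_obj (reindex E B U lft fx) X)) \<and>
         (\<forall>\<phi> \<in> Arr (fibre E B U (xOmega P A')).
            on_arr (reindex E B U lft f) (on_arr (al A') \<phi>) =
            on_arr (al A) (on_arr (reindex E B U lft fx) \<phi>)) \<and>
         (\<forall>X \<in> Obj (fibre E B U A').
            on_arr (reindex E B U lft f) (\<eta> A' X) = \<eta> A (on_obj (reindex E B U lft f) X)) \<and>
         (\<forall>X \<in> Obj (fibre E B U (xOmega P A')).
            on_arr (reindex E B U lft fx) (\<epsilon> A' X) = \<epsilon> A (on_obj (reindex E B U lft fx) X))))"

text \<open>The products \<open>m \<times> 1 = m + 1\<close> in \<open>Ctx R\<close>; the new variable is the last one.\<close>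

definition ctx_products :: "('o, 'a, 'z) cubical_data_scheme \<Rightarrow> (nat, ('o, 'a) ctxmap) omega_products"
  where "ctx_products R = \<lparr>Omega = 1, xOmega = (\<lambda>m. m + 1),
     ofst = (\<lambda>m. (m + 1, map (rproj R (m + 1)) [0..<m])),
     osnd = (\<lambda>m. (m + 1, [rproj R (m + 1) m]))\<rparr>"

section \<open>Parametric models of System F\<close>

text \<open>Internal terminal objects, products and exponentials of \<open>Lv R l\<close> are arrows of the ambient
  category: \<open>one\<close> is defined on the terminal object, all others on \<open>pow (Amb R) (R0 R l) 2\<close>, the
  object of pairs of objects. The components \<open>one_eps\<close>, \<open>times_eps\<close> and \<open>expo_ups\<close> are the comparison
  isomorphisms for the degeneracies \<open>degen l k\<close>.\<close>

record ('o, 'a) model_data = "('o, 'a) cubical_data" +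
  one :: "nat \<Rightarrow> 'a"
  one_eps :: "nat \<Rightarrow> nat \<Rightarrow> 'a"
  times :: "nat \<Rightarrow> 'a"
  fst_arr :: "nat \<Rightarrow> 'a"
  snd_arr :: "nat \<Rightarrow> 'a"
  times_eps :: "nat \<Rightarrow> nat \<Rightarrow> 'a"
  expo :: "nat \<Rightarrow> 'a"
  eval_arr :: "nat \<Rightarrow> 'a"
  expo_ups :: "nat \<Rightarrow> nat \<Rightarrow> 'a"
  all_fun :: "nat \<Rightarrow> (nat \<times> ('o, 'a) relfun, ('o, 'a) intmap,
    nat \<times> ('o, 'a) relfun, ('o, 'a) intmap) functr"
  all_unit :: "nat \<Rightarrow> nat \<times> ('o, 'a) relfun \<Rightarrow> ('o, 'a) intmap"
  all_counit :: "nat \<Rightarrow> nat \<times> ('o, 'a) relfun \<Rightarrow> ('o, 'a) intmap"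

abbreviation pr2 :: "('o, 'a) model_data \<Rightarrow> 'a \<Rightarrow> 'a \<Rightarrow> 'a" where
  "pr2 R A B \<equiv> pair (Amb R) A B"

definition iprod :: "('o, 'a) model_data \<Rightarrow> nat \<Rightarrow> 'a \<Rightarrow> 'a \<Rightarrow> 'a" where
  "iprod R l A B = acomp R (times R l) (pr2 R A B)"

definition ifst :: "('o, 'a) model_data \<Rightarrow> nat \<Rightarrow> 'a \<Rightarrow> 'a \<Rightarrow> 'a" where
  "ifst R l A B = acomp R (fst_arr R l) (pr2 R A B)"

definition isnd :: "('o, 'a) model_data \<Rightarrow> nat \<Rightarrow> 'a \<Rightarrow> 'a \<Rightarrow> 'a" where
  "isnd R l A B = acomp R (snd_arr R l) (pr2 R A B)"

definition ipair :: "('o, 'a) model_data \<Rightarrow> nat \<Rightarrow> 'a \<Rightarrow> 'a \<Rightarrow> 'a" where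
  "ipair R l f g = (THE h. h \<in> lhom R l (lsrc R l f) (iprod R l (ltgt R l f) (ltgt R l g)) \<and>
     lcomp R l (ifst R l (ltgt R l f) (ltgt R l g)) h = f \<and>
     lcomp R l (isnd R l (ltgt R l f) (ltgt R l g)) h = g)"

definition iprodmap :: "('o, 'a) model_data \<Rightarrow> nat \<Rightarrow> 'a \<Rightarrow> 'a \<Rightarrow> 'a" where
  "iprodmap R l f g = ipair R l
     (lcomp R l f (ifst R l (lsrc R l f) (lsrc R l g)))
     (lcomp R l g (isnd R l (lsrc R l f) (lsrc R l g)))"

definition iexp :: "('o, 'a) model_data \<Rightarrow> nat \<Rightarrow> 'a \<Rightarrow> 'a \<Rightarrow> 'a" where
  "iexp R l A B = acomp R (expo R l) (pr2 R A B)"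

definition ieval :: "('o, 'a) model_data \<Rightarrow> nat \<Rightarrow> 'a \<Rightarrow> 'a \<Rightarrow> 'a" where
  "ieval R l A B = acomp R (eval_arr R l) (pr2 R A B)"

text \<open>The transpose \<open>D \<rightarrow> (A \<Rightarrow> B)\<close> of \<open>f : D \<times> A \<rightarrow> B\<close>.\<close>

definition icurry :: "('o, 'a) model_data \<Rightarrow> nat \<Rightarrow> 'a \<Rightarrow> 'a \<Rightarrow> 'a \<Rightarrow> 'a \<Rightarrow> 'a" where
  "icurry R l D A B f = (THE h. h \<in> lhom R l D (iexp R l A B) \<and>
     lcomp R l (ieval R l A B) (iprodmap R l h (lid R l A)) = f)"

text \<open>\<open>f \<Rightarrow> g : (A' \<Rightarrow> B) \<rightarrow> (A \<Rightarrow> B')\<close> for \<open>f : A \<rightarrow> A'\<close> and \<open>g : B \<rightarrow> B'\<close>.\<close>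

definition iexpmap :: "('o, 'a) model_data \<Rightarrow> nat \<Rightarrow> 'a \<Rightarrow> 'a \<Rightarrow> 'a" where
  "iexpmap R l f g =
     (let A = lsrc R l f; A' = ltgt R l f; B = lsrc R l g; B' = ltgt R l g; D = iexp R l A' B in
      icurry R l D A B'
        (lcomp R l g (lcomp R l (ieval R l A' B) (iprodmap R l (lid R l D) f))))"

definition stable_terminal :: "('o, 'a) model_data \<Rightarrow> bool" where
  "stable_terminal R \<longleftrightarrow>
     (\<forall>l. enat l \<le> dimn R \<longrightarrow>
        one R l \<in> hom (Amb R) (term_ob (Amb R)) (R0 R l) \<and>
        (\<forall>J \<in> Obj (Amb R). \<forall>A \<in> hom (Amb R) J (R0 R l).
           \<exists>!h. h \<in> lhom R l A (acomp R (one R l) (bang (Amb R) J)))) \<and>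
     (\<forall>e l k. enat l < dimn R \<and> k \<le> l \<longrightarrow>
        acomp R (act0 R (face e l k)) (one R (l + 1)) = one R l) \<and>
     (\<forall>l k. enat l < dimn R \<and> k \<le> l \<longrightarrow>
        one_eps R l k \<in> Good R (l + 1) \<and>
        one_eps R l k \<in> lhom R (l + 1) (acomp R (act0 R (degen l k)) (one R l)) (one R (l + 1)))"

definition stable_products :: "('o, 'a) model_data \<Rightarrow> bool" where
  "stable_products R \<longleftrightarrow>
     (\<forall>l. enat l \<le> dimn R \<longrightarrow>
        times R l \<in> hom (Amb R) (pow (Amb R) (R0 R l) 2) (R0 R l) \<and>
        fst_arr R l \<in> hom (Amb R) (pow (Amb R) (R0 R l) 2) (R1 R l) \<and>
        snd_arr R l \<in> hom (Amb R) (pow (Amb R) (R0 R l) 2) (R1 R l) \<and>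
        (\<forall>J \<in> Obj (Amb R). \<forall>A \<in> hom (Amb R) J (R0 R l). \<forall>B \<in> hom (Amb R) J (R0 R l).
           ifst R l A B \<in> lhom R l (iprod R l A B) A \<and>
           isnd R l A B \<in> lhom R l (iprod R l A B) B \<and>
           (\<forall>D \<in> hom (Amb R) J (R0 R l). \<forall>f \<in> lhom R l D A. \<forall>g \<in> lhom R l D B.
              \<exists>!h. h \<in> lhom R l D (iprod R l A B) \<and>
                lcomp R l (ifst R l A B) h = f \<and> lcomp R l (isnd R l A B) h = g)) \<and>
        (\<forall>f \<in> Good R l. \<forall>g \<in> Good R l. Dom (Amb R) f = Dom (Amb R) g \<longrightarrow>
           iprodmap R l f g \<in> Good R l)) \<and>
     (\<forall>e l k. enat l < dimn R \<and> k \<le> l \<longrightarrow>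
        (let h = face e l k in
         \<forall>J \<in> Obj (Amb R). \<forall>A \<in> hom (Amb R) J (R0 R (l + 1)). \<forall>B \<in> hom (Amb R) J (R0 R (l + 1)).
           acomp R (act0 R h) (iprod R (l + 1) A B) =
             iprod R l (acomp R (act0 R h) A) (acomp R (act0 R h) B) \<and>
           acomp R (act1 R h) (ifst R (l + 1) A B) =
             ifst R l (acomp R (act0 R h) A) (acomp R (act0 R h) B) \<and>
           acomp R (act1 R h) (isnd R (l + 1) A B) =
             isnd R l (acomp R (act0 R h) A) (acomp R (act0 R h) B))) \<and>
     (\<forall>l k. enat l < dimn R \<and> k \<le> l \<longrightarrow>
        times_eps R l k \<in> Good R (l + 1) \<and>
        times_eps R l k \<in> hom (Amb R) (pow (Amb R) (R0 R l) 2) (R1 R (l + 1)) \<and>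
        (let h = degen l k in
         \<forall>J \<in> Obj (Amb R). \<forall>A \<in> hom (Amb R) J (R0 R l). \<forall>B \<in> hom (Amb R) J (R0 R l).
           acomp R (times_eps R l k) (pr2 R A B) \<in> lhom R (l + 1)
             (acomp R (act0 R h) (iprod R l A B))
             (iprod R (l + 1) (acomp R (act0 R h) A) (acomp R (act0 R h) B)) \<and>
           lcomp R (l + 1) (ifst R (l + 1) (acomp R (act0 R h) A) (acomp R (act0 R h) B))
             (acomp R (times_eps R l k) (pr2 R A B)) = acomp R (act1 R h) (ifst R l A B) \<and>
           lcomp R (l + 1) (isnd R (l + 1) (acomp R (act0 R h) A) (acomp R (act0 R h) B))
             (acomp R (times_eps R l k) (pr2 R A B)) = acomp R (act1 R h) (isnd R l A B)))"

definition stable_exponentials :: "('o, 'a) model_data \<Rightarrow> bool" where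
  "stable_exponentials R \<longleftrightarrow>
     (\<forall>l. enat l \<le> dimn R \<longrightarrow>
        expo R l \<in> hom (Amb R) (pow (Amb R) (R0 R l) 2) (R0 R l) \<and>
        eval_arr R l \<in> hom (Amb R) (pow (Amb R) (R0 R l) 2) (R1 R l) \<and>
        (\<forall>J \<in> Obj (Amb R). \<forall>A \<in> hom (Amb R) J (R0 R l). \<forall>B \<in> hom (Amb R) J (R0 R l).
           ieval R l A B \<in> lhom R l (iprod R l (iexp R l A B) A) B \<and>
           (\<forall>D \<in> hom (Amb R) J (R0 R l). \<forall>f \<in> lhom R l (iprod R l D A) B.
              \<exists>!h. h \<in> lhom R l D (iexp R l A B) \<and>
                lcomp R l (ieval R l A B) (iprodmap R l h (lid R l A)) = f)) \<and>
        (\<forall>f \<in> Good R l. \<forall>g \<in> Good R l. Dom (Amb R) f = Dom (Amb R) g \<longrightarrow>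
           iexpmap R l f g \<in> Good R l)) \<and>
     (\<forall>e l k. enat l < dimn R \<and> k \<le> l \<longrightarrow>
        (let h = face e l k in
         \<forall>J \<in> Obj (Amb R). \<forall>A \<in> hom (Amb R) J (R0 R (l + 1)). \<forall>B \<in> hom (Amb R) J (R0 R (l + 1)).
           acomp R (act0 R h) (iexp R (l + 1) A B) =
             iexp R l (acomp R (act0 R h) A) (acomp R (act0 R h) B) \<and>
           acomp R (act1 R h) (ieval R (l + 1) A B) =
             ieval R l (acomp R (act0 R h) A) (acomp R (act0 R h) B))) \<and>
     (\<forall>l k. enat l < dimn R \<and> k \<le> l \<longrightarrow>
        expo_ups R l k \<in> Good R (l + 1) \<and>
        expo_ups R l k \<in> hom (Amb R) (pow (Amb R) (R0 R l) 2) (R1 R (l + 1)) \<and>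
        (let h = degen l k in
         \<forall>J \<in> Obj (Amb R). \<forall>A \<in> hom (Amb R) J (R0 R l). \<forall>B \<in> hom (Amb R) J (R0 R l).
           acomp R (expo_ups R l k) (pr2 R A B) \<in> lhom R (l + 1)
             (acomp R (act0 R h) (iexp R l A B))
             (iexp R (l + 1) (acomp R (act0 R h) A) (acomp R (act0 R h) B)) \<and>
           lcomp R (l + 1) (ieval R (l + 1) (acomp R (act0 R h) A) (acomp R (act0 R h) B))
             (lcomp R (l + 1)
               (iprodmap R (l + 1) (acomp R (expo_ups R l k) (pr2 R A B))
                 (lid R (l + 1) (acomp R (act0 R h) A)))
               (acomp R (times_eps R l k) (pr2 R (iexp R l A B) A))) =
           acomp R (act1 R h) (ieval R l A B)))"

text \<open>That \<open>forget\<close> is a split fibration includes that \<open>IntCat R\<close> is a category, i.e. that \<open>rwhisker\<close>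
  along context maps preserves degeneracy-preservation. This does not follow from the other
  conditions, since natural transformations out of a discrete category need not commute with the
  action \<open>rups\<close> on good isomorphisms.\<close>

definition parametric_model :: "('o, 'a) model_data \<Rightarrow> bool" where
  "parametric_model R \<longleftrightarrow>
     finitely_complete (Amb R) \<and> cubical_category (Amb R) (dimn R) (Rel R) \<and> good_class R \<and>
     stable_terminal R \<and> stable_products R \<and> stable_exponentials R \<and>
     split_simple_products (IntCat R) (Ctx R) forget (int_lift R) (ctx_products R)
       (all_fun R) (all_unit R) (all_counit R)"

section \<open>System F\<close>

text \<open>De Bruijn indices for both type and term variables. \<open>Lam T t\<close> is \<open>\<lambda>x:T. t\<close> and \<open>TLam t\<close> is
  \<open>\<Lambda>X. t\<close>. A type context is the number \<open>n\<close> of its type variables.\<close>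

datatype ty = TVar nat | Fun ty ty | All ty
datatype tm = Var nat | Lam ty tm | App tm tm | TLam tm | TApp tm ty

definition up_ren :: "(nat \<Rightarrow> nat) \<Rightarrow> nat \<Rightarrow> nat" where
  "up_ren \<rho> = case_nat 0 (\<lambda>i. Suc (\<rho> i))"

primrec ren_ty :: "(nat \<Rightarrow> nat) \<Rightarrow> ty \<Rightarrow> ty" where
  "ren_ty \<rho> (TVar i) = TVar (\<rho> i)"
| "ren_ty \<rho> (Fun S T) = Fun (ren_ty \<rho> S) (ren_ty \<rho> T)"
| "ren_ty \<rho> (All T) = All (ren_ty (up_ren \<rho>) T)"

definition up_sub_ty :: "(nat \<Rightarrow> ty) \<Rightarrow> nat \<Rightarrow> ty" where
  "up_sub_ty \<sigma> = case_nat (TVar 0) (\<lambda>i. ren_ty Suc (\<sigma> i))"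

primrec sub_ty :: "(nat \<Rightarrow> ty) \<Rightarrow> ty \<Rightarrow> ty" where
  "sub_ty \<sigma> (TVar i) = \<sigma> i"
| "sub_ty \<sigma> (Fun S T) = Fun (sub_ty \<sigma> S) (sub_ty \<sigma> T)"
| "sub_ty \<sigma> (All T) = All (sub_ty (up_sub_ty \<sigma>) T)"

abbreviation inst_ty :: "ty \<Rightarrow> ty \<Rightarrow> ty" where
  "inst_ty T S \<equiv> sub_ty (case_nat S TVar) T"

primrec ren_tm :: "(nat \<Rightarrow> nat) \<Rightarrow> tm \<Rightarrow> tm" where
  "ren_tm \<rho> (Var i) = Var (\<rho> i)"
| "ren_tm \<rho> (Lam T t) = Lam T (ren_tm (up_ren \<rho>) t)"
| "ren_tm \<rho> (App t u) = App (ren_tm \<rho> t) (ren_tm \<rho> u)"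
| "ren_tm \<rho> (TLam t) = TLam (ren_tm \<rho> t)"
| "ren_tm \<rho> (TApp t S) = TApp (ren_tm \<rho> t) S"

primrec sub_ty_tm :: "(nat \<Rightarrow> ty) \<Rightarrow> tm \<Rightarrow> tm" where
  "sub_ty_tm \<sigma> (Var i) = Var i"
| "sub_ty_tm \<sigma> (Lam T t) = Lam (sub_ty \<sigma> T) (sub_ty_tm \<sigma> t)"
| "sub_ty_tm \<sigma> (App t u) = App (sub_ty_tm \<sigma> t) (sub_ty_tm \<sigma> u)"
| "sub_ty_tm \<sigma> (TLam t) = TLam (sub_ty_tm (up_sub_ty \<sigma>) t)"
| "sub_ty_tm \<sigma> (TApp t S) = TApp (sub_ty_tm \<sigma> t) (sub_ty \<sigma> S)"

abbreviation weaken_ty :: "ty \<Rightarrow> ty" where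
  "weaken_ty \<equiv> ren_ty Suc"
abbreviation weaken_ty_tm :: "tm \<Rightarrow> tm" where
  "weaken_ty_tm \<equiv> sub_ty_tm (\<lambda>i. TVar (Suc i))"

definition up_sub_tm :: "(nat \<Rightarrow> tm) \<Rightarrow> nat \<Rightarrow> tm" where
  "up_sub_tm \<sigma> = case_nat (Var 0) (\<lambda>i. ren_tm Suc (\<sigma> i))"

primrec sub_tm :: "(nat \<Rightarrow> tm) \<Rightarrow> tm \<Rightarrow> tm" where
  "sub_tm \<sigma> (Var i) = \<sigma> i"
| "sub_tm \<sigma> (Lam T t) = Lam T (sub_tm (up_sub_tm \<sigma>) t)"
| "sub_tm \<sigma> (App t u) = App (sub_tm \<sigma> t) (sub_tm \<sigma> u)"
| "sub_tm \<sigma> (TLam t) = TLam (sub_tm (\<lambda>i. weaken_ty_tm (\<sigma> i)) t)"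
| "sub_tm \<sigma> (TApp t S) = TApp (sub_tm \<sigma> t) S"

primrec wf_ty :: "nat \<Rightarrow> ty \<Rightarrow> bool" where
  "wf_ty n (TVar i) \<longleftrightarrow> i < n"
| "wf_ty n (Fun S T) \<longleftrightarrow> wf_ty n S \<and> wf_ty n T"
| "wf_ty n (All T) \<longleftrightarrow> wf_ty (Suc n) T"

inductive typing :: "nat \<Rightarrow> ty list \<Rightarrow> tm \<Rightarrow> ty \<Rightarrow> bool" where
  t_var: "\<lbrakk>\<forall>S \<in> set \<Delta>. wf_ty n S; i < length \<Delta>\<rbrakk> \<Longrightarrow> typing n \<Delta> (Var i) (\<Delta> ! i)"
| t_lam: "typing n (S # \<Delta>) t T \<Longrightarrow> typing n \<Delta> (Lam S t) (Fun S T)"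
| t_app: "\<lbrakk>typing n \<Delta> t (Fun S T); typing n \<Delta> u S\<rbrakk> \<Longrightarrow> typing n \<Delta> (App t u) T"
| t_tlam: "typing (Suc n) (map weaken_ty \<Delta>) t T \<Longrightarrow> typing n \<Delta> (TLam t) (All T)"
| t_tapp: "\<lbrakk>typing n \<Delta> t (All T); wf_ty n S\<rbrakk> \<Longrightarrow> typing n \<Delta> (TApp t S) (inst_ty T S)"

inductive beta_eta :: "nat \<Rightarrow> ty list \<Rightarrow> tm \<Rightarrow> tm \<Rightarrow> ty \<Rightarrow> bool" where
  e_refl: "typing n \<Delta> t T \<Longrightarrow> beta_eta n \<Delta> t t T"
| e_sym: "beta_eta n \<Delta> s t T \<Longrightarrow> beta_eta n \<Delta> t s T"
| e_trans: "\<lbrakk>beta_eta n \<Delta> s t T; beta_eta n \<Delta> t u T\<rbrakk> \<Longrightarrow> beta_eta n \<Delta> s u T"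
| e_lam: "beta_eta n (S # \<Delta>) s t T \<Longrightarrow> beta_eta n \<Delta> (Lam S s) (Lam S t) (Fun S T)"
| e_app: "\<lbrakk>beta_eta n \<Delta> s t (Fun S T); beta_eta n \<Delta> u v S\<rbrakk>
    \<Longrightarrow> beta_eta n \<Delta> (App s u) (App t v) T"
| e_tlam: "beta_eta (Suc n) (map weaken_ty \<Delta>) s t T \<Longrightarrow> beta_eta n \<Delta> (TLam s) (TLam t) (All T)"
| e_tapp: "\<lbrakk>beta_eta n \<Delta> s t (All T); wf_ty n S\<rbrakk>
    \<Longrightarrow> beta_eta n \<Delta> (TApp s S) (TApp t S) (inst_ty T S)"
| e_beta: "\<lbrakk>typing n (S # \<Delta>) t T; typing n \<Delta> u S\<rbrakk>
    \<Longrightarrow> beta_eta n \<Delta> (App (Lam S t) u) (sub_tm (case_nat u Var) t) T"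
| e_eta: "typing n \<Delta> t (Fun S T) \<Longrightarrow> beta_eta n \<Delta> (Lam S (App (ren_tm Suc t) (Var 0))) t (Fun S T)"
| e_tbeta: "\<lbrakk>typing (Suc n) (map weaken_ty \<Delta>) t T; wf_ty n S\<rbrakk>
    \<Longrightarrow> beta_eta n \<Delta> (TApp (TLam t) S) (sub_ty_tm (case_nat S TVar) t) (inst_ty T S)"
| e_teta: "typing n \<Delta> t (All T) \<Longrightarrow> beta_eta n \<Delta> (TLam (TApp (weaken_ty_tm t) (TVar 0))) t (All T)"

text \<open>Lambda-bound variables carry types, so a typable term has a unique type in a given context;
  \<open>the_ty \<Delta> t\<close> computes it.\<close>

primrec the_ty :: "ty list \<Rightarrow> tm \<Rightarrow> ty" where
  "the_ty \<Delta> (Var i) = \<Delta> ! i"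
| "the_ty \<Delta> (Lam S t) = Fun S (the_ty (S # \<Delta>) t)"
| "the_ty \<Delta> (App t u) = (case the_ty \<Delta> t of Fun S T \<Rightarrow> T | _ \<Rightarrow> undefined)"
| "the_ty \<Delta> (TLam t) = All (the_ty (map weaken_ty \<Delta>) t)"
| "the_ty \<Delta> (TApp t S) = (case the_ty \<Delta> t of All T \<Rightarrow> inst_ty T S | _ \<Rightarrow> undefined)"

section \<open>The interpretation\<close>

definition rone :: "('o, 'a) model_data \<Rightarrow> nat \<Rightarrow> ('o, 'a) relfun" where
  "rone R n = mk_relfun R n
     (\<lambda>l. disc_fun R n l (acomp R (one R l) (bang (Amb R) (pow (Amb R) (R0 R l) n))))
     (\<lambda>l k. acomp R (one_eps R l k) (bang (Amb R) (pow (Amb R) (R0 R l) n)))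
     (\<lambda>l f. lid R l (acomp R (one R l) (bang (Amb R) (Dom (Amb R) f))))"

definition rprod :: "('o, 'a) model_data \<Rightarrow> nat
    \<Rightarrow> ('o, 'a) relfun \<Rightarrow> ('o, 'a) relfun \<Rightarrow> ('o, 'a) relfun" where
  "rprod R n F G = mk_relfun R n
     (\<lambda>l. disc_fun R n l (iprod R l (f0 (rfun F l)) (f0 (rfun G l))))
     (\<lambda>l k. lcomp R (l + 1) (iprodmap R (l + 1) (reps F l k) (reps G l k))
        (acomp R (times_eps R l k) (pr2 R (f0 (rfun F l)) (f0 (rfun G l)))))
     (\<lambda>l f. iprodmap R l (rups F l f) (rups G l f))"

definition rexp :: "('o, 'a) model_data \<Rightarrow> nat
    \<Rightarrow> ('o, 'a) relfun \<Rightarrow> ('o, 'a) relfun \<Rightarrow> ('o, 'a) relfun" where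
  "rexp R n F G = mk_relfun R n
     (\<lambda>l. disc_fun R n l (iexp R l (f0 (rfun F l)) (f0 (rfun G l))))
     (\<lambda>l k. lcomp R (l + 1) (iexpmap R (l + 1) (linv R (l + 1) (reps F l k)) (reps G l k))
        (acomp R (expo_ups R l k) (pr2 R (f0 (rfun F l)) (f0 (rfun G l)))))
     (\<lambda>l f. iexpmap R l (linv R l (rups F l f)) (rups G l f))"

definition rfst :: "('o, 'a) model_data \<Rightarrow> nat
    \<Rightarrow> ('o, 'a) relfun \<Rightarrow> ('o, 'a) relfun \<Rightarrow> ('o, 'a) relnat" where
  "rfst R n F G = mk_relnat R (rprod R n F G) F (\<lambda>l. ifst R l (f0 (rfun F l)) (f0 (rfun G l)))"

definition rsnd :: "('o, 'a) model_data \<Rightarrow> nat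
    \<Rightarrow> ('o, 'a) relfun \<Rightarrow> ('o, 'a) relfun \<Rightarrow> ('o, 'a) relnat" where
  "rsnd R n F G = mk_relnat R (rprod R n F G) G (\<lambda>l. isnd R l (f0 (rfun F l)) (f0 (rfun G l)))"

definition rpair :: "('o, 'a) model_data \<Rightarrow> nat
    \<Rightarrow> ('o, 'a) relnat \<Rightarrow> ('o, 'a) relnat \<Rightarrow> ('o, 'a) relnat" where
  "rpair R n \<phi> \<psi> = mk_relnat R (rdom \<phi>) (rprod R n (rcod \<phi>) (rcod \<psi>))
     (\<lambda>l. ipair R l (rnat \<phi> l) (rnat \<psi> l))"

definition reval :: "('o, 'a) model_data \<Rightarrow> nat
    \<Rightarrow> ('o, 'a) relfun \<Rightarrow> ('o, 'a) relfun \<Rightarrow> ('o, 'a) relnat" where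
  "reval R n F G = mk_relnat R (rprod R n (rexp R n F G) F) G
     (\<lambda>l. ieval R l (f0 (rfun F l)) (f0 (rfun G l)))"

definition rcurry :: "('o, 'a) model_data \<Rightarrow> nat \<Rightarrow> ('o, 'a) relfun
    \<Rightarrow> ('o, 'a) relfun \<Rightarrow> ('o, 'a) relfun \<Rightarrow> ('o, 'a) relnat \<Rightarrow> ('o, 'a) relnat" where
  "rcurry R n H F G \<phi> = mk_relnat R H (rexp R n F G)
     (\<lambda>l. icurry R l (f0 (rfun H l)) (f0 (rfun F l)) (f0 (rfun G l)) (rnat \<phi> l))"

text \<open>\<open>\<phi>\<close> as a vertical arrow of \<open>IntCat R\<close> over \<open>n\<close>.\<close>

definition vert :: "('o, 'a) model_data \<Rightarrow> nat \<Rightarrow> ('o, 'a) relnat \<Rightarrow> ('o, 'a) intmap" where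
  "vert R n \<phi> = \<lparr>int_dom = (n, rdom \<phi>), int_cod = (n, rcod \<phi>),
     int_base = Ide (Ctx R) n, int_nat = \<phi>\<rparr>"

text \<open>The innermost type variable \<open>TVar 0\<close> is the last projection.\<close>

primrec ty_int :: "('o, 'a) model_data \<Rightarrow> nat \<Rightarrow> ty \<Rightarrow> ('o, 'a) relfun" where
  "ty_int R n (TVar i) = rproj R n (n - Suc i)"
| "ty_int R n (Fun S T) = rexp R n (ty_int R n S) (ty_int R n T)"
| "ty_int R n (All T) = snd (on_obj (all_fun R n) (Suc n, ty_int R (Suc n) T))"

primrec ctx_int :: "('o, 'a) model_data \<Rightarrow> nat \<Rightarrow> ty list \<Rightarrow> ('o, 'a) relfun" where
  "ctx_int R n [] = rone R n"
| "ctx_int R n (T # \<Delta>) = rprod R n (ctx_int R n \<Delta>) (ty_int R n T)"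

fun var_int :: "('o, 'a) model_data \<Rightarrow> nat \<Rightarrow> ty list \<Rightarrow> nat \<Rightarrow> ('o, 'a) relnat" where
  "var_int R n [] i = undefined"
| "var_int R n (T # \<Delta>) 0 = rsnd R n (ctx_int R n \<Delta>) (ty_int R n T)"
| "var_int R n (T # \<Delta>) (Suc i) =
     rcomp R (var_int R n \<Delta> i) (rfst R n (ctx_int R n \<Delta>) (ty_int R n T))"

text \<open>A type abstraction is interpreted by transposing along the adjunction between weakening and
  \<open>\<forall>\<close>; a type application by the counit, reindexed along \<open>\<langle>1, S\<rangle> : n \<rightarrow> n + 1\<close>.\<close>

primrec tm_int :: "('o, 'a) model_data \<Rightarrow> nat \<Rightarrow> ty list \<Rightarrow> tm \<Rightarrow> ('o, 'a) relnat" where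
  "tm_int R n \<Delta> (Var i) = var_int R n \<Delta> i"
| "tm_int R n \<Delta> (Lam S t) =
     rcurry R n (ctx_int R n \<Delta>) (ty_int R n S) (ty_int R n (the_ty (S # \<Delta>) t))
       (tm_int R n (S # \<Delta>) t)"
| "tm_int R n \<Delta> (App t u) = (case the_ty \<Delta> t of
       Fun S T \<Rightarrow> rcomp R (reval R n (ty_int R n S) (ty_int R n T))
         (rpair R n (tm_int R n \<Delta> t) (tm_int R n \<Delta> u))
     | _ \<Rightarrow> undefined)"
| "tm_int R n \<Delta> (TLam t) = int_nat
     (on_arr (all_fun R n) (vert R (Suc n) (tm_int R (Suc n) (map weaken_ty \<Delta>) t))
        \<cdot>\<^bsub>IntCat R\<^esub> all_unit R n (n, ctx_int R n \<Delta>))"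
| "tm_int R n \<Delta> (TApp t S) = (case the_ty \<Delta> t of
       All T \<Rightarrow> rcomp R
         (rwhisker R n (int_nat (all_counit R n (Suc n, ty_int R (Suc n) T)))
           (map (rproj R n) [0..<n] @ [ty_int R n S]))
         (tm_int R n \<Delta> t)
     | _ \<Rightarrow> undefined)"

end

theory Submission
  imports Defs
begin

text \<open>At every stage \<open>J\<close> of the ambient category, the generalised elements of a level of \<open>Rel\<close> form an
  ordinary cartesian closed category. Face maps and reindexing along \<open>J' \<rightarrow> J\<close> act on these as strict
  cartesian closed functors, degeneracies as functors preserving products and exponentials up to the
  given good isomorphisms. Levelwise products and exponentials therefore make the functors
  \<open>|Rel|\<^sup>n \<rightarrow> Rel\<close> a cartesian closed category: naturality with respect to the degeneracy witnesses is
  the naturality of pairing, evaluation and transposition for a pseudofunctor. Substitution along a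
  context map is again a strict cartesian closed functor, because the action on good isomorphisms is
  functorial and the degeneracy is a section of the face map used for reindexing. Split simple products
  say that quantification is right adjoint to weakening, stably under substitution. This is the
  categorical structure that interprets System F, and \<open>\<beta>\<eta>\<close>-soundness reduces to the semantic
  substitution lemmas for types and terms. For terms one may take an arbitrary map \<open>\<theta>\<close> between context
  interpretations that agrees with the syntactic substitution on variables, so that tuples of terms
  never have to be formed.\<close>

section \<open>Categories with products and exponentials\<close>

text \<open>The obstacle is the degeneracies. They preserve products and exponentials only up to
  good isomorphisms, so every functor carries witnesses, and every operation on functors or natural
  transformations must be checked against them. Exponentiation is contravariant in its first
  argument; therefore the witnesses must be invertible, and \<open>rexp\<close> contains inverses of
  good isomorphisms. For products and exponentials these checks are instances of a few equations
  about one functor between two cartesian closed categories, proved once in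
  \<open>ccc_pseudofunctor\<close>. Most laws of substitution are not computed from the formula of
  \<open>rsubst\<close>. That substitution yields functors again and is unital and associative is
  part of \<open>Ctx R\<close> being a category; that whiskering preserves degeneracy witnesses is
  closure of \<open>IntCat R\<close> under composition. Both are contained in the notion of a split
  fibration. What must be computed is that \<open>rsubst\<close> commutes with \<open>rone\<close>,
  \<open>rprod\<close> and \<open>rexp\<close>, and that the reindexing functors of
  \<open>forget\<close> are whiskering.\<close>

locale cat =
  fixes C :: "('o, 'a, 'z) category_scheme" (structure)
  assumes Dom_in [simp]: "f \<in> Arr C \<Longrightarrow> Dom C f \<in> Obj C"
    and Cod_in [simp]: "f \<in> Arr C \<Longrightarrow> Cod C f \<in> Obj C"
    and Ide_in [simp]: "a \<in> Obj C \<Longrightarrow> Ide C a \<in> Arr C"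
    and Dom_Ide [simp]: "a \<in> Obj C \<Longrightarrow> Dom C (Ide C a) = a"
    and Cod_Ide [simp]: "a \<in> Obj C \<Longrightarrow> Cod C (Ide C a) = a"
    and Comp_in [simp]: "\<lbrakk>f \<in> Arr C; g \<in> Arr C; Dom C g = Cod C f\<rbrakk> \<Longrightarrow> g \<cdot> f \<in> Arr C"
    and Dom_Comp [simp]: "\<lbrakk>f \<in> Arr C; g \<in> Arr C; Dom C g = Cod C f\<rbrakk> \<Longrightarrow> Dom C (g \<cdot> f) = Dom C f"
    and Cod_Comp [simp]: "\<lbrakk>f \<in> Arr C; g \<in> Arr C; Dom C g = Cod C f\<rbrakk> \<Longrightarrow> Cod C (g \<cdot> f) = Cod C g"
    and Comp_Ide_right [simp]: "\<lbrakk>f \<in> Arr C; Dom C f = a\<rbrakk> \<Longrightarrow> f \<cdot> Ide C a = f"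
    and Comp_Ide_left [simp]: "\<lbrakk>f \<in> Arr C; Cod C f = a\<rbrakk> \<Longrightarrow> Ide C a \<cdot> f = f"
    and Comp_assoc [simp]: "\<lbrakk>f \<in> Arr C; g \<in> Arr C; h \<in> Arr C; Dom C g = Cod C f; Dom C h = Cod C g\<rbrakk>
      \<Longrightarrow> (h \<cdot> g) \<cdot> f = h \<cdot> (g \<cdot> f)"

text \<open>\<open>cat\<close> restates the axioms with \<open>Arr\<close>, \<open>Dom\<close> and
  \<open>Cod\<close> in place of \<open>hom\<close>, so that they are conditional rewrite rules
  whose side conditions the simplifier can discharge; composites are normalised to the right. The
  record scheme lets the extension \<open>cc\<close> inherit them.\<close>

lemma category_imp_cat:
  assumes "category C"
  shows "cat C"
proof -
  interpret category C by fact
  have *: "g \<cdot>\<^bsub>C\<^esub> f \<in> Arr C \<and> Dom C (g \<cdot>\<^bsub>C\<^esub> f) = Dom C f \<and> Cod C (g \<cdot>\<^bsub>C\<^esub> f) = Cod C g"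
    if "f \<in> Arr C" "g \<in> Arr C" "Dom C g = Cod C f" for f g
    using Comp_hom[of f "Dom C f" "Cod C f" g "Cod C g"] that by (simp add: hom_def)
  show ?thesis
  proof
    show "\<lbrakk>f \<in> Arr C; g \<in> Arr C; h \<in> Arr C; Dom C g = Cod C f; Dom C h = Cod C g\<rbrakk>
      \<Longrightarrow> (h \<cdot>\<^bsub>C\<^esub> g) \<cdot>\<^bsub>C\<^esub> f = h \<cdot>\<^bsub>C\<^esub> (g \<cdot>\<^bsub>C\<^esub> f)" for f g h
      using Comp_assoc[of f "Dom C f" "Cod C f" g "Cod C g" h "Cod C h"] by (simp add: hom_def)
  qed (use Ide_hom Dom_Obj Cod_Obj Comp_Ide_right Comp_Ide_left * in \<open>auto simp: hom_def\<close>)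
qed

text \<open>Products and exponentials are chosen operations, so that preservation by a functor is a
  system of equations. The record is instantiated twice: by the generalised elements of a level
  (\<open>stage\<close>) and by the functors out of a power (\<open>fcc\<close>).\<close>

record ('o, 'a) cc = "('o, 'a) category" +
  prd :: "'o \<Rightarrow> 'o \<Rightarrow> 'o"
  pfst :: "'o \<Rightarrow> 'o \<Rightarrow> 'a"
  psnd :: "'o \<Rightarrow> 'o \<Rightarrow> 'a"
  ppair :: "'a \<Rightarrow> 'a \<Rightarrow> 'a"
  expn :: "'o \<Rightarrow> 'o \<Rightarrow> 'o"
  evl :: "'o \<Rightarrow> 'o \<Rightarrow> 'a"
  cur :: "'o \<Rightarrow> 'o \<Rightarrow> 'o \<Rightarrow> 'a \<Rightarrow> 'a"

definition pmap :: "('o, 'a, 'z) cc_scheme \<Rightarrow> 'a \<Rightarrow> 'a \<Rightarrow> 'a" where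
  "pmap S f g = ppair S (f \<cdot>\<^bsub>S\<^esub> pfst S (Dom S f) (Dom S g)) (g \<cdot>\<^bsub>S\<^esub> psnd S (Dom S f) (Dom S g))"

text \<open>For f : a -> a' and g : b -> b' this is the arrow from a' => b to a => b', contravariant
  in f. The formula is that of \<open>iexpmap\<close>, so at a \<open>stage\<close> the two agree by
  unfolding.\<close>

definition emap :: "('o, 'a, 'z) cc_scheme \<Rightarrow> 'a \<Rightarrow> 'a \<Rightarrow> 'a" where
  "emap S f g = cur S (expn S (Cod S f) (Dom S g)) (Dom S f) (Cod S g)
     (g \<cdot>\<^bsub>S\<^esub> (evl S (Cod S f) (Dom S g) \<cdot>\<^bsub>S\<^esub> pmap S (Ide S (expn S (Cod S f) (Dom S g))) f))"

text \<open>Uniqueness of pairings and transposes is expressed by the equations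
  \<open>ppair_eta\<close> and \<open>cur_eta\<close>; together with the beta laws they amount to
  the universal properties.\<close>

locale ccc = cat S for S :: "('o, 'a, 'z) cc_scheme" (structure) +
  assumes prd_in [simp]: "\<lbrakk>a \<in> Obj S; b \<in> Obj S\<rbrakk> \<Longrightarrow> prd S a b \<in> Obj S"
    and pfst_in [simp]: "\<lbrakk>a \<in> Obj S; b \<in> Obj S\<rbrakk> \<Longrightarrow> pfst S a b \<in> Arr S"
    and psnd_in [simp]: "\<lbrakk>a \<in> Obj S; b \<in> Obj S\<rbrakk> \<Longrightarrow> psnd S a b \<in> Arr S"
    and Dom_pfst [simp]: "\<lbrakk>a \<in> Obj S; b \<in> Obj S\<rbrakk> \<Longrightarrow> Dom S (pfst S a b) = prd S a b"
    and Dom_psnd [simp]: "\<lbrakk>a \<in> Obj S; b \<in> Obj S\<rbrakk> \<Longrightarrow> Dom S (psnd S a b) = prd S a b"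
    and Cod_pfst [simp]: "\<lbrakk>a \<in> Obj S; b \<in> Obj S\<rbrakk> \<Longrightarrow> Cod S (pfst S a b) = a"
    and Cod_psnd [simp]: "\<lbrakk>a \<in> Obj S; b \<in> Obj S\<rbrakk> \<Longrightarrow> Cod S (psnd S a b) = b"
    and ppair_in [simp]: "\<lbrakk>f \<in> Arr S; g \<in> Arr S; Dom S g = Dom S f\<rbrakk> \<Longrightarrow> ppair S f g \<in> Arr S"
    and Dom_ppair [simp]:
      "\<lbrakk>f \<in> Arr S; g \<in> Arr S; Dom S g = Dom S f\<rbrakk> \<Longrightarrow> Dom S (ppair S f g) = Dom S f"
    and Cod_ppair [simp]:
      "\<lbrakk>f \<in> Arr S; g \<in> Arr S; Dom S g = Dom S f\<rbrakk> \<Longrightarrow> Cod S (ppair S f g) = prd S (Cod S f) (Cod S g)"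
    and pfst_ppair [simp]: "\<lbrakk>f \<in> Arr S; g \<in> Arr S; Dom S g = Dom S f; Cod S f = a; Cod S g = b\<rbrakk>
      \<Longrightarrow> pfst S a b \<cdot> ppair S f g = f"
    and psnd_ppair [simp]: "\<lbrakk>f \<in> Arr S; g \<in> Arr S; Dom S g = Dom S f; Cod S f = a; Cod S g = b\<rbrakk>
      \<Longrightarrow> psnd S a b \<cdot> ppair S f g = g"
    and ppair_eta: "\<lbrakk>h \<in> Arr S; a \<in> Obj S; b \<in> Obj S; Cod S h = prd S a b\<rbrakk>
      \<Longrightarrow> ppair S (pfst S a b \<cdot> h) (psnd S a b \<cdot> h) = h"
    and expn_in [simp]: "\<lbrakk>a \<in> Obj S; b \<in> Obj S\<rbrakk> \<Longrightarrow> expn S a b \<in> Obj S"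
    and evl_in [simp]: "\<lbrakk>a \<in> Obj S; b \<in> Obj S\<rbrakk> \<Longrightarrow> evl S a b \<in> Arr S"
    and Dom_evl [simp]: "\<lbrakk>a \<in> Obj S; b \<in> Obj S\<rbrakk> \<Longrightarrow> Dom S (evl S a b) = prd S (expn S a b) a"
    and Cod_evl [simp]: "\<lbrakk>a \<in> Obj S; b \<in> Obj S\<rbrakk> \<Longrightarrow> Cod S (evl S a b) = b"
    and cur_in [simp]: "\<lbrakk>f \<in> Arr S; d \<in> Obj S; a \<in> Obj S; Dom S f = prd S d a; Cod S f = b\<rbrakk>
      \<Longrightarrow> cur S d a b f \<in> Arr S"
    and Dom_cur [simp]: "\<lbrakk>f \<in> Arr S; d \<in> Obj S; a \<in> Obj S; Dom S f = prd S d a; Cod S f = b\<rbrakk>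
      \<Longrightarrow> Dom S (cur S d a b f) = d"
    and Cod_cur [simp]: "\<lbrakk>f \<in> Arr S; d \<in> Obj S; a \<in> Obj S; Dom S f = prd S d a; Cod S f = b\<rbrakk>
      \<Longrightarrow> Cod S (cur S d a b f) = expn S a b"
    and evl_cur: "\<lbrakk>f \<in> Arr S; d \<in> Obj S; a \<in> Obj S; Dom S f = prd S d a; Cod S f = b\<rbrakk>
      \<Longrightarrow> evl S a b \<cdot> pmap S (cur S d a b f) (Ide S a) = f"
    and cur_eta: "\<lbrakk>h \<in> Arr S; a \<in> Obj S; b \<in> Obj S; Dom S h = d; Cod S h = expn S a b\<rbrakk>
      \<Longrightarrow> cur S d a b (evl S a b \<cdot> pmap S h (Ide S a)) = h"
begin

text \<open>\<open>Comp_assoc\<close> nests composites to the right, which hides the redex of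
  \<open>pfst_ppair\<close> as soon as another arrow is applied before the pairing. This form
  restores it.\<close>

lemma pfst_ppair_comp [simp]:
  assumes "f \<in> Arr S" "g \<in> Arr S" "Dom S g = Dom S f" "Cod S f = a" "Cod S g = b"
    "k \<in> Arr S" "Cod S k = Dom S f"
  shows "pfst S a b \<cdot> (ppair S f g \<cdot> k) = f \<cdot> k"
proof -
  have "pfst S a b \<cdot> (ppair S f g \<cdot> k) = (pfst S a b \<cdot> ppair S f g) \<cdot> k"
    using assms by (subst Comp_assoc) auto
  then show ?thesis using assms by simp
qed

lemma psnd_ppair_comp [simp]:
  assumes "f \<in> Arr S" "g \<in> Arr S" "Dom S g = Dom S f" "Cod S f = a" "Cod S g = b"
    "k \<in> Arr S" "Cod S k = Dom S f"
  shows "psnd S a b \<cdot> (ppair S f g \<cdot> k) = g \<cdot> k"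
proof -
  have "psnd S a b \<cdot> (ppair S f g \<cdot> k) = (psnd S a b \<cdot> ppair S f g) \<cdot> k"
    using assms by (subst Comp_assoc) auto
  then show ?thesis using assms by simp
qed

lemma ppair_eqI:
  assumes "h \<in> Arr S" "k \<in> Arr S" "a \<in> Obj S" "b \<in> Obj S" "Cod S h = prd S a b" "Cod S k = prd S a
      b"
    "pfst S a b \<cdot> h = pfst S a b \<cdot> k" "psnd S a b \<cdot> h = psnd S a b \<cdot> k"
  shows "h = k"
  by (metis ppair_eta assms)

lemma ppair_comp:
  assumes "f \<in> Arr S" "g \<in> Arr S" "Dom S g = Dom S f" "k \<in> Arr S" "Cod S k = Dom S f"
  shows "ppair S f g \<cdot> k = ppair S (f \<cdot> k) (g \<cdot> k)"
  by (rule ppair_eqI[of _ _ "Cod S f" "Cod S g"]) (use assms in auto)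

lemma pmap_in [simp]: "\<lbrakk>f \<in> Arr S; g \<in> Arr S\<rbrakk> \<Longrightarrow> pmap S f g \<in> Arr S"
  and Dom_pmap [simp]:
    "\<lbrakk>f \<in> Arr S; g \<in> Arr S\<rbrakk> \<Longrightarrow> Dom S (pmap S f g) = prd S (Dom S f) (Dom S g)"
  and Cod_pmap [simp]:
    "\<lbrakk>f \<in> Arr S; g \<in> Arr S\<rbrakk> \<Longrightarrow> Cod S (pmap S f g) = prd S (Cod S f) (Cod S g)"
  by (simp_all add: pmap_def)

lemma pmap_ppair:
  assumes "f \<in> Arr S" "g \<in> Arr S" "h \<in> Arr S" "k \<in> Arr S"
    "Dom S f = Cod S h" "Dom S g = Cod S k" "Dom S h = Dom S k"
  shows "pmap S f g \<cdot> ppair S h k = ppair S (f \<cdot> h) (g \<cdot> k)"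
  using assms by (simp add: pmap_def ppair_comp)

lemma pmap_comp:
  assumes "f \<in> Arr S" "g \<in> Arr S" "h \<in> Arr S" "k \<in> Arr S"
    "Dom S f = Cod S h" "Dom S g = Cod S k"
  shows "pmap S f g \<cdot> pmap S h k = pmap S (f \<cdot> h) (g \<cdot> k)"
  using assms pmap_ppair[of f g "h \<cdot> pfst S (Dom S h) (Dom S k)" "k \<cdot> psnd S (Dom S h) (Dom S k)"]
  by (simp add: pmap_def[of S h k] pmap_def[of S "f \<cdot> h" "g \<cdot> k"])

lemma pmap_Ide [simp]:
  assumes "a \<in> Obj S" "b \<in> Obj S"
  shows "pmap S (Ide S a) (Ide S b) = Ide S (prd S a b)"
  using assms ppair_eta[of "Ide S (prd S a b)" a b] by (simp add: pmap_def)

lemma pfst_pmap [simp]: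
  assumes "f \<in> Arr S" "g \<in> Arr S" "Cod S f = a" "Cod S g = b"
  shows "pfst S a b \<cdot> pmap S f g = f \<cdot> pfst S (Dom S f) (Dom S g)"
  using assms by (simp add: pmap_def)

lemma psnd_pmap [simp]:
  assumes "f \<in> Arr S" "g \<in> Arr S" "Cod S f = a" "Cod S g = b"
  shows "psnd S a b \<cdot> pmap S f g = g \<cdot> psnd S (Dom S f) (Dom S g)"
  using assms by (simp add: pmap_def)

lemma cur_eqI:
  assumes "h \<in> Arr S" "k \<in> Arr S" "a \<in> Obj S" "b \<in> Obj S" "Dom S k = Dom S h"
    "Cod S h = expn S a b" "Cod S k = expn S a b"
    "evl S a b \<cdot> pmap S h (Ide S a) = evl S a b \<cdot> pmap S k (Ide S a)"
  shows "h = k"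
  by (metis cur_eta assms)

lemma evl_cur_comp:
  assumes "f \<in> Arr S" "d \<in> Obj S" "a \<in> Obj S" "Dom S f = prd S d a" "Cod S f = b"
    "k \<in> Arr S" "Cod S k = prd S d a"
  shows "evl S a b \<cdot> (pmap S (cur S d a b f) (Ide S a) \<cdot> k) = f \<cdot> k"
  using assms evl_cur[of f d a b]
  by (subst Comp_assoc[symmetric]) (auto simp del: Comp_assoc)

text \<open>Semantic counterpart of a beta redex: with \<open>h\<close> an identity, the left side
  is what the application of an abstraction unfolds to.\<close>

lemma evl_cur_ppair:
  assumes "f \<in> Arr S" "d \<in> Obj S" "a \<in> Obj S" "Dom S f = prd S d a" "Cod S f = b"
    "h \<in> Arr S" "Cod S h = d" "k \<in> Arr S" "Cod S k = a" "Dom S h = Dom S k"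
  shows "evl S a b \<cdot> ppair S (cur S d a b f \<cdot> h) k = f \<cdot> ppair S h k"
  using assms evl_cur_comp[of f d a b "ppair S h k"] by (auto simp: pmap_ppair)

text \<open>Naturality of transposition in the context; this is what pushes a substitution under an
  abstraction.\<close>

lemma cur_comp:
  assumes "f \<in> Arr S" "d \<in> Obj S" "a \<in> Obj S" "Dom S f = prd S d a" "Cod S f = b"
    "k \<in> Arr S" "Cod S k = d"
  shows "cur S d a b f \<cdot> k = cur S (Dom S k) a b (f \<cdot> pmap S k (Ide S a))"
proof (rule cur_eqI[of _ _ a b])
  have "pmap S (cur S d a b f \<cdot> k) (Ide S a) = pmap S (cur S d a b f) (Ide S a) \<cdot> pmap S k (Ide S
      a)"
    using assms by (auto simp: pmap_comp)
  then show "evl S a b \<cdot> pmap S (cur S d a b f \<cdot> k) (Ide S a)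
    = evl S a b \<cdot> pmap S (cur S (Dom S k) a b (f \<cdot> pmap S k (Ide S a))) (Ide S a)"
    using assms by (auto simp: evl_cur evl_cur_comp)
qed (use assms in auto)

lemma emap_in [simp]: "\<lbrakk>f \<in> Arr S; g \<in> Arr S\<rbrakk> \<Longrightarrow> emap S f g \<in> Arr S"
  and Dom_emap [simp]:
    "\<lbrakk>f \<in> Arr S; g \<in> Arr S\<rbrakk> \<Longrightarrow> Dom S (emap S f g) = expn S (Cod S f) (Dom S g)"
  and Cod_emap [simp]:
    "\<lbrakk>f \<in> Arr S; g \<in> Arr S\<rbrakk> \<Longrightarrow> Cod S (emap S f g) = expn S (Dom S f) (Cod S g)"
  by (simp_all add: emap_def)

lemma evl_emap:
  assumes "f \<in> Arr S" "g \<in> Arr S" "Dom S f = a" "Cod S f = a'" "Dom S g = b" "Cod S g = b'"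
    "h \<in> Arr S" "Cod S h = prd S (expn S a' b) a"
  shows "evl S a b' \<cdot> (pmap S (emap S f g) (Ide S a) \<cdot> h)
    = g \<cdot> (evl S a' b \<cdot> (pmap S (Ide S (expn S a' b)) f \<cdot> h))"
  using assms by (auto simp: emap_def evl_cur_comp)

lemma emap_Ide:
  assumes "a \<in> Obj S" "b \<in> Obj S"
  shows "emap S (Ide S a) (Ide S b) = Ide S (expn S a b)"
  using assms cur_eta[of "Ide S (expn S a b)" a b "expn S a b"] by (simp add: emap_def)

text \<open>Both sides are compared after evaluation, where each \<open>emap\<close> on the left is
  removed by one application of \<open>evl_emap\<close>.\<close>

lemma emap_comp:
  assumes "f \<in> Arr S" "g \<in> Arr S" "f' \<in> Arr S" "g' \<in> Arr S" "Dom S f' = Cod S f" "Dom S g = Cod S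
      g'"
  shows "emap S f g \<cdot> emap S f' g' = emap S (f' \<cdot> f) (g \<cdot> g')"
proof (rule cur_eqI[of _ _ "Dom S f" "Cod S g"])
  let ?D = "expn S (Cod S f') (Dom S g')" and ?a = "Dom S f" and ?b = "Cod S g"
    and ?m = "Cod S f" and ?n = "Dom S g"
  have "evl S ?a ?b \<cdot> pmap S (emap S f g \<cdot> emap S f' g') (Ide S ?a)
      = evl S ?a ?b \<cdot> (pmap S (emap S f g) (Ide S ?a) \<cdot> pmap S (emap S f' g') (Ide S ?a))"
    using assms by (simp add: pmap_comp)
  also have "\<dots> = g \<cdot> (evl S ?m ?n \<cdot> (pmap S (Ide S (expn S ?m ?n)) f \<cdot> pmap S (emap S f' g') (Ide S
      ?a)))"
    using assms by (intro evl_emap) auto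
  \<comment> \<open>Interchange: \<open>f\<close> acts on the argument and
    \<open>emap S f' g'\<close> on the function, so the two commute, and the second
    \<open>emap\<close> comes to stand directly under the evaluation.\<close>
  also have "pmap S (Ide S (expn S ?m ?n)) f \<cdot> pmap S (emap S f' g') (Ide S ?a)
      = pmap S (emap S f' g') (Ide S ?m) \<cdot> pmap S (Ide S ?D) f"
    using assms by (simp add: pmap_comp)
  also have "evl S ?m ?n \<cdot> (pmap S (emap S f' g') (Ide S ?m) \<cdot> pmap S (Ide S ?D) f)
      = g' \<cdot> (evl S (Cod S f') (Dom S g') \<cdot> (pmap S (Ide S ?D) f' \<cdot> pmap S (Ide S ?D) f))"
    using assms by (intro evl_emap) auto
  also have "g \<cdot> \<dots> = evl S ?a ?b \<cdot> pmap S (emap S (f' \<cdot> f) (g \<cdot> g')) (Ide S ?a)"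
    using assms evl_emap[of "f' \<cdot> f" "g \<cdot> g'" ?a "Cod S f'" "Dom S g'" ?b "Ide S (prd S ?D ?a)"]
    by (simp add: pmap_comp)
  finally show "evl S ?a ?b \<cdot> pmap S (emap S f g \<cdot> emap S f' g') (Ide S ?a)
      = evl S ?a ?b \<cdot> pmap S (emap S (f' \<cdot> f) (g \<cdot> g')) (Ide S ?a)" .
qed (use assms in auto)

end

section \<open>Functors that preserve products and exponentials, strictly or up to
  isomorphism\<close>

locale cat_functor = A: cat A + B: cat B
  for A :: "('o1, 'a1, 'z1) category_scheme" and B :: "('o2, 'a2, 'z2) category_scheme" +
  fixes F0 :: "'o1 \<Rightarrow> 'o2" and F1 :: "'a1 \<Rightarrow> 'a2"
  assumes F0_in [simp]: "a \<in> Obj A \<Longrightarrow> F0 a \<in> Obj B"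
    and F1_in [simp]: "f \<in> Arr A \<Longrightarrow> F1 f \<in> Arr B"
    and Dom_F1 [simp]: "f \<in> Arr A \<Longrightarrow> Dom B (F1 f) = F0 (Dom A f)"
    and Cod_F1 [simp]: "f \<in> Arr A \<Longrightarrow> Cod B (F1 f) = F0 (Cod A f)"
    and F1_Ide: "a \<in> Obj A \<Longrightarrow> F1 (Ide A a) = Ide B (F0 a)"
    and F1_Comp: "\<lbrakk>f \<in> Arr A; g \<in> Arr A; Dom A g = Cod A f\<rbrakk>
      \<Longrightarrow> F1 (g \<cdot>\<^bsub>A\<^esub> f) = F1 g \<cdot>\<^bsub>B\<^esub> F1 f"
begin

abbreviation compB (infixr "\<bullet>" 70) where "g \<bullet> f \<equiv> g \<cdot>\<^bsub>B\<^esub> f"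

end

text \<open>Only the objects, the projections and evaluation are required to be preserved;
  preservation of pairing, of transposition and of the actions on arrows follows from
  uniqueness.\<close>

locale ccc_functor = A: ccc A + B: ccc B + cat_functor A B F0 F1
  for A :: "('o1, 'a1, 'z1) cc_scheme" and B :: "('o2, 'a2, 'z2) cc_scheme" and F0 F1 +
  assumes F0_prd: "\<lbrakk>a \<in> Obj A; b \<in> Obj A\<rbrakk> \<Longrightarrow> F0 (prd A a b) = prd B (F0 a) (F0 b)"
    and F1_pfst: "\<lbrakk>a \<in> Obj A; b \<in> Obj A\<rbrakk> \<Longrightarrow> F1 (pfst A a b) = pfst B (F0 a) (F0 b)"
    and F1_psnd: "\<lbrakk>a \<in> Obj A; b \<in> Obj A\<rbrakk> \<Longrightarrow> F1 (psnd A a b) = psnd B (F0 a) (F0 b)"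
    and F0_expn: "\<lbrakk>a \<in> Obj A; b \<in> Obj A\<rbrakk> \<Longrightarrow> F0 (expn A a b) = expn B (F0 a) (F0 b)"
    and F1_evl: "\<lbrakk>a \<in> Obj A; b \<in> Obj A\<rbrakk> \<Longrightarrow> F1 (evl A a b) = evl B (F0 a) (F0 b)"
begin

lemma F1_ppair:
  assumes "f \<in> Arr A" "g \<in> Arr A" "Dom A g = Dom A f"
  shows "F1 (ppair A f g) = ppair B (F1 f) (F1 g)"
proof (rule B.ppair_eqI[of _ _ "F0 (Cod A f)" "F0 (Cod A g)"])
  show "pfst B (F0 (Cod A f)) (F0 (Cod A g)) \<bullet> F1 (ppair A f g)
    = pfst B (F0 (Cod A f)) (F0 (Cod A g)) \<bullet> ppair B (F1 f) (F1 g)"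
    using assms F1_Comp[of "ppair A f g" "pfst A (Cod A f) (Cod A g)", symmetric] by (simp add:
        F1_pfst)
  show "psnd B (F0 (Cod A f)) (F0 (Cod A g)) \<bullet> F1 (ppair A f g)
    = psnd B (F0 (Cod A f)) (F0 (Cod A g)) \<bullet> ppair B (F1 f) (F1 g)"
    using assms F1_Comp[of "ppair A f g" "psnd A (Cod A f) (Cod A g)", symmetric] by (simp add:
        F1_psnd)
qed (use assms in \<open>auto simp: F0_prd\<close>)

lemma F1_pmap:
  assumes "f \<in> Arr A" "g \<in> Arr A"
  shows "F1 (pmap A f g) = pmap B (F1 f) (F1 g)"
  using assms by (simp add: pmap_def F1_ppair F1_Comp F1_pfst F1_psnd)

lemma F1_cur:
  assumes "f \<in> Arr A" "d \<in> Obj A" "a \<in> Obj A" "Dom A f = prd A d a" "Cod A f = b"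
  shows "F1 (cur A d a b f) = cur B (F0 d) (F0 a) (F0 b) (F1 f)"
proof (rule B.cur_eqI[of _ _ "F0 a" "F0 b"])
  have "evl B (F0 a) (F0 b) \<bullet> pmap B (F1 (cur A d a b f)) (Ide B (F0 a))
      = F1 (evl A a b \<cdot>\<^bsub>A\<^esub> pmap A (cur A d a b f) (Ide A a))"
    using assms by (subst F1_Comp) (auto simp: F1_pmap F1_evl F1_Ide)
  then show "evl B (F0 a) (F0 b) \<bullet> pmap B (F1 (cur A d a b f)) (Ide B (F0 a))
      = evl B (F0 a) (F0 b) \<bullet> pmap B (cur B (F0 d) (F0 a) (F0 b) (F1 f)) (Ide B (F0 a))"
    using assms by (auto simp: A.evl_cur B.evl_cur F0_prd)
qed (use assms in \<open>auto simp: F0_prd F0_expn\<close>)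

lemma F1_emap:
  assumes "f \<in> Arr A" "g \<in> Arr A"
  shows "F1 (emap A f g) = emap B (F1 f) (F1 g)"
  using assms by (simp add: emap_def F1_cur F1_Comp F1_evl F1_pmap F1_Ide F0_expn)

end

text \<open>The comparison maps \<open>\<tau>\<close> and \<open>\<upsilon>\<close> play the roles of the witnesses \<open>\<epsilon>(h, A, B)\<close> and
  \<open>\<upsilon>(h, A, B)\<close> of stability under a degeneracy \<open>h\<close>.\<close>

locale ccc_pseudofunctor = A: ccc A + B: ccc B + cat_functor A B F0 F1
  for A :: "('o1, 'a1, 'z1) cc_scheme" and B :: "('o2, 'a2, 'z2) cc_scheme" and F0 F1 +
  fixes \<tau> \<tau>' \<upsilon> :: "'o1 \<Rightarrow> 'o1 \<Rightarrow> 'a2"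
  assumes tau_in [simp]: "\<lbrakk>a \<in> Obj A; b \<in> Obj A\<rbrakk> \<Longrightarrow> \<tau> a b \<in> Arr B"
    and Dom_tau [simp]: "\<lbrakk>a \<in> Obj A; b \<in> Obj A\<rbrakk> \<Longrightarrow> Dom B (\<tau> a b) = F0 (prd A a b)"
    and Cod_tau [simp]: "\<lbrakk>a \<in> Obj A; b \<in> Obj A\<rbrakk> \<Longrightarrow> Cod B (\<tau> a b) = prd B (F0 a) (F0 b)"
    and tau'_in [simp]: "\<lbrakk>a \<in> Obj A; b \<in> Obj A\<rbrakk> \<Longrightarrow> \<tau>' a b \<in> Arr B"
    and Dom_tau' [simp]: "\<lbrakk>a \<in> Obj A; b \<in> Obj A\<rbrakk> \<Longrightarrow> Dom B (\<tau>' a b) = prd B (F0 a) (F0 b)"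
    and Cod_tau' [simp]: "\<lbrakk>a \<in> Obj A; b \<in> Obj A\<rbrakk> \<Longrightarrow> Cod B (\<tau>' a b) = F0 (prd A a b)"
    and tau_tau': "\<lbrakk>a \<in> Obj A; b \<in> Obj A\<rbrakk> \<Longrightarrow> \<tau> a b \<bullet> \<tau>' a b = Ide B (prd B (F0 a) (F0 b))"
    and pfst_tau: "\<lbrakk>a \<in> Obj A; b \<in> Obj A\<rbrakk> \<Longrightarrow> pfst B (F0 a) (F0 b) \<bullet> \<tau> a b = F1 (pfst A a b)"
    and psnd_tau: "\<lbrakk>a \<in> Obj A; b \<in> Obj A\<rbrakk> \<Longrightarrow> psnd B (F0 a) (F0 b) \<bullet> \<tau> a b = F1 (psnd A a b)"
    and upsilon_in [simp]: "\<lbrakk>a \<in> Obj A; b \<in> Obj A\<rbrakk> \<Longrightarrow> \<upsilon> a b \<in> Arr B"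
    and Dom_upsilon [simp]: "\<lbrakk>a \<in> Obj A; b \<in> Obj A\<rbrakk> \<Longrightarrow> Dom B (\<upsilon> a b) = F0 (expn A a b)"
    and Cod_upsilon [simp]: "\<lbrakk>a \<in> Obj A; b \<in> Obj A\<rbrakk> \<Longrightarrow> Cod B (\<upsilon> a b) = expn B (F0 a) (F0 b)"
    and evl_upsilon: "\<lbrakk>a \<in> Obj A; b \<in> Obj A\<rbrakk> \<Longrightarrow>
      evl B (F0 a) (F0 b) \<bullet> (pmap B (\<upsilon> a b) (Ide B (F0 a)) \<bullet> \<tau> (expn A a b) a) = F1 (evl A a b)"
begin

lemma pfst_tau_comp:
  assumes "a \<in> Obj A" "b \<in> Obj A" "h \<in> Arr B" "Cod B h = F0 (prd A a b)"
  shows "pfst B (F0 a) (F0 b) \<bullet> (\<tau> a b \<bullet> h) = F1 (pfst A a b) \<bullet> h"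
  using assms by (subst B.Comp_assoc[symmetric]) (auto simp: pfst_tau simp del: B.Comp_assoc)

lemma psnd_tau_comp:
  assumes "a \<in> Obj A" "b \<in> Obj A" "h \<in> Arr B" "Cod B h = F0 (prd A a b)"
  shows "psnd B (F0 a) (F0 b) \<bullet> (\<tau> a b \<bullet> h) = F1 (psnd A a b) \<bullet> h"
  using assms by (subst B.Comp_assoc[symmetric]) (auto simp: psnd_tau simp del: B.Comp_assoc)

lemma tau_ppair:
  assumes "f \<in> Arr A" "g \<in> Arr A" "Dom A g = Dom A f" "Cod A f = a" "Cod A g = b"
  shows "\<tau> a b \<bullet> F1 (ppair A f g) = ppair B (F1 f) (F1 g)"
proof (rule B.ppair_eqI[of _ _ "F0 a" "F0 b"])
  show "pfst B (F0 a) (F0 b) \<bullet> (\<tau> a b \<bullet> F1 (ppair A f g))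
    = pfst B (F0 a) (F0 b) \<bullet> ppair B (F1 f) (F1 g)"
    using assms by (auto simp: pfst_tau_comp F1_Comp[symmetric])
  show "psnd B (F0 a) (F0 b) \<bullet> (\<tau> a b \<bullet> F1 (ppair A f g))
    = psnd B (F0 a) (F0 b) \<bullet> ppair B (F1 f) (F1 g)"
    using assms by (auto simp: psnd_tau_comp F1_Comp[symmetric])
qed (use assms in auto)

text \<open>Naturality of \<tau> is not an axiom: it follows from compatibility with the
  projections, since a map into a product is determined by them.\<close>

lemma tau_pmap:
  assumes "f \<in> Arr A" "g \<in> Arr A" "Dom A f = a" "Cod A f = a'" "Dom A g = b" "Cod A g = b'"
  shows "\<tau> a' b' \<bullet> F1 (pmap A f g) = pmap B (F1 f) (F1 g) \<bullet> \<tau> a b"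
proof -
  have "pmap B (F1 f) (F1 g) \<bullet> \<tau> a b
      = ppair B (F1 f \<bullet> F1 (pfst A a b)) (F1 g \<bullet> F1 (psnd A a b))"
    using assms by (auto simp: pmap_def B.ppair_comp pfst_tau psnd_tau)
  then show ?thesis
    using assms by (auto simp: pmap_def tau_ppair F1_Comp)
qed

text \<open>In this and the following lemmas the functor is a degeneracy, and \<open>eA\<close>,
  \<open>eB\<close>, \<open>eD\<close> are degeneracy witnesses. The composite of
  \<open>pmap B eA eB\<close> with \<tau> is the witness that \<open>rprod\<close> takes, so the
  equations express degeneracy-preservation of the two projections.\<close>

lemma pfst_pmap_tau:
  assumes "a \<in> Obj A" "b \<in> Obj A" "eA \<in> Arr B" "Dom B eA = F0 a" "Cod B eA = a'"
    "eB \<in> Arr B" "Dom B eB = F0 b" "Cod B eB = b'"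
  shows "pfst B a' b' \<bullet> (pmap B eA eB \<bullet> \<tau> a b) = eA \<bullet> F1 (pfst A a b)"
    "psnd B a' b' \<bullet> (pmap B eA eB \<bullet> \<tau> a b) = eB \<bullet> F1 (psnd A a b)"
  using assms by (auto simp: pmap_def B.ppair_comp pfst_tau psnd_tau)

text \<open>Degeneracy-preservation of a pairing: \<open>f\<close> and \<open>g\<close> are
  components at the lower level, \<open>f'\<close> and \<open>g'\<close> components at the upper
  level reindexed along the degeneracy, and the last two premises are the degeneracy squares of the
  two components.\<close>

lemma ppair_natural:
  assumes "a \<in> Obj A" "b \<in> Obj A" "eA \<in> Arr B" "Dom B eA = F0 a" "Cod B eA = a'"
    "eB \<in> Arr B" "Dom B eB = F0 b" "Cod B eB = b'"
    "f \<in> Arr A" "g \<in> Arr A" "Dom A f = d" "Dom A g = d" "Cod A f = a" "Cod A g = b"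
    "eD \<in> Arr B" "Dom B eD = F0 d" "Cod B eD = d'" "f' \<in> Arr B" "g' \<in> Arr B" "Dom B f' = d'" "Dom B
        g' = d'"
    "Cod B f' = a'" "Cod B g' = b'" "f' \<bullet> eD = eA \<bullet> F1 f" "g' \<bullet> eD = eB \<bullet> F1 g"
  shows "ppair B f' g' \<bullet> eD = (pmap B eA eB \<bullet> \<tau> a b) \<bullet> F1 (ppair A f g)"
  using assms by (simp add: tau_ppair B.pmap_ppair B.ppair_comp)

text \<open>The witness of an exponential is \<open>emap B iA eB\<close> after \<upsilon>, with
  \<open>iA\<close> inverse to \<open>eA\<close> because of contravariance. On an argument
  transported by \<open>eA\<close> the two cancel, which leaves plain evaluation under
  \<open>eB\<close>.\<close>

lemma evl_emap_upsilon:
  assumes "a \<in> Obj A" "b \<in> Obj A" "eA \<in> Arr B" "Dom B eA = F0 a" "Cod B eA = a'"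
    "iA \<in> Arr B" "Dom B iA = a'" "Cod B iA = F0 a" "iA \<bullet> eA = Ide B (F0 a)"
    "eB \<in> Arr B" "Dom B eB = F0 b" "Cod B eB = b'"
  shows "evl B a' b' \<bullet> pmap B (emap B iA eB \<bullet> \<upsilon> a b) eA
    = eB \<bullet> (evl B (F0 a) (F0 b) \<bullet> pmap B (\<upsilon> a b) (Ide B (F0 a)))"
proof -
  have [simp]: "a' \<in> Obj B" "b' \<in> Obj B" using assms B.Cod_in by blast+
  have "pmap B (emap B iA eB \<bullet> \<upsilon> a b) eA = pmap B (emap B iA eB) (Ide B a') \<bullet> pmap B (\<upsilon> a b) eA"
    using assms by (simp add: B.pmap_comp)
  then have "evl B a' b' \<bullet> pmap B (emap B iA eB \<bullet> \<upsilon> a b) eA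
    = eB \<bullet> (evl B (F0 a) (F0 b) \<bullet> (pmap B (Ide B (expn B (F0 a) (F0 b))) iA \<bullet> pmap B (\<upsilon> a b) eA))"
    using assms by (simp add: B.evl_emap)
  then show ?thesis using assms by (simp add: B.pmap_comp)
qed

text \<open>Degeneracy-preservation of evaluation: the cancellation of \<open>iA\<close> against
  \<open>eA\<close>, followed by the compatibility \<open>evl_upsilon\<close> of \<upsilon> with
  evaluation.\<close>

lemma evl_natural:
  assumes "a \<in> Obj A" "b \<in> Obj A" "eA \<in> Arr B" "Dom B eA = F0 a" "Cod B eA = a'"
    "iA \<in> Arr B" "Dom B iA = a'" "Cod B iA = F0 a" "iA \<bullet> eA = Ide B (F0 a)"
    "eB \<in> Arr B" "Dom B eB = F0 b" "Cod B eB = b'"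
  shows "evl B a' b' \<bullet> (pmap B (emap B iA eB \<bullet> \<upsilon> a b) eA \<bullet> \<tau> (expn A a b) a)
    = eB \<bullet> F1 (evl A a b)"
proof -
  have [simp]: "a' \<in> Obj B" "b' \<in> Obj B" using assms B.Cod_in by blast+
  have "evl B a' b' \<bullet> (pmap B (emap B iA eB \<bullet> \<upsilon> a b) eA \<bullet> \<tau> (expn A a b) a)
    = (evl B a' b' \<bullet> pmap B (emap B iA eB \<bullet> \<upsilon> a b) eA) \<bullet> \<tau> (expn A a b) a"
    using assms by simp
  then show ?thesis
    using assms by (simp add: evl_emap_upsilon evl_upsilon)
qed

text \<open>Degeneracy-preservation of a transpose. Maps into an exponential agree once their
  evaluations do, and the evaluation of the right side can be computed by \<open>evl_natural\<close>
  after it has been rewritten so that \<tau> is applied to an image under \<open>F1\<close>.\<close>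

lemma cur_natural:
  assumes "a \<in> Obj A" "b \<in> Obj A" "eA \<in> Arr B" "Dom B eA = F0 a" "Cod B eA = a'"
    "iA \<in> Arr B" "Dom B iA = a'" "Cod B iA = F0 a" "iA \<bullet> eA = Ide B (F0 a)" "eA \<bullet> iA = Ide B a'"
    "eB \<in> Arr B" "Dom B eB = F0 b" "Cod B eB = b'"
    "d \<in> Obj A" "f \<in> Arr A" "Dom A f = prd A d a" "Cod A f = b"
    "eD \<in> Arr B" "Dom B eD = F0 d" "Cod B eD = d'" "f' \<in> Arr B" "Dom B f' = prd B d' a'" "Cod B f'
        = b'"
    "f' \<bullet> (pmap B eD eA \<bullet> \<tau> d a) = eB \<bullet> F1 f"
  shows "cur B d' a' b' f' \<bullet> eD = (emap B iA eB \<bullet> \<upsilon> a b) \<bullet> F1 (cur A d a b f)"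
proof (rule B.cur_eqI[of _ _ a' b'])
  have [simp]: "a' \<in> Obj B" "b' \<in> Obj B" "d' \<in> Obj B" using assms B.Cod_in by blast+
  let ?x = "emap B iA eB \<bullet> \<upsilon> a b" and ?c = "cur A d a b f" and ?i = "pmap B (Ide B (F0 d)) iA"
  \<comment> \<open>The identity of \<open>a'\<close> is split as \<open>eA\<close> after
    \<open>iA\<close>, so that the argument is transported by \<open>eA\<close>, as
    \<open>evl_natural\<close> requires.\<close>
  have "pmap B (?x \<bullet> F1 ?c) (Ide B a') = pmap B ?x eA \<bullet> (pmap B (F1 ?c) (F1 (Ide A a)) \<bullet> ?i)"
    using assms by (simp add: B.pmap_comp F1_Ide)
  \<comment> \<open>Naturality of \<tau> needs a \<tau> to act on; its right inverse \<tau>' creates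
    one.\<close>
  also have "?i = \<tau> d a \<bullet> (\<tau>' d a \<bullet> ?i)"
    using assms by (subst B.Comp_assoc[symmetric]) (auto simp: tau_tau' simp del: B.Comp_assoc)
  also have "pmap B (F1 ?c) (F1 (Ide A a)) \<bullet> \<dots>
      = (pmap B (F1 ?c) (F1 (Ide A a)) \<bullet> \<tau> d a) \<bullet> (\<tau>' d a \<bullet> ?i)"
    using assms by simp
  also have "pmap B (F1 ?c) (F1 (Ide A a)) \<bullet> \<tau> d a = \<tau> (expn A a b) a \<bullet> F1 (pmap A ?c (Ide A a))"
    using assms by (subst tau_pmap) auto
  finally have "evl B a' b' \<bullet> pmap B (?x \<bullet> F1 ?c) (Ide B a')
      = (evl B a' b' \<bullet> (pmap B ?x eA \<bullet> \<tau> (expn A a b) a)) \<bullet>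
        (F1 (pmap A ?c (Ide A a)) \<bullet> (\<tau>' d a \<bullet> ?i))"
    using assms by simp
  also have "evl B a' b' \<bullet> (pmap B ?x eA \<bullet> \<tau> (expn A a b) a) = eB \<bullet> F1 (evl A a b)"
    using assms by (intro evl_natural) auto
  also have "\<dots> \<bullet> (F1 (pmap A ?c (Ide A a)) \<bullet> (\<tau>' d a \<bullet> ?i))
      = (eB \<bullet> F1 (evl A a b \<cdot>\<^bsub>A\<^esub> pmap A ?c (Ide A a))) \<bullet> (\<tau>' d a \<bullet> ?i)"
    using assms by (simp add: F1_Comp)
  also have "evl A a b \<cdot>\<^bsub>A\<^esub> pmap A ?c (Ide A a) = f"
    using assms by (intro A.evl_cur) auto
  \<comment> \<open>The hypothesis on \<open>f'\<close>, read from right to left; the inserted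
    \<tau> and \<tau>' cancel again afterwards.\<close>
  also have "(eB \<bullet> F1 f) = f' \<bullet> (pmap B eD eA \<bullet> \<tau> d a)" using assms(24) by simp
  also have "(f' \<bullet> (pmap B eD eA \<bullet> \<tau> d a)) \<bullet> (\<tau>' d a \<bullet> ?i)
      = f' \<bullet> (pmap B eD eA \<bullet> (\<tau> d a \<bullet> (\<tau>' d a \<bullet> ?i)))"
    using assms(1-23) by simp
  also have "\<tau> d a \<bullet> (\<tau>' d a \<bullet> ?i) = ?i"
    using assms(1-23) by (subst B.Comp_assoc[symmetric]) (auto simp: tau_tau' simp del:
        B.Comp_assoc)
  also have "pmap B eD eA \<bullet> ?i = pmap B eD (Ide B a')"
    using assms(1-23) by (simp add: B.pmap_comp)
  also have "f' \<bullet> pmap B eD (Ide B a') = evl B a' b' \<bullet> pmap B (cur B d' a' b' f' \<bullet> eD) (Ide B a')"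
    using assms(1-23) B.evl_cur_comp[of f' d' a' b' "pmap B eD (Ide B a')"] by (simp add:
        B.pmap_comp)
  finally show "evl B a' b' \<bullet> pmap B (cur B d' a' b' f' \<bullet> eD) (Ide B a')
      = evl B a' b' \<bullet> pmap B (?x \<bullet> F1 ?c) (Ide B a')" by simp
qed (use assms B.Cod_in in \<open>auto\<close>)

end

section \<open>Finite limits and internal categories\<close>

locale finite_limits =
  fixes C :: "('o, 'a) category" (structure)
  assumes complete: "finitely_complete C"
begin

sublocale cat C
  using complete by (auto simp: finitely_complete_def intro: category_imp_cat)

lemma limit_exists:
  fixes J :: "(nat, nat) category"
  assumes "category J" "finite (Obj J)" "finite (Arr J)" "is_functor J C D"
  shows "\<exists>L \<pi>. is_limit J C D L \<pi>"
  using complete assms unfolding finitely_complete_def by blast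

text \<open>A power is the limit of the constant diagram over the discrete category with
  \<open>n\<close> objects, in which every object is its own identity arrow.\<close>

lemma is_power_exists:
  assumes "X \<in> Obj C"
  shows "\<exists>c. is_power C X n c"
proof -
  let ?J = "\<lparr>Obj = {..<n}, Arr = {..<n}, Dom = id, Cod = id, Ide = id, Comp = \<lambda>g f. f\<rparr>"
  let ?D = "\<lparr>on_obj = \<lambda>_. X, on_arr = \<lambda>_. Ide C X\<rparr> :: (nat, nat, _, _) functr"
  have "category ?J" by unfold_locales (auto simp: hom_def)
  moreover have "is_functor ?J C ?D" using assms by (auto simp: is_functor_def hom_def)
  ultimately obtain L \<pi> where L: "is_limit ?J C ?D L \<pi>"
    using limit_exists[of ?J ?D] by auto
  have "is_cone ?J C ?D K \<kappa> \<longleftrightarrow> K \<in> Obj C \<and> (\<forall>i<n. \<kappa> i \<in> hom C K X)" for K \<kappa>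
    by (auto simp: is_cone_def hom_def)
  with L have "is_power C X n (L, \<pi>)"
    by (auto simp: is_limit_def is_power_def Ball_def)
  then show ?thesis by blast
qed

lemma is_power_power_cone: "X \<in> Obj C \<Longrightarrow> is_power C X n (power_cone C X n)"
  unfolding power_cone_def using is_power_exists by (rule someI_ex)

lemma pow_in [simp]: "X \<in> Obj C \<Longrightarrow> pow C X n \<in> Obj C"
  using is_power_power_cone[of X n] by (auto simp: is_power_def pow_def)

lemma proj_in [simp]: "\<lbrakk>X \<in> Obj C; i < n\<rbrakk> \<Longrightarrow> proj C X n i \<in> Arr C"
  and Dom_proj [simp]: "\<lbrakk>X \<in> Obj C; i < n\<rbrakk> \<Longrightarrow> Dom C (proj C X n i) = pow C X n"
  and Cod_proj [simp]: "\<lbrakk>X \<in> Obj C; i < n\<rbrakk> \<Longrightarrow> Cod C (proj C X n i) = X"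
  using is_power_power_cone[of X n] by (auto simp: is_power_def pow_def proj_def hom_def)

lemma tup_unique:
  assumes "X \<in> Obj C" "J \<in> Obj C" "\<And>i. i < n \<Longrightarrow> f i \<in> Arr C \<and> Dom C (f i) = J \<and> Cod C (f i) = X"
  shows "\<exists>!h. h \<in> hom C J (pow C X n) \<and> (\<forall>i<n. proj C X n i \<cdot> h = f i)"
  using is_power_power_cone[of X n] assms by (auto simp: is_power_def pow_def proj_def hom_def)

lemma tup_spec:
  assumes "X \<in> Obj C" "J \<in> Obj C" "\<And>i. i < n \<Longrightarrow> f i \<in> Arr C \<and> Dom C (f i) = J \<and> Cod C (f i) = X"
  shows "tup C J X n f \<in> hom C J (pow C X n) \<and> (\<forall>i<n. proj C X n i \<cdot> tup C J X n f = f i)"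
  unfolding tup_def by (rule theI') (rule tup_unique[OF assms])

lemma tup_in [simp]:
  assumes "X \<in> Obj C" "J \<in> Obj C" "\<And>i. i < n \<Longrightarrow> f i \<in> Arr C \<and> Dom C (f i) = J \<and> Cod C (f i) = X"
  shows "tup C J X n f \<in> Arr C" "Dom C (tup C J X n f) = J" "Cod C (tup C J X n f) = pow C X n"
  using tup_spec[OF assms] by (auto simp: hom_def)

lemma proj_tup [simp]:
  assumes "X \<in> Obj C" "J \<in> Obj C" "\<And>i. i < n \<Longrightarrow> f i \<in> Arr C \<and> Dom C (f i) = J \<and> Cod C (f i) = X" "i
      < n"
  shows "proj C X n i \<cdot> tup C J X n f = f i"
  using tup_spec[of X J n f] assms by blast

lemma pow_eqI:
  assumes "X \<in> Obj C" "h \<in> Arr C" "k \<in> Arr C" "Dom C k = Dom C h"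
    "Cod C h = pow C X n" "Cod C k = pow C X n" "\<And>i. i < n \<Longrightarrow> proj C X n i \<cdot> h = proj C X n i \<cdot> k"
  shows "h = k"
  using tup_unique[of X "Dom C h" n "\<lambda>i. proj C X n i \<cdot> h"] assms
  by (auto simp: hom_def)

lemma tup_cong: "(\<And>i. i < n \<Longrightarrow> f i = g i) \<Longrightarrow> tup C J X n f = tup C J X n g"
  unfolding tup_def by (rule arg_cong[where f = The]) auto

lemma proj_tup_comp [simp]:
  assumes "X \<in> Obj C" "J \<in> Obj C" "\<And>i. i < n \<Longrightarrow> f i \<in> Arr C \<and> Dom C (f i) = J \<and> Cod C (f i) = X"
    "i < n" "u \<in> Arr C" "Cod C u = J"
  shows "proj C X n i \<cdot> (tup C J X n f \<cdot> u) = f i \<cdot> u"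
proof -
  have "proj C X n i \<cdot> (tup C J X n f \<cdot> u) = (proj C X n i \<cdot> tup C J X n f) \<cdot> u"
    using assms by (subst Comp_assoc) auto
  then show ?thesis using assms by simp
qed

lemma tup_comp:
  assumes "X \<in> Obj C" "J \<in> Obj C" "\<And>i. i < n \<Longrightarrow> f i \<in> Arr C \<and> Dom C (f i) = J \<and> Cod C (f i) = X"
    "u \<in> Arr C" "Cod C u = J"
  shows "tup C J X n f \<cdot> u = tup C (Dom C u) X n (\<lambda>i. f i \<cdot> u)"
  by (rule pow_eqI[of X _ _ n]) (use assms in auto)

lemma pow_map_in [simp]: "u \<in> Arr C \<Longrightarrow> pow_map C n u \<in> Arr C"
  and Dom_pow_map [simp]: "u \<in> Arr C \<Longrightarrow> Dom C (pow_map C n u) = pow C (Dom C u) n"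
  and Cod_pow_map [simp]: "u \<in> Arr C \<Longrightarrow> Cod C (pow_map C n u) = pow C (Cod C u) n"
  by (simp_all add: pow_map_def)

lemma proj_pow_map [simp]:
  assumes "u \<in> Arr C" "i < n" "Cod C u = X"
  shows "proj C X n i \<cdot> pow_map C n u = u \<cdot> proj C (Dom C u) n i"
  using assms by (auto simp: pow_map_def)

lemma proj_pow_map_comp [simp]:
  assumes "u \<in> Arr C" "i < n" "Cod C u = X" "v \<in> Arr C" "Cod C v = pow C (Dom C u) n"
  shows "proj C X n i \<cdot> (pow_map C n u \<cdot> v) = u \<cdot> (proj C (Dom C u) n i \<cdot> v)"
proof -
  have "proj C X n i \<cdot> (pow_map C n u \<cdot> v) = (proj C X n i \<cdot> pow_map C n u) \<cdot> v"
    using assms by (subst Comp_assoc) auto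
  then show ?thesis using assms by auto
qed

lemma pow_map_Ide [simp]: "X \<in> Obj C \<Longrightarrow> pow_map C n (Ide C X) = Ide C (pow C X n)"
  by (rule pow_eqI[of X _ _ n]) auto

lemma pow_map_comp:
  assumes "u \<in> Arr C" "v \<in> Arr C" "Cod C v = Dom C u"
  shows "pow_map C n (u \<cdot> v) = pow_map C n u \<cdot> pow_map C n v"
  by (rule pow_eqI[of "Cod C u" _ _ n]) (use assms in auto)

lemma pair_in [simp]:
  assumes "f \<in> Arr C" "g \<in> Arr C" "Dom C g = Dom C f" "Cod C g = Cod C f"
  shows "pair C f g \<in> Arr C" "Dom C (pair C f g) = Dom C f" "Cod C (pair C f g) = pow C (Cod C f) 2"
  using assms by (simp_all add: pair_def)

lemma pair_comp [simp]:
  assumes "f \<in> Arr C" "g \<in> Arr C" "Dom C g = Dom C f" "Cod C g = Cod C f" "u \<in> Arr C" "Cod C u =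
      Dom C f"
  shows "pair C f g \<cdot> u = pair C (f \<cdot> u) (g \<cdot> u)"
  using assms by (auto simp: pair_def tup_comp intro: tup_cong)

lemma is_terminal_term_ob: "is_terminal C (term_ob C)"
proof -
  let ?J = "\<lparr>Obj = {}, Arr = {}, Dom = id, Cod = id, Ide = id, Comp = \<lambda>g f. f\<rparr> :: (nat, nat)
      category"
  \<comment> \<open>Any value at all is a functor out of the empty category.\<close>
  let ?D = "undefined :: (nat, nat, 'o, 'a) functr"
  have "category ?J" by unfold_locales (auto simp: hom_def)
  then obtain L \<pi> where L: "is_limit ?J C ?D L \<pi>"
    using limit_exists[of ?J ?D] by (auto simp: is_functor_def)
  then have "is_terminal C L"
    unfolding is_terminal_def is_limit_def is_cone_def by (auto simp: hom_def)
  then show ?thesis unfolding term_ob_def by (rule someI)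
qed

lemma bang_unique: "J \<in> Obj C \<Longrightarrow> \<exists>!h. h \<in> hom C J (term_ob C)"
  using is_terminal_term_ob by (auto simp: is_terminal_def)

lemma bang_in [simp]: "J \<in> Obj C \<Longrightarrow> bang C J \<in> Arr C"
  and Dom_bang [simp]: "J \<in> Obj C \<Longrightarrow> Dom C (bang C J) = J"
  and Cod_bang [simp]: "J \<in> Obj C \<Longrightarrow> Cod C (bang C J) = term_ob C"
  using theI'[OF bang_unique, of J] by (auto simp: bang_def hom_def)

lemma bang_comp [simp]: "\<lbrakk>u \<in> Arr C; Cod C u = J\<rbrakk> \<Longrightarrow> bang C J \<cdot> u = bang C (Dom C u)"
  using bang_unique[of "Dom C u"] by (auto simp: hom_def)

lemma pullback_exists:
  assumes fg [simp]: "f \<in> Arr C" "g \<in> Arr C" and c: "Cod C f = Cod C g"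
  shows "\<exists>c. is_pullback C f g c"
proof -
  \<comment> \<open>The cospan 0 -> 2 <- 1: the numbers 0, 1, 2 also name the identities, 3 and 4
    the two arrows into 2. In a composable pair at least one arrow is an identity, so the composite
    is the other one.\<close>
  define J :: "(nat, nat) category" where "J = \<lparr>Obj = {0, 1, 2}, Arr = {0, 1, 2, 3, 4},
      Dom = \<lambda>a. if a = 3 then 0 else if a = 4 then 1 else a,
      Cod = \<lambda>a. if a = 3 \<or> a = 4 then 2 else a, Ide = id, Comp = \<lambda>h k. if k \<le> 2 then h else k\<rparr>"
  define D :: "(nat, nat, 'o, 'a) functr" where "D =
      \<lparr>on_obj = \<lambda>j. if j = 0 then Dom C f else if j = 1 then Dom C g else Cod C g,
       on_arr = \<lambda>a. if a = 3 then f else if a = 4 then g else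
         Ide C (if a = 0 then Dom C f else if a = 1 then Dom C g else Cod C g)\<rparr>"
  have "category J" by unfold_locales (auto simp: J_def hom_def split: if_splits)
  moreover have "is_functor J C D" using c by (auto simp: is_functor_def J_def D_def hom_def)
  ultimately obtain L \<pi> where L: "is_limit J C D L \<pi>"
    using limit_exists[of J D] by (auto simp: J_def)
  have cone: "is_cone J C D K \<kappa> \<longleftrightarrow> K \<in> Obj C \<and> \<kappa> 0 \<in> hom C K (Dom C f) \<and> \<kappa> 1 \<in> hom C K (Dom C g)
     \<and> \<kappa> 2 = g \<cdot> \<kappa> 1 \<and> f \<cdot> \<kappa> 0 = g \<cdot> \<kappa> 1" for K \<kappa>
    using c by (auto simp: is_cone_def J_def D_def hom_def)
  have p: "\<pi> 0 \<in> hom C L (Dom C f)" "\<pi> 1 \<in> hom C L (Dom C g)" "f \<cdot> \<pi> 0 = g \<cdot> \<pi> 1" "L \<in> Obj C"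
    and p2: "\<pi> 2 = g \<cdot> \<pi> 1"
    using L unfolding is_limit_def cone by auto
  have "\<exists>!h. h \<in> hom C K L \<and> \<pi> 0 \<cdot> h = u \<and> \<pi> 1 \<cdot> h = v"
    if "K \<in> Obj C" "u \<in> hom C K (Dom C f)" "v \<in> hom C K (Dom C g)" "f \<cdot> u = g \<cdot> v" for K u v
  proof -
    let ?\<kappa> = "\<lambda>j::nat. if j = 0 then u else if j = 1 then v else g \<cdot> v"
    have "is_cone J C D K ?\<kappa>" using that by (auto simp: cone)
    then have "\<exists>!h. h \<in> hom C K L \<and> (\<forall>j \<in> Obj J. \<pi> j \<cdot> h = ?\<kappa> j)"
      using L unfolding is_limit_def by blast
    \<comment> \<open>The leg to the vertex 2 is forced by the leg to 1, so two equations determine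
      the mediating arrow.\<close>
    moreover have "h \<in> hom C K L \<and> (\<forall>j \<in> Obj J. \<pi> j \<cdot> h = ?\<kappa> j)
      \<longleftrightarrow> h \<in> hom C K L \<and> \<pi> 0 \<cdot> h = u \<and> \<pi> 1 \<cdot> h = v" for h
    proof -
      have "h \<in> hom C K L \<Longrightarrow> \<pi> 2 \<cdot> h = g \<cdot> (\<pi> 1 \<cdot> h)"
        using p(2) by (simp add: p2 hom_def)
      then show ?thesis by (auto simp: J_def)
    qed
    ultimately show ?thesis by simp
  qed
  then have "is_pullback C f g (L, \<pi> 0, \<pi> 1)"
    using p by (auto simp: is_pullback_def)
  then show ?thesis by blast
qed

lemma is_pullback_pb:
  "\<lbrakk>f \<in> Arr C; g \<in> Arr C; Cod C f = Cod C g\<rbrakk> \<Longrightarrow> is_pullback C f g (pb C f g)"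
  unfolding pb_def using pullback_exists by (rule someI_ex)

lemma pb_in:
  assumes "f \<in> Arr C" "g \<in> Arr C" "Cod C f = Cod C g"
  shows "fst (snd (pb C f g)) \<in> Arr C" "Dom C (fst (snd (pb C f g))) = fst (pb C f g)"
    "Cod C (fst (snd (pb C f g))) = Dom C f"
    "snd (snd (pb C f g)) \<in> Arr C" "Dom C (snd (snd (pb C f g))) = fst (pb C f g)"
    "Cod C (snd (snd (pb C f g))) = Dom C g"
    "f \<cdot> fst (snd (pb C f g)) = g \<cdot> snd (snd (pb C f g))" "fst (pb C f g) \<in> Obj C"
proof -
  obtain P p q where pb: "pb C f g = (P, p, q)" by (cases "pb C f g") auto
  have "p \<in> hom C P (Dom C f)" "q \<in> hom C P (Dom C g)" "f \<cdot> p = g \<cdot> q"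
    using is_pullback_pb[OF assms] unfolding pb by (auto simp: is_pullback_def)
  then show "fst (snd (pb C f g)) \<in> Arr C" "Dom C (fst (snd (pb C f g))) = fst (pb C f g)"
    "Cod C (fst (snd (pb C f g))) = Dom C f"
    "snd (snd (pb C f g)) \<in> Arr C" "Dom C (snd (snd (pb C f g))) = fst (pb C f g)"
    "Cod C (snd (snd (pb C f g))) = Dom C g"
    "f \<cdot> fst (snd (pb C f g)) = g \<cdot> snd (snd (pb C f g))" "fst (pb C f g) \<in> Obj C"
    using Dom_in[of p] by (auto simp: pb hom_def)
qed

lemma pb_pair_unique:
  assumes "f \<in> Arr C" "g \<in> Arr C" "Cod C f = Cod C g" "u \<in> Arr C" "v \<in> Arr C" "Dom C v = Dom C u"
    "Cod C u = Dom C f" "Cod C v = Dom C g" "f \<cdot> u = g \<cdot> v"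
  shows "\<exists>!h. h \<in> hom C (Dom C u) (fst (pb C f g)) \<and>
     fst (snd (pb C f g)) \<cdot> h = u \<and> snd (snd (pb C f g)) \<cdot> h = v"
proof -
  obtain P p q where pb: "pb C f g = (P, p, q)" by (cases "pb C f g") auto
  have "u \<in> hom C (Dom C u) (Dom C f)" "v \<in> hom C (Dom C u) (Dom C g)" "Dom C u \<in> Obj C"
    using assms by (auto simp: hom_def)
  then show ?thesis
    using is_pullback_pb[OF assms(1-3)] assms(9) unfolding pb is_pullback_def by auto
qed

lemma pb_pair_spec:
  assumes "f \<in> Arr C" "g \<in> Arr C" "Cod C f = Cod C g" "u \<in> Arr C" "v \<in> Arr C" "Dom C v = Dom C u"
    "Cod C u = Dom C f" "Cod C v = Dom C g" "f \<cdot> u = g \<cdot> v"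
  shows "pb_pair C f g u v \<in> Arr C" "Dom C (pb_pair C f g u v) = Dom C u"
    "Cod C (pb_pair C f g u v) = fst (pb C f g)"
    "fst (snd (pb C f g)) \<cdot> pb_pair C f g u v = u" "snd (snd (pb C f g)) \<cdot> pb_pair C f g u v = v"
  using theI'[OF pb_pair_unique[OF assms]] by (auto simp: pb_pair_def hom_def)

lemma pb_pair_eqI:
  assumes "f \<in> Arr C" "g \<in> Arr C" "Cod C f = Cod C g" "h \<in> Arr C" "k \<in> Arr C" "Dom C k = Dom C h"
    "Cod C h = fst (pb C f g)" "Cod C k = fst (pb C f g)"
    "fst (snd (pb C f g)) \<cdot> h = fst (snd (pb C f g)) \<cdot> k" "snd (snd (pb C f g)) \<cdot> h = snd (snd (pb
        C f g)) \<cdot> k"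
  shows "h = k"
proof -
  let ?p = "fst (snd (pb C f g))" and ?q = "snd (snd (pb C f g))"
  have "f \<cdot> (?p \<cdot> h) = (f \<cdot> ?p) \<cdot> h"
    using pb_in[OF assms(1-3)] assms by (subst Comp_assoc) auto
  also have "\<dots> = g \<cdot> (?q \<cdot> h)"
    using pb_in[OF assms(1-3)] assms by (auto simp: pb_in)
  finally show ?thesis
    using pb_pair_unique[of f g "?p \<cdot> h" "?q \<cdot> h"] assms pb_in[OF assms(1-3)] by (auto simp:
        hom_def)
qed

end

section \<open>Internal categories computed with generalised elements\<close>

locale internal_cat = finite_limits C for C :: "('o, 'a) category" (structure) +
  fixes X :: "('o, 'a) icat"
  assumes X: "internal_category C X"
begin

lemma icat_in [simp]:
  "Ob X \<in> Obj C" "Mor X \<in> Obj C" "src X \<in> Arr C" "tgt X \<in> Arr C" "idn X \<in> Arr C" "cmp X \<in> Arr C"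
  "Dom C (src X) = Mor X" "Cod C (src X) = Ob X" "Dom C (tgt X) = Mor X" "Cod C (tgt X) = Ob X"
  "Dom C (idn X) = Ob X" "Cod C (idn X) = Mor X" "Dom C (cmp X) = fst (pb C (src X) (tgt X))"
  "Cod C (cmp X) = Mor X" "src X \<cdot> idn X = Ide C (Ob X)" "tgt X \<cdot> idn X = Ide C (Ob X)"
  using X by (auto simp: internal_category_def hom_def cpairs_def)

lemma src_idn_comp [simp]:
  assumes "A \<in> Arr C" "Cod C A = Ob X"
  shows "src X \<cdot> (idn X \<cdot> A) = A" "tgt X \<cdot> (idn X \<cdot> A) = A"
proof -
  have "src X \<cdot> (idn X \<cdot> A) = (src X \<cdot> idn X) \<cdot> A" "tgt X \<cdot> (idn X \<cdot> A) = (tgt X \<cdot> idn X) \<cdot> A"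
    using assms by (auto simp del: icat_in(15,16))
  then show "src X \<cdot> (idn X \<cdot> A) = A" "tgt X \<cdot> (idn X \<cdot> A) = A" using assms by auto
qed

context
  fixes f g
  assumes fg: "f \<in> Arr C" "g \<in> Arr C" "Cod C f = Mor X" "Cod C g = Mor X" "Dom C g = Dom C f"
    "src X \<cdot> g = tgt X \<cdot> f"
begin

private lemma pbp:
  "pb_pair C (src X) (tgt X) g f \<in> Arr C" "Dom C (pb_pair C (src X) (tgt X) g f) = Dom C f"
  "Cod C (pb_pair C (src X) (tgt X) g f) = fst (pb C (src X) (tgt X))"
  "cpair1 C X \<cdot> pb_pair C (src X) (tgt X) g f = g" "cpair2 C X \<cdot> pb_pair C (src X) (tgt X) g f = f"
  using pb_pair_spec[of "src X" "tgt X" g f] fg by (auto simp: cpair1_def cpair2_def)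

lemma icomp_in [simp]: "icomp C X g f \<in> Arr C" "Dom C (icomp C X g f) = Dom C f"
  "Cod C (icomp C X g f) = Mor X"
  using pbp by (simp_all add: icomp_def)

lemma src_tgt_icomp [simp]: "src X \<cdot> icomp C X g f = src X \<cdot> f" "tgt X \<cdot> icomp C X g f = tgt X \<cdot> g"
proof -
  let ?h = "pb_pair C (src X) (tgt X) g f"
  note pb = pb_in[of "src X" "tgt X"]
  have "src X \<cdot> icomp C X g f = (src X \<cdot> cmp X) \<cdot> ?h" "tgt X \<cdot> icomp C X g f = (tgt X \<cdot> cmp X) \<cdot> ?h"
    using pbp by (simp_all add: icomp_def)
  moreover have "src X \<cdot> cmp X = src X \<cdot> cpair2 C X" "tgt X \<cdot> cmp X = tgt X \<cdot> cpair1 C X"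
    using X by (auto simp: internal_category_def)
  moreover have "(src X \<cdot> cpair2 C X) \<cdot> ?h = src X \<cdot> f" "(tgt X \<cdot> cpair1 C X) \<cdot> ?h = tgt X \<cdot> g"
    using pbp pb by (auto simp: cpair1_def cpair2_def)
  ultimately show "src X \<cdot> icomp C X g f = src X \<cdot> f" "tgt X \<cdot> icomp C X g f = tgt X \<cdot> g" by
      simp_all
qed

text \<open>Pairing into the chosen pullback is unique and therefore natural in the stage, and
  composition is a fixed arrow applied to such a pair.\<close>

lemma icomp_comp [simp]:
  assumes "u \<in> Arr C" "Cod C u = Dom C f"
  shows "icomp C X g f \<cdot> u = icomp C X (g \<cdot> u) (f \<cdot> u)"
proof -
  note pb = pb_in[of "src X" "tgt X"]
  have "src X \<cdot> (g \<cdot> u) = (src X \<cdot> g) \<cdot> u" using assms fg(1-5) by simp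
  also have "\<dots> = tgt X \<cdot> (f \<cdot> u)" unfolding fg(6) using assms fg(1-5) by simp
  finally have e: "src X \<cdot> (g \<cdot> u) = tgt X \<cdot> (f \<cdot> u)" .
  let ?h = "pb_pair C (src X) (tgt X) (g \<cdot> u) (f \<cdot> u)"
  have s: "?h \<in> Arr C" "Dom C ?h = Dom C u" "Cod C ?h = fst (pb C (src X) (tgt X))"
    "fst (snd (pb C (src X) (tgt X))) \<cdot> ?h = g \<cdot> u" "snd (snd (pb C (src X) (tgt X))) \<cdot> ?h = f \<cdot> u"
    using pb_pair_spec[OF _ _ _ _ _ _ _ _ e] fg(1-5) assms by simp_all
  have t: "fst (snd (pb C (src X) (tgt X))) \<cdot> (pb_pair C (src X) (tgt X) g f \<cdot> u) = g \<cdot> u"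
    "snd (snd (pb C (src X) (tgt X))) \<cdot> (pb_pair C (src X) (tgt X) g f \<cdot> u) = f \<cdot> u"
    using pbp pb assms fg(1-5)
    by (subst Comp_assoc[symmetric]; simp add: cpair1_def cpair2_def del: Comp_assoc)+
  have "pb_pair C (src X) (tgt X) g f \<cdot> u = ?h"
    by (rule pb_pair_eqI[of "src X" "tgt X"]) (simp_all add: s t pbp assms fg(1-5))
  then show ?thesis using pbp assms fg by (simp add: icomp_def)
qed

end

lemma icomp_idn [simp]:
  assumes "f \<in> Arr C" "Cod C f = Mor X"
  shows "tgt X \<cdot> f = A \<Longrightarrow> icomp C X (idn X \<cdot> A) f = f" "src X \<cdot> f = A \<Longrightarrow> icomp C X f (idn X \<cdot> A) = f"
  using X assms by (auto simp: internal_category_def hom_def)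

lemma icomp_assoc [simp]:
  assumes "f \<in> Arr C" "Cod C f = Mor X" "g \<in> Arr C" "Cod C g = Mor X" "h \<in> Arr C" "Cod C h = Mor X"
    "Dom C g = Dom C f" "Dom C h = Dom C g" "src X \<cdot> g = tgt X \<cdot> f" "src X \<cdot> h = tgt X \<cdot> g"
  shows "icomp C X (icomp C X h g) f = icomp C X h (icomp C X g f)"
proof -
  have "\<lbrakk>J \<in> Obj C; f \<in> hom C J (Mor X); g \<in> hom C J (Mor X); h \<in> hom C J (Mor X);
      src X \<cdot> g = tgt X \<cdot> f; src X \<cdot> h = tgt X \<cdot> g\<rbrakk>
    \<Longrightarrow> icomp C X h (icomp C X g f) = icomp C X (icomp C X h g) f" for J
    using X unfolding internal_category_def by blast
  from this[of "Dom C f"] show ?thesis using assms by (simp add: hom_def)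
qed

lemma iiso_iff: "iiso C X f \<longleftrightarrow> f \<in> Arr C \<and> Cod C f = Mor X \<and>
   (\<exists>g \<in> Arr C. Dom C g = Dom C f \<and> Cod C g = Mor X \<and> src X \<cdot> g = tgt X \<cdot> f \<and> tgt X \<cdot> g = src X \<cdot> f
       \<and>
     icomp C X g f = idn X \<cdot> (src X \<cdot> f) \<and> icomp C X f g = idn X \<cdot> (tgt X \<cdot> f))"
  by (auto simp: iiso_def ihom_def hom_def)

text \<open>\<open>iinv\<close> is a definite description, so an inverse found by hand must be shown
  to be the only one; the argument is the usual one that a left inverse and a right inverse
  coincide.\<close>

lemma iinv_eqI:
  assumes "f \<in> Arr C" "Cod C f = Mor X" "g \<in> Arr C" "Dom C g = Dom C f" "Cod C g = Mor X"
    "src X \<cdot> g = tgt X \<cdot> f" "tgt X \<cdot> g = src X \<cdot> f"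
    "icomp C X g f = idn X \<cdot> (src X \<cdot> f)" "icomp C X f g = idn X \<cdot> (tgt X \<cdot> f)"
  shows "iinv C X f = g"
  unfolding iinv_def
proof (rule the_equality)
  fix h
  assume "h \<in> ihom C X (tgt X \<cdot> f) (src X \<cdot> f) \<and> icomp C X h f = idn X \<cdot> (src X \<cdot> f)
    \<and> icomp C X f h = idn X \<cdot> (tgt X \<cdot> f)"
  then have h: "h \<in> Arr C" "Dom C h = Dom C f" "Cod C h = Mor X" "src X \<cdot> h = tgt X \<cdot> f"
    "tgt X \<cdot> h = src X \<cdot> f" "icomp C X h f = idn X \<cdot> (src X \<cdot> f)"
    using assms by (auto simp: ihom_def hom_def)
  have "h = icomp C X h (icomp C X f g)" using h assms by simp
  also have "\<dots> = icomp C X (icomp C X h f) g" using h assms by (subst icomp_assoc) auto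
  also have "\<dots> = g" using h assms by simp
  finally show "h = g" .
qed (use assms in \<open>auto simp: ihom_def hom_def\<close>)

lemma iinv_in [simp]:
  assumes "iiso C X f"
  shows "iinv C X f \<in> Arr C" "Dom C (iinv C X f) = Dom C f" "Cod C (iinv C X f) = Mor X"
    "src X \<cdot> iinv C X f = tgt X \<cdot> f" "tgt X \<cdot> iinv C X f = src X \<cdot> f"
    "icomp C X (iinv C X f) f = idn X \<cdot> (src X \<cdot> f)" "icomp C X f (iinv C X f) = idn X \<cdot> (tgt X \<cdot>
        f)"
  using assms iinv_eqI by (auto simp: iiso_iff)

lemma iiso_in: "iiso C X f \<Longrightarrow> f \<in> Arr C \<and> Cod C f = Mor X"
  by (simp add: iiso_def)

text \<open>The defining equations of an inverse are equations between generalised elements, and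
  these persist under reindexing.\<close>

lemma iinv_comp:
  assumes "iiso C X f" "u \<in> Arr C" "Cod C u = Dom C f"
  shows "iinv C X (f \<cdot> u) = iinv C X f \<cdot> u"
proof -
  note f = iiso_in[OF assms(1)] and i = iinv_in[OF assms(1)]
  have s: "src X \<cdot> (iinv C X f \<cdot> u) = tgt X \<cdot> (f \<cdot> u)" "tgt X \<cdot> (iinv C X f \<cdot> u) = src X \<cdot> (f \<cdot> u)"
    using f i assms by (subst Comp_assoc[symmetric]; simp del: Comp_assoc)+
  moreover have "icomp C X (iinv C X f \<cdot> u) (f \<cdot> u) = icomp C X (iinv C X f) f \<cdot> u"
    "icomp C X (f \<cdot> u) (iinv C X f \<cdot> u) = icomp C X f (iinv C X f) \<cdot> u"
    using f i(1-5) assms by (subst icomp_comp; simp)+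
  ultimately show ?thesis
    using f assms i by (intro iinv_eqI) auto
qed

lemma iinv_idn: "\<lbrakk>A \<in> Arr C; Cod C A = Ob X\<rbrakk> \<Longrightarrow> iinv C X (idn X \<cdot> A) = idn X \<cdot> A"
  by (intro iinv_eqI) auto

lemma iinv_icomp:
  assumes "iiso C X f" "iiso C X g" "Dom C g = Dom C f" "src X \<cdot> g = tgt X \<cdot> f"
  shows "iinv C X (icomp C X g f) = icomp C X (iinv C X f) (iinv C X g)"
proof -
  note f = iiso_in[OF assms(1)] and i = iinv_in[OF assms(1)]
    and g = iiso_in[OF assms(2)] and j = iinv_in[OF assms(2)]
  have "icomp C X (icomp C X (iinv C X f) (iinv C X g)) (icomp C X g f)
      = icomp C X (iinv C X f) (icomp C X (icomp C X (iinv C X g) g) f)"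
    using f g i(1-5) j(1-5) assms by (simp del: iinv_in(6,7))
  also have "icomp C X (iinv C X g) g = idn X \<cdot> (tgt X \<cdot> f)" using j assms by simp
  also have "icomp C X (iinv C X f) (icomp C X \<dots> f) = idn X \<cdot> (src X \<cdot> f)" using f i by simp
  finally have 1: "icomp C X (icomp C X (iinv C X f) (iinv C X g)) (icomp C X g f) = idn X \<cdot> (src X
      \<cdot> f)" .
  have "icomp C X (icomp C X g f) (icomp C X (iinv C X f) (iinv C X g))
      = icomp C X g (icomp C X (icomp C X f (iinv C X f)) (iinv C X g))"
    using f g i(1-5) j(1-5) assms by (simp del: iinv_in(6,7))
  also have "icomp C X f (iinv C X f) = idn X \<cdot> (src X \<cdot> g)" using i assms by simp
  also have "icomp C X g (icomp C X \<dots> (iinv C X g)) = idn X \<cdot> (tgt X \<cdot> g)" using g j by simp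
  finally have 2: "icomp C X (icomp C X g f) (icomp C X (iinv C X f) (iinv C X g)) = idn X \<cdot> (tgt X
      \<cdot> g)" .
  show ?thesis
  proof (rule iinv_eqI)
    show "icomp C X (icomp C X (iinv C X f) (iinv C X g)) (icomp C X g f) = idn X \<cdot> (src X \<cdot> icomp
        C X g f)"
      unfolding 1 using f g assms by simp
    show "icomp C X (icomp C X g f) (icomp C X (iinv C X f) (iinv C X g)) = idn X \<cdot> (tgt X \<cdot> icomp
        C X g f)"
      unfolding 2 using f g assms by simp
  qed (use f g i(1-5) j(1-5) assms in auto)
qed

end

section \<open>Internal functors acting on generalised elements\<close>

locale internal_ftr = finite_limits C for C :: "('o, 'a) category" (structure) +
  fixes F :: "('o, 'a) ifun"
  assumes F: "internal_functor C F"
    and idom: "internal_category C (idom F)" and icod: "internal_category C (icod F)"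
begin

sublocale A: internal_cat C "idom F" by unfold_locales (rule idom)
sublocale B: internal_cat C "icod F" by unfold_locales (rule icod)

lemma ifun_in [simp]:
  "f0 F \<in> Arr C" "Dom C (f0 F) = Ob (idom F)" "Cod C (f0 F) = Ob (icod F)"
  "f1 F \<in> Arr C" "Dom C (f1 F) = Mor (idom F)" "Cod C (f1 F) = Mor (icod F)"
  using F by (auto simp: internal_functor_def hom_def)

lemma f1_src_tgt [simp]:
  assumes "f \<in> Arr C" "Cod C f = Mor (idom F)"
  shows "src (icod F) \<cdot> (f1 F \<cdot> f) = f0 F \<cdot> (src (idom F) \<cdot> f)"
    "tgt (icod F) \<cdot> (f1 F \<cdot> f) = f0 F \<cdot> (tgt (idom F) \<cdot> f)"
proof -
  have "src (icod F) \<cdot> f1 F = f0 F \<cdot> src (idom F)" "tgt (icod F) \<cdot> f1 F = f0 F \<cdot> tgt (idom F)"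
    using F by (auto simp: internal_functor_def)
  then show "src (icod F) \<cdot> (f1 F \<cdot> f) = f0 F \<cdot> (src (idom F) \<cdot> f)"
    "tgt (icod F) \<cdot> (f1 F \<cdot> f) = f0 F \<cdot> (tgt (idom F) \<cdot> f)"
    using assms by (subst Comp_assoc[symmetric]; simp del: Comp_assoc; simp)+
qed

lemma f1_idn [simp]:
  assumes "A \<in> Arr C" "Cod C A = Ob (idom F)"
  shows "f1 F \<cdot> (idn (idom F) \<cdot> A) = idn (icod F) \<cdot> (f0 F \<cdot> A)"
proof -
  have "f1 F \<cdot> idn (idom F) = idn (icod F) \<cdot> f0 F"
    using F by (auto simp: internal_functor_def)
  then show ?thesis
    using assms by (subst Comp_assoc[symmetric]; simp del: Comp_assoc; simp)
qed

lemma f1_icomp [simp]: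
  assumes fg: "f \<in> Arr C" "g \<in> Arr C" "Cod C f = Mor (idom F)" "Cod C g = Mor (idom F)"
    "Dom C g = Dom C f" "src (idom F) \<cdot> g = tgt (idom F) \<cdot> f"
  shows "f1 F \<cdot> icomp C (idom F) g f = icomp C (icod F) (f1 F \<cdot> g) (f1 F \<cdot> f)"
proof -
  let ?h = "pb_pair C (src (idom F)) (tgt (idom F)) g f"
  note h = pb_pair_spec[of "src (idom F)" "tgt (idom F)" g f] and pb = pb_in[of "src (idom F)" "tgt
      (idom F)"]
  have "f1 F \<cdot> icomp C (idom F) g f = (f1 F \<cdot> cmp (idom F)) \<cdot> ?h"
    using h fg by (simp add: icomp_def)
  also have "f1 F \<cdot> cmp (idom F) =
       icomp C (icod F) (f1 F \<cdot> cpair1 C (idom F)) (f1 F \<cdot> cpair2 C (idom F))"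
    using F by (auto simp: internal_functor_def)
  also have "\<dots> \<cdot> ?h = icomp C (icod F) (f1 F \<cdot> g) (f1 F \<cdot> f)"
    using h fg pb by (simp add: cpair1_def cpair2_def)
  finally show ?thesis .
qed

end

section \<open>Powers of an internal category\<close>

context internal_cat
begin

lemma ipow_sel [simp]:
  "Ob (ipow C n X) = pow C (Ob X) n" "Mor (ipow C n X) = pow C (Mor X) n"
  "src (ipow C n X) = pow_map C n (src X)" "tgt (ipow C n X) = pow_map C n (tgt X)"
  "idn (ipow C n X) = pow_map C n (idn X)"
  by (simp_all add: ipow_def Let_def)

text \<open>In the power, \<open>cmp\<close> is a tuple of compositions on the pullback of the
  powers of \<open>src\<close> and \<open>tgt\<close>. Since composition is natural in the stage,
  evaluating the tuple at a pair of arrows composes them in each component.\<close>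

lemma ipow_icomp:
  assumes fg: "f \<in> Arr C" "g \<in> Arr C" "Cod C f = pow C (Mor X) n" "Cod C g = pow C (Mor X) n"
    "Dom C g = Dom C f" "pow_map C n (src X) \<cdot> g = pow_map C n (tgt X) \<cdot> f"
  shows "icomp C (ipow C n X) g f \<in> Arr C" "Dom C (icomp C (ipow C n X) g f) = Dom C f"
    "Cod C (icomp C (ipow C n X) g f) = pow C (Mor X) n"
    "\<And>i. i < n \<Longrightarrow> proj C (Mor X) n i \<cdot> icomp C (ipow C n X) g f
      = icomp C X (proj C (Mor X) n i \<cdot> g) (proj C (Mor X) n i \<cdot> f)"
proof -
  let ?s = "pow_map C n (src X)" and ?t = "pow_map C n (tgt X)"
  let ?h = "pb_pair C ?s ?t g f" and ?p = "fst (snd (pb C ?s ?t))" and ?q = "snd (snd (pb C ?s ?t))"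
  let ?c = "\<lambda>i. icomp C X (proj C (Mor X) n i \<cdot> ?p) (proj C (Mor X) n i \<cdot> ?q)"
  have h: "?h \<in> Arr C" "Dom C ?h = Dom C f" "Cod C ?h = fst (pb C ?s ?t)" "?p \<cdot> ?h = g" "?q \<cdot> ?h =
      f"
    using pb_pair_spec[of ?s ?t g f] fg by auto
  note pb = pb_in[of ?s ?t, simplified]
  \<comment> \<open>Projecting the pullback square shows that the components of the universal pair
    are composable, without which \<open>icomp\<close> has no meaning.\<close>
  have e: "src X \<cdot> (proj C (Mor X) n i \<cdot> ?p) = tgt X \<cdot> (proj C (Mor X) n i \<cdot> ?q)" if "i < n" for i
  proof -
    have "src X \<cdot> (proj C (Mor X) n i \<cdot> ?p) = proj C (Ob X) n i \<cdot> (?s \<cdot> ?p)"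
      using that pb(1-6) by simp
    also have "?s \<cdot> ?p = ?t \<cdot> ?q" using pb(7) .
    also have "proj C (Ob X) n i \<cdot> \<dots> = tgt X \<cdot> (proj C (Mor X) n i \<cdot> ?q)" using that pb(1-6) by simp
    finally show ?thesis .
  qed
  have c: "?c i \<in> Arr C \<and> Dom C (?c i) = fst (pb C ?s ?t) \<and> Cod C (?c i) = Mor X" if "i < n" for i
    using that pb e by simp
  have eq: "icomp C (ipow C n X) g f = tup C (fst (pb C ?s ?t)) (Mor X) n ?c \<cdot> ?h"
    by (simp add: icomp_def ipow_def Let_def)
  have "proj C (Mor X) n i \<cdot> icomp C (ipow C n X) g f = ?c i \<cdot> ?h" if "i < n" for i
    unfolding eq using c h pb that by simp
  then show "\<And>i. i < n \<Longrightarrow> proj C (Mor X) n i \<cdot> icomp C (ipow C n X) g f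
      = icomp C X (proj C (Mor X) n i \<cdot> g) (proj C (Mor X) n i \<cdot> f)"
    using h pb e by simp
  show "icomp C (ipow C n X) g f \<in> Arr C" "Dom C (icomp C (ipow C n X) g f) = Dom C f"
    "Cod C (icomp C (ipow C n X) g f) = pow C (Mor X) n"
    unfolding eq using c h pb by simp_all
qed

text \<open>The componentwise inverses are collected into a tuple. Consequently a tuple of good
  isomorphisms is an isomorphism of the power, which leads to the componentwise description
  \<open>good_tuples_iff\<close>.\<close>

lemma iiso_ipow:
  assumes f: "f \<in> Arr C" "Cod C f = pow C (Mor X) n" and iso: "\<And>i. i < n \<Longrightarrow> iiso C X (proj C (Mor X)
      n i \<cdot> f)"
  shows "iiso C (ipow C n X) f"
proof -
  define g where "g = tup C (Dom C f) (Mor X) n (\<lambda>i. iinv C X (proj C (Mor X) n i \<cdot> f))"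
  have g: "g \<in> Arr C" "Dom C g = Dom C f" "Cod C g = pow C (Mor X) n"
    and gi: "\<And>i. i < n \<Longrightarrow> proj C (Mor X) n i \<cdot> g = iinv C X (proj C (Mor X) n i \<cdot> f)"
    unfolding g_def using f iso by simp_all
  have s: "pow_map C n (src X) \<cdot> g = pow_map C n (tgt X) \<cdot> f"
    by (rule pow_eqI[of "Ob X" _ _ n]) (use f g gi iso in auto)
  have t: "pow_map C n (src X) \<cdot> f = pow_map C n (tgt X) \<cdot> g"
    by (rule pow_eqI[of "Ob X" _ _ n]) (use f g gi iso in auto)
  have "icomp C (ipow C n X) g f = pow_map C n (idn X) \<cdot> (pow_map C n (src X) \<cdot> f)"
    by (rule pow_eqI[of "Mor X" _ _ n])
      (simp_all add: ipow_icomp[OF f(1) g(1) f(2) g(3,2) s] f g gi iso)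
  moreover have "icomp C (ipow C n X) f g = pow_map C n (idn X) \<cdot> (pow_map C n (tgt X) \<cdot> f)"
    by (rule pow_eqI[of "Mor X" _ _ n])
      (simp_all add: ipow_icomp[OF g(1) f(1) g(3) f(2) g(2)[symmetric] t] f g gi iso)
  ultimately show ?thesis
    unfolding iiso_def using f g s t by (auto simp: ihom_def hom_def intro!: bexI[of _ g])
qed

end

section \<open>The levels of a parametric model\<close>

text \<open>The generalised elements at stage \<open>J\<close> of the level \<open>l\<close>.\<close>

definition stage :: "('o, 'a) model_data \<Rightarrow> nat \<Rightarrow> 'o \<Rightarrow> ('a, 'a) cc" where
  "stage R l J = \<lparr>Obj = {A \<in> Arr (Amb R). Dom (Amb R) A = J \<and> Cod (Amb R) A = R0 R l},
     Arr = {f \<in> Arr (Amb R). Dom (Amb R) f = J \<and> Cod (Amb R) f = R1 R l},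
     Dom = \<lambda>f. lsrc R l f, Cod = \<lambda>f. ltgt R l f, Ide = \<lambda>A. lid R l A, Comp = \<lambda>g f. lcomp R l g f,
     prd = iprod R l, pfst = ifst R l, psnd = isnd R l, ppair = ipair R l,
     expn = iexp R l, evl = ieval R l, cur = icurry R l\<rparr>"

lemma stage_sel:
  "Obj (stage R l J) = {A \<in> Arr (Amb R). Dom (Amb R) A = J \<and> Cod (Amb R) A = R0 R l}"
  "Arr (stage R l J) = {f \<in> Arr (Amb R). Dom (Amb R) f = J \<and> Cod (Amb R) f = R1 R l}"
  "Dom (stage R l J) f = lsrc R l f" "Cod (stage R l J) f = ltgt R l f"
  "Ide (stage R l J) A = lid R l A" "Comp (stage R l J) g f = lcomp R l g f"
  "prd (stage R l J) = iprod R l" "pfst (stage R l J) = ifst R l" "psnd (stage R l J) = isnd R l"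
  "ppair (stage R l J) = ipair R l" "expn (stage R l J) = iexp R l" "evl (stage R l J) = ieval R l"
  "cur (stage R l J) = icurry R l"
  by (simp_all add: stage_def)

lemma stage_pmap: "pmap (stage R l J) f g = iprodmap R l f g"
  by (simp add: pmap_def iprodmap_def stage_sel)

lemma stage_emap: "emap (stage R l J) f g = iexpmap R l f g"
  by (simp add: emap_def iexpmap_def stage_sel stage_pmap Let_def)

lemmas stage_simps = stage_sel stage_pmap stage_emap

lemma cube_comp_face_degen: "k \<le> l \<Longrightarrow> cube_comp (face e l k) (degen l k) = cube_id l"
  by (auto simp: cube_comp_def face_def degen_def cube_id_def fun_eq_iff)

lemma enat_Suc_le [simp]: "enat l < p \<Longrightarrow> enat (Suc l) \<le> p"
  by (simp add: Suc_ile_eq)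

lemma enat_less_le [simp]: "enat l < p \<Longrightarrow> enat l \<le> p"
  by simp

locale model =
  fixes R :: "('o, 'a) model_data"
  assumes model: "parametric_model R"
begin

abbreviation "\<A> \<equiv> Arr (Amb R)"
abbreviation "\<D> \<equiv> Dom (Amb R)"
abbreviation "\<C> \<equiv> Cod (Amb R)"

sublocale finite_limits "Amb R"
  using model by unfold_locales (simp add: parametric_model_def)

lemma level_internal_cat: "enat l \<le> dimn R \<Longrightarrow> internal_cat (Amb R) (Lv R l)"
  using model by unfold_locales
    (auto simp: parametric_model_def cubical_category_def is_functor_def cube_upto_def Cat_def)

lemma act_internal_ftr:
  assumes "h \<in> cube_arr_upto (dimn R)"
  shows "internal_ftr (Amb R) (on_arr (Rel R) h) \<and> idom (on_arr (Rel R) h) = Lv R (cdom h) \<and>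
    icod (on_arr (Rel R) h) = Lv R (ccod h)"
proof -
  have "on_arr (Rel R) h \<in> hom (Cat (Amb R)) (Lv R (cdom h)) (Lv R (ccod h))"
    using model assms
    by (auto simp: parametric_model_def cubical_category_def is_functor_def cube_upto_def cube_def)
  then show ?thesis
    by (auto simp: hom_def Cat_def intro!: internal_ftr.intro internal_ftr_axioms.intro
        finite_limits_axioms)
qed

lemma face_internal_ftr:
  assumes "enat l < dimn R" "k \<le> l"
  shows "internal_ftr (Amb R) (on_arr (Rel R) (face e l k))"
    "idom (on_arr (Rel R) (face e l k)) = Lv R (Suc l)" "icod (on_arr (Rel R) (face e l k)) = Lv R
        l"
  using act_internal_ftr[OF cface[OF assms]] by (auto simp: face_def)

lemma degen_internal_ftr:
  assumes "enat l < dimn R" "k \<le> l"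
  shows "internal_ftr (Amb R) (on_arr (Rel R) (degen l k))"
    "idom (on_arr (Rel R) (degen l k)) = Lv R l" "icod (on_arr (Rel R) (degen l k)) = Lv R (Suc l)"
  using act_internal_ftr[OF cdegen[OF assms]] by (auto simp: degen_def)

text \<open>Functoriality of \<open>Rel\<close> carries the retraction
  \<open>cube_comp_face_degen\<close> over to the action on objects. \<open>rsubst\<close> depends
  on it for moving a tuple of witnesses from the stage of level \<open>l\<close> to that of level
  \<open>Suc l\<close> and back.\<close>

lemma face_degen_act0:
  assumes "enat l < dimn R" "k \<le> l"
  shows "acomp R (act0 R (face e l k)) (act0 R (degen l k)) = Ide (Amb R) (R0 R l)"
proof -
  have F: "is_functor (cube_upto (dimn R)) (Cat (Amb R)) (Rel R)"
    using model by (auto simp: parametric_model_def cubical_category_def)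
  have "on_arr (Rel R) (cube_comp (face e l k) (degen l k))
      = ifcomp (Amb R) (on_arr (Rel R) (face e l k)) (on_arr (Rel R) (degen l k))"
    using F cface[OF assms, of e] cdegen[OF assms]
    by (auto simp: is_functor_def cube_upto_def cube_def Cat_def face_def degen_def)
  moreover have "on_arr (Rel R) (cube_id l) = ifid (Amb R) (Lv R l)"
    using F assms by (auto simp: is_functor_def cube_upto_def cube_def Cat_def)
  ultimately have "ifcomp (Amb R) (on_arr (Rel R) (face e l k)) (on_arr (Rel R) (degen l k))
      = ifid (Amb R) (Lv R l)"
    using assms by (simp add: cube_comp_face_degen)
  then show ?thesis by (simp add: ifcomp_def ifid_def)
qed

section \<open>One level: good isomorphisms, products and exponentials\<close>

context
  fixes l :: nat assumes l: "enat l \<le> dimn R"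
begin

interpretation internal_cat "Amb R" "Lv R l" using l by (rule level_internal_cat)

lemmas level_in [simp] = icat_in
lemmas level_src_idn_comp [simp] = src_idn_comp
lemmas level_icomp_in [simp] = icomp_in
lemmas level_src_tgt_icomp [simp] = src_tgt_icomp
lemmas level_icomp_comp [simp] = icomp_comp
lemmas level_icomp_idn [simp] = icomp_idn
lemmas level_icomp_assoc [simp] = icomp_assoc
lemmas level_iinv_in [simp] = iinv_in
lemmas level_iinv_comp = iinv_comp
lemmas level_iinv_idn [simp] = iinv_idn
lemmas level_iinv_icomp = iinv_icomp
lemmas level_ipow_sel [simp] = ipow_sel
lemmas level_ipow_icomp = ipow_icomp

lemma good_iiso [simp]: "f \<in> Good R l \<Longrightarrow> iiso (Amb R) (Lv R l) f"
  and good_lid [simp]: "\<lbrakk>A \<in> \<A>; \<C> A = R0 R l\<rbrakk> \<Longrightarrow> lid R l A \<in> Good R l"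
  and good_lcomp [simp]: "\<lbrakk>f \<in> Good R l; g \<in> Good R l; \<D> g = \<D> f;
    lsrc R l g = ltgt R l f\<rbrakk> \<Longrightarrow> lcomp R l g f \<in> Good R l"
  and good_linv [simp]: "f \<in> Good R l \<Longrightarrow> linv R l f \<in> Good R l"
  and good_comp [simp]: "\<lbrakk>f \<in> Good R l; u \<in> \<A>; \<C> u = \<D> f\<rbrakk>
    \<Longrightarrow> acomp R f u \<in> Good R l"
proof -
  have G: "\<lbrakk>J \<in> Obj (Amb R); A \<in> hom (Amb R) J (R0 R l)\<rbrakk> \<Longrightarrow> lid R l A \<in> Good R l" for J A
    using model l unfolding parametric_model_def good_class_def by blast
  show "\<lbrakk>A \<in> \<A>; \<C> A = R0 R l\<rbrakk> \<Longrightarrow> lid R l A \<in> Good R l"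
    using G[of "\<D> A"] by (simp add: hom_def)
qed (use model l in \<open>unfold parametric_model_def good_class_def, auto\<close>)

lemma good_in: "f \<in> Good R l \<Longrightarrow> f \<in> \<A>" "f \<in> Good R l \<Longrightarrow> \<C> f = R1 R l"
  using iiso_in good_iiso by blast+

text \<open>Good components are isomorphisms, and isomorphisms of a power are found
  componentwise.\<close>

lemma good_tuples_iff: "f \<in> good_tuples R n l \<longleftrightarrow>
   (\<exists>m. f \<in> hom (Amb R) (pow (Amb R) (R0 R l) m) (pow (Amb R) (R1 R l) n)) \<and>
   (\<forall>k<n. acomp R (proj (Amb R) (R1 R l) n k) f \<in> Good R l)"
  unfolding good_tuples_def using iiso_ipow[of f n] by (auto simp: hom_def)

private lemma SP: "times R l \<in> hom (Amb R) (pow (Amb R) (R0 R l) 2) (R0 R l) \<and>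
        fst_arr R l \<in> hom (Amb R) (pow (Amb R) (R0 R l) 2) (R1 R l) \<and>
        snd_arr R l \<in> hom (Amb R) (pow (Amb R) (R0 R l) 2) (R1 R l)"
  and SPu: "\<lbrakk>J \<in> Obj (Amb R); A \<in> hom (Amb R) J (R0 R l); B \<in> hom (Amb R) J (R0 R l)\<rbrakk> \<Longrightarrow>
           ifst R l A B \<in> lhom R l (iprod R l A B) A \<and>
           isnd R l A B \<in> lhom R l (iprod R l A B) B \<and>
           (\<forall>D \<in> hom (Amb R) J (R0 R l). \<forall>f \<in> lhom R l D A. \<forall>g \<in> lhom R l D B.
              \<exists>!h. h \<in> lhom R l D (iprod R l A B) \<and>
                lcomp R l (ifst R l A B) h = f \<and> lcomp R l (isnd R l A B) h = g)"
  and SPg: "\<lbrakk>f \<in> Good R l; g \<in> Good R l; \<D> f = \<D> g\<rbrakk> \<Longrightarrow>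
           iprodmap R l f g \<in> Good R l"
  using model l unfolding parametric_model_def stable_products_def by blast+

private lemma SE: "expo R l \<in> hom (Amb R) (pow (Amb R) (R0 R l) 2) (R0 R l) \<and>
        eval_arr R l \<in> hom (Amb R) (pow (Amb R) (R0 R l) 2) (R1 R l)"
  and SEu: "\<lbrakk>J \<in> Obj (Amb R); A \<in> hom (Amb R) J (R0 R l); B \<in> hom (Amb R) J (R0 R l)\<rbrakk> \<Longrightarrow>
           ieval R l A B \<in> lhom R l (iprod R l (iexp R l A B) A) B \<and>
           (\<forall>D \<in> hom (Amb R) J (R0 R l). \<forall>f \<in> lhom R l (iprod R l D A) B.
              \<exists>!h. h \<in> lhom R l D (iexp R l A B) \<and>
                lcomp R l (ieval R l A B) (iprodmap R l h (lid R l A)) = f)"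
  and SEg: "\<lbrakk>f \<in> Good R l; g \<in> Good R l; \<D> f = \<D> g\<rbrakk> \<Longrightarrow>
           iexpmap R l f g \<in> Good R l"
  using model l unfolding parametric_model_def stable_exponentials_def by blast+

lemmas good_iprodmap [simp] = SPg
lemmas good_iexpmap [simp] = SEg

lemma structure_in [simp]:
  "times R l \<in> \<A>" "\<D> (times R l) = pow (Amb R) (R0 R l) 2"
  "\<C> (times R l) = R0 R l"
  "fst_arr R l \<in> \<A>" "\<D> (fst_arr R l) = pow (Amb R) (R0 R l) 2"
  "\<C> (fst_arr R l) = R1 R l"
  "snd_arr R l \<in> \<A>" "\<D> (snd_arr R l) = pow (Amb R) (R0 R l) 2"
  "\<C> (snd_arr R l) = R1 R l"
  "expo R l \<in> \<A>" "\<D> (expo R l) = pow (Amb R) (R0 R l) 2"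
  "\<C> (expo R l) = R0 R l"
  "eval_arr R l \<in> \<A>" "\<D> (eval_arr R l) = pow (Amb R) (R0 R l) 2"
  "\<C> (eval_arr R l) = R1 R l"
  using SP SE by (auto simp: hom_def)

lemma one_in [simp]: "one R l \<in> \<A>" "\<D> (one R l) = term_ob (Amb R)"
  "\<C> (one R l) = R0 R l"
  using model l unfolding parametric_model_def stable_terminal_def hom_def by auto

context
  fixes A B
  assumes AB: "A \<in> \<A>" "B \<in> \<A>" "\<D> B = \<D> A"
    "\<C> A = R0 R l" "\<C> B = R0 R l"
begin

lemma iprod_in [simp]: "iprod R l A B \<in> \<A>" "\<D> (iprod R l A B) = \<D> A"
  "\<C> (iprod R l A B) = R0 R l"
  "iexp R l A B \<in> \<A>" "\<D> (iexp R l A B) = \<D> A"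
  "\<C> (iexp R l A B) = R0 R l"
  using AB by (simp_all add: iprod_def iexp_def)

end

context
  fixes A B
  assumes AB: "A \<in> \<A>" "B \<in> \<A>" "\<D> B = \<D> A"
    "\<C> A = R0 R l" "\<C> B = R0 R l"
begin

lemma ifst_in [simp]:
  "ifst R l A B \<in> \<A>" "\<D> (ifst R l A B) = \<D> A"
  "\<C> (ifst R l A B) = R1 R l" "lsrc R l (ifst R l A B) = iprod R l A B" "ltgt R l (ifst R l A B) =
      A"
  "isnd R l A B \<in> \<A>" "\<D> (isnd R l A B) = \<D> A"
  "\<C> (isnd R l A B) = R1 R l" "lsrc R l (isnd R l A B) = iprod R l A B" "ltgt R l (isnd R l A B) =
      B"
  using SPu[of "\<D> A" A B] AB by (auto simp: ihom_def hom_def)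

lemma ieval_in [simp]:
  "ieval R l A B \<in> \<A>" "\<D> (ieval R l A B) = \<D> A"
  "\<C> (ieval R l A B) = R1 R l"
  "lsrc R l (ieval R l A B) = iprod R l (iexp R l A B) A" "ltgt R l (ieval R l A B) = B"
  using SEu[of "\<D> A" A B] AB by (auto simp: ihom_def hom_def)

lemma structure_comp [simp]:
  assumes "u \<in> \<A>" "\<C> u = \<D> A"
  shows "acomp R (iprod R l A B) u = iprod R l (acomp R A u) (acomp R B u)"
    "acomp R (iexp R l A B) u = iexp R l (acomp R A u) (acomp R B u)"
    "acomp R (ifst R l A B) u = ifst R l (acomp R A u) (acomp R B u)"
    "acomp R (isnd R l A B) u = isnd R l (acomp R A u) (acomp R B u)"
    "acomp R (ieval R l A B) u = ieval R l (acomp R A u) (acomp R B u)"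
  using AB assms by (simp_all add: iprod_def iexp_def ifst_def isnd_def ieval_def)

end

private lemma pair_ex1:
  assumes fg: "f \<in> \<A>" "g \<in> \<A>" "\<C> f = R1 R l" "\<C> g = R1 R l"
    "\<D> g = \<D> f" "lsrc R l g = lsrc R l f" "ltgt R l f = A" "ltgt R l g = B"
  shows "\<exists>!h. h \<in> lhom R l (lsrc R l f) (iprod R l A B) \<and>
     lcomp R l (ifst R l A B) h = f \<and> lcomp R l (isnd R l A B) h = g"
proof -
  have "A \<in> hom (Amb R) (\<D> f) (R0 R l)" "B \<in> hom (Amb R) (\<D> f) (R0 R l)"
    "lsrc R l f \<in> hom (Amb R) (\<D> f) (R0 R l)" "\<D> f \<in> Obj (Amb R)"
    using fg(1-5) by (auto simp: hom_def fg(7,8)[symmetric])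
  moreover have "f \<in> lhom R l (lsrc R l f) A" "g \<in> lhom R l (lsrc R l f) B"
    using fg by (auto simp: ihom_def hom_def)
  ultimately show ?thesis using SPu by blast
qed

private lemma curry_ex1:
  assumes f: "f \<in> \<A>" "\<C> f = R1 R l" "D \<in> \<A>" "A \<in> \<A>"
    "\<D> D = \<D> f" "\<D> A = \<D> f"
    "\<C> D = R0 R l" "\<C> A = R0 R l" "lsrc R l f = iprod R l D A" "ltgt R l f = B"
  shows "\<exists>!h. h \<in> lhom R l D (iexp R l A B) \<and>
     lcomp R l (ieval R l A B) (iprodmap R l h (lid R l A)) = f"
proof -
  have "A \<in> hom (Amb R) (\<D> f) (R0 R l)" "B \<in> hom (Amb R) (\<D> f) (R0 R l)"
    "D \<in> hom (Amb R) (\<D> f) (R0 R l)" "\<D> f \<in> Obj (Amb R)"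
    using f(1-8) by (auto simp: hom_def f(10)[symmetric])
  moreover have "f \<in> lhom R l (iprod R l D A) B"
    using f by (auto simp: ihom_def hom_def)
  ultimately show ?thesis using SEu by blast
qed

context
  fixes f g
  assumes fg: "f \<in> \<A>" "g \<in> \<A>" "\<C> f = R1 R l" "\<C> g = R1 R l"
    "\<D> g = \<D> f"
begin

private lemma pair_spec:
  assumes "lsrc R l g = lsrc R l f"
  shows "ipair R l f g \<in> lhom R l (lsrc R l f) (iprod R l (ltgt R l f) (ltgt R l g)) \<and>
     lcomp R l (ifst R l (ltgt R l f) (ltgt R l g)) (ipair R l f g) = f \<and>
     lcomp R l (isnd R l (ltgt R l f) (ltgt R l g)) (ipair R l f g) = g"
  unfolding ipair_def by (rule theI') (rule pair_ex1[OF fg assms refl refl])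

lemma ipair_in [simp]:
  assumes "lsrc R l g = lsrc R l f"
  shows "ipair R l f g \<in> \<A>" "\<D> (ipair R l f g) = \<D> f"
    "\<C> (ipair R l f g) = R1 R l" "lsrc R l (ipair R l f g) = lsrc R l f"
    "ltgt R l (ipair R l f g) = iprod R l (ltgt R l f) (ltgt R l g)"
    "\<lbrakk>ltgt R l f = A; ltgt R l g = B\<rbrakk> \<Longrightarrow> lcomp R l (ifst R l A B) (ipair R l f g) = f"
    "\<lbrakk>ltgt R l f = A; ltgt R l g = B\<rbrakk> \<Longrightarrow> lcomp R l (isnd R l A B) (ipair R l f g) = g"
  using pair_spec[OF assms] fg by (auto simp: ihom_def hom_def)

end

context
  fixes f g
  assumes fg: "f \<in> \<A>" "g \<in> \<A>" "\<C> f = R1 R l" "\<C> g = R1 R l"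
    "\<D> g = \<D> f"
begin

lemma iprodmap_in [simp]:
  "iprodmap R l f g \<in> \<A>" "\<D> (iprodmap R l f g) = \<D> f"
  "\<C> (iprodmap R l f g) = R1 R l"
  "lsrc R l (iprodmap R l f g) = iprod R l (lsrc R l f) (lsrc R l g)"
  "ltgt R l (iprodmap R l f g) = iprod R l (ltgt R l f) (ltgt R l g)"
  using fg by (simp_all add: iprodmap_def)

end

private lemma pair_eta:
  assumes h: "h \<in> \<A>" "\<C> h = R1 R l" "A \<in> \<A>" "B \<in> \<A>"
    "\<D> A = \<D> h" "\<D> B = \<D> h"
    "\<C> A = R0 R l" "\<C> B = R0 R l" "ltgt R l h = iprod R l A B"
  shows "ipair R l (lcomp R l (ifst R l A B) h) (lcomp R l (isnd R l A B) h) = h"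
proof -
  let ?f = "lcomp R l (ifst R l A B) h" and ?g = "lcomp R l (isnd R l A B) h"
  have t: "ltgt R l ?f = A" "ltgt R l ?g = B" "lsrc R l ?f = lsrc R l h" "lsrc R l ?g = lsrc R l h"
    using h by simp_all
  have "\<exists>!k. k \<in> lhom R l (lsrc R l ?f) (iprod R l A B) \<and>
     lcomp R l (ifst R l A B) k = ?f \<and> lcomp R l (isnd R l A B) k = ?g"
    by (rule pair_ex1) (use h in simp_all)
  then show ?thesis
    unfolding ipair_def t by (rule the1_equality) (use h in \<open>simp add: ihom_def hom_def\<close>)
qed

context
  fixes f D A B
  assumes f: "f \<in> \<A>" "\<C> f = R1 R l" "D \<in> \<A>" "A \<in> \<A>"
    "\<D> D = \<D> f" "\<D> A = \<D> f"
    "\<C> D = R0 R l" "\<C> A = R0 R l" "lsrc R l f = iprod R l D A" "ltgt R l f = B"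
begin

private lemma curry_spec: "icurry R l D A B f \<in> lhom R l D (iexp R l A B) \<and>
    lcomp R l (ieval R l A B) (iprodmap R l (icurry R l D A B f) (lid R l A)) = f"
  unfolding icurry_def by (rule theI') (rule curry_ex1[OF f])

lemma icurry_in [simp]: "icurry R l D A B f \<in> \<A>" "\<D> (icurry R l D A B f) = \<D> f"
  "\<C> (icurry R l D A B f) = R1 R l" "lsrc R l (icurry R l D A B f) = D"
  "ltgt R l (icurry R l D A B f) = iexp R l A B"
  "lcomp R l (ieval R l A B) (iprodmap R l (icurry R l D A B f) (lid R l A)) = f"
  using curry_spec f by (simp_all add: ihom_def hom_def)

end

private lemma curry_eta:
  assumes h: "h \<in> \<A>" "\<C> h = R1 R l" "A \<in> \<A>" "B \<in> \<A>"
    "\<D> A = \<D> h" "\<D> B = \<D> h"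
    "\<C> A = R0 R l" "\<C> B = R0 R l" "ltgt R l h = iexp R l A B" "lsrc R l h = D"
  shows "icurry R l D A B (lcomp R l (ieval R l A B) (iprodmap R l h (lid R l A))) = h"
proof -
  let ?f = "lcomp R l (ieval R l A B) (iprodmap R l h (lid R l A))"
  have D: "D \<in> \<A>" "\<D> D = \<D> h" "\<C> D = R0 R l"
    using h(1-8) by (simp_all flip: h(10))
  have "\<exists>!k. k \<in> lhom R l D (iexp R l A B) \<and>
     lcomp R l (ieval R l A B) (iprodmap R l k (lid R l A)) = ?f"
    by (rule curry_ex1) (use h D in simp_all)
  then show ?thesis
    unfolding icurry_def by (rule the1_equality) (use h D in \<open>simp add: ihom_def hom_def\<close>)
qed

text \<open>The universal properties of the model quantify over all stages, so unique existence is
  available at \<open>J\<close>: it makes \<open>ipair\<close> and \<open>icurry\<close> well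
  defined and yields the two eta laws.\<close>

lemma ccc_stage: "ccc (stage R l J)"
  by unfold_locales (auto simp: stage_simps pair_eta curry_eta)

lemma iexpmap_in [simp]:
  assumes "f \<in> \<A>" "g \<in> \<A>" "\<C> f = R1 R l" "\<C> g = R1 R l"
    "\<D> g = \<D> f"
  shows "iexpmap R l f g \<in> \<A>" "\<D> (iexpmap R l f g) = \<D> f"
    "\<C> (iexpmap R l f g) = R1 R l"
    "lsrc R l (iexpmap R l f g) = iexp R l (ltgt R l f) (lsrc R l g)"
    "ltgt R l (iexpmap R l f g) = iexp R l (lsrc R l f) (ltgt R l g)"
  using ccc.emap_in[OF ccc_stage, of f "\<D> f" g] ccc.Dom_emap[OF ccc_stage, of f "\<D> f" g]
    ccc.Cod_emap[OF ccc_stage, of f "\<D> f" g] assms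
  by (simp_all add: stage_simps)

lemma iprodmap_lid [simp]:
  assumes "A \<in> \<A>" "B \<in> \<A>" "\<C> A = R0 R l" "\<C> B = R0 R l"
    "\<D> B = \<D> A"
  shows "iprodmap R l (lid R l A) (lid R l B) = lid R l (iprod R l A B)"
    "iexpmap R l (lid R l A) (lid R l B) = lid R l (iexp R l A B)"
  using ccc.pmap_Ide[OF ccc_stage, of A "\<D> A" B] ccc.emap_Ide[OF ccc_stage, of A "\<D> A" B] assms
  by (simp_all add: stage_simps)

lemma iprodmap_lcomp:
  assumes "f \<in> \<A>" "g \<in> \<A>" "h \<in> \<A>" "k \<in> \<A>"
    "\<C> f = R1 R l" "\<C> g = R1 R l" "\<C> h = R1 R l" "\<C> k = R1 R l"
    "\<D> g = \<D> f" "\<D> h = \<D> f" "\<D> k = \<D> f"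
    "lsrc R l f = ltgt R l h" "lsrc R l g = ltgt R l k"
  shows "iprodmap R l (lcomp R l f h) (lcomp R l g k) = lcomp R l (iprodmap R l f g) (iprodmap R l
      h k)"
  using ccc.pmap_comp[OF ccc_stage, of f "\<D> f" g h k] assms by (simp add: stage_simps)

lemma iexpmap_lcomp:
  assumes "f \<in> \<A>" "g \<in> \<A>" "h \<in> \<A>" "k \<in> \<A>"
    "\<C> f = R1 R l" "\<C> g = R1 R l" "\<C> h = R1 R l" "\<C> k = R1 R l"
    "\<D> g = \<D> f" "\<D> h = \<D> f" "\<D> k = \<D> f"
    "lsrc R l h = ltgt R l f" "lsrc R l g = ltgt R l k"
  shows "iexpmap R l (lcomp R l h f) (lcomp R l g k) = lcomp R l (iexpmap R l f g) (iexpmap R l h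
      k)"
  using ccc.emap_comp[OF ccc_stage, of f "\<D> f" g h k] assms by (simp add: stage_simps)

text \<open>The structure at a stage is given by fixed ambient arrows composed with pairs of
  generalised elements, hence is strictly preserved by precomposition with \<open>u\<close>.\<close>

lemma ccc_functor_reindex:
  assumes "u \<in> \<A>"
  shows "ccc_functor (stage R l (\<C> u)) (stage R l (\<D> u)) (\<lambda>A. acomp R A u) (\<lambda>f. acomp R f u)"
proof -
  interpret A: ccc "stage R l (\<C> u)" by (rule ccc_stage)
  interpret B: ccc "stage R l (\<D> u)" by (rule ccc_stage)
  show ?thesis
    by unfold_locales (use assms in \<open>auto simp: stage_simps\<close>)
qed

context
  fixes u
  assumes u: "u \<in> \<A>"
begin

interpretation F: ccc_functor "stage R l (\<C> u)" "stage R l (\<D> u)"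
  "\<lambda>A. acomp R A u" "\<lambda>f. acomp R f u"
  using u by (rule ccc_functor_reindex)

lemma ipair_comp [simp]:
  assumes "f \<in> \<A>" "g \<in> \<A>" "\<C> f = R1 R l" "\<C> g = R1 R l"
    "\<D> f = \<C> u" "\<D> g = \<C> u" "lsrc R l g = lsrc R l f"
  shows "acomp R (ipair R l f g) u = ipair R l (acomp R f u) (acomp R g u)"
  using F.F1_ppair[of f g] assms by (simp add: stage_simps)

lemma iprodmap_comp [simp]:
  assumes "f \<in> \<A>" "g \<in> \<A>" "\<C> f = R1 R l" "\<C> g = R1 R l"
    "\<D> f = \<C> u" "\<D> g = \<C> u"
  shows "acomp R (iprodmap R l f g) u = iprodmap R l (acomp R f u) (acomp R g u)"
    "acomp R (iexpmap R l f g) u = iexpmap R l (acomp R f u) (acomp R g u)"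
  using F.F1_pmap[of f g] F.F1_emap[of f g] assms by (simp_all add: stage_simps)

lemma icurry_comp [simp]:
  assumes "f \<in> \<A>" "\<C> f = R1 R l" "D \<in> \<A>" "A \<in> \<A>"
    "\<D> f = \<C> u" "\<D> D = \<C> u" "\<D> A = \<C> u"
    "\<C> D = R0 R l" "\<C> A = R0 R l" "lsrc R l f = iprod R l D A" "ltgt R l f = B"
  shows "acomp R (icurry R l D A B f) u
    = icurry R l (acomp R D u) (acomp R A u) (acomp R B u) (acomp R f u)"
  using F.F1_cur[of f D A B] assms by (simp add: stage_simps)

end

end

section \<open>Face maps and degeneracies acting on generalised elements\<close>

context
  fixes l k :: nat assumes lk: "enat l < dimn R" "k \<le> l"
begin

private lemma ll: "enat l \<le> dimn R" "enat (Suc l) \<le> dimn R" using lk by simp_all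

context
  fixes e :: endpoint
begin

interpretation F: internal_ftr "Amb R" "on_arr (Rel R) (face e l k)"
  using lk by (rule face_internal_ftr)

lemmas face_idom [simp] = face_internal_ftr(2,3)[OF lk]
lemmas face_in [simp] = F.ifun_in[unfolded face_internal_ftr(2,3)[OF lk]]
lemmas face_act1 [simp] = F.f1_src_tgt[unfolded face_internal_ftr(2,3)[OF lk]]
  F.f1_idn[unfolded face_internal_ftr(2,3)[OF lk]] F.f1_icomp[unfolded face_internal_ftr(2,3)[OF
      lk]]

lemma face_one: "acomp R (act0 R (face e l k)) (one R (Suc l)) = one R l"
  using model lk unfolding parametric_model_def stable_terminal_def by simp

lemma face_iprod [simp]:
  assumes "A \<in> \<A>" "B \<in> \<A>" "\<D> B = \<D> A"
    "\<C> A = R0 R (Suc l)" "\<C> B = R0 R (Suc l)"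
  shows "acomp R (act0 R (face e l k)) (iprod R (Suc l) A B)
      = iprod R l (acomp R (act0 R (face e l k)) A) (acomp R (act0 R (face e l k)) B)" (is ?P)
    "acomp R (act1 R (face e l k)) (ifst R (Suc l) A B)
      = ifst R l (acomp R (act0 R (face e l k)) A) (acomp R (act0 R (face e l k)) B)" (is ?F)
    "acomp R (act1 R (face e l k)) (isnd R (Suc l) A B)
      = isnd R l (acomp R (act0 R (face e l k)) A) (acomp R (act0 R (face e l k)) B)" (is ?S)
    "acomp R (act0 R (face e l k)) (iexp R (Suc l) A B)
      = iexp R l (acomp R (act0 R (face e l k)) A) (acomp R (act0 R (face e l k)) B)" (is ?E)
    "acomp R (act1 R (face e l k)) (ieval R (Suc l) A B)
      = ieval R l (acomp R (act0 R (face e l k)) A) (acomp R (act0 R (face e l k)) B)" (is ?V)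
proof -
  have "\<D> A \<in> Obj (Amb R)" "A \<in> hom (Amb R) (\<D> A) (R0 R (Suc l))"
    "B \<in> hom (Amb R) (\<D> A) (R0 R (Suc l))"
    using assms by (auto simp: hom_def)
  note J = this[unfolded Suc_eq_plus1]
  show ?P ?F ?S
    using model lk J unfolding parametric_model_def stable_products_def Let_def Suc_eq_plus1 by
        blast+
  show ?E ?V
    using model lk J unfolding parametric_model_def stable_exponentials_def Let_def Suc_eq_plus1 by
        blast+
qed

text \<open>Stability under face maps is strict; \<open>F1_ppair\<close> and \<open>F1_cur\<close>
  then make faces commute with pairing and transposition too.\<close>

lemma ccc_functor_face:
  "ccc_functor (stage R (Suc l) J) (stage R l J)
     (\<lambda>A. acomp R (act0 R (face e l k)) A) (\<lambda>f. acomp R (act1 R (face e l k)) f)"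
proof -
  interpret A: ccc "stage R (Suc l) J" using ll by (intro ccc_stage)
  interpret B: ccc "stage R l J" using ll by (intro ccc_stage)
  show ?thesis
    by unfold_locales (use ll in \<open>auto simp: stage_simps\<close>)
qed

lemma face_ipair [simp]:
  assumes "f \<in> \<A>" "g \<in> \<A>" "\<C> f = R1 R (Suc l)" "\<C> g = R1 R (Suc l)"
    "\<D> g = \<D> f" "lsrc R (Suc l) g = lsrc R (Suc l) f"
  shows "acomp R (act1 R (face e l k)) (ipair R (Suc l) f g)
    = ipair R l (acomp R (act1 R (face e l k)) f) (acomp R (act1 R (face e l k)) g)"
  using ccc_functor.F1_ppair[OF ccc_functor_face, of f "\<D> f" g] assms by (simp add: stage_simps)

lemma face_icurry [simp]:
  assumes "f \<in> \<A>" "\<C> f = R1 R (Suc l)" "D \<in> \<A>" "A \<in> \<A>"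
    "\<D> D = \<D> f" "\<D> A = \<D> f"
    "\<C> D = R0 R (Suc l)" "\<C> A = R0 R (Suc l)"
    "lsrc R (Suc l) f = iprod R (Suc l) D A" "ltgt R (Suc l) f = B"
  shows "acomp R (act1 R (face e l k)) (icurry R (Suc l) D A B f)
    = icurry R l (acomp R (act0 R (face e l k)) D) (acomp R (act0 R (face e l k)) A)
        (acomp R (act0 R (face e l k)) B) (acomp R (act1 R (face e l k)) f)"
  using ccc_functor.F1_cur[OF ccc_functor_face, of f "\<D> f" D A B] assms by (simp add: stage_simps)

end

interpretation D: internal_ftr "Amb R" "on_arr (Rel R) (degen l k)"
  using lk by (rule degen_internal_ftr)

lemmas degen_idom [simp] = degen_internal_ftr(2,3)[OF lk]
lemmas degen_in [simp] = D.ifun_in[unfolded degen_internal_ftr(2,3)[OF lk]]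
lemmas degen_act1 [simp] = D.f1_src_tgt[unfolded degen_internal_ftr(2,3)[OF lk]]
  D.f1_idn[unfolded degen_internal_ftr(2,3)[OF lk]] D.f1_icomp[unfolded degen_internal_ftr(2,3)[OF
      lk]]

lemma one_eps_good [simp]: "one_eps R l k \<in> \<A>" "\<C> (one_eps R l k) = R1 R (Suc l)"
    "one_eps R l k \<in> Good R (Suc l)"
  and one_eps_in [simp]: "\<D> (one_eps R l k) = term_ob (Amb R)"
    "lsrc R (Suc l) (one_eps R l k) = acomp R (act0 R (degen l k)) (one R l)"
    "ltgt R (Suc l) (one_eps R l k) = one R (Suc l)"
proof -
  have "one_eps R l k \<in> Good R (Suc l) \<and> one_eps R l k
     \<in> lhom R (Suc l) (acomp R (act0 R (degen l k)) (one R l)) (one R (Suc l))"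
    using model lk unfolding parametric_model_def stable_terminal_def by simp
  then show "one_eps R l k \<in> \<A>" "\<C> (one_eps R l k) = R1 R (Suc l)"
    "one_eps R l k \<in> Good R (Suc l)" "\<D> (one_eps R l k) = term_ob (Amb R)"
    "lsrc R (Suc l) (one_eps R l k) = acomp R (act0 R (degen l k)) (one R l)"
    "ltgt R (Suc l) (one_eps R l k) = one R (Suc l)"
    using ll by (auto simp: ihom_def hom_def)
qed

lemma eps_good [simp]: "times_eps R l k \<in> \<A>" "\<C> (times_eps R l k) = R1 R (Suc l)"
  "expo_ups R l k \<in> \<A>" "\<C> (expo_ups R l k) = R1 R (Suc l)"
  "times_eps R l k \<in> Good R (Suc l)" "expo_ups R l k \<in> Good R (Suc l)"
  "\<D> (times_eps R l k) = pow (Amb R) (R0 R l) 2"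
  "\<D> (expo_ups R l k) = pow (Amb R) (R0 R l) 2"
  using model lk unfolding parametric_model_def stable_products_def stable_exponentials_def
  by (auto simp: hom_def)

context
  fixes A B
  assumes AB: "A \<in> \<A>" "B \<in> \<A>" "\<D> B = \<D> A"
    "\<C> A = R0 R l" "\<C> B = R0 R l"
begin

private lemma homAB: "\<D> A \<in> Obj (Amb R)" "A \<in> hom (Amb R) (\<D> A) (R0 R l)"
  "B \<in> hom (Amb R) (\<D> A) (R0 R l)"
  using AB by (auto simp: hom_def)

lemma times_eps_in [simp]:
  "lsrc R (Suc l) (acomp R (times_eps R l k) (pr2 R A B)) = acomp R (act0 R (degen l k)) (iprod R l
      A B)"
  "ltgt R (Suc l) (acomp R (times_eps R l k) (pr2 R A B))
     = iprod R (Suc l) (acomp R (act0 R (degen l k)) A) (acomp R (act0 R (degen l k)) B)"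
  "lcomp R (Suc l) (ifst R (Suc l) (acomp R (act0 R (degen l k)) A) (acomp R (act0 R (degen l k))
      B))
     (acomp R (times_eps R l k) (pr2 R A B)) = acomp R (act1 R (degen l k)) (ifst R l A B)"
  "lcomp R (Suc l) (isnd R (Suc l) (acomp R (act0 R (degen l k)) A) (acomp R (act0 R (degen l k))
      B))
     (acomp R (times_eps R l k) (pr2 R A B)) = acomp R (act1 R (degen l k)) (isnd R l A B)"
  using model lk homAB unfolding parametric_model_def stable_products_def Let_def Suc_eq_plus1
      ihom_def by blast+

lemma expo_ups_in [simp]:
  "lsrc R (Suc l) (acomp R (expo_ups R l k) (pr2 R A B)) = acomp R (act0 R (degen l k)) (iexp R l A
      B)"
  "ltgt R (Suc l) (acomp R (expo_ups R l k) (pr2 R A B))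
     = iexp R (Suc l) (acomp R (act0 R (degen l k)) A) (acomp R (act0 R (degen l k)) B)"
  and ieval_expo_ups:
    "lcomp R (Suc l) (ieval R (Suc l) (acomp R (act0 R (degen l k)) A) (acomp R (act0 R (degen l
        k)) B))
      (lcomp R (Suc l)
        (iprodmap R (Suc l) (acomp R (expo_ups R l k) (pr2 R A B))
          (lid R (Suc l) (acomp R (act0 R (degen l k)) A)))
        (acomp R (times_eps R l k) (pr2 R (iexp R l A B) A))) =
     acomp R (act1 R (degen l k)) (ieval R l A B)"
  using model lk homAB unfolding parametric_model_def stable_exponentials_def Let_def Suc_eq_plus1
      ihom_def by blast+

end

text \<open>\<tau> is the comparison \<open>times_eps\<close>, and its inverse \<tau>' exists
  because good morphisms are isomorphisms.\<close>

lemma ccc_pseudofunctor_degen: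
  "ccc_pseudofunctor (stage R l J) (stage R (Suc l) J)
     (\<lambda>A. acomp R (act0 R (degen l k)) A) (\<lambda>f. acomp R (act1 R (degen l k)) f)
     (\<lambda>A B. acomp R (times_eps R l k) (pr2 R A B))
     (\<lambda>A B. linv R (Suc l) (acomp R (times_eps R l k) (pr2 R A B)))
     (\<lambda>A B. acomp R (expo_ups R l k) (pr2 R A B))"
proof -
  interpret A: ccc "stage R l J" using ll by (intro ccc_stage)
  interpret B: ccc "stage R (Suc l) J" using ll by (intro ccc_stage)
  show ?thesis
    by unfold_locales (use ll lk in \<open>auto simp: stage_simps ieval_expo_ups\<close>)
qed

end

section \<open>Functors and natural transformations out of discrete powers\<close>

abbreviation pw :: "nat \<Rightarrow> nat \<Rightarrow> 'o" where
  "pw n l \<equiv> pow (Amb R) (R0 R l) n"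
abbreviation ob :: "('o, 'a) relfun \<Rightarrow> nat \<Rightarrow> 'a" where
  "ob F l \<equiv> f0 (rfun F l)"
abbreviation fpow :: "nat \<Rightarrow> endpoint \<Rightarrow> nat \<Rightarrow> nat \<Rightarrow> 'a" where
  "fpow n e l k \<equiv> pow_map (Amb R) n (act0 R (face e l k))"
abbreviation dpow :: "nat \<Rightarrow> nat \<Rightarrow> nat \<Rightarrow> 'a" where
  "dpow n l k \<equiv> pow_map (Amb R) n (act0 R (degen l k))"
abbreviation spow :: "nat \<Rightarrow> nat \<Rightarrow> 'a" where
  "spow n l \<equiv> pow_map (Amb R) n (src (Lv R l))"
abbreviation tpow :: "nat \<Rightarrow> nat \<Rightarrow> 'a" where
  "tpow n l \<equiv> pow_map (Amb R) n (tgt (Lv R l))"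
abbreviation ipw :: "nat \<Rightarrow> nat \<Rightarrow> 'a" where
  "ipw n l \<equiv> pow_map (Amb R) n (idn (Lv R l))"

lemma discpow_sel [simp]:
  assumes "enat l \<le> dimn R"
  shows "Ob (on_obj (discpow R n) l) = pw n l" "Mor (on_obj (discpow R n) l) = pw n l"
    "src (on_obj (discpow R n) l) = Ide (Amb R) (pw n l)" "tgt (on_obj (discpow R n) l) = Ide (Amb
        R) (pw n l)"
    "idn (on_obj (discpow R n) l) = Ide (Amb R) (pw n l)"
  using assms by (simp_all add: cpow_def cdisc_def ipow_def idisc_def Let_def)

lemma discpow_act_sel [simp]:
  "f0 (on_arr (discpow R n) h) = pow_map (Amb R) n (act0 R h)"
  "f1 (on_arr (discpow R n) h) = pow_map (Amb R) n (act0 R h)"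
  "idom (on_arr (discpow R n) h) = ipow (Amb R) n (idisc (Amb R) (idom (on_arr (Rel R) h)))"
  by (simp_all add: cpow_def cdisc_def ipow_map_def idisc_map_def)

text \<open>In a discrete category \<open>src\<close> and \<open>tgt\<close> are identities, so the
  two projections from the composable pairs coincide and composition is that projection; the power
  inherits this component by component. The functors considered here start from such a category and
  must be shown to preserve composition.\<close>

lemma discpow_cmp:
  assumes "enat l \<le> dimn R"
  shows "cmp (on_obj (discpow R n) l) = cpair1 (Amb R) (on_obj (discpow R n) l)"
    "cpair2 (Amb R) (on_obj (discpow R n) l) = cpair1 (Amb R) (on_obj (discpow R n) l)"
    "cpair1 (Amb R) (on_obj (discpow R n) l) \<in> \<A>"
    "\<C> (cpair1 (Amb R) (on_obj (discpow R n) l)) = pw n l"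
proof -
  let ?c = "pb (Amb R) (Ide (Amb R) (pw n l)) (Ide (Amb R) (pw n l))"
  note pb = pb_in[of "Ide (Amb R) (pw n l)" "Ide (Amb R) (pw n l)"]
  have icomp: "icomp (Amb R) (idisc (Amb R) (Lv R l)) f f = f"
    if "f \<in> \<A>" "\<C> f = R0 R l" for f
    unfolding icomp_def idisc_def
    by simp (rule pb_pair_spec(4), use that assms in simp_all)
  have c: "fst (snd ?c) \<in> \<A>" "snd (snd ?c) = fst (snd ?c)" "\<C> (fst (snd ?c)) = pw n l"
    "\<D> (fst (snd ?c)) = fst ?c" "fst ?c \<in> Obj (Amb R)"
    using pb assms by simp_all
  have tup: "tup (Amb R) (\<D> p) (R0 R l) n (\<lambda>i. icomp (Amb R) (idisc (Amb R) (Lv R l))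
        (acomp R (proj (Amb R) (R0 R l) n i) p) (acomp R (proj (Amb R) (R0 R l) n i) p)) = p"
    if "p \<in> \<A>" "\<C> p = pw n l" for p
  proof -
    have "tup (Amb R) (\<D> p) (R0 R l) n (\<lambda>i. icomp (Amb R) (idisc (Amb R) (Lv R l))
        (acomp R (proj (Amb R) (R0 R l) n i) p) (acomp R (proj (Amb R) (R0 R l) n i) p))
      = tup (Amb R) (\<D> p) (R0 R l) n (\<lambda>i. acomp R (proj (Amb R) (R0 R l) n i) p)"
      using that assms by (intro tup_cong icomp) simp_all
    also have "\<dots> = p"
      by (rule pow_eqI[of "R0 R l" _ _ n]) (use that assms in simp_all)
    finally show ?thesis .
  qed
  have "cmp (on_obj (discpow R n) l) = tup (Amb R) (fst ?c) (R0 R l) n (\<lambda>i. icomp (Amb R) (idisc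
      (Amb R) (Lv R l))
        (acomp R (proj (Amb R) (R0 R l) n i) (fst (snd ?c))) (acomp R (proj (Amb R) (R0 R l) n i)
            (snd (snd ?c))))"
    using assms by (simp add: cpow_def cdisc_def ipow_def idisc_def Let_def)
  also have "\<dots> = fst (snd ?c)"
    unfolding c(2) using tup[OF c(1,3)] unfolding c(4) .
  finally show "cmp (on_obj (discpow R n) l) = cpair1 (Amb R) (on_obj (discpow R n) l)"
    "cpair2 (Amb R) (on_obj (discpow R n) l) = cpair1 (Amb R) (on_obj (discpow R n) l)"
    "cpair1 (Amb R) (on_obj (discpow R n) l) \<in> \<A>"
    "\<C> (cpair1 (Amb R) (on_obj (discpow R n) l)) = pw n l"
    unfolding cpair1_def cpair2_def using assms c(1-4) by simp_all
qed

lemma disc_fun_sel [simp]: "idom (disc_fun R n l u) = on_obj (discpow R n) l"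
  "icod (disc_fun R n l u) = Lv R l" "f0 (disc_fun R n l u) = u" "f1 (disc_fun R n l u) = lid R l u"
  by (simp_all add: disc_fun_def)

lemma internal_functor_disc_fun:
  assumes "enat l \<le> dimn R" "u \<in> \<A>" "\<D> u = pw n l" "\<C> u = R0 R l"
  shows "internal_functor (Amb R) (disc_fun R n l u)"
  unfolding internal_functor_def using assms discpow_cmp[OF assms(1)]
  by (auto simp: hom_def)

text \<open>The arrows of a discrete category are its identities, so preservation of identities
  fixes the action on arrows.\<close>

lemma disc_fun_unique:
  assumes "enat l \<le> dimn R" "internal_functor (Amb R) F" "idom F = on_obj (discpow R n) l" "icod F
      = Lv R l"
  shows "F = disc_fun R n l (f0 F)"
proof -
  have "acomp R (f1 F) (idn (idom F)) = lid R l (f0 F)" "f1 F \<in> hom (Amb R) (Mor (idom F)) (R1 R l)"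
    using assms(2,4) by (auto simp: internal_functor_def)
  then have "f1 F = lid R l (f0 F)"
    using assms by (simp add: hom_def)
  then show ?thesis using assms by (simp add: disc_fun_def)
qed

section \<open>Tuples of good isomorphisms\<close>

lemma good_tuplesD:
  assumes "f \<in> good_tuples R n l" "enat l \<le> dimn R"
  shows "f \<in> \<A>" "\<C> f = pow (Amb R) (R1 R l) n" "\<exists>m. \<D> f = pw m l"
    "i < n \<Longrightarrow> acomp R (proj (Amb R) (R1 R l) n i) f \<in> Good R l"
  using assms by (auto simp: good_tuples_iff hom_def)

lemma good_tuples_idn:
  assumes "enat l \<le> dimn R" "A \<in> hom (Amb R) (pw m l) (pw n l)"
  shows "acomp R (ipw n l) A \<in> good_tuples R n l"
  using assms by (auto simp: good_tuples_iff hom_def)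

lemma good_tuples_icomp:
  assumes "enat l \<le> dimn R" "f \<in> good_tuples R n l" "g \<in> good_tuples R n l"
    "\<D> f = \<D> g" "acomp R (spow n l) g = acomp R (tpow n l) f"
  shows "icomp (Amb R) (ipow (Amb R) n (Lv R l)) g f \<in> good_tuples R n l"
proof -
  note f = good_tuplesD[OF assms(2,1)] and g = good_tuplesD[OF assms(3,1)]
  note c = level_ipow_icomp[OF assms(1) f(1) g(1) f(2) g(2) assms(4)[symmetric] assms(5)]
  have "lsrc R l (acomp R (proj (Amb R) (R1 R l) n i) g) = ltgt R l (acomp R (proj (Amb R) (R1 R l)
      n i) f)"
    if "i < n" for i
  proof -
    have "lsrc R l (acomp R (proj (Amb R) (R1 R l) n i) g)
        = acomp R (proj (Amb R) (R0 R l) n i) (acomp R (spow n l) g)"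
      using that g(1,2) assms(1) by simp
    also note assms(5)
    also have "acomp R (proj (Amb R) (R0 R l) n i) (acomp R (tpow n l) f)
        = ltgt R l (acomp R (proj (Amb R) (R1 R l) n i) f)"
      using that f(1,2) assms(1) by simp
    finally show ?thesis .
  qed
  then show ?thesis
    using c f g assms(1,4) by (auto simp: good_tuples_iff hom_def)
qed

lemma good_tuples_comp:
  assumes "enat l \<le> dimn R" "f \<in> good_tuples R n l" "u \<in> hom (Amb R) (pw m l) (\<D> f)"
  shows "acomp R f u \<in> good_tuples R n l"
proof -
  note f = good_tuplesD[OF assms(2,1)]
  have "acomp R (proj (Amb R) (R1 R l) n i) (acomp R f u) \<in> Good R l" if "i < n" for i
    using good_comp[OF assms(1) f(4)[OF that], of u] that f assms by (simp add: hom_def)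
  then show ?thesis
    using f assms by (auto simp: good_tuples_iff hom_def)
qed

section \<open>Functors and natural transformations described by their components\<close>

lemma mk_relfun_sel [simp]:
  "enat l \<le> dimn R \<Longrightarrow> rfun (mk_relfun R n F e v) l = F l"
  "\<lbrakk>enat l < dimn R; k \<le> l\<rbrakk> \<Longrightarrow> reps (mk_relfun R n F e v) l k = e l k"
  "\<lbrakk>enat l \<le> dimn R; f \<in> good_tuples R n l\<rbrakk> \<Longrightarrow> rups (mk_relfun R n F e v) l f = v l f"
  by (simp_all add: mk_relfun_def)

text \<open>\<open>mk_relfun\<close> is \<open>undefined\<close> outside the intended domain, so
  agreement on the domain gives equality of records.\<close>

lemma mk_relfun_cong:
  assumes "\<And>l. enat l \<le> dimn R \<Longrightarrow> F l = F' l"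
    "\<And>l k. \<lbrakk>enat l < dimn R; k \<le> l\<rbrakk> \<Longrightarrow> e l k = e' l k"
    "\<And>l f. \<lbrakk>enat l \<le> dimn R; f \<in> good_tuples R n l\<rbrakk> \<Longrightarrow> v l f = v' l f"
  shows "mk_relfun R n F e v = mk_relfun R n F' e' v'"
  using assms by (auto simp: mk_relfun_def fun_eq_iff)

lemma mk_relfun_idem [simp]: "mk_relfun R n (rfun (mk_relfun R n F e v)) (reps (mk_relfun R n F e
    v))
    (rups (mk_relfun R n F e v)) = mk_relfun R n F e v"
  by (rule mk_relfun_cong) simp_all

text \<open>Both functors send all arrows of a discrete category to identities, so the naturality
  square is automatic and only the typing of \<eta> remains. The source level \<open>m\<close> and
  the target level \<open>l\<close> may differ, as they do for degeneracy witnesses.\<close>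

lemma inat_discrete:
  assumes "enat l \<le> dimn R" "idom F = on_obj (discpow R n) m" "idom G = on_obj (discpow R n) m"
      "enat m \<le> dimn R"
    "icod F = Lv R l" "icod G = Lv R l" "f0 F \<in> \<A>" "\<D> (f0 F) = pw n m" "\<C> (f0 F) = R0 R l"
    "f1 F = lid R l (f0 F)" "f1 G = lid R l (f0 G)"
  shows "inat (Amb R) F G \<eta> \<longleftrightarrow> \<eta> \<in> \<A> \<and> \<D> \<eta> = pw n m \<and> \<C> \<eta> = R1 R l \<and>
    lsrc R l \<eta> = f0 F \<and> ltgt R l \<eta> = f0 G"
  using assms by (auto simp: inat_def ihom_def hom_def)

text \<open>Reduces \<open>is_relfun\<close> to conditions on the object parts \<open>u\<close>, the
  witnesses \<epsilon> and the action \<open>v\<close>, all in terms of generalised elements; out of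
  a discrete power the functor laws hold by themselves.\<close>

lemma relfunI:
  assumes u: "\<And>l. enat l \<le> dimn R \<Longrightarrow> u l \<in> \<A>" "\<And>l. enat l \<le> dimn R \<Longrightarrow> \<D> (u l) = pw n l"
      "\<And>l. enat l \<le> dimn R \<Longrightarrow> \<C> (u l) = R0 R l"
    and face: "\<And>e l k. \<lbrakk>enat l < dimn R; k \<le> l\<rbrakk> \<Longrightarrow>
      acomp R (act0 R (face e l k)) (u (Suc l)) = acomp R (u l) (fpow n e l k)"
    and eps: "\<And>l k. \<lbrakk>enat l < dimn R; k \<le> l\<rbrakk> \<Longrightarrow> \<epsilon> l k \<in> Good R (Suc l)"
      "\<And>l k. \<lbrakk>enat l < dimn R; k \<le> l\<rbrakk> \<Longrightarrow> \<D> (\<epsilon> l k) = pw n l"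
      "\<And>l k. \<lbrakk>enat l < dimn R; k \<le> l\<rbrakk> \<Longrightarrow> lsrc R (Suc l) (\<epsilon> l k) = acomp R (act0 R (degen l k)) (u l)"
      "\<And>l k. \<lbrakk>enat l < dimn R; k \<le> l\<rbrakk> \<Longrightarrow> ltgt R (Suc l) (\<epsilon> l k) = acomp R (u (Suc l)) (dpow n l k)"
    and ups: "\<And>l f. \<lbrakk>enat l \<le> dimn R; f \<in> good_tuples R n l\<rbrakk> \<Longrightarrow> v l f \<in> Good R l"
      "\<And>l f. \<lbrakk>enat l \<le> dimn R; f \<in> good_tuples R n l\<rbrakk> \<Longrightarrow> \<D> (v l f) = \<D> f"
      "\<And>l f. \<lbrakk>enat l \<le> dimn R; f \<in> good_tuples R n l\<rbrakk> \<Longrightarrow> lsrc R l (v l f) = acomp R (u l) (acomp R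
          (spow n l) f)"
      "\<And>l f. \<lbrakk>enat l \<le> dimn R; f \<in> good_tuples R n l\<rbrakk> \<Longrightarrow> ltgt R l (v l f) = acomp R (u l) (acomp R
          (tpow n l) f)"
      "\<And>l m A. \<lbrakk>enat l \<le> dimn R; A \<in> hom (Amb R) (pw m l) (pw n l)\<rbrakk> \<Longrightarrow>
        v l (acomp R (ipw n l) A) = lid R l (acomp R (u l) A)"
      "\<And>l f g. \<lbrakk>enat l \<le> dimn R; f \<in> good_tuples R n l; g \<in> good_tuples R n l; \<D> f = \<D> g;
        acomp R (spow n l) g = acomp R (tpow n l) f\<rbrakk> \<Longrightarrow>
        v l (icomp (Amb R) (ipow (Amb R) n (Lv R l)) g f) = lcomp R l (v l g) (v l f)"
      "\<And>l f m w. \<lbrakk>enat l \<le> dimn R; f \<in> good_tuples R n l; w \<in> hom (Amb R) (pw m l) (\<D> f)\<rbrakk> \<Longrightarrow>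
        v l (acomp R f w) = acomp R (v l f) w"
  shows "is_relfun R n (mk_relfun R n (\<lambda>l. disc_fun R n l (u l)) \<epsilon> v)"
proof -
  let ?F = "mk_relfun R n (\<lambda>l. disc_fun R n l (u l)) \<epsilon> v"
  have 1: "cubical_functor (Amb R) (dimn R) (discpow R n) (Rel R) (rfun ?F)"
    using u by (auto simp: cubical_functor_def internal_functor_disc_fun)
  have 2: "face_preserving (Amb R) (dimn R) (discpow R n) (Rel R) (rfun ?F)"
    unfolding face_preserving_def
  proof (intro allI impI)
    fix e l k assume lk: "enat l < dimn R \<and> k \<le> l"
    then have l: "enat l \<le> dimn R" "enat (Suc l) \<le> dimn R" by simp_all
    show "ifcomp (Amb R) (on_arr (Rel R) (face e l k)) (rfun ?F (l + 1))
        = ifcomp (Amb R) (rfun ?F l) (on_arr (discpow R n) (face e l k))"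
      using l lk u face[of l k e] by (simp add: ifcomp_def) (simp add: cpow_def cdisc_def)
  qed
  have 3: "degeneracy_witness (Amb R) (dimn R) (discpow R n) (Rel R) (rfun ?F) (reps ?F)"
    unfolding degeneracy_witness_def
  proof (intro allI impI)
    fix l k assume lk: "enat l < dimn R \<and> k \<le> l"
    then have l: "enat l \<le> dimn R" "enat (Suc l) \<le> dimn R" by simp_all
    have "inat (Amb R) (ifcomp (Amb R) (on_arr (Rel R) (degen l k)) (rfun ?F l))
        (ifcomp (Amb R) (rfun ?F (l + 1)) (on_arr (discpow R n) (degen l k))) (\<epsilon> l k)"
      using l lk u eps[of l k] good_in[of "Suc l" "\<epsilon> l k"]
      by (subst inat_discrete[where l = "Suc l" and m = l and n = n]) (simp_all add: ifcomp_def,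
          simp_all add: cpow_def cdisc_def)
    then show "inat (Amb R) (ifcomp (Amb R) (on_arr (Rel R) (degen l k)) (rfun ?F l))
        (ifcomp (Amb R) (rfun ?F (l + 1)) (on_arr (discpow R n) (degen l k))) (reps ?F l k) \<and>
        iiso (Amb R) (Lv R (l + 1)) (reps ?F l k)"
      using l lk eps by simp
  qed
  have 4: "v l f \<in> lhom R l (acomp R (u l) (acomp R (spow n l) f)) (acomp R (u l) (acomp R (tpow n
      l) f))"
    if "enat l \<le> dimn R" "f \<in> good_tuples R n l" for l f
    using that good_tuplesD[OF that(2,1)] u[of l] ups(1-4)[OF that] good_in[OF that(1) ups(1)[OF
        that]]
    by (auto simp: ihom_def hom_def)
  show ?thesis
    unfolding is_relfun_def
    using 1 2 3 4 eps(1) ups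
    by (auto simp: good_tuples_idn good_tuples_icomp good_tuples_comp)
qed

text \<open>The converse of \<open>relfunI\<close>: what an object of \<open>FunCat R n\<close>
  provides, in the same elementary terms.\<close>

lemma
  assumes "is_relfun R n F"
  shows relfun_form: "mk_relfun R n (\<lambda>l. disc_fun R n l (ob F l)) (reps F) (rups F) = F"
    and relfun_ob: "\<And>l. enat l \<le> dimn R \<Longrightarrow> ob F l \<in> \<A>"
      "\<And>l. enat l \<le> dimn R \<Longrightarrow> \<D> (ob F l) = pw n l"
      "\<And>l. enat l \<le> dimn R \<Longrightarrow> \<C> (ob F l) = R0 R l"
    and relfun_rfun: "\<And>l. enat l \<le> dimn R \<Longrightarrow> rfun F l = disc_fun R n l (ob F l)"
    and relfun_face: "\<And>e l k. \<lbrakk>enat l < dimn R; k \<le> l\<rbrakk> \<Longrightarrow>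
      acomp R (act0 R (face e l k)) (ob F (Suc l)) = acomp R (ob F l) (fpow n e l k)"
    and relfun_eps: "\<And>l k. \<lbrakk>enat l < dimn R; k \<le> l\<rbrakk> \<Longrightarrow> reps F l k \<in> Good R (Suc l)"
      "\<And>l k. \<lbrakk>enat l < dimn R; k \<le> l\<rbrakk> \<Longrightarrow> \<D> (reps F l k) = pw n l"
      "\<And>l k. \<lbrakk>enat l < dimn R; k \<le> l\<rbrakk> \<Longrightarrow> lsrc R (Suc l) (reps F l k) = acomp R (act0 R (degen l k))
          (ob F l)"
      "\<And>l k. \<lbrakk>enat l < dimn R; k \<le> l\<rbrakk> \<Longrightarrow> ltgt R (Suc l) (reps F l k) = acomp R (ob F (Suc l)) (dpow
          n l k)"
      "\<And>l k. \<lbrakk>enat l < dimn R; k \<le> l\<rbrakk> \<Longrightarrow> reps F l k \<in> \<A>"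
      "\<And>l k. \<lbrakk>enat l < dimn R; k \<le> l\<rbrakk> \<Longrightarrow> \<C> (reps F l k) = R1 R (Suc l)"
    and relfun_ups: "\<And>l f. \<lbrakk>enat l \<le> dimn R; f \<in> good_tuples R n l\<rbrakk> \<Longrightarrow> rups F l f \<in> Good R l"
      "\<And>l f. \<lbrakk>enat l \<le> dimn R; f \<in> good_tuples R n l\<rbrakk> \<Longrightarrow> \<D> (rups F l f) = \<D> f"
      "\<And>l f. \<lbrakk>enat l \<le> dimn R; f \<in> good_tuples R n l\<rbrakk> \<Longrightarrow> lsrc R l (rups F l f) = acomp R (ob F l)
          (acomp R (spow n l) f)"
      "\<And>l f. \<lbrakk>enat l \<le> dimn R; f \<in> good_tuples R n l\<rbrakk> \<Longrightarrow> ltgt R l (rups F l f) = acomp R (ob F l)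
          (acomp R (tpow n l) f)"
      "\<And>l f. \<lbrakk>enat l \<le> dimn R; f \<in> good_tuples R n l\<rbrakk> \<Longrightarrow> rups F l f \<in> \<A>"
      "\<And>l f. \<lbrakk>enat l \<le> dimn R; f \<in> good_tuples R n l\<rbrakk> \<Longrightarrow> \<C> (rups F l f) = R1 R l"
    and relfun_ups_idn: "\<And>l m A. \<lbrakk>enat l \<le> dimn R; A \<in> hom (Amb R) (pw m l) (pw n l)\<rbrakk> \<Longrightarrow>
        rups F l (acomp R (ipw n l) A) = lid R l (acomp R (ob F l) A)"
    and relfun_ups_icomp: "\<And>l f g. \<lbrakk>enat l \<le> dimn R; f \<in> good_tuples R n l; g \<in> good_tuples R n l;
        \<D> f = \<D> g; acomp R (spow n l) g = acomp R (tpow n l) f\<rbrakk> \<Longrightarrow>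
        rups F l (icomp (Amb R) (ipow (Amb R) n (Lv R l)) g f) = lcomp R l (rups F l g) (rups F l
            f)"
    and relfun_ups_comp: "\<And>l f m w. \<lbrakk>enat l \<le> dimn R; f \<in> good_tuples R n l; w \<in> hom (Amb R) (pw m
        l) (\<D> f)\<rbrakk> \<Longrightarrow>
        rups F l (acomp R f w) = acomp R (rups F l f) w"
proof -
  note D = assms[unfolded is_relfun_def]
  have F: "F = mk_relfun R n (rfun F) (reps F) (rups F)"
    and 1: "cubical_functor (Amb R) (dimn R) (discpow R n) (Rel R) (rfun F)"
    and 2: "face_preserving (Amb R) (dimn R) (discpow R n) (Rel R) (rfun F)"
    and 3: "degeneracy_witness (Amb R) (dimn R) (discpow R n) (Rel R) (rfun F) (reps F)"
    and eps: "\<And>l k. \<lbrakk>enat l < dimn R; k \<le> l\<rbrakk> \<Longrightarrow> reps F l k \<in> Good R (Suc l)"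
    using D by simp_all
  show rf: "rfun F l = disc_fun R n l (ob F l)" if "enat l \<le> dimn R" for l
    using 1 that by (intro disc_fun_unique) (auto simp: cubical_functor_def)
  have "mk_relfun R n (\<lambda>l. disc_fun R n l (ob F l)) (reps F) (rups F) = mk_relfun R n (rfun F)
      (reps F) (rups F)"
    by (rule mk_relfun_cong) (simp_all flip: rf)
  then show "mk_relfun R n (\<lambda>l. disc_fun R n l (ob F l)) (reps F) (rups F) = F"
    using F by simp
  show u: "ob F l \<in> \<A>" "\<D> (ob F l) = pw n l" "\<C> (ob F l) = R0 R l"
    if "enat l \<le> dimn R" for l
    using 1 that by (auto simp: cubical_functor_def internal_functor_def hom_def)
  show "acomp R (act0 R (face e l k)) (ob F (Suc l)) = acomp R (ob F l) (fpow n e l k)"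
    if "enat l < dimn R" "k \<le> l" for e l k
  proof -
    have "f0 (ifcomp (Amb R) (on_arr (Rel R) (face e l k)) (rfun F (Suc l)))
        = f0 (ifcomp (Amb R) (rfun F l) (on_arr (discpow R n) (face e l k)))"
      using 2 that by (simp add: face_preserving_def)
    then show ?thesis by (simp add: ifcomp_def)
  qed
  show "reps F l k \<in> Good R (Suc l)"
    if "enat l < dimn R" "k \<le> l" for l k using eps that .
  show "\<D> (reps F l k) = pw n l" "lsrc R (Suc l) (reps F l k) = acomp R (act0 R (degen l k)) (ob F
      l)"
    "ltgt R (Suc l) (reps F l k) = acomp R (ob F (Suc l)) (dpow n l k)" "reps F l k \<in> \<A>"
    "\<C> (reps F l k) = R1 R (Suc l)"
    if lk: "enat l < dimn R" "k \<le> l" for l k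
  proof -
    have "reps F l k \<in> lhom R (Suc l) (acomp R (act0 R (degen l k)) (ob F l)) (acomp R (ob F (Suc
        l)) (dpow n l k))"
    proof -
      let ?F = "ifcomp (Amb R) (on_arr (Rel R) (degen l k)) (rfun F l)"
      have "reps F l k \<in> ihom (Amb R) (icod ?F) (f0 ?F)
          (f0 (ifcomp (Amb R) (rfun F (Suc l)) (on_arr (discpow R n) (degen l k))))"
        using 3 lk unfolding degeneracy_witness_def inat_def Suc_eq_plus1 by blast
      then show ?thesis using lk by (simp add: ifcomp_def)
    qed
    then show "\<D> (reps F l k) = pw n l" "lsrc R (Suc l) (reps F l k) = acomp R (act0 R (degen l k))
        (ob F l)"
      "ltgt R (Suc l) (reps F l k) = acomp R (ob F (Suc l)) (dpow n l k)" "reps F l k \<in> \<A>"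
      "\<C> (reps F l k) = R1 R (Suc l)"
      using lk u[of l] by (auto simp: ihom_def hom_def)
  qed
  have ups: "rups F l f \<in> Good R l \<and> rups F l f \<in> lhom R l (acomp R (ob F l) (acomp R (spow n l) f))
      (acomp R (ob F l) (acomp R (tpow n l) f))" if l: "enat l \<le> dimn R" "f \<in> good_tuples R n l"
          for l f
    using D l by simp
  then show "rups F l f \<in> Good R l" if l: "enat l \<le> dimn R" "f \<in> good_tuples R n l" for l f
    using that by blast
  show "\<D> (rups F l f) = \<D> f" "lsrc R l (rups F l f) = acomp R (ob F l) (acomp R (spow n l) f)"
    "ltgt R l (rups F l f) = acomp R (ob F l) (acomp R (tpow n l) f)" "rups F l f \<in> \<A>"
    "\<C> (rups F l f) = R1 R l"
    if l: "enat l \<le> dimn R" "f \<in> good_tuples R n l" for l f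
    using ups[OF l] good_tuplesD[OF l(2,1)] u[OF l(1)] l(1) by (auto simp: ihom_def hom_def)
  show "rups F l (acomp R (ipw n l) A) = lid R l (acomp R (ob F l) A)"
    if "enat l \<le> dimn R" "A \<in> hom (Amb R) (pw m l) (pw n l)" for l m A
    using D that by simp
  show "rups F l (icomp (Amb R) (ipow (Amb R) n (Lv R l)) g f) = lcomp R l (rups F l g) (rups F l
      f)"
    if "enat l \<le> dimn R" "f \<in> good_tuples R n l" "g \<in> good_tuples R n l"
        "\<D> f = \<D> g" "acomp R (spow n l) g = acomp R (tpow n l) f" for l f g
    using D that by simp
  show "rups F l (acomp R f w) = acomp R (rups F l f) w"
    if "enat l \<le> dimn R" "f \<in> good_tuples R n l" "w \<in> hom (Amb R) (pw m l) (\<D> f)" for l f m w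
    using D that by simp
qed

lemma relfun_eqI:
  assumes "is_relfun R n F" "is_relfun R n G" "\<And>l. enat l \<le> dimn R \<Longrightarrow> ob F l = ob G l"
    "\<And>l k. \<lbrakk>enat l < dimn R; k \<le> l\<rbrakk> \<Longrightarrow> reps F l k = reps G l k"
    "\<And>l f. \<lbrakk>enat l \<le> dimn R; f \<in> good_tuples R n l\<rbrakk> \<Longrightarrow> rups F l f = rups G l f"
  shows "F = G"
proof -
  have "mk_relfun R n (\<lambda>l. disc_fun R n l (ob F l)) (reps F) (rups F)
      = mk_relfun R n (\<lambda>l. disc_fun R n l (ob G l)) (reps G) (rups G)"
    by (rule mk_relfun_cong) (use assms(3-) in auto)
  then show ?thesis
    using relfun_form[OF assms(1)] relfun_form[OF assms(2)] by simp
qed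

lemma mk_relnat_sel [simp]:
  "rdom (mk_relnat R F G \<eta>) = F" "rcod (mk_relnat R F G \<eta>) = G"
  "enat l \<le> dimn R \<Longrightarrow> rnat (mk_relnat R F G \<eta>) l = \<eta> l"
  by (simp_all add: mk_relnat_def)

lemma mk_relnat_cong:
  assumes "\<And>l. enat l \<le> dimn R \<Longrightarrow> \<eta> l = \<eta>' l"
  shows "mk_relnat R F G \<eta> = mk_relnat R F G \<eta>'"
  using assms by (auto simp: mk_relnat_def fun_eq_iff)

text \<open>By \<open>inat_discrete\<close> ordinary naturality is only a typing condition, so the
  equations for face maps and degeneracies carry the content.\<close>

lemma is_relnat_iff: "is_relnat R n \<eta> \<longleftrightarrow>
  mk_relnat R (rdom \<eta>) (rcod \<eta>) (rnat \<eta>) = \<eta> \<and> is_relfun R n (rdom \<eta>) \<and> is_relfun R n (rcod \<eta>) \<and>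
  (\<forall>l. enat l \<le> dimn R \<longrightarrow> rnat \<eta> l \<in> \<A> \<and> \<D> (rnat \<eta> l) = pw n l \<and>
    \<C> (rnat \<eta> l) = R1 R l \<and> lsrc R l (rnat \<eta> l) = ob (rdom \<eta>) l \<and> ltgt R l (rnat \<eta> l) = ob (rcod \<eta>)
        l) \<and>
  (\<forall>e l k. enat l < dimn R \<and> k \<le> l \<longrightarrow>
    acomp R (act1 R (face e l k)) (rnat \<eta> (Suc l)) = acomp R (rnat \<eta> l) (fpow n e l k)) \<and>
  (\<forall>l k. enat l < dimn R \<and> k \<le> l \<longrightarrow>
    lcomp R (Suc l) (acomp R (rnat \<eta> (Suc l)) (dpow n l k)) (reps (rdom \<eta>) l k) =
    lcomp R (Suc l) (reps (rcod \<eta>) l k) (acomp R (act1 R (degen l k)) (rnat \<eta> l)))"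
proof -
  have nat: "inat (Amb R) (rfun F l) (rfun G l) \<theta> \<longleftrightarrow> \<theta> \<in> \<A> \<and> \<D> \<theta> = pw n l \<and>
      \<C> \<theta> = R1 R l \<and> lsrc R l \<theta> = ob F l \<and> ltgt R l \<theta> = ob G l"
    if "enat l \<le> dimn R" "is_relfun R n F" "is_relfun R n G" for F G l \<theta>
  proof (rule inat_discrete)
    show "f1 (rfun F l) = lid R l (ob F l)" "f1 (rfun G l) = lid R l (ob G l)"
      "idom (rfun F l) = on_obj (discpow R n) l" "idom (rfun G l) = on_obj (discpow R n) l"
      "icod (rfun F l) = Lv R l" "icod (rfun G l) = Lv R l"
      by (subst relfun_rfun[OF that(2,1)] relfun_rfun[OF that(3,1)], simp)+
  qed (use that relfun_ob[OF that(2,1)] in simp_all)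
  show ?thesis
    by (auto simp: is_relnat_def cubical_nat_def face_preserving_nat_def
        degeneracy_preserving_nat_def nat
      is_relfun_def[of R n "rdom \<eta>"] is_relfun_def[of R n "rcod \<eta>"] simp del: enat_ord_simps)
qed

section \<open>Products and exponentials of functors\<close>

lemma is_relfun_rone: "is_relfun R n (rone R n)"
  unfolding rone_def
proof (rule relfunI)
  fix l f
  assume l: "enat l \<le> dimn R" and f: "f \<in> good_tuples R n l"
  note f = good_tuplesD[OF f l]
  show "lsrc R l (lid R l (acomp R (one R l) (bang (Amb R) (\<D> f))))
      = acomp R (acomp R (one R l) (bang (Amb R) (pw n l))) (acomp R (spow n l) f)"
    "ltgt R l (lid R l (acomp R (one R l) (bang (Amb R) (\<D> f))))
      = acomp R (acomp R (one R l) (bang (Amb R) (pw n l))) (acomp R (tpow n l) f)"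
    using l f by simp_all
  show "lid R l (acomp R (one R l) (bang (Amb R) (\<D> f))) \<in> Good R l"
    "\<D> (lid R l (acomp R (one R l) (bang (Amb R) (\<D> f)))) = \<D> f"
    using l f by simp_all
  fix m w assume "w \<in> hom (Amb R) (pw m l) (\<D> f)"
  then show "lid R l (acomp R (one R l) (bang (Amb R) (\<D> (acomp R f w))))
      = acomp R (lid R l (acomp R (one R l) (bang (Amb R) (\<D> f)))) w"
    using l f by (simp add: hom_def)
next
  fix l m A
  assume "enat l \<le> dimn R" "A \<in> hom (Amb R) (pw m l) (pw n l)"
  then show "lid R l (acomp R (one R l) (bang (Amb R) (\<D> (acomp R (ipw n l) A))))
      = lid R l (acomp R (acomp R (one R l) (bang (Amb R) (pw n l))) A)"
    by (simp add: hom_def)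
next
  fix l f g
  assume l: "enat l \<le> dimn R" and fg: "f \<in> good_tuples R n l" "g \<in> good_tuples R n l"
    "\<D> f = \<D> g" "acomp R (spow n l) g = acomp R (tpow n l) f"
  note f = good_tuplesD[OF fg(1) l] and g = good_tuplesD[OF fg(2) l]
  show "lid R l (acomp R (one R l) (bang (Amb R) (\<D> (icomp (Amb R) (ipow (Amb R) n (Lv R l)) g f))))
      = lcomp R l (lid R l (acomp R (one R l) (bang (Amb R) (\<D> g))))
          (lid R l (acomp R (one R l) (bang (Amb R) (\<D> f))))"
    using level_ipow_icomp(2)[OF l f(1) g(1) f(2) g(2) fg(3)[symmetric] fg(4)] f(1) g(1) fg(3) l by
        simp
next
  fix e l k
  assume lk: "enat l < dimn R" "k \<le> l"
  \<comment> \<open>Bracketed so that \<open>face_one\<close> applies: the face meets the constant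
    \<open>one\<close> before the reindexing along the map to the terminal object.\<close>
  have "acomp R (act0 R (face e l k)) (acomp R (one R (Suc l)) (bang (Amb R) (pw n (Suc l))))
      = acomp R (acomp R (act0 R (face e l k)) (one R (Suc l))) (bang (Amb R) (pw n (Suc l)))"
    using lk by simp
  then show "acomp R (act0 R (face e l k)) (acomp R (one R (Suc l)) (bang (Amb R) (pw n (Suc l))))
      = acomp R (acomp R (one R l) (bang (Amb R) (pw n l))) (fpow n e l k)"
    using lk by (simp add: face_one)
next
  fix l k
  assume lk: "enat l < dimn R" "k \<le> l"
  have "lsrc R (Suc l) (acomp R (one_eps R l k) (bang (Amb R) (pw n l)))
      = acomp R (lsrc R (Suc l) (one_eps R l k)) (bang (Amb R) (pw n l))"
    "ltgt R (Suc l) (acomp R (one_eps R l k) (bang (Amb R) (pw n l)))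
      = acomp R (ltgt R (Suc l) (one_eps R l k)) (bang (Amb R) (pw n l))"
    using lk by (simp_all del: one_eps_in(2,3))
  then show "lsrc R (Suc l) (acomp R (one_eps R l k) (bang (Amb R) (pw n l)))
      = acomp R (act0 R (degen l k)) (acomp R (one R l) (bang (Amb R) (pw n l)))"
    "ltgt R (Suc l) (acomp R (one_eps R l k) (bang (Amb R) (pw n l)))
      = acomp R (acomp R (one R (Suc l)) (bang (Amb R) (pw n (Suc l)))) (dpow n l k)"
    using lk by simp_all
qed simp_all

context
  fixes n F G
  assumes F: "is_relfun R n F" and G: "is_relfun R n G"
begin

private lemmas F_ob = relfun_ob[OF F] and G_ob = relfun_ob[OF G]
private lemmas F_eps = relfun_eps[OF F] and G_eps = relfun_eps[OF G]
private lemmas F_ups = relfun_ups[OF F] and G_ups = relfun_ups[OF G]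
private lemmas F_face = relfun_face[OF F] and G_face = relfun_face[OF G]

private lemma ups_src_tgt:
  assumes "enat l \<le> dimn R" "f \<in> good_tuples R n l" "g \<in> good_tuples R n l"
    "\<D> f = \<D> g" "acomp R (spow n l) g = acomp R (tpow n l) f"
  shows "lsrc R l (rups F l g) = ltgt R l (rups F l f)" "lsrc R l (rups G l g) = ltgt R l (rups G l
      f)"
  using assms by (simp_all add: F_ups G_ups)

text \<open>The action on good isomorphisms is functorial because \<open>iprodmap\<close> is, and
  its values are good because the class is closed under products.\<close>

lemma is_relfun_rprod: "is_relfun R n (rprod R n F G)"
  unfolding rprod_def
proof (rule relfunI)
  fix l f
  assume l: "enat l \<le> dimn R" and f: "f \<in> good_tuples R n l"
  note fD = good_tuplesD[OF f l]
  show "iprodmap R l (rups F l f) (rups G l f) \<in> Good R l"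
    "\<D> (iprodmap R l (rups F l f) (rups G l f)) = \<D> f"
    "lsrc R l (iprodmap R l (rups F l f) (rups G l f))
      = acomp R (iprod R l (ob F l) (ob G l)) (acomp R (spow n l) f)"
    "ltgt R l (iprodmap R l (rups F l f) (rups G l f))
      = acomp R (iprod R l (ob F l) (ob G l)) (acomp R (tpow n l) f)"
    using l f fD by (simp_all add: F_ups G_ups F_ob G_ob)
  fix m w assume w: "w \<in> hom (Amb R) (pw m l) (\<D> f)"
  then show "iprodmap R l (rups F l (acomp R f w)) (rups G l (acomp R f w))
      = acomp R (iprodmap R l (rups F l f) (rups G l f)) w"
    using l f fD relfun_ups_comp[OF F l f w] relfun_ups_comp[OF G l f w]
    by (simp add: hom_def F_ups G_ups)
next
  fix l m A
  assume l: "enat l \<le> dimn R" and A: "A \<in> hom (Amb R) (pw m l) (pw n l)"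
  then show "iprodmap R l (rups F l (acomp R (ipw n l) A)) (rups G l (acomp R (ipw n l) A))
      = lid R l (acomp R (iprod R l (ob F l) (ob G l)) A)"
    using relfun_ups_idn[OF F l A] relfun_ups_idn[OF G l A] by (simp add: hom_def F_ob G_ob)
next
  fix l f g
  assume l: "enat l \<le> dimn R" and fg: "f \<in> good_tuples R n l" "g \<in> good_tuples R n l"
    "\<D> f = \<D> g" "acomp R (spow n l) g = acomp R (tpow n l) f"
  show "iprodmap R l (rups F l (icomp (Amb R) (ipow (Amb R) n (Lv R l)) g f))
        (rups G l (icomp (Amb R) (ipow (Amb R) n (Lv R l)) g f))
      = lcomp R l (iprodmap R l (rups F l g) (rups G l g)) (iprodmap R l (rups F l f) (rups G l f))"
    unfolding relfun_ups_icomp[OF F l fg] relfun_ups_icomp[OF G l fg]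
    by (rule iprodmap_lcomp[OF l]) (use l fg(1-3) ups_src_tgt[OF l fg] in \<open>simp_all add:
        F_ups(2,5,6) G_ups(2,5,6)\<close>)
qed (simp_all add: F_ob G_ob F_eps G_eps F_face G_face)

text \<open>The first argument enters through \<open>linv\<close>, since exponentiation reverses it.
  Inversion reverses composition as well, so the resulting action is covariant and
  functorial.\<close>

lemma is_relfun_rexp: "is_relfun R n (rexp R n F G)"
  unfolding rexp_def
proof (rule relfunI)
  fix l f
  assume l: "enat l \<le> dimn R" and f: "f \<in> good_tuples R n l"
  note fD = good_tuplesD[OF f l]
  show "iexpmap R l (linv R l (rups F l f)) (rups G l f) \<in> Good R l"
    "\<D> (iexpmap R l (linv R l (rups F l f)) (rups G l f)) = \<D> f"
    "lsrc R l (iexpmap R l (linv R l (rups F l f)) (rups G l f))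
      = acomp R (iexp R l (ob F l) (ob G l)) (acomp R (spow n l) f)"
    "ltgt R l (iexpmap R l (linv R l (rups F l f)) (rups G l f))
      = acomp R (iexp R l (ob F l) (ob G l)) (acomp R (tpow n l) f)"
    using l f fD by (simp_all add: F_ups G_ups F_ob G_ob)
  fix m w assume w: "w \<in> hom (Amb R) (pw m l) (\<D> f)"
  then show "iexpmap R l (linv R l (rups F l (acomp R f w))) (rups G l (acomp R f w))
      = acomp R (iexpmap R l (linv R l (rups F l f)) (rups G l f)) w"
    using l f fD relfun_ups_comp[OF F l f w] relfun_ups_comp[OF G l f w]
      level_iinv_comp[OF l, of "rups F l f" w]
    by (simp add: hom_def F_ups G_ups)
next
  fix l m A
  assume l: "enat l \<le> dimn R" and A: "A \<in> hom (Amb R) (pw m l) (pw n l)"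
  then show "iexpmap R l (linv R l (rups F l (acomp R (ipw n l) A))) (rups G l (acomp R (ipw n l)
      A))
      = lid R l (acomp R (iexp R l (ob F l) (ob G l)) A)"
    using relfun_ups_idn[OF F l A] relfun_ups_idn[OF G l A] by (simp add: hom_def F_ob G_ob)
next
  fix l f g
  assume l: "enat l \<le> dimn R" and fg: "f \<in> good_tuples R n l" "g \<in> good_tuples R n l"
    "\<D> f = \<D> g" "acomp R (spow n l) g = acomp R (tpow n l) f"
  have i: "linv R l (lcomp R l (rups F l g) (rups F l f)) = lcomp R l (linv R l (rups F l f)) (linv
      R l (rups F l g))"
    by (rule level_iinv_icomp[OF l]) (use l fg(1-3) ups_src_tgt[OF l fg] in \<open>simp_all add:
        F_ups(1,2)\<close>)
  have ii: "iiso (Amb R) (Lv R l) (rups F l f)" "iiso (Amb R) (Lv R l) (rups F l g)"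
    using l fg by (simp_all add: F_ups(1))
  have iv: "lsrc R l (linv R l (rups F l f)) = ltgt R l (linv R l (rups F l g))"
    unfolding level_iinv_in(4)[OF l ii(1)] level_iinv_in(5)[OF l ii(2)] using ups_src_tgt[OF l fg]
        by simp
  show "iexpmap R l (linv R l (rups F l (icomp (Amb R) (ipow (Amb R) n (Lv R l)) g f)))
        (rups G l (icomp (Amb R) (ipow (Amb R) n (Lv R l)) g f))
      = lcomp R l (iexpmap R l (linv R l (rups F l g)) (rups G l g)) (iexpmap R l (linv R l (rups F
          l f)) (rups G l f))"
    unfolding relfun_ups_icomp[OF F l fg] relfun_ups_icomp[OF G l fg] i
    by (rule iexpmap_lcomp[OF l _ _ _ _ _ _ _ _ _ _ _ iv ups_src_tgt(2)[OF l fg]])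
      (use l fg(1-3) ii in \<open>simp_all add: F_ups(2,5,6) G_ups(2,5,6)\<close>)
qed (simp_all add: F_ob G_ob F_eps G_eps F_face G_face)

end

lemma rprod_sel [simp]:
  "enat l \<le> dimn R \<Longrightarrow> ob (rprod R n F G) l = iprod R l (ob F l) (ob G l)"
  "\<lbrakk>enat l < dimn R; k \<le> l\<rbrakk> \<Longrightarrow> reps (rprod R n F G) l k
     = lcomp R (Suc l) (iprodmap R (Suc l) (reps F l k) (reps G l k)) (acomp R (times_eps R l k)
         (pr2 R (ob F l) (ob G l)))"
  "\<lbrakk>enat l \<le> dimn R; f \<in> good_tuples R n l\<rbrakk> \<Longrightarrow> rups (rprod R n F G) l f = iprodmap R l (rups F l f)
      (rups G l f)"
  by (simp_all add: rprod_def)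

lemma rexp_sel [simp]:
  "enat l \<le> dimn R \<Longrightarrow> ob (rexp R n F G) l = iexp R l (ob F l) (ob G l)"
  "\<lbrakk>enat l < dimn R; k \<le> l\<rbrakk> \<Longrightarrow> reps (rexp R n F G) l k
     = lcomp R (Suc l) (iexpmap R (Suc l) (linv R (Suc l) (reps F l k)) (reps G l k))
         (acomp R (expo_ups R l k) (pr2 R (ob F l) (ob G l)))"
  "\<lbrakk>enat l \<le> dimn R; f \<in> good_tuples R n l\<rbrakk> \<Longrightarrow> rups (rexp R n F G) l f
     = iexpmap R l (linv R l (rups F l f)) (rups G l f)"
  by (simp_all add: rexp_def)

lemma rone_sel [simp]:
  "enat l \<le> dimn R \<Longrightarrow> ob (rone R n) l = acomp R (one R l) (bang (Amb R) (pw n l))"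
  "\<lbrakk>enat l < dimn R; k \<le> l\<rbrakk> \<Longrightarrow> reps (rone R n) l k = acomp R (one_eps R l k) (bang (Amb R) (pw n l))"
  "\<lbrakk>enat l \<le> dimn R; f \<in> good_tuples R n l\<rbrakk> \<Longrightarrow> rups (rone R n) l f
     = lid R l (acomp R (one R l) (bang (Amb R) (\<D> f)))"
  by (simp_all add: rone_def)

section \<open>Natural transformations and the operations on them\<close>

lemma relnatD:
  assumes "is_relnat R n \<eta>"
  shows "is_relfun R n (rdom \<eta>)" "is_relfun R n (rcod \<eta>)"
    "\<And>l. enat l \<le> dimn R \<Longrightarrow> rnat \<eta> l \<in> \<A>"
    "\<And>l. enat l \<le> dimn R \<Longrightarrow> \<D> (rnat \<eta> l) = pw n l"
    "\<And>l. enat l \<le> dimn R \<Longrightarrow> \<C> (rnat \<eta> l) = R1 R l"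
    "\<And>l. enat l \<le> dimn R \<Longrightarrow> lsrc R l (rnat \<eta> l) = ob (rdom \<eta>) l"
    "\<And>l. enat l \<le> dimn R \<Longrightarrow> ltgt R l (rnat \<eta> l) = ob (rcod \<eta>) l"
    "\<And>e l k. \<lbrakk>enat l < dimn R; k \<le> l\<rbrakk> \<Longrightarrow>
      acomp R (act1 R (face e l k)) (rnat \<eta> (Suc l)) = acomp R (rnat \<eta> l) (fpow n e l k)"
    "\<And>l k. \<lbrakk>enat l < dimn R; k \<le> l\<rbrakk> \<Longrightarrow>
      lcomp R (Suc l) (acomp R (rnat \<eta> (Suc l)) (dpow n l k)) (reps (rdom \<eta>) l k) =
      lcomp R (Suc l) (reps (rcod \<eta>) l k) (acomp R (act1 R (degen l k)) (rnat \<eta> l))"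
  using assms unfolding is_relnat_iff by blast+

text \<open>With composites nested to the right, \<open>lsrc R l f\<close> no longer occurs in
  \<open>lsrc R l (acomp R f u)\<close>; the known value of the source has to be supplied
  explicitly.\<close>

lemma lsrc_comp:
  assumes "enat l \<le> dimn R" "lsrc R l f = A" "f \<in> \<A>" "\<C> f = R1 R l" "u \<in> \<A>" "\<C> u = \<D> f"
  shows "lsrc R l (acomp R f u) = acomp R A u"
  unfolding assms(2)[symmetric] using assms(1,3-) by simp

lemma ltgt_comp:
  assumes "enat l \<le> dimn R" "ltgt R l f = A" "f \<in> \<A>" "\<C> f = R1 R l" "u \<in> \<A>" "\<C> u = \<D> f"
  shows "ltgt R l (acomp R f u) = acomp R A u"
  unfolding assms(2)[symmetric] using assms(1,3-) by simp

lemma relnat_comp: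
  assumes \<eta>: "is_relnat R n \<eta>" and "enat l \<le> dimn R" "u \<in> \<A>" "\<C> u = pw n l"
  shows "lsrc R l (acomp R (rnat \<eta> l) u) = acomp R (ob (rdom \<eta>) l) u"
    "ltgt R l (acomp R (rnat \<eta> l) u) = acomp R (ob (rcod \<eta>) l) u"
  by (rule lsrc_comp ltgt_comp; use assms in \<open>simp add: relnatD[OF \<eta>]\<close>)+

lemma relnat_eqI:
  assumes "is_relnat R n \<eta>" "is_relnat R n \<theta>" "rdom \<eta> = rdom \<theta>" "rcod \<eta> = rcod \<theta>"
    "\<And>l. enat l \<le> dimn R \<Longrightarrow> rnat \<eta> l = rnat \<theta> l"
  shows "\<eta> = \<theta>"
proof -
  have "mk_relnat R (rdom \<eta>) (rcod \<eta>) (rnat \<eta>) = mk_relnat R (rdom \<theta>) (rcod \<theta>) (rnat \<theta>)"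
    unfolding assms(3,4) by (rule mk_relnat_cong) (rule assms(5))
  then show ?thesis using assms(1,2) unfolding is_relnat_iff by simp
qed

lemma relnatI:
  assumes "is_relfun R n F" "is_relfun R n G"
    "\<And>l. enat l \<le> dimn R \<Longrightarrow> \<eta> l \<in> \<A>"
    "\<And>l. enat l \<le> dimn R \<Longrightarrow> \<D> (\<eta> l) = pw n l"
    "\<And>l. enat l \<le> dimn R \<Longrightarrow> \<C> (\<eta> l) = R1 R l"
    "\<And>l. enat l \<le> dimn R \<Longrightarrow> lsrc R l (\<eta> l) = ob F l"
    "\<And>l. enat l \<le> dimn R \<Longrightarrow> ltgt R l (\<eta> l) = ob G l"
    "\<And>e l k. \<lbrakk>enat l < dimn R; k \<le> l\<rbrakk> \<Longrightarrow>
      acomp R (act1 R (face e l k)) (\<eta> (Suc l)) = acomp R (\<eta> l) (fpow n e l k)"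
    "\<And>l k. \<lbrakk>enat l < dimn R; k \<le> l\<rbrakk> \<Longrightarrow>
      lcomp R (Suc l) (acomp R (\<eta> (Suc l)) (dpow n l k)) (reps F l k) =
      lcomp R (Suc l) (reps G l k) (acomp R (act1 R (degen l k)) (\<eta> l))"
  shows "is_relnat R n (mk_relnat R F G \<eta>)"
proof -
  have "mk_relnat R F G (rnat (mk_relnat R F G \<eta>)) = mk_relnat R F G \<eta>"
    by (rule mk_relnat_cong) simp
  then show ?thesis
    unfolding is_relnat_iff using assms by (simp del: enat_ord_simps)
qed

lemma is_relnat_rid:
  assumes F: "is_relfun R n F"
  shows "is_relnat R n (rid R F)"
  unfolding rid_def
  by (rule relnatI[OF F F]) (simp_all add: relfun_ob[OF F] relfun_eps[OF F] relfun_face[OF F])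

text \<open>The degeneracy square of a composite is the pasting of the squares of \<eta> and
  \<theta> along the witness of the functor in the middle.\<close>

lemma is_relnat_rcomp:
  assumes \<eta>: "is_relnat R n \<eta>" and \<theta>: "is_relnat R n \<theta>" and c: "rdom \<theta> = rcod \<eta>"
  shows "is_relnat R n (rcomp R \<theta> \<eta>)"
  unfolding rcomp_def
proof (rule relnatI)
  note \<eta>D = relnatD[OF \<eta>] and \<theta>D = relnatD[OF \<theta>]
  note [simp] = relfun_ob[OF \<eta>D(1)] relfun_ob[OF \<eta>D(2)] relfun_ob[OF \<theta>D(2)]
    relfun_eps[OF \<eta>D(1)] relfun_eps[OF \<eta>D(2)] relfun_eps[OF \<theta>D(2)]
  show "is_relfun R n (rdom \<eta>)" "is_relfun R n (rcod \<theta>)" by fact+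
  fix l k
  assume lk: "enat l < dimn R" "k \<le> l"
  then have l: "enat l \<le> dimn R" "enat (Suc l) \<le> dimn R" by simp_all
  let ?d = "acomp R (act1 R (degen l k))"
  have "lcomp R (Suc l) (acomp R (lcomp R (Suc l) (rnat \<theta> (Suc l)) (rnat \<eta> (Suc l))) (dpow n l k))
      (reps (rdom \<eta>) l k)
      = lcomp R (Suc l) (acomp R (rnat \<theta> (Suc l)) (dpow n l k))
         (lcomp R (Suc l) (acomp R (rnat \<eta> (Suc l)) (dpow n l k)) (reps (rdom \<eta>) l k))"
    using lk l by (simp add: \<eta>D(3-7) \<theta>D(3-7) relnat_comp[OF \<eta>] relnat_comp[OF \<theta>] c)
  also have "\<dots> = lcomp R (Suc l) (acomp R (rnat \<theta> (Suc l)) (dpow n l k)) (lcomp R (Suc l) (reps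
      (rcod \<eta>) l k) (?d (rnat \<eta> l)))"
    using lk by (simp add: \<eta>D(9))
  also have "\<dots> = lcomp R (Suc l) (lcomp R (Suc l) (acomp R (rnat \<theta> (Suc l)) (dpow n l k)) (reps
      (rdom \<theta>) l k)) (?d (rnat \<eta> l))"
    using lk l by (simp add: \<eta>D(3-7) \<theta>D(3-7) relnat_comp[OF \<eta>] relnat_comp[OF \<theta>] c)
  also have "\<dots> = lcomp R (Suc l) (lcomp R (Suc l) (reps (rcod \<theta>) l k) (?d (rnat \<theta> l))) (?d (rnat \<eta>
      l))"
    using lk by (simp only: \<theta>D(9))
  also have "\<dots> = lcomp R (Suc l) (reps (rcod \<theta>) l k) (?d (lcomp R l (rnat \<theta> l) (rnat \<eta> l)))"
    using lk l by (simp add: \<eta>D(3-7) \<theta>D(3-7) c)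
  finally show "lcomp R (Suc l) (acomp R (lcomp R (Suc l) (rnat \<theta> (Suc l)) (rnat \<eta> (Suc l))) (dpow
      n l k)) (reps (rdom \<eta>) l k)
      = lcomp R (Suc l) (reps (rcod \<theta>) l k) (?d (lcomp R l (rnat \<theta> l) (rnat \<eta> l)))" .
qed (simp_all add: relnatD[OF \<eta>] relnatD[OF \<theta>] c)

context
  fixes n F G
  assumes F: "is_relfun R n F" and G: "is_relfun R n G"
begin

private lemmas FG_simps = relfun_ob[OF F] relfun_ob[OF G] relfun_eps[OF F] relfun_eps[OF G]
  relfun_face[OF F] relfun_face[OF G]

text \<open>The degeneracy squares are instances of \<open>pfst_pmap_tau\<close> at the stage
  \<open>pw n l\<close>, with the witnesses of \<open>F\<close> and \<open>G\<close> for
  \<open>eA\<close> and \<open>eB\<close>.\<close>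

lemma is_relnat_rfst: "is_relnat R n (rfst R n F G)"
  and is_relnat_rsnd: "is_relnat R n (rsnd R n F G)"
proof -
  have "lcomp R (Suc l) (acomp R (ifst R (Suc l) (ob F (Suc l)) (ob G (Suc l))) (dpow n l k)) (reps
      (rprod R n F G) l k)
      = lcomp R (Suc l) (reps F l k) (acomp R (act1 R (degen l k)) (ifst R l (ob F l) (ob G l)))"
    "lcomp R (Suc l) (acomp R (isnd R (Suc l) (ob F (Suc l)) (ob G (Suc l))) (dpow n l k)) (reps
        (rprod R n F G) l k)
      = lcomp R (Suc l) (reps G l k) (acomp R (act1 R (degen l k)) (isnd R l (ob F l) (ob G l)))"
    if lk: "enat l < dimn R" "k \<le> l" for l k
  proof -
    note P = ccc_pseudofunctor.pfst_pmap_tau[OF ccc_pseudofunctor_degen[OF lk], of "ob F l" "pw n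
        l" "ob G l" "reps F l k" "acomp R (ob F (Suc l)) (dpow n l k)"
        "reps G l k" "acomp R (ob G (Suc l)) (dpow n l k)", unfolded stage_simps]
    show "lcomp R (Suc l) (acomp R (ifst R (Suc l) (ob F (Suc l)) (ob G (Suc l))) (dpow n l k))
        (reps (rprod R n F G) l k)
      = lcomp R (Suc l) (reps F l k) (acomp R (act1 R (degen l k)) (ifst R l (ob F l) (ob G l)))"
      using P(1) lk by (simp add: FG_simps)
    show "lcomp R (Suc l) (acomp R (isnd R (Suc l) (ob F (Suc l)) (ob G (Suc l))) (dpow n l k))
        (reps (rprod R n F G) l k)
      = lcomp R (Suc l) (reps G l k) (acomp R (act1 R (degen l k)) (isnd R l (ob F l) (ob G l)))"
      using P(2) lk by (simp add: FG_simps)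
  qed
  note degen = this
  show "is_relnat R n (rfst R n F G)"
    unfolding rfst_def
    by (rule relnatI[OF is_relfun_rprod[OF F G] F]; (rule degen)?; simp add: FG_simps)
  show "is_relnat R n (rsnd R n F G)"
    unfolding rsnd_def
    by (rule relnatI[OF is_relfun_rprod[OF F G] G]; (rule degen)?; simp add: FG_simps)
qed

text \<open>An instance of \<open>evl_natural\<close>, in which \<open>iA\<close> is the inverse of
  the witness of \<open>F\<close>, as in the definition of \<open>rexp\<close>.\<close>

lemma is_relnat_reval: "is_relnat R n (reval R n F G)"
proof -
  have degen: "lcomp R (Suc l) (acomp R (ieval R (Suc l) (ob F (Suc l)) (ob G (Suc l))) (dpow n l
      k))
        (reps (rprod R n (rexp R n F G) F) l k)
      = lcomp R (Suc l) (reps G l k) (acomp R (act1 R (degen l k)) (ieval R l (ob F l) (ob G l)))"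
    if lk: "enat l < dimn R" "k \<le> l" for l k
  proof -
    note P = ccc_pseudofunctor.evl_natural[OF ccc_pseudofunctor_degen[OF lk], of "ob F l" "pw n l"
        "ob G l" "reps F l k" "acomp R (ob F (Suc l)) (dpow n l k)"
        "linv R (Suc l) (reps F l k)" "reps G l k" "acomp R (ob G (Suc l)) (dpow n l k)", unfolded
            stage_simps]
    show ?thesis
      using P lk by (simp add: FG_simps)
  qed
  show "is_relnat R n (reval R n F G)"
    unfolding reval_def
    by (rule relnatI[OF is_relfun_rprod[OF is_relfun_rexp[OF F G] F] G]; (rule degen)?; simp add:
        FG_simps)
qed

end

text \<open>The degeneracy squares of \<phi> and \<psi> are the last two premises of
  \<open>ppair_natural\<close>.\<close>

lemma is_relnat_rpair:
  assumes \<phi>: "is_relnat R n \<phi>" and \<psi>: "is_relnat R n \<psi>" and d: "rdom \<psi> = rdom \<phi>"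
  shows "is_relnat R n (rpair R n \<phi> \<psi>)"
proof -
  note \<phi>D = relnatD[OF \<phi>] and \<psi>D = relnatD[OF \<psi>]
  note fun_simps = relfun_ob[OF \<phi>D(1)] relfun_ob[OF \<phi>D(2)] relfun_ob[OF \<psi>D(2)]
    relfun_eps[OF \<phi>D(1)] relfun_eps[OF \<phi>D(2)] relfun_eps[OF \<psi>D(2)]
  have degen: "lcomp R (Suc l) (acomp R (ipair R (Suc l) (rnat \<phi> (Suc l)) (rnat \<psi> (Suc l))) (dpow n
      l k)) (reps (rdom \<phi>) l k)
      = lcomp R (Suc l) (reps (rprod R n (rcod \<phi>) (rcod \<psi>)) l k) (acomp R (act1 R (degen l k))
          (ipair R l (rnat \<phi> l) (rnat \<psi> l)))"
    if lk: "enat l < dimn R" "k \<le> l" for l k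
  proof -
    let ?c = "\<lambda>F. acomp R (ob F (Suc l)) (dpow n l k)"
    note P = ccc_pseudofunctor.ppair_natural[OF ccc_pseudofunctor_degen[OF lk], of "ob (rcod \<phi>) l"
        "pw n l" "ob (rcod \<psi>) l" "reps (rcod \<phi>) l k" "?c (rcod \<phi>)"
        "reps (rcod \<psi>) l k" "?c (rcod \<psi>)" "rnat \<phi> l" "rnat \<psi> l" "ob (rdom \<phi>) l" "reps (rdom \<phi>) l k"
            "?c (rdom \<phi>)"
        "acomp R (rnat \<phi> (Suc l)) (dpow n l k)" "acomp R (rnat \<psi> (Suc l)) (dpow n l k)", unfolded
            stage_simps]
    show ?thesis
      using P lk \<psi>D(9)[OF lk, unfolded d]
      by (simp add: fun_simps \<phi>D(3-7,9) \<psi>D(3-7) d relnat_comp[OF \<phi>] relnat_comp[OF \<psi>])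
  qed
  show ?thesis
    unfolding rpair_def
    by (rule relnatI[OF \<phi>D(1) is_relfun_rprod[OF \<phi>D(2) \<psi>D(2)]]; (rule degen)?;
      simp add: fun_simps \<phi>D(3-8) \<psi>D(3-8) d)
qed

text \<open>\<open>cur_natural\<close> uses both inverse laws for the witness of \<open>F\<close>;
  its last premise is the degeneracy square of \<phi>, whose source is a product.\<close>

lemma is_relnat_rcurry:
  assumes \<phi>: "is_relnat R n \<phi>" and H: "is_relfun R n H" and F: "is_relfun R n F"
    and dom: "rdom \<phi> = rprod R n H F" and cod: "rcod \<phi> = G"
  shows "is_relnat R n (rcurry R n H F G \<phi>)"
proof -
  note \<phi>D = relnatD[OF \<phi>]
  have G: "is_relfun R n G" using \<phi>D(2) cod by simp
  note fun_simps = relfun_ob[OF F] relfun_ob[OF G] relfun_ob[OF H] relfun_eps[OF F] relfun_eps[OF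
      G] relfun_eps[OF H]
    relfun_face[OF F] relfun_face[OF G] relfun_face[OF H]
  have degen: "lcomp R (Suc l) (acomp R (icurry R (Suc l) (ob H (Suc l)) (ob F (Suc l)) (ob G (Suc
      l)) (rnat \<phi> (Suc l))) (dpow n l k)) (reps H l k)
      = lcomp R (Suc l) (reps (rexp R n F G) l k) (acomp R (act1 R (degen l k)) (icurry R l (ob H
          l) (ob F l) (ob G l) (rnat \<phi> l)))"
    if lk: "enat l < dimn R" "k \<le> l" for l k
  proof -
    let ?c = "\<lambda>F. acomp R (ob F (Suc l)) (dpow n l k)"
    note P = ccc_pseudofunctor.cur_natural[OF ccc_pseudofunctor_degen[OF lk], of "ob F l" "pw n l"
        "ob G l" "reps F l k" "?c F" "linv R (Suc l) (reps F l k)"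
       "reps G l k" "?c G" "ob H l" "rnat \<phi> l" "reps H l k" "?c H" "acomp R (rnat \<phi> (Suc l)) (dpow
           n l k)", unfolded stage_simps]
    show ?thesis
      using P lk \<phi>D(9)[OF lk]
      by (simp add: fun_simps \<phi>D(3-7) dom cod relnat_comp[OF \<phi>])
  qed
  show ?thesis
    unfolding rcurry_def
    by (rule relnatI[OF H is_relfun_rexp[OF F G]]; (rule degen)?; simp add: fun_simps \<phi>D(3-8) dom
        cod)
qed

text \<open>\<open>FunCat R n\<close> with its chosen products and exponentials, in the record that
  gives access to the equational reasoning of \<open>ccc\<close>.\<close>

definition fcc :: "nat \<Rightarrow> (('o, 'a) relfun, ('o, 'a) relnat) cc" where
  "fcc n = \<lparr>Obj = {F. is_relfun R n F}, Arr = {\<eta>. is_relnat R n \<eta>},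
     Dom = rdom, Cod = rcod, Ide = rid R, Comp = rcomp R,
     prd = rprod R n, pfst = rfst R n, psnd = rsnd R n, ppair = rpair R n,
     expn = rexp R n, evl = reval R n, cur = rcurry R n\<rparr>"

lemma fcc_sel:
  "Obj (fcc n) = {F. is_relfun R n F}" "Arr (fcc n) = {\<eta>. is_relnat R n \<eta>}"
  "Dom (fcc n) = rdom" "Cod (fcc n) = rcod" "Ide (fcc n) = rid R" "Comp (fcc n) = rcomp R"
  "prd (fcc n) = rprod R n" "pfst (fcc n) = rfst R n" "psnd (fcc n) = rsnd R n" "ppair (fcc n) =
      rpair R n"
  "expn (fcc n) = rexp R n" "evl (fcc n) = reval R n" "cur (fcc n) = rcurry R n"
  by (simp_all add: fcc_def)

lemma rop_sel [simp]:
  "rdom (rid R F) = F" "rcod (rid R F) = F" "rdom (rcomp R \<theta> \<eta>) = rdom \<eta>" "rcod (rcomp R \<theta> \<eta>) =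
      rcod \<theta>"
  "rdom (rfst R n F G) = rprod R n F G" "rcod (rfst R n F G) = F"
  "rdom (rsnd R n F G) = rprod R n F G" "rcod (rsnd R n F G) = G"
  "rdom (rpair R n \<eta> \<theta>) = rdom \<eta>" "rcod (rpair R n \<eta> \<theta>) = rprod R n (rcod \<eta>) (rcod \<theta>)"
  "rdom (reval R n F G) = rprod R n (rexp R n F G) F" "rcod (reval R n F G) = G"
  "rdom (rcurry R n H F G \<eta>) = H" "rcod (rcurry R n H F G \<eta>) = rexp R n F G"
  by (simp_all add: rid_def rcomp_def rfst_def rsnd_def rpair_def reval_def rcurry_def)

lemma rnat_rop [simp]:
  assumes "enat l \<le> dimn R"
  shows "rnat (rid R F) l = lid R l (ob F l)" "rnat (rcomp R \<theta> \<eta>) l = lcomp R l (rnat \<theta> l) (rnat \<eta>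
      l)"
    "rnat (rfst R n F G) l = ifst R l (ob F l) (ob G l)" "rnat (rsnd R n F G) l = isnd R l (ob F l)
        (ob G l)"
    "rnat (rpair R n \<eta> \<theta>) l = ipair R l (rnat \<eta> l) (rnat \<theta> l)"
    "rnat (reval R n F G) l = ieval R l (ob F l) (ob G l)"
    "rnat (rcurry R n H F G \<eta>) l = icurry R l (ob H l) (ob F l) (ob G l) (rnat \<eta> l)"
  using assms by (simp_all add: rid_def rcomp_def rfst_def rsnd_def rpair_def reval_def rcurry_def)

lemma cat_fcc: "cat (fcc n)"
proof (unfold_locales, unfold fcc_sel mem_Collect_eq)
  fix f g h assume f: "is_relnat R n f" and g: "is_relnat R n g" and h: "is_relnat R n h"
    and fg: "rdom g = rcod f" and gh: "rdom h = rcod g"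
  note comps = is_relnat_rcomp[OF is_relnat_rcomp[OF f g fg] h] is_relnat_rcomp[OF f
      is_relnat_rcomp[OF g h gh]]
  show "rcomp R (rcomp R h g) f = rcomp R h (rcomp R g f)"
    by (rule relnat_eqI[of n]) (use comps relnatD[OF f] relnatD[OF g] relnatD[OF h] fg gh in
        simp_all)
next
  fix f F assume f: "is_relnat R n f" and F: "rdom f = F"
  note comps = is_relnat_rcomp[OF is_relnat_rid[OF relnatD(1)[OF f]] f]
  show "rcomp R f (rid R F) = f"
    by (rule relnat_eqI[of n]) (use comps f relnatD[OF f] F in simp_all)
next
  fix f F assume f: "is_relnat R n f" and F: "rcod f = F"
  note comps = is_relnat_rcomp[OF f is_relnat_rid[OF relnatD(2)[OF f]]]
  show "rcomp R (rid R F) f = f"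
    by (rule relnat_eqI[of n]) (use comps f relnatD[OF f] F in simp_all)
qed (auto intro: is_relnat_rcomp is_relnat_rid relnatD)

lemma is_relnat_pmap:
  assumes "is_relnat R n f" "is_relnat R n g"
  shows "is_relnat R n (pmap (fcc n) f g)"
  unfolding pmap_def fcc_sel
  by (intro is_relnat_rpair is_relnat_rcomp is_relnat_rfst is_relnat_rsnd) (use assms relnatD in
      auto)

lemma rnat_pmap:
  assumes f: "is_relnat R n f" and g: "is_relnat R n g" and l: "enat l \<le> dimn R"
  shows "rnat (pmap (fcc n) f g) l = iprodmap R l (rnat f l) (rnat g l)"
  unfolding pmap_def fcc_sel iprodmap_def
  using l by (simp add: relnatD[OF f] relnatD[OF g])

text \<open>Equality of natural transformations is levelwise, and level \<open>l\<close> lives at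
  the stage \<open>pw n l\<close>, so each law is the corresponding law of
  \<open>stage R l (pw n l)\<close>.\<close>

lemma ccc_fcc: "ccc (fcc n)"
proof -
  interpret cat "fcc n" by (rule cat_fcc)
  show ?thesis
  proof (unfold_locales, unfold fcc_sel mem_Collect_eq)
    fix f g F G
    assume f: "is_relnat R n f" and g: "is_relnat R n g" and fg: "rdom g = rdom f" "rcod f = F"
        "rcod g = G"
    note p = is_relnat_rpair[OF f g fg(1)]
    have F: "is_relfun R n F" and G: "is_relfun R n G" using fg relnatD f g by blast+
    show "rcomp R (rfst R n F G) (rpair R n f g) = f"
    proof (rule relnat_eqI)
      show "is_relnat R n (rcomp R (rfst R n F G) (rpair R n f g))"
        using fg by (intro is_relnat_rcomp[OF p is_relnat_rfst[OF F G]]) simp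
    qed (use f fg relnatD[OF f] relnatD[OF g] in simp_all)
    show "rcomp R (rsnd R n F G) (rpair R n f g) = g"
    proof (rule relnat_eqI)
      show "is_relnat R n (rcomp R (rsnd R n F G) (rpair R n f g))"
        using fg by (intro is_relnat_rcomp[OF p is_relnat_rsnd[OF F G]]) simp
    qed (use g fg relnatD[OF f] relnatD[OF g] in simp_all)
  next
    fix h F G
    assume h: "is_relnat R n h" and F: "is_relfun R n F" and G: "is_relfun R n G" and c: "rcod h =
        rprod R n F G"
    show "rpair R n (rcomp R (rfst R n F G) h) (rcomp R (rsnd R n F G) h) = h"
    proof (rule relnat_eqI)
      show "is_relnat R n (rpair R n (rcomp R (rfst R n F G) h) (rcomp R (rsnd R n F G) h))"
        using c by (intro is_relnat_rpair is_relnat_rcomp[OF h] is_relnat_rfst[OF F G]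
            is_relnat_rsnd[OF F G]) simp_all
      fix l assume l: "enat l \<le> dimn R"
      interpret S: ccc "stage R l (pw n l)" using l by (rule ccc_stage)
      show "rnat (rpair R n (rcomp R (rfst R n F G) h) (rcomp R (rsnd R n F G) h)) l = rnat h l"
        using S.ppair_eta[of "rnat h l" "ob F l" "ob G l"] l
        by (simp add: relnatD[OF h] relfun_ob[OF F] relfun_ob[OF G] c stage_simps)
    qed (use h c in simp_all)
  next
    fix f H F G
    assume f: "is_relnat R n f" and H: "is_relfun R n H" and F: "is_relfun R n F"
      and c: "rdom f = rprod R n H F" "rcod f = G"
    have G: "is_relfun R n G" using c(2) relnatD(2)[OF f] by simp
    note cu = is_relnat_rcurry[OF f H F c]
    note pm = is_relnat_pmap[OF cu is_relnat_rid[OF F]]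
    show "rcomp R (reval R n F G) (pmap (fcc n) (rcurry R n H F G f) (rid R F)) = f"
    proof (rule relnat_eqI)
      show "is_relnat R n (rcomp R (reval R n F G) (pmap (fcc n) (rcurry R n H F G f) (rid R F)))"
        by (intro is_relnat_rcomp[OF pm is_relnat_reval[OF F G]]) (simp add: pmap_def fcc_sel)
      fix l assume l: "enat l \<le> dimn R"
      show "rnat (rcomp R (reval R n F G) (pmap (fcc n) (rcurry R n H F G f) (rid R F))) l = rnat f
          l"
        using l by (simp add: rnat_pmap[OF cu is_relnat_rid[OF F]] relnatD[OF f] relfun_ob[OF F]
            relfun_ob[OF G]
          relfun_ob[OF H] c)
    qed (use f c in \<open>simp_all add: pmap_def fcc_sel\<close>)
  next
    fix h F G H
    assume h: "is_relnat R n h" and F: "is_relfun R n F" and G: "is_relfun R n G" and c: "rdom h =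
        H" "rcod h = rexp R n F G"
    have H: "is_relfun R n H" using c(1) relnatD(1)[OF h] by simp
    note pm = is_relnat_pmap[OF h is_relnat_rid[OF F]]
    have ev: "is_relnat R n (rcomp R (reval R n F G) (pmap (fcc n) h (rid R F)))"
      by (intro is_relnat_rcomp[OF pm is_relnat_reval[OF F G]]) (simp add: pmap_def fcc_sel c)
    show "rcurry R n H F G (rcomp R (reval R n F G) (pmap (fcc n) h (rid R F))) = h"
    proof (rule relnat_eqI)
      show "is_relnat R n (rcurry R n H F G (rcomp R (reval R n F G) (pmap (fcc n) h (rid R F))))"
        by (intro is_relnat_rcurry[OF ev H F]) (simp_all add: pmap_def fcc_sel c)
      fix l assume l: "enat l \<le> dimn R"
      interpret S: ccc "stage R l (pw n l)" using l by (rule ccc_stage)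
      show "rnat (rcurry R n H F G (rcomp R (reval R n F G) (pmap (fcc n) h (rid R F)))) l = rnat h
          l"
        using S.cur_eta[of "rnat h l" "ob F l" "ob G l" "ob H l"] l
        by (simp add: rnat_pmap[OF h is_relnat_rid[OF F]] relnatD[OF h] relfun_ob[OF F]
            relfun_ob[OF G] c stage_simps)
    qed (use h c in simp_all)
  qed (auto simp: is_relfun_rprod is_relfun_rexp is_relnat_rfst is_relnat_rsnd is_relnat_rpair
      is_relnat_reval
      is_relnat_rcurry)
qed

section \<open>Substitution\<close>

abbreviation ids :: "nat \<Rightarrow> ('o, 'a) relfun list" where
  "ids n \<equiv> map (rproj R n) [0..<n]"

lemma ssp: "split_simple_products (IntCat R) (Ctx R) forget (int_lift R) (ctx_products R)
    (all_fun R) (all_unit R) (all_counit R)"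
  using model by (simp add: parametric_model_def)

text \<open>A split fibration is in particular a functor between categories, so the hypothesis on
  \<open>forget\<close> includes the category axioms for \<open>IntCat R\<close> and
  \<open>Ctx R\<close>.\<close>

lemma category_IntCat: "category (IntCat R)" and category_Ctx: "category (Ctx R)"
  and sfib: "split_fibration (IntCat R) (Ctx R) forget (int_lift R)"
  using ssp by (simp_all add: split_simple_products_def split_fibration_def)

sublocale Ctx: category "Ctx R" by (rule category_Ctx)
sublocale IntCat: category "IntCat R" by (rule category_IntCat)

definition relfuns :: "nat \<Rightarrow> nat \<Rightarrow> ('o, 'a) relfun list \<Rightarrow> bool" where
  "relfuns n m Fs \<longleftrightarrow> length Fs = m \<and> (\<forall>F \<in> set Fs. is_relfun R n F)"

lemma relfuns_hom: "(n, Fs) \<in> hom (Ctx R) n m \<longleftrightarrow> relfuns n m Fs"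
  by (auto simp: relfuns_def hom_def Ctx_def)

lemma relfunsD: "relfuns n m Fs \<Longrightarrow> length Fs = m" "\<lbrakk>relfuns n m Fs; i < m\<rbrakk> \<Longrightarrow> is_relfun R n (Fs ! i)"
  by (auto simp: relfuns_def)

lemma relfuns_ids: "relfuns n n (ids n)"
  using Ctx.Ide_hom[of n] by (simp add: Ctx_def flip: relfuns_hom)

lemma is_relfun_rproj: "i < n \<Longrightarrow> is_relfun R n (rproj R n i)"
  using relfunsD(2)[OF relfuns_ids, of i n] by simp

text \<open>\<open>G\<close> is regarded as an arrow from \<open>m\<close> to 1 in
  \<open>Ctx R\<close>, and the claim is closure under composition. In the same way the unit and
  associativity laws of \<open>Ctx R\<close> give the laws of substitution
  \<open>rsubst_ids\<close>, \<open>rsubst_rproj\<close> and \<open>rsubst_rsubst\<close>.\<close>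

lemma is_relfun_rsubst:
  assumes "is_relfun R m G" "relfuns n m Fs"
  shows "is_relfun R n (rsubst R n G Fs)"
  using Ctx.Comp_hom[of "(n, Fs)" n m "(m, [G])" 1] assms
  by (simp add: relfuns_hom) (simp add: relfuns_def hom_def Ctx_def)

lemma relfuns_rsubst:
  assumes "relfuns m k Gs" "relfuns n m Fs"
  shows "relfuns n k (map (\<lambda>G. rsubst R n G Fs) Gs)"
  using assms is_relfun_rsubst[OF _ assms(2)] by (auto simp: relfuns_def)

lemma rsubst_ids:
  assumes "is_relfun R n F"
  shows "rsubst R n F (ids n) = F"
  using Ctx.Comp_Ide_right[of "(n, [F])" n 1] assms
  by (simp add: relfuns_hom) (simp add: relfuns_def Ctx_def)

lemma rsubst_rproj:
  assumes "relfuns n m Fs" "i < m"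
  shows "rsubst R n (rproj R m i) Fs = Fs ! i"
proof -
  have "map (\<lambda>G. rsubst R n G Fs) (ids m) = Fs"
    using Ctx.Comp_Ide_left[of "(n, Fs)" n m] assms(1)
    by (simp add: relfuns_hom) (simp add: relfuns_def Ctx_def)
  then have "map (\<lambda>G. rsubst R n G Fs) (ids m) ! i = Fs ! i" by simp
  then show ?thesis using assms(2) by simp
qed

lemma rsubst_rsubst:
  assumes "is_relfun R k G" "relfuns m k Fs" "relfuns n m Es"
  shows "rsubst R n (rsubst R m G Fs) Es = rsubst R n G (map (\<lambda>F. rsubst R n F Es) Fs)"
  using Ctx.Comp_assoc[of "(n, Es)" n m "(m, Fs)" k "(k, [G])" 1] assms
  by (simp add: relfuns_hom) (simp add: relfuns_def Ctx_def)

definition ups_tuple :: "('o, 'a) relfun list \<Rightarrow> nat \<Rightarrow> 'a \<Rightarrow> 'a" where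
  "ups_tuple Fs l f = tup (Amb R) (\<D> f) (R1 R l) (length Fs) (\<lambda>i. rups (Fs ! i) l f)"

text \<open>The argument that \<open>rsubst\<close> hands to \<open>rups\<close>: the witnesses of
  the \<open>Fs\<close>, moved to the stage \<open>pw n (Suc l)\<close> along a face.\<close>

definition eps_tuple_face :: "nat \<Rightarrow> ('o, 'a) relfun list \<Rightarrow> nat \<Rightarrow> nat \<Rightarrow> 'a" where
  "eps_tuple_face n Fs l k = acomp R (eps_tuple R n Fs l k) (fpow n Top l k)"

lemma rsubst_sel:
  "enat l \<le> dimn R \<Longrightarrow> ob (rsubst R n G Fs) l = acomp R (ob G l) (objtup R n Fs l)"
  "\<lbrakk>enat l < dimn R; k \<le> l\<rbrakk> \<Longrightarrow> reps (rsubst R n G Fs) l k = lcomp R (Suc l)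
     (acomp R (rups G (Suc l) (eps_tuple_face n Fs l k)) (dpow n l k)) (acomp R (reps G l k)
         (objtup R n Fs l))"
  "\<lbrakk>enat l \<le> dimn R; f \<in> good_tuples R n l\<rbrakk> \<Longrightarrow> rups (rsubst R n G Fs) l f = rups G l (ups_tuple Fs l
      f)"
  by (simp_all add: rsubst_def ups_tuple_def eps_tuple_face_def)

section \<open>Substitution into the terminal functor, products and exponentials\<close>

context
  fixes n m Fs
  assumes Fs: "relfuns n m Fs"
begin

private lemmas len = relfunsD(1)[OF Fs] and Fi = relfunsD(2)[OF Fs]

lemma objtup_in [simp]:
  assumes "enat l \<le> dimn R"
  shows "objtup R n Fs l \<in> \<A>" "\<D> (objtup R n Fs l) = pw n l"
    "\<C> (objtup R n Fs l) = pw m l"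
    "i < m \<Longrightarrow> acomp R (proj (Amb R) (R0 R l) m i) (objtup R n Fs l) = ob (Fs ! i) l"
  unfolding objtup_def len using assms relfun_ob[OF Fi] by simp_all

lemma ups_tuple_good:
  assumes l: "enat l \<le> dimn R" and f: "f \<in> good_tuples R n l"
  shows "ups_tuple Fs l f \<in> good_tuples R m l" "\<D> (ups_tuple Fs l f) = \<D> f"
proof -
  note fD = good_tuplesD[OF f l]
  have r: "rups (Fs ! i) l f \<in> \<A>" "\<D> (rups (Fs ! i) l f) = \<D> f"
    "\<C> (rups (Fs ! i) l f) = R1 R l" "rups (Fs ! i) l f \<in> Good R l" if "i < m" for i
    using relfun_ups[OF Fi[OF that] l f] by simp_all
  show "ups_tuple Fs l f \<in> good_tuples R m l" "\<D> (ups_tuple Fs l f) = \<D> f"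
    using l fD(1-3) r by (auto simp: good_tuples_iff ups_tuple_def hom_def len)
qed

context
  fixes l k
  assumes lk: "enat l < dimn R" "k \<le> l"
begin

private lemma eps_tuple_in:
  "eps_tuple R n Fs l k \<in> \<A>" "\<D> (eps_tuple R n Fs l k) = pw n l"
  "\<C> (eps_tuple R n Fs l k) = pow (Amb R) (R1 R (Suc l)) m"
  "i < m \<Longrightarrow> acomp R (proj (Amb R) (R1 R (Suc l)) m i) (eps_tuple R n Fs l k) = reps (Fs ! i) l k"
  "\<lbrakk>i < m; u \<in> \<A>; \<C> u = pw n l\<rbrakk> \<Longrightarrow>
    acomp R (proj (Amb R) (R1 R (Suc l)) m i) (acomp R (eps_tuple R n Fs l k) u) = acomp R (reps
        (Fs ! i) l k) u"
proof -
  have l: "enat l \<le> dimn R" "enat (Suc l) \<le> dimn R" using lk by simp_all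
  note r = relfun_eps(2,5,6)[OF Fi lk]
  show "eps_tuple R n Fs l k \<in> \<A>" "\<D> (eps_tuple R n Fs l k) = pw n l"
    "\<C> (eps_tuple R n Fs l k) = pow (Amb R) (R1 R (Suc l)) m"
    "i < m \<Longrightarrow> acomp R (proj (Amb R) (R1 R (Suc l)) m i) (eps_tuple R n Fs l k) = reps (Fs ! i) l k"
    "\<lbrakk>i < m; u \<in> \<A>; \<C> u = pw n l\<rbrakk> \<Longrightarrow>
      acomp R (proj (Amb R) (R1 R (Suc l)) m i) (acomp R (eps_tuple R n Fs l k) u) = acomp R (reps
          (Fs ! i) l k) u"
    unfolding eps_tuple_def len Suc_eq_plus1[symmetric] using l r by simp_all
qed

lemma eps_tuple_face_good:
  "eps_tuple_face n Fs l k \<in> good_tuples R m (Suc l)" "\<D> (eps_tuple_face n Fs l k) = pw n (Suc l)"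
  unfolding eps_tuple_face_def using lk eps_tuple_in relfun_eps(1,2)[OF Fi lk]
  by (auto simp: good_tuples_iff hom_def)

text \<open>The degeneracy is a section of the face map, so reindexing along both has no effect.\<close>

lemma eps_tuple_face_src:
  "acomp R (spow m (Suc l)) (acomp R (eps_tuple_face n Fs l k) (dpow n l k)) = acomp R (dpow m l k)
      (objtup R n Fs l)"
proof -
  have l: "enat l \<le> dimn R" "enat (Suc l) \<le> dimn R" using lk by simp_all
  have "acomp R (fpow n Top l k) (dpow n l k) = pow_map (Amb R) n (acomp R (act0 R (face Top l k))
      (act0 R (degen l k)))"
    using lk l by (subst pow_map_comp) auto
  also have "\<dots> = Ide (Amb R) (pw n l)" using lk l by (simp add: face_degen_act0)
  finally have "acomp R (eps_tuple_face n Fs l k) (dpow n l k) = eps_tuple R n Fs l k"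
    unfolding eps_tuple_face_def using lk l eps_tuple_in(1-3) by simp
  moreover have "acomp R (spow m (Suc l)) (eps_tuple R n Fs l k) = acomp R (dpow m l k) (objtup R n
      Fs l)"
    by (rule pow_eqI[of "R0 R (Suc l)" _ _ m])
      (use lk l eps_tuple_in relfun_eps(3)[OF Fi lk] in simp_all)
  ultimately show ?thesis by simp
qed

text \<open>The witness of a substituted functor is a composite of two arrows; the last two
  equations show that these are composable, since both meet at \<open>ob G\<close> applied to the
  degenerate tuple.\<close>

lemma eps_tuple_face_ups:
  assumes G: "is_relfun R m G"
  shows "rups G (Suc l) (eps_tuple_face n Fs l k) \<in> Good R (Suc l)"
    "rups G (Suc l) (eps_tuple_face n Fs l k) \<in> \<A>"
    "\<D> (rups G (Suc l) (eps_tuple_face n Fs l k)) = pw n (Suc l)"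
    "\<C> (rups G (Suc l) (eps_tuple_face n Fs l k)) = R1 R (Suc l)"
    "lsrc R (Suc l) (acomp R (rups G (Suc l) (eps_tuple_face n Fs l k)) (dpow n l k))
      = acomp R (ob G (Suc l)) (acomp R (dpow m l k) (objtup R n Fs l))"
    "ltgt R (Suc l) (acomp R (reps G l k) (objtup R n Fs l))
      = acomp R (ob G (Suc l)) (acomp R (dpow m l k) (objtup R n Fs l))"
proof -
  have l: "enat l \<le> dimn R" "enat (Suc l) \<le> dimn R" using lk by simp_all
  note e = eps_tuple_face_good and u = relfun_ups[OF G l(2) eps_tuple_face_good(1)]
  note eD = good_tuplesD[OF e(1) l(2)]
  show uu: "rups G (Suc l) (eps_tuple_face n Fs l k) \<in> Good R (Suc l)"
    "rups G (Suc l) (eps_tuple_face n Fs l k) \<in> \<A>"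
    "\<D> (rups G (Suc l) (eps_tuple_face n Fs l k)) = pw n (Suc l)"
    "\<C> (rups G (Suc l) (eps_tuple_face n Fs l k)) = R1 R (Suc l)"
    using u e by simp_all
  have "lsrc R (Suc l) (acomp R (rups G (Suc l) (eps_tuple_face n Fs l k)) (dpow n l k))
      = acomp R (acomp R (ob G (Suc l)) (acomp R (spow m (Suc l)) (eps_tuple_face n Fs l k))) (dpow
          n l k)"
    by (rule lsrc_comp[OF l(2)]) (use u uu lk l in simp_all)
  also have "\<dots> = acomp R (ob G (Suc l)) (acomp R (spow m (Suc l)) (acomp R (eps_tuple_face n Fs l
      k) (dpow n l k)))"
    using lk l eD(1,2) e(2) relfun_ob[OF G l(2)] by simp
  finally show "lsrc R (Suc l) (acomp R (rups G (Suc l) (eps_tuple_face n Fs l k)) (dpow n l k))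
      = acomp R (ob G (Suc l)) (acomp R (dpow m l k) (objtup R n Fs l))"
    unfolding eps_tuple_face_src .
  have "ltgt R (Suc l) (acomp R (reps G l k) (objtup R n Fs l))
      = acomp R (acomp R (ob G (Suc l)) (dpow m l k)) (objtup R n Fs l)"
    by (rule ltgt_comp[OF l(2)]) (use lk l relfun_eps[OF G lk] in simp_all)
  then show "ltgt R (Suc l) (acomp R (reps G l k) (objtup R n Fs l))
      = acomp R (ob G (Suc l)) (acomp R (dpow m l k) (objtup R n Fs l))"
    using lk l relfun_ob[OF G l(2)] by simp
qed

end

text \<open>On the constant functor \<open>one\<close> the action on good isomorphisms is an
  identity, so of the two factors of the composite witness only \<open>one_eps\<close>
  survives.\<close>

lemma rsubst_rone: "rsubst R n (rone R m) Fs = rone R n"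
proof (rule relfun_eqI)
  fix l k assume lk: "enat l < dimn R" "k \<le> l"
  then have l: "enat l \<le> dimn R" "enat (Suc l) \<le> dimn R" by simp_all
  have "ltgt R (Suc l) (acomp R (one_eps R l k) (bang (Amb R) (pw n l))) = acomp R (one R (Suc l))
      (bang (Amb R) (pw n l))"
    by (rule ltgt_comp) (use lk l in simp_all)
  then show "reps (rsubst R n (rone R m) Fs) l k = reps (rone R n) l k"
    using lk l eps_tuple_face_good[OF lk] by (simp add: rsubst_sel)
next
  fix l f assume "enat l \<le> dimn R" "f \<in> good_tuples R n l"
  then show "rups (rsubst R n (rone R m) Fs) l f = rups (rone R n) l f"
    using ups_tuple_good[of l f] by (simp add: rsubst_sel)
qed (simp_all add: is_relfun_rsubst[OF is_relfun_rone Fs] is_relfun_rone rsubst_sel)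

context
  fixes F G
  assumes F: "is_relfun R m F" and G: "is_relfun R m G"
begin

private lemmas sub_simps = relfun_ob[OF F] relfun_ob[OF G] relfun_eps[OF F] relfun_eps[OF G]

text \<open>The composite witness is a product of actions, after a product of witnesses, after
  \<open>times_eps\<close>; bifunctoriality of \<open>iprodmap\<close> merges the two
  products.\<close>

lemma rsubst_rprod: "rsubst R n (rprod R m F G) Fs = rprod R n (rsubst R n F Fs) (rsubst R n G Fs)"
proof (rule relfun_eqI)
  fix l k assume lk: "enat l < dimn R" "k \<le> l"
  then have l: "enat l \<le> dimn R" "enat (Suc l) \<le> dimn R" by simp_all
  note uF = eps_tuple_face_ups[OF lk F] and uG = eps_tuple_face_ups[OF lk G]
  let ?E = "eps_tuple_face n Fs l k" and ?o = "objtup R n Fs l"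
  let ?uF = "acomp R (rups F (Suc l) ?E) (dpow n l k)" and ?uG = "acomp R (rups G (Suc l) ?E) (dpow
      n l k)"
    and ?t = "acomp R (times_eps R l k) (pr2 R (acomp R (ob F l) ?o) (acomp R (ob G l) ?o))"
  have sF: "lsrc R (Suc l) (acomp R (reps F l k) ?o) = acomp R (act0 R (degen l k)) (acomp R (ob F
      l) ?o)"
    by (subst lsrc_comp[OF l(2) relfun_eps(3)[OF F lk]]) (use lk l in \<open>simp_all add: sub_simps\<close>)
  have sG: "lsrc R (Suc l) (acomp R (reps G l k) ?o) = acomp R (act0 R (degen l k)) (acomp R (ob G
      l) ?o)"
    by (subst lsrc_comp[OF l(2) relfun_eps(3)[OF G lk]]) (use lk l in \<open>simp_all add: sub_simps\<close>)
  have "reps (rsubst R n (rprod R m F G) Fs) l k = lcomp R (Suc l) (iprodmap R (Suc l) ?uF ?uG)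
      (lcomp R (Suc l) (iprodmap R (Suc l) (acomp R (reps F l k) ?o) (acomp R (reps G l k) ?o)) ?t)"
    using lk l eps_tuple_face_good[OF lk] uF(1-4) uG(1-4) by (simp add: rsubst_sel sub_simps)
  also have "\<dots> = lcomp R (Suc l) (lcomp R (Suc l) (iprodmap R (Suc l) ?uF ?uG)
      (iprodmap R (Suc l) (acomp R (reps F l k) ?o) (acomp R (reps G l k) ?o))) ?t"
    using lk l uF uG sF sG by (simp add: sub_simps)
  also have "lcomp R (Suc l) (iprodmap R (Suc l) ?uF ?uG)
      (iprodmap R (Suc l) (acomp R (reps F l k) ?o) (acomp R (reps G l k) ?o))
      = iprodmap R (Suc l) (lcomp R (Suc l) ?uF (acomp R (reps F l k) ?o)) (lcomp R (Suc l) ?uG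
          (acomp R (reps G l k) ?o))"
    by (rule iprodmap_lcomp[symmetric, OF l(2)]) (use lk l uF uG in \<open>simp_all add: sub_simps\<close>)
  finally show "reps (rsubst R n (rprod R m F G) Fs) l k = reps (rprod R n (rsubst R n F Fs)
      (rsubst R n G Fs)) l k"
    using lk l by (simp add: rsubst_sel)
next
  fix l f assume "enat l \<le> dimn R" "f \<in> good_tuples R n l"
  then show "rups (rsubst R n (rprod R m F G) Fs) l f = rups (rprod R n (rsubst R n F Fs) (rsubst R
      n G Fs)) l f"
    using ups_tuple_good[of l f] by (simp add: rsubst_sel)
qed (simp_all add: is_relfun_rsubst[OF _ Fs] is_relfun_rprod F G rsubst_sel sub_simps)

text \<open>As for products, with \<open>iexpmap\<close> in place of \<open>iprodmap\<close>.
  Because of contravariance, merging composes the inverses in the opposite order, and this is the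
  inverse of the composite.\<close>

lemma rsubst_rexp: "rsubst R n (rexp R m F G) Fs = rexp R n (rsubst R n F Fs) (rsubst R n G Fs)"
proof (rule relfun_eqI)
  fix l k assume lk: "enat l < dimn R" "k \<le> l"
  then have l: "enat l \<le> dimn R" "enat (Suc l) \<le> dimn R" by simp_all
  note uF = eps_tuple_face_ups[OF lk F] and uG = eps_tuple_face_ups[OF lk G]
  let ?E = "eps_tuple_face n Fs l k" and ?o = "objtup R n Fs l"
  let ?uF = "acomp R (rups F (Suc l) ?E) (dpow n l k)" and ?uG = "acomp R (rups G (Suc l) ?E) (dpow
      n l k)"
    and ?v = "acomp R (expo_ups R l k) (pr2 R (acomp R (ob F l) ?o) (acomp R (ob G l) ?o))"
    and ?eF = "acomp R (reps F l k) ?o" and ?eG = "acomp R (reps G l k) ?o"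
  have sF: "lsrc R (Suc l) ?eF = acomp R (act0 R (degen l k)) (acomp R (ob F l) ?o)"
    by (subst lsrc_comp[OF l(2) relfun_eps(3)[OF F lk]]) (use lk l in \<open>simp_all add: sub_simps\<close>)
  have sG: "lsrc R (Suc l) ?eG = acomp R (act0 R (degen l k)) (acomp R (ob G l) ?o)"
    by (subst lsrc_comp[OF l(2) relfun_eps(3)[OF G lk]]) (use lk l in \<open>simp_all add: sub_simps\<close>)
  have ii: "iiso (Amb R) (Lv R (Suc l)) ?uF" "iiso (Amb R) (Lv R (Suc l)) ?eF"
    using lk l uF by (auto intro!: good_iiso simp: sub_simps)
  note iv = level_iinv_in[OF l(2) ii(1)] level_iinv_in[OF l(2) ii(2)]
  have inv: "acomp R (linv R (Suc l) (rups F (Suc l) ?E)) (dpow n l k) = linv R (Suc l) ?uF"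
    "acomp R (linv R (Suc l) (reps F l k)) ?o = linv R (Suc l) ?eF"
    using lk l uF by (simp_all add: level_iinv_comp sub_simps)
  have "reps (rsubst R n (rexp R m F G) Fs) l k = lcomp R (Suc l) (iexpmap R (Suc l) (linv R (Suc
      l) ?uF) ?uG)
      (lcomp R (Suc l) (iexpmap R (Suc l) (linv R (Suc l) ?eF) ?eG) ?v)"
    unfolding inv[symmetric]
    using lk l eps_tuple_face_good[OF lk] uF(1-4) uG(1-4) by (simp add: rsubst_sel sub_simps)
  also have "\<dots> = lcomp R (Suc l) (lcomp R (Suc l) (iexpmap R (Suc l) (linv R (Suc l) ?uF) ?uG)
      (iexpmap R (Suc l) (linv R (Suc l) ?eF) ?eG)) ?v"
    using lk l uF uG sF sG iv(1-5) iv(8-12) by (simp add: sub_simps)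
  also have "lcomp R (Suc l) (iexpmap R (Suc l) (linv R (Suc l) ?uF) ?uG)
      (iexpmap R (Suc l) (linv R (Suc l) ?eF) ?eG)
      = iexpmap R (Suc l) (lcomp R (Suc l) (linv R (Suc l) ?eF) (linv R (Suc l) ?uF)) (lcomp R (Suc
          l) ?uG ?eG)"
    by (rule iexpmap_lcomp[symmetric, OF l(2)])
      (use lk l uF uG iv(1-5) iv(8-12) in \<open>simp_all add: sub_simps\<close>)
  also have "lcomp R (Suc l) (linv R (Suc l) ?eF) (linv R (Suc l) ?uF) = linv R (Suc l) (lcomp R
      (Suc l) ?uF ?eF)"
    by (rule level_iinv_icomp[symmetric, OF l(2) ii(2,1)]) (use lk l uF in \<open>simp_all add:
        sub_simps\<close>)
  finally show "reps (rsubst R n (rexp R m F G) Fs) l k = reps (rexp R n (rsubst R n F Fs) (rsubst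
      R n G Fs)) l k"
    using lk l by (simp add: rsubst_sel)
next
  fix l f assume "enat l \<le> dimn R" "f \<in> good_tuples R n l"
  then show "rups (rsubst R n (rexp R m F G) Fs) l f = rups (rexp R n (rsubst R n F Fs) (rsubst R n
      G Fs)) l f"
    using ups_tuple_good[of l f] by (simp add: rsubst_sel)
qed (simp_all add: is_relfun_rsubst[OF _ Fs] is_relfun_rexp F G rsubst_sel sub_simps)

end

end

section \<open>Whiskering natural transformations along context maps\<close>

lemma relnat_rcomp_rid:
  assumes "is_relnat R n \<eta>"
  shows "rdom \<eta> = F \<Longrightarrow> rcomp R \<eta> (rid R F) = \<eta>" "rcod \<eta> = F \<Longrightarrow> rcomp R (rid R F) \<eta> = \<eta>"
  using assms cat.Comp_Ide_right[OF cat_fcc, of \<eta> n F] cat.Comp_Ide_left[OF cat_fcc, of \<eta> n F]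
  by (simp_all add: fcc_sel)

lemma relnat_rcomp_assoc:
  assumes "is_relnat R n f" "is_relnat R n g" "is_relnat R n h" "rdom g = rcod f" "rdom h = rcod g"
  shows "rcomp R (rcomp R h g) f = rcomp R h (rcomp R g f)"
  using assms cat.Comp_assoc[OF cat_fcc, of f n g h] by (simp add: fcc_sel)

lemma hom_FunCat: "\<eta> \<in> hom (FunCat R n) F G \<longleftrightarrow> is_relnat R n \<eta> \<and> rdom \<eta> = F \<and> rcod \<eta> = G"
  by (auto simp: hom_def FunCat_def)

lemma Ctx_Ide: "Ide (Ctx R) n = (n, ids n)"
  by (simp add: Ctx_def)

lemma rwhisker_sel [simp]: "rdom (rwhisker R n \<theta> Fs) = rsubst R n (rdom \<theta>) Fs"
  "rcod (rwhisker R n \<theta> Fs) = rsubst R n (rcod \<theta>) Fs"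
  "enat l \<le> dimn R \<Longrightarrow> rnat (rwhisker R n \<theta> Fs) l = acomp R (rnat \<theta> l) (objtup R n Fs l)"
  by (simp_all add: rwhisker_def)

lemma vert_sel [simp]: "int_dom (vert R n \<eta>) = (n, rdom \<eta>)" "int_cod (vert R n \<eta>) = (n, rcod \<eta>)"
  "int_base (vert R n \<eta>) = (n, ids n)" "int_nat (vert R n \<eta>) = \<eta>"
  by (simp_all add: vert_def Ctx_Ide)

lemma vert_in_IntCat:
  assumes "is_relnat R n \<eta>"
  shows "vert R n \<eta> \<in> Arr (IntCat R)"
  using relnatD(1,2)[OF assms] assms relfuns_ids[of n]
  by (simp add: IntCat_def hom_FunCat rsubst_ids relfuns_hom)

lemma lift_in_IntCat:
  assumes "is_relfun R m F" "relfuns n m Fs"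
  shows "int_lift R (n, Fs) (m, F) \<in> Arr (IntCat R)"
  using assms by (simp add: IntCat_def int_lift_def Let_def hom_FunCat relfuns_hom is_relfun_rsubst
      is_relnat_rid)

text \<open>The degeneracy square cannot be computed: the witness of a substituted functor involves
  \<open>rups\<close>, with which a natural transformation need not commute. It is read off from the
  composite of \<open>vert R m \<theta>\<close> with the cartesian lift of \<open>Fs\<close>, an
  arrow of \<open>IntCat R\<close> whose natural transformation is the whiskering.\<close>

lemma is_relnat_rwhisker:
  assumes \<theta>: "is_relnat R m \<theta>" and Fs: "relfuns n m Fs"
  shows "is_relnat R n (rwhisker R n \<theta> Fs)"
proof -
  note \<theta>D = relnatD[OF \<theta>]
  let ?\<phi> = "int_lift R (n, Fs) (m, rdom \<theta>)" and ?F = "rsubst R n (rdom \<theta>) Fs"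
  have "?\<phi> \<in> hom (IntCat R) (n, ?F) (m, rdom \<theta>)" "vert R m \<theta> \<in> hom (IntCat R) (m, rdom \<theta>) (m, rcod
      \<theta>)"
    using lift_in_IntCat[OF \<theta>D(1) Fs] vert_in_IntCat[OF \<theta>]
    by (simp_all add: hom_def) (simp_all add: IntCat_def int_lift_def Let_def)
  then have "vert R m \<theta> \<cdot>\<^bsub>IntCat R\<^esub> ?\<phi> \<in> Arr (IntCat R)"
    using IntCat.Comp_hom by (auto simp: hom_def)
  then have "is_relnat R n (rcomp R (rwhisker R n \<theta> Fs) (rid R ?F))"
    by (simp add: IntCat_def hom_FunCat int_lift_def Let_def)
  \<comment> \<open>The lift contributes an identity, which disappears levelwise.\<close>
  moreover have "rcomp R (rwhisker R n \<theta> Fs) (rid R ?F)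
      = mk_relnat R ?F (rsubst R n (rcod \<theta>) Fs) (\<lambda>l. acomp R (rnat \<theta> l) (objtup R n Fs l))"
    unfolding rcomp_def rop_sel rwhisker_sel
    by (rule mk_relnat_cong) (simp add: rsubst_sel objtup_in[OF Fs] \<theta>D(3-7) relnat_comp[OF \<theta>])
  ultimately show ?thesis by (simp add: rwhisker_def)
qed

lemma rwhisker_ids:
  assumes \<theta>: "is_relnat R n \<theta>"
  shows "rwhisker R n \<theta> (ids n) = \<theta>"
proof (rule relnat_eqI[OF is_relnat_rwhisker[OF \<theta> relfuns_ids] \<theta>])
  fix l assume l: "enat l \<le> dimn R"
  have "objtup R n (ids n) l = Ide (Amb R) (pw n l)"
    by (rule pow_eqI[of "R0 R l" _ _ n])
      (use l objtup_in[OF relfuns_ids l] in \<open>simp_all add: rproj_def\<close>)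
  then show "rnat (rwhisker R n \<theta> (ids n)) l = rnat \<theta> l"
    using l by (simp add: relnatD[OF \<theta>])
qed (simp_all add: rsubst_ids relnatD[OF \<theta>])

text \<open>Whiskering is precomposition with \<open>objtup\<close>, so it suffices that object
  tuples compose.\<close>

lemma rwhisker_rwhisker:
  assumes \<theta>: "is_relnat R k \<theta>" and Fs: "relfuns m k Fs" and Es: "relfuns n m Es"
  shows "rwhisker R n (rwhisker R m \<theta> Fs) Es = rwhisker R n \<theta> (map (\<lambda>F. rsubst R n F Es) Fs)"
proof (rule relnat_eqI)
  have FEs: "relfuns n k (map (\<lambda>F. rsubst R n F Es) Fs)" by (rule relfuns_rsubst[OF Fs Es])
  show "is_relnat R n (rwhisker R n (rwhisker R m \<theta> Fs) Es)"
    "is_relnat R n (rwhisker R n \<theta> (map (\<lambda>F. rsubst R n F Es) Fs))"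
    by (intro is_relnat_rwhisker[OF _ Es] is_relnat_rwhisker[OF \<theta>] Fs FEs)+
  fix l assume l: "enat l \<le> dimn R"
  have "acomp R (objtup R m Fs l) (objtup R n Es l) = objtup R n (map (\<lambda>F. rsubst R n F Es) Fs) l"
    by (rule pow_eqI[of "R0 R l" _ _ k])
      (use l objtup_in[OF Fs l] objtup_in[OF Es l] objtup_in[OF FEs l] relfunsD(1)[OF Fs]
        relfun_ob[OF relfunsD(2)[OF Fs]] in \<open>simp_all add: rsubst_sel flip: Comp_assoc\<close>)
  then show "rnat (rwhisker R n (rwhisker R m \<theta> Fs) Es) l = rnat (rwhisker R n \<theta> (map (\<lambda>F. rsubst R
      n F Es) Fs)) l"
    using l objtup_in(1-3)[OF Fs l] objtup_in(1-3)[OF Es l] by (simp add: relnatD[OF \<theta>])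
qed (simp_all add: rsubst_rsubst[OF _ Fs Es] relnatD[OF \<theta>])

text \<open>On objects this is the strict commutation of \<open>rsubst\<close> with products and
  exponentials. On arrows both sides agree levelwise, since whiskering reindexes along
  \<open>objtup\<close> and the structure of each level is stable under reindexing.\<close>

lemma ccc_functor_rwhisker:
  assumes Fs: "relfuns n m Fs"
  shows "ccc_functor (fcc m) (fcc n) (\<lambda>F. rsubst R n F Fs) (\<lambda>\<theta>. rwhisker R n \<theta> Fs)"
proof -
  interpret A: ccc "fcc m" by (rule ccc_fcc)
  interpret B: ccc "fcc n" by (rule ccc_fcc)
  note wh = is_relnat_rwhisker[OF _ Fs] and o = objtup_in[OF Fs]
  show ?thesis
  proof (unfold_locales, unfold fcc_sel mem_Collect_eq)
    fix F G assume F: "is_relfun R m F" and G: "is_relfun R m G"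
    note s = is_relfun_rsubst[OF F Fs] is_relfun_rsubst[OF G Fs]
    show "rwhisker R n (rid R F) Fs = rid R (rsubst R n F Fs)"
      by (rule relnat_eqI[OF wh[OF is_relnat_rid[OF F]] is_relnat_rid[OF s(1)]])
        (simp_all add: relfun_ob[OF F] o rsubst_sel)
    show "rwhisker R n (rfst R m F G) Fs = rfst R n (rsubst R n F Fs) (rsubst R n G Fs)"
      by (rule relnat_eqI[OF wh[OF is_relnat_rfst[OF F G]] is_relnat_rfst[OF s]])
        (simp_all add: relfun_ob[OF F] relfun_ob[OF G] o rsubst_sel rsubst_rprod[OF Fs F G])
    show "rwhisker R n (rsnd R m F G) Fs = rsnd R n (rsubst R n F Fs) (rsubst R n G Fs)"
      by (rule relnat_eqI[OF wh[OF is_relnat_rsnd[OF F G]] is_relnat_rsnd[OF s]])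
        (simp_all add: relfun_ob[OF F] relfun_ob[OF G] o rsubst_sel rsubst_rprod[OF Fs F G])
    show "rwhisker R n (reval R m F G) Fs = reval R n (rsubst R n F Fs) (rsubst R n G Fs)"
      by (rule relnat_eqI[OF wh[OF is_relnat_reval[OF F G]] is_relnat_reval[OF s]])
        (simp_all add: relfun_ob[OF F] relfun_ob[OF G] o rsubst_sel rsubst_rprod[OF Fs _ F]
          rsubst_rexp[OF Fs F G] is_relfun_rexp[OF F G])
  next
    fix f g assume f: "is_relnat R m f" and g: "is_relnat R m g" and fg: "rdom g = rcod f"
    show "rwhisker R n (rcomp R g f) Fs = rcomp R (rwhisker R n g Fs) (rwhisker R n f Fs)"
      by (rule relnat_eqI[OF wh[OF is_relnat_rcomp[OF f g fg]] is_relnat_rcomp[OF wh[OF f] wh[OF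
          g]]])
        (simp_all add: fg o relnatD[OF f] relnatD[OF g])
  qed (simp_all add: wh is_relfun_rsubst[OF _ Fs] rsubst_rprod[OF Fs] rsubst_rexp[OF Fs])
qed

lemmas rwhisker_rcomp = ccc_functor_rwhisker[THEN ccc_functor.axioms(3), THEN cat_functor.F1_Comp,
    unfolded fcc_sel mem_Collect_eq]
lemmas rwhisker_rpair = ccc_functor_rwhisker[THEN ccc_functor.F1_ppair, unfolded fcc_sel
    mem_Collect_eq]
  and rwhisker_rfst = ccc_functor_rwhisker[THEN ccc_functor.F1_pfst, unfolded fcc_sel
      mem_Collect_eq]
  and rwhisker_rsnd = ccc_functor_rwhisker[THEN ccc_functor.F1_psnd, unfolded fcc_sel
      mem_Collect_eq]
  and rwhisker_reval = ccc_functor_rwhisker[THEN ccc_functor.F1_evl, unfolded fcc_sel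
      mem_Collect_eq]
  and rwhisker_rcurry = ccc_functor_rwhisker[THEN ccc_functor.F1_cur, unfolded fcc_sel
      mem_Collect_eq]

section \<open>The adjunction between weakening and universal quantification\<close>

abbreviation fib :: "nat \<Rightarrow> (nat \<times> ('o, 'a) relfun, ('o, 'a) intmap) category" where
  "fib n \<equiv> fibre (IntCat R) (Ctx R) forget n"

abbreviation rdx :: "nat \<Rightarrow> ('o, 'a) relfun list \<Rightarrow> (nat \<times> ('o, 'a) relfun, ('o, 'a) intmap,
    nat \<times> ('o, 'a) relfun, ('o, 'a) intmap) functr" where
  "rdx n Fs \<equiv> reindex (IntCat R) (Ctx R) forget (int_lift R) (n, Fs)"

lemma Obj_fib: "X \<in> Obj (fib n) \<longleftrightarrow> (\<exists>F. X = (n, F) \<and> is_relfun R n F)"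
  by (cases X) (auto simp: fibre_def IntCat_def forget_def)

text \<open>Substitution along the identity context map is trivial by \<open>rsubst_ids\<close>, so
  the fibre over \<open>n\<close> is \<open>FunCat R n\<close> in disguise: a vertical arrow carries
  no more than its natural transformation.\<close>

lemma Arr_fib: "\<chi> \<in> Arr (fib n) \<longleftrightarrow> \<chi> = vert R n (int_nat \<chi>) \<and> is_relnat R n (int_nat \<chi>)"
proof
  assume \<chi>: "\<chi> \<in> Arr (fib n)"
  obtain F G where FG: "int_dom \<chi> = (n, F)" "int_cod \<chi> = (n, G)" "int_base \<chi> = (n, ids n)"
    using \<chi> by (cases "int_dom \<chi>"; cases "int_cod \<chi>") (auto simp: fibre_def IntCat_def forget_def
        Ctx_Ide)
  moreover have "is_relnat R n (int_nat \<chi>) \<and> rdom (int_nat \<chi>) = F \<and> rcod (int_nat \<chi>) = G"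
    using \<chi> FG by (auto simp: fibre_def IntCat_def hom_FunCat rsubst_ids)
  ultimately show "\<chi> = vert R n (int_nat \<chi>) \<and> is_relnat R n (int_nat \<chi>)"
    by (simp add: vert_def Ctx_Ide)
next
  assume \<chi>: "\<chi> = vert R n (int_nat \<chi>) \<and> is_relnat R n (int_nat \<chi>)"
  then have "vert R n (int_nat \<chi>) \<in> Arr (IntCat R)" by (metis vert_in_IntCat)
  then have "vert R n (int_nat \<chi>) \<in> Arr (fib n)"
    by (simp add: fibre_def forget_def Ctx_Ide) (simp add: IntCat_def)
  then show "\<chi> \<in> Arr (fib n)" using \<chi> by metis
qed

lemma vert_in_fib [simp]: "vert R n \<eta> \<in> Arr (fib n) \<longleftrightarrow> is_relnat R n \<eta>"
  by (simp add: Arr_fib)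

lemma fib_sel [simp]: "Dom (fib n) = int_dom" "Cod (fib n) = int_cod" "Comp (fib n) = Comp (IntCat
    R)"
  "Ide (fib n) = Ide (IntCat R)"
  by (simp_all add: fibre_def IntCat_def)

lemma hom_fib: "\<chi> \<in> hom (fib n) (n, F) (n, G) \<longleftrightarrow>
  \<chi> = vert R n (int_nat \<chi>) \<and> int_nat \<chi> \<in> hom (FunCat R n) F G"
  unfolding hom_FunCat by (auto simp: hom_def Arr_fib) (metis vert_sel(1,2) prod.inject)+

lemma Comp_vert:
  assumes "is_relnat R n \<theta>"
  shows "vert R n \<theta> \<cdot>\<^bsub>IntCat R\<^esub> vert R n \<eta> = vert R n (rcomp R \<theta> \<eta>)"
proof -
  have "(n, ids n) \<cdot>\<^bsub>Ctx R\<^esub> (n, ids n) = (n, ids n)"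
    using Ctx.Comp_Ide_right[of "(n, ids n)" n n] relfuns_ids by (simp add: relfuns_hom Ctx_Ide)
  then show ?thesis
    by (simp add: IntCat_def vert_def Ctx_Ide rwhisker_ids[OF assms])
qed

lemma Ide_vert: "Ide (IntCat R) (n, F) = vert R n (rid R F)"
  by (simp add: IntCat_def vert_def)

lemma vert_inject: "vert R n \<eta> = vert R n \<theta> \<longleftrightarrow> \<eta> = \<theta>"
  by (metis vert_sel(4))

lemma rdx_obj: "on_obj (rdx n Fs) (m, F) = (n, rsubst R n F Fs)"
  by (simp add: reindex_def IntCat_def int_lift_def Let_def)

text \<open>Reindexing is defined by factoring through a cartesian lift. The natural transformation
  of the lift is an identity, so the factor is forced to be the whiskering of \<eta>.\<close>

lemma rdx_arr:
  assumes \<eta>: "is_relnat R m \<eta>" and Fs: "relfuns n m Fs"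
  shows "on_arr (rdx n Fs) (vert R m \<eta>) = vert R n (rwhisker R n \<eta> Fs)"
proof -
  note \<eta>D = relnatD[OF \<eta>] and wh = is_relnat_rwhisker[OF \<eta> Fs]
  let ?F = "rsubst R n (rdom \<eta>) Fs" and ?G = "rsubst R n (rcod \<eta>) Fs"
  have c: "(n, Fs) \<cdot>\<^bsub>Ctx R\<^esub> (n, ids n) = (n, Fs)" "(m, ids m) \<cdot>\<^bsub>Ctx R\<^esub> (n, Fs) = (n, Fs)"
    using Ctx.Comp_Ide_right[of "(n, Fs)" n m] Ctx.Comp_Ide_left[of "(n, Fs)" n m] Fs
    by (simp_all add: relfuns_hom Ctx_Ide)
  have G: "is_relfun R n ?G" by (rule is_relfun_rsubst[OF \<eta>D(2) Fs])
  have l: "int_lift R (n, Fs) (m, rcod \<eta>) \<cdot>\<^bsub>IntCat R\<^esub> \<chi>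
      = \<lparr>int_dom = int_dom \<chi>, int_cod = (m, rcod \<eta>), int_base = (n, Fs), int_nat = int_nat \<chi>\<rparr>"
    if "int_base \<chi> = (n, ids n)" "is_relnat R n (int_nat \<chi>)" "fst (int_dom \<chi>) = n" "rcod (int_nat
        \<chi>) = ?G" for \<chi>
    using that c by (simp add: IntCat_def int_lift_def Let_def rwhisker_ids[OF is_relnat_rid[OF G]]
        relnat_rcomp_rid)
  have r: "vert R m \<eta> \<cdot>\<^bsub>IntCat R\<^esub> int_lift R (n, Fs) (m, rdom \<eta>)
      = \<lparr>int_dom = (n, ?F), int_cod = (m, rcod \<eta>), int_base = (n, Fs), int_nat = rwhisker R n \<eta> Fs\<rparr>"
    using c by (simp add: IntCat_def int_lift_def Let_def vert_def Ctx_Ide relnat_rcomp_rid[OF wh])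
  \<comment> \<open>An equivalence with an equation for \<chi>, from which the simplifier evaluates
    the definite description in \<open>reindex\<close>.\<close>
  have "(\<chi> \<in> hom (IntCat R) (n, ?F) (n, ?G) \<and> int_base \<chi> = (n, ids n) \<and>
      int_lift R (n, Fs) (m, rcod \<eta>) \<cdot>\<^bsub>IntCat R\<^esub> \<chi> = vert R m \<eta> \<cdot>\<^bsub>IntCat R\<^esub> int_lift R (n, Fs) (m,
          rdom \<eta>))
    \<longleftrightarrow> \<chi> = vert R n (rwhisker R n \<eta> Fs)" (is "?P \<longleftrightarrow> _") for \<chi>
  proof
    assume P: ?P
    then have "\<chi> \<in> hom (fib n) (n, ?F) (n, ?G)"
      by (auto simp: hom_def fibre_def forget_def Ctx_Ide IntCat_def)
    then have v: "\<chi> = vert R n (int_nat \<chi>)" "is_relnat R n (int_nat \<chi>)" "rcod (int_nat \<chi>) = ?G"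
      by (auto simp: hom_fib hom_FunCat)
    have "int_nat (int_lift R (n, Fs) (m, rcod \<eta>) \<cdot>\<^bsub>IntCat R\<^esub> \<chi>) = rwhisker R n \<eta> Fs"
      using P r by simp
    moreover have "int_dom \<chi> = (n, rdom (int_nat \<chi>))" by (metis v(1) vert_sel(1))
    ultimately have "int_nat \<chi> = rwhisker R n \<eta> Fs"
      using l[of \<chi>] P v by simp
    then show "\<chi> = vert R n (rwhisker R n \<eta> Fs)" using v(1) by simp
  next
    assume \<chi>: "\<chi> = vert R n (rwhisker R n \<eta> Fs)"
    have "vert R n (rwhisker R n \<eta> Fs) \<in> hom (IntCat R) (n, ?F) (n, ?G)"
      using vert_in_IntCat[OF wh] by (simp add: hom_def) (simp add: IntCat_def)
    then show ?P using l[of \<chi>] r wh \<chi> by simp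
  qed
  then have "(THE \<chi>. \<chi> \<in> hom (IntCat R) (n, ?F) (n, ?G) \<and> int_base \<chi> = (n, ids n) \<and>
      int_lift R (n, Fs) (m, rcod \<eta>) \<cdot>\<^bsub>IntCat R\<^esub> \<chi> = vert R m \<eta> \<cdot>\<^bsub>IntCat R\<^esub> int_lift R (n, Fs) (m,
          rdom \<eta>))
    = vert R n (rwhisker R n \<eta> Fs)" by simp
  moreover have "Dom (IntCat R) = int_dom" "Cod (IntCat R) = int_cod" "Dom (Ctx R) = fst"
    by (simp_all add: IntCat_def Ctx_def)
  moreover have "int_dom (int_lift R (n, Fs) (m, H)) = (n, rsubst R n H Fs)" for H
    by (simp add: int_lift_def Let_def)
  ultimately show ?thesis
    by (simp add: reindex_def forget_def Ctx_Ide)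
qed

section \<open>Quantification in terms of functors and natural transformations\<close>

abbreviation wks :: "nat \<Rightarrow> ('o, 'a) relfun list" where
  "wks n \<equiv> map (rproj R (Suc n)) [0..<n]"
abbreviation weak :: "nat \<Rightarrow> ('o, 'a) relfun \<Rightarrow> ('o, 'a) relfun" where
  "weak n F \<equiv> rsubst R (Suc n) F (wks n)"
abbreviation wk :: "nat \<Rightarrow> ('o, 'a) relnat \<Rightarrow> ('o, 'a) relnat" where
  "wk n \<eta> \<equiv> rwhisker R (Suc n) \<eta> (wks n)"

text \<open>The context map \<open>Fs\<close> times the identity of one further variable, as
  \<open>times_omega_ctx\<close> confirms. The further variable is the last one, hence its
  projection is appended.\<close>

definition ups :: "nat \<Rightarrow> ('o, 'a) relfun list \<Rightarrow> ('o, 'a) relfun list" where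
  "ups n Fs = map (weak n) Fs @ [rproj R (Suc n) n]"

text \<open>The data of the adjunction are taken out of the total category: its right adjoint,
  counit and unit become functors and natural transformations.\<close>

definition rall :: "nat \<Rightarrow> ('o, 'a) relfun \<Rightarrow> ('o, 'a) relfun" where
  "rall n T = snd (on_obj (all_fun R n) (Suc n, T))"
definition counit :: "nat \<Rightarrow> ('o, 'a) relfun \<Rightarrow> ('o, 'a) relnat" where
  "counit n T = int_nat (all_counit R n (Suc n, T))"
definition unit :: "nat \<Rightarrow> ('o, 'a) relfun \<Rightarrow> ('o, 'a) relnat" where
  "unit n H = int_nat (all_unit R n (n, H))"
definition rall_map :: "nat \<Rightarrow> ('o, 'a) relnat \<Rightarrow> ('o, 'a) relnat" where
  "rall_map n \<eta> = int_nat (on_arr (all_fun R n) (vert R (Suc n) \<eta>))"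
text \<open>The transpose of \<eta> under the adjunction between weakening and
  quantification.\<close>

definition tlam :: "nat \<Rightarrow> ('o, 'a) relfun \<Rightarrow> ('o, 'a) relnat \<Rightarrow> ('o, 'a) relnat" where
  "tlam n H \<eta> = rcomp R (rall_map n \<eta>) (unit n H)"

lemma relfuns_wks: "relfuns (Suc n) n (wks n)"
  by (auto simp: relfuns_def is_relfun_rproj)

lemma is_relfun_weak: "is_relfun R n F \<Longrightarrow> is_relfun R (Suc n) (weak n F)"
  by (rule is_relfun_rsubst[OF _ relfuns_wks])

lemma is_relnat_wk: "is_relnat R n \<eta> \<Longrightarrow> is_relnat R (Suc n) (wk n \<eta>)"
  by (rule is_relnat_rwhisker[OF _ relfuns_wks])

lemma relfuns_ups: "relfuns n m Fs \<Longrightarrow> relfuns (Suc n) (Suc m) (ups n Fs)"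
  by (auto simp: relfuns_def ups_def is_relfun_weak is_relfun_rproj)

lemma adj: "is_adjunction (fib n) (fib (Suc n)) (rdx (Suc n) (wks n)) (all_fun R n) (all_unit R n)
    (all_counit R n)"
  using ssp by (simp add: split_simple_products_def ctx_products_def) (simp add: Ctx_def)

lemma adjD:
  shows adj_unit: "X \<in> Obj (fib n) \<Longrightarrow>
      all_unit R n X \<in> hom (fib n) X (on_obj (all_fun R n) (on_obj (rdx (Suc n) (wks n)) X))"
    and adj_counit: "Y \<in> Obj (fib (Suc n)) \<Longrightarrow>
      all_counit R n Y \<in> hom (fib (Suc n)) (on_obj (rdx (Suc n) (wks n)) (on_obj (all_fun R n) Y))
          Y"
    and adj_left: "X \<in> Obj (fib n) \<Longrightarrow> all_counit R n (on_obj (rdx (Suc n) (wks n)) X)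
        \<cdot>\<^bsub>IntCat R\<^esub> on_arr (rdx (Suc n) (wks n)) (all_unit R n X)
      = Ide (IntCat R) (on_obj (rdx (Suc n) (wks n)) X)"
    and adj_right: "Y \<in> Obj (fib (Suc n)) \<Longrightarrow> on_arr (all_fun R n) (all_counit R n Y)
        \<cdot>\<^bsub>IntCat R\<^esub> all_unit R n (on_obj (all_fun R n) Y) = Ide (IntCat R) (on_obj (all_fun R n) Y)"
  using adj[of n] unfolding is_adjunction_def fib_sel by simp_all

lemma all_functor: "is_functor (fib (Suc n)) (fib n) (all_fun R n)"
  using adj[of n] by (simp add: is_adjunction_def)

lemma
  assumes "is_relfun R (Suc n) T"
  shows all_fun_obj: "on_obj (all_fun R n) (Suc n, T) = (n, rall n T)"
    and is_relfun_rall: "is_relfun R n (rall n T)"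
proof -
  have "on_obj (all_fun R n) (Suc n, T) \<in> Obj (fib n)"
    using all_functor[of n] assms by (auto simp: is_functor_def Obj_fib)
  then show "on_obj (all_fun R n) (Suc n, T) = (n, rall n T)" "is_relfun R n (rall n T)"
    unfolding Obj_fib rall_def by auto
qed

lemma
  assumes "is_relnat R (Suc n) \<eta>"
  shows all_fun_arr: "on_arr (all_fun R n) (vert R (Suc n) \<eta>) = vert R n (rall_map n \<eta>)"
    and is_relnat_rall_map: "is_relnat R n (rall_map n \<eta>)"
    and rall_map_sel: "rdom (rall_map n \<eta>) = rall n (rdom \<eta>)" "rcod (rall_map n \<eta>) = rall n (rcod
        \<eta>)"
proof -
  have "on_arr (all_fun R n) (vert R (Suc n) \<eta>) \<in> hom (fib n) (n, rall n (rdom \<eta>)) (n, rall n (rcod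
      \<eta>))"
  proof -
    have "vert R (Suc n) \<eta> \<in> Arr (fib (Suc n))" using assms by simp
    then have "on_arr (all_fun R n) (vert R (Suc n) \<eta>) \<in> hom (fib n)
        (on_obj (all_fun R n) (Suc n, rdom \<eta>)) (on_obj (all_fun R n) (Suc n, rcod \<eta>))"
      using all_functor[of n] unfolding is_functor_def fib_sel by (metis vert_sel(1,2))
    then show ?thesis using relnatD(1,2)[OF assms] by (simp add: all_fun_obj)
  qed
  then show "on_arr (all_fun R n) (vert R (Suc n) \<eta>) = vert R n (rall_map n \<eta>)" "is_relnat R n
      (rall_map n \<eta>)"
    "rdom (rall_map n \<eta>) = rall n (rdom \<eta>)" "rcod (rall_map n \<eta>) = rall n (rcod \<eta>)"
    unfolding hom_fib hom_FunCat rall_map_def by simp_all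
qed

lemma
  assumes "is_relfun R (Suc n) T"
  shows all_counit_vert: "all_counit R n (Suc n, T) = vert R (Suc n) (counit n T)"
    and is_relnat_counit: "is_relnat R (Suc n) (counit n T)"
    and counit_sel: "rdom (counit n T) = weak n (rall n T)" "rcod (counit n T) = T"
proof -
  have "all_counit R n (Suc n, T) \<in> hom (fib (Suc n)) (Suc n, weak n (rall n T)) (Suc n, T)"
    using adj_counit[of "(Suc n, T)" n] assms by (simp add: Obj_fib all_fun_obj rdx_obj)
  then show "all_counit R n (Suc n, T) = vert R (Suc n) (counit n T)" "is_relnat R (Suc n) (counit
      n T)"
    "rdom (counit n T) = weak n (rall n T)" "rcod (counit n T) = T"
    unfolding hom_fib hom_FunCat counit_def by simp_all
qed

lemma
  assumes "is_relfun R n H"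
  shows all_unit_vert: "all_unit R n (n, H) = vert R n (unit n H)"
    and is_relnat_unit: "is_relnat R n (unit n H)"
    and unit_sel: "rdom (unit n H) = H" "rcod (unit n H) = rall n (weak n H)"
proof -
  have "all_unit R n (n, H) \<in> hom (fib n) (n, H) (n, rall n (weak n H))"
    using adj_unit[of "(n, H)" n] assms is_relfun_weak[OF assms] by (simp add: Obj_fib all_fun_obj
        rdx_obj)
  then show "all_unit R n (n, H) = vert R n (unit n H)" "is_relnat R n (unit n H)"
    "rdom (unit n H) = H" "rcod (unit n H) = rall n (weak n H)"
    unfolding hom_fib hom_FunCat unit_def by simp_all
qed

lemma unit_natural:
  assumes \<eta>: "is_relnat R n \<eta>"
  shows "rcomp R (unit n (rcod \<eta>)) \<eta> = rcomp R (rall_map n (wk n \<eta>)) (unit n (rdom \<eta>))"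
proof -
  have "all_unit R n (n, rcod \<eta>) \<cdot>\<^bsub>IntCat R\<^esub> vert R n \<eta>
      = on_arr (all_fun R n) (on_arr (rdx (Suc n) (wks n)) (vert R n \<eta>)) \<cdot>\<^bsub>IntCat R\<^esub> all_unit R n
          (n, rdom \<eta>)"
    using adj[of n] \<eta> unfolding is_adjunction_def fib_sel by (metis vert_in_fib vert_sel(1,2))
  then show ?thesis
    using relnatD[OF \<eta>] is_relnat_wk[OF \<eta>]
    by (simp add: rdx_arr[OF \<eta> relfuns_wks] all_unit_vert all_fun_arr Comp_vert is_relnat_unit
        is_relnat_rall_map vert_inject)
qed

lemma counit_natural:
  assumes \<eta>: "is_relnat R (Suc n) \<eta>"
  shows "rcomp R \<eta> (counit n (rdom \<eta>)) = rcomp R (counit n (rcod \<eta>)) (wk n (rall_map n \<eta>))"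
proof -
  have "vert R (Suc n) \<eta> \<cdot>\<^bsub>IntCat R\<^esub> all_counit R n (Suc n, rdom \<eta>)
      = all_counit R n (Suc n, rcod \<eta>) \<cdot>\<^bsub>IntCat R\<^esub> on_arr (rdx (Suc n) (wks n)) (on_arr (all_fun R
          n) (vert R (Suc n) \<eta>))"
    using adj[of n] \<eta> unfolding is_adjunction_def fib_sel by (metis vert_in_fib vert_sel(1,2))
  then show ?thesis
    using relnatD[OF \<eta>]
    by (simp add: all_fun_arr[OF \<eta>] rdx_arr[OF is_relnat_rall_map[OF \<eta>] relfuns_wks]
        all_counit_vert Comp_vert
      \<eta> is_relnat_counit vert_inject)
qed

lemma counit_unit:
  assumes H: "is_relfun R n H"
  shows "rcomp R (counit n (weak n H)) (wk n (unit n H)) = rid R (weak n H)"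
proof -
  have "all_counit R n (on_obj (rdx (Suc n) (wks n)) (n, H)) \<cdot>\<^bsub>IntCat R\<^esub> on_arr (rdx (Suc n) (wks
      n)) (all_unit R n (n, H))
      = Ide (IntCat R) (on_obj (rdx (Suc n) (wks n)) (n, H))"
    using H by (intro adj_left) (simp add: Obj_fib)
  then show ?thesis
    using is_relfun_weak[OF H]
    by (simp add: rdx_obj all_unit_vert[OF H] rdx_arr[OF is_relnat_unit[OF H] relfuns_wks]
        all_counit_vert Comp_vert
      is_relnat_counit Ide_vert vert_inject)
qed

lemma rall_map_counit_unit:
  assumes T: "is_relfun R (Suc n) T"
  shows "rcomp R (rall_map n (counit n T)) (unit n (rall n T)) = rid R (rall n T)"
proof -
  have "on_arr (all_fun R n) (all_counit R n (Suc n, T)) \<cdot>\<^bsub>IntCat R\<^esub> all_unit R n (on_obj (all_fun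
      R n) (Suc n, T))
      = Ide (IntCat R) (on_obj (all_fun R n) (Suc n, T))"
    using T by (intro adj_right) (simp add: Obj_fib)
  then show ?thesis
    using is_relfun_rall[OF T]
    by (simp add: all_fun_obj[OF T] all_unit_vert all_counit_vert[OF T] all_fun_arr[OF
        is_relnat_counit[OF T]] Comp_vert
      is_relnat_rall_map[OF is_relnat_counit[OF T]] Ide_vert vert_inject)
qed

lemma rall_map_rcomp:
  assumes \<eta>: "is_relnat R (Suc n) \<eta>" and \<theta>: "is_relnat R (Suc n) \<theta>" and c: "rdom \<theta> = rcod \<eta>"
  shows "rall_map n (rcomp R \<theta> \<eta>) = rcomp R (rall_map n \<theta>) (rall_map n \<eta>)"
proof -
  have "on_arr (all_fun R n) (vert R (Suc n) \<theta> \<cdot>\<^bsub>IntCat R\<^esub> vert R (Suc n) \<eta>)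
      = on_arr (all_fun R n) (vert R (Suc n) \<theta>) \<cdot>\<^bsub>IntCat R\<^esub> on_arr (all_fun R n) (vert R (Suc n) \<eta>)"
    using all_functor[of n] \<eta> \<theta> c by (simp add: is_functor_def)
  then show ?thesis
    by (simp add: all_fun_arr \<eta> \<theta> is_relnat_rcomp c Comp_vert is_relnat_rall_map vert_inject)
qed

context
  fixes n H \<eta>
  assumes H: "is_relfun R n H" and \<eta>: "is_relnat R (Suc n) \<eta>" "rdom \<eta> = weak n H"
begin

lemma is_relnat_tlam: "is_relnat R n (tlam n H \<eta>)"
  and tlam_sel: "rdom (tlam n H \<eta>) = H" "rcod (tlam n H \<eta>) = rall n (rcod \<eta>)"
  unfolding tlam_def using is_relnat_unit[OF H] unit_sel[OF H] is_relnat_rall_map[OF \<eta>(1)]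
      rall_map_sel[OF \<eta>(1)] \<eta>(2)
  by (auto intro: is_relnat_rcomp)

text \<open>One half of the adjunction bijection: naturality of the counit moves \<eta> to the
  outside, and a triangle identity removes the rest. Semantically this is the beta law of type
  abstraction.\<close>

lemma counit_tlam: "rcomp R (counit n (rcod \<eta>)) (wk n (tlam n H \<eta>)) = \<eta>"
proof -
  note u = is_relnat_unit[OF H] unit_sel[OF H] and m = is_relnat_rall_map[OF \<eta>(1)] rall_map_sel[OF
      \<eta>(1)]
    and c = is_relnat_counit[OF relnatD(2)[OF \<eta>(1)]] counit_sel[OF relnatD(2)[OF \<eta>(1)]]
    and c' = is_relnat_counit[OF relnatD(1)[OF \<eta>(1)]] counit_sel[OF relnatD(1)[OF \<eta>(1)]]
  have "rcomp R (counit n (rcod \<eta>)) (wk n (tlam n H \<eta>))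
      = rcomp R (counit n (rcod \<eta>)) (rcomp R (wk n (rall_map n \<eta>)) (wk n (unit n H)))"
    unfolding tlam_def using u m \<eta> by (simp add: rwhisker_rcomp[OF relfuns_wks])
  also have "\<dots> = rcomp R (rcomp R (counit n (rcod \<eta>)) (wk n (rall_map n \<eta>))) (wk n (unit n H))"
    by (rule relnat_rcomp_assoc[symmetric]) (use u m c \<eta> in \<open>simp_all add: is_relnat_wk\<close>)
  also have "\<dots> = rcomp R (rcomp R \<eta> (counit n (rdom \<eta>))) (wk n (unit n H))"
    by (simp add: counit_natural[OF \<eta>(1)])
  also have "\<dots> = rcomp R \<eta> (rcomp R (counit n (rdom \<eta>)) (wk n (unit n H)))"
    by (rule relnat_rcomp_assoc) (use u m c' \<eta> in \<open>simp_all add: is_relnat_wk\<close>)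
  also have "\<dots> = \<eta>"
    using \<eta> counit_unit[OF H] relnat_rcomp_rid[OF \<eta>(1)] by simp
  finally show ?thesis .
qed

end

text \<open>The other half, by naturality of the unit and the second triangle identity. A map into
  \<open>rall n T\<close> is therefore determined by the composite of its weakening with the
  counit.\<close>

lemma tlam_counit:
  assumes \<psi>: "is_relnat R n \<psi>" "rdom \<psi> = H" "rcod \<psi> = rall n T" and T: "is_relfun R (Suc n) T"
  shows "tlam n H (rcomp R (counit n T) (wk n \<psi>)) = \<psi>"
proof -
  have H: "is_relfun R n H" using relnatD(1)[OF \<psi>(1)] \<psi>(2) by simp
  note u = is_relnat_unit[OF H] unit_sel[OF H] and u' = is_relnat_unit[OF is_relfun_rall[OF T]]
      unit_sel[OF is_relfun_rall[OF T]]
    and c = is_relnat_counit[OF T] counit_sel[OF T]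
    and w = is_relnat_wk[OF \<psi>(1)]
    and mc = is_relnat_rall_map[OF is_relnat_counit[OF T]] rall_map_sel[OF is_relnat_counit[OF T]]
    and mw = is_relnat_rall_map[OF is_relnat_wk[OF \<psi>(1)]] rall_map_sel[OF is_relnat_wk[OF \<psi>(1)]]
  have "tlam n H (rcomp R (counit n T) (wk n \<psi>)) = rcomp R (rcomp R (rall_map n (counit n T))
      (rall_map n (wk n \<psi>))) (unit n H)"
    unfolding tlam_def using c w \<psi> by (simp add: rall_map_rcomp)
  also have "\<dots> = rcomp R (rall_map n (counit n T)) (rcomp R (rall_map n (wk n \<psi>)) (unit n H))"
    by (rule relnat_rcomp_assoc) (use u c mc mw \<psi> in simp_all)
  also have "\<dots> = rcomp R (rall_map n (counit n T)) (rcomp R (unit n (rall n T)) \<psi>)"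
    using unit_natural[OF \<psi>(1)] \<psi> by simp
  also have "\<dots> = rcomp R (rcomp R (rall_map n (counit n T)) (unit n (rall n T))) \<psi>"
    by (rule relnat_rcomp_assoc[symmetric]) (use u' c mc \<psi> in simp_all)
  also have "\<dots> = \<psi>"
    using rall_map_counit_unit[OF T] relnat_rcomp_rid[OF \<psi>(1)] \<psi> by simp
  finally show ?thesis .
qed

text \<open>The product map is a definite description, so uniqueness has to be shown. Composing a
  candidate with the weakening map recovers its first \<open>m\<close> entries, and composing it
  with the last projection recovers the final one.\<close>

lemma times_omega_ctx:
  assumes Fs: "relfuns n m Fs"
  shows "times_omega (Ctx R) (ctx_products R) (n, Fs) = (Suc n, ups n Fs)"
proof -
  let ?ofst = "\<lambda>m. (Suc m, wks m)"
  have o: "ofst (ctx_products R) m = (Suc m, wks m)" "osnd (ctx_products R) m = (Suc m, [rproj R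
      (Suc m) m])"
    "xOmega (ctx_products R) m = Suc m" for m
    by (simp_all add: ctx_products_def)
  have len: "length Fs = m" using Fs by (simp add: relfuns_def)
  have sel: "Dom (Ctx R) (n, Fs) = n" "Cod (Ctx R) (n, Fs) = m"
    "(k, Gs) \<cdot>\<^bsub>Ctx R\<^esub> (j, Hs) = (j, map (\<lambda>G. rsubst R j G Hs) Gs)" for k Gs j Hs
    using len by (simp_all add: Ctx_def)
  have "(h \<in> hom (Ctx R) (Suc n) (Suc m) \<and> (Suc m, wks m) \<cdot>\<^bsub>Ctx R\<^esub> h = (n, Fs) \<cdot>\<^bsub>Ctx R\<^esub> (Suc n, wks
      n) \<and>
      (Suc m, [rproj R (Suc m) m]) \<cdot>\<^bsub>Ctx R\<^esub> h = (Suc n, [rproj R (Suc n) n])) \<longleftrightarrow> h = (Suc n, ups n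
          Fs)" for h
  proof
    assume h: "h \<in> hom (Ctx R) (Suc n) (Suc m) \<and> (Suc m, wks m) \<cdot>\<^bsub>Ctx R\<^esub> h = (n, Fs) \<cdot>\<^bsub>Ctx R\<^esub> (Suc
        n, wks n) \<and>
      (Suc m, [rproj R (Suc m) m]) \<cdot>\<^bsub>Ctx R\<^esub> h = (Suc n, [rproj R (Suc n) n])"
    obtain Hs where Hs: "h = (Suc n, Hs)" using h by (cases h) (auto simp: hom_def Ctx_def)
    have rel: "relfuns (Suc n) (Suc m) Hs" using h Hs by (simp add: relfuns_hom)
    have e: "map (\<lambda>G. rsubst R (Suc n) G Hs) (wks m) = map (weak n) Fs"
      "rsubst R (Suc n) (rproj R (Suc m) m) Hs = rproj R (Suc n) n"
      using h Hs by (simp_all add: sel)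
    have "Hs ! i = weak n (Fs ! i)" if "i < m" for i
      using arg_cong[OF e(1), of "\<lambda>xs. xs ! i"] that len rsubst_rproj[OF rel, of i] by simp
    moreover have "Hs ! m = rproj R (Suc n) n"
      using e(2) rsubst_rproj[OF rel, of m] by simp
    ultimately have "Hs = ups n Fs"
      using len relfunsD(1)[OF rel] by (intro nth_equalityI) (auto simp: ups_def nth_append
          less_Suc_eq)
    then show "h = (Suc n, ups n Fs)" using Hs by simp
  next
    assume h: "h = (Suc n, ups n Fs)"
    have rel: "relfuns (Suc n) (Suc m) (ups n Fs)" by (rule relfuns_ups[OF Fs])
    have "map (\<lambda>G. rsubst R (Suc n) G (ups n Fs)) (wks m) = map (weak n) Fs"
      using len rsubst_rproj[OF rel] by (intro nth_equalityI) (auto simp: ups_def nth_append)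
    moreover have "rsubst R (Suc n) (rproj R (Suc m) m) (ups n Fs) = rproj R (Suc n) n"
      using len rsubst_rproj[OF rel, of m] by (simp add: ups_def nth_append)
    ultimately show "h \<in> hom (Ctx R) (Suc n) (Suc m) \<and> (Suc m, wks m) \<cdot>\<^bsub>Ctx R\<^esub> h = (n, Fs) \<cdot>\<^bsub>Ctx R\<^esub>
        (Suc n, wks n) \<and>
      (Suc m, [rproj R (Suc m) m]) \<cdot>\<^bsub>Ctx R\<^esub> h = (Suc n, [rproj R (Suc n) n])"
      using h rel by (simp add: relfuns_hom sel)
  qed
  then show ?thesis
    unfolding times_omega_def sel(1,2) o by simp
qed

text \<open>The Beck-Chevalley equations for objects and for counits, translated into substitution
  and whiskering along \<open>ups n Fs\<close>; stability of transposes is deduced from them in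
  \<open>rwhisker_tlam\<close>.\<close>

lemma
  assumes T: "is_relfun R (Suc m) T" and Fs: "relfuns n m Fs"
  shows rsubst_rall: "rsubst R n (rall m T) Fs = rall n (rsubst R (Suc n) T (ups n Fs))"
    and rwhisker_counit: "rwhisker R (Suc n) (counit m T) (ups n Fs) = counit n (rsubst R (Suc n) T
        (ups n Fs))"
proof -
  have T': "is_relfun R (Suc n) (rsubst R (Suc n) T (ups n Fs))"
    by (rule is_relfun_rsubst[OF T relfuns_ups[OF Fs]])
  have f: "(n, Fs) \<in> Arr (Ctx R)" "Dom (Ctx R) (n, Fs) = n" "Cod (Ctx R) (n, Fs) = m"
    using Fs by (auto simp: relfuns_def Ctx_def)
  have BC: "(\<forall>X \<in> Obj (fib (Suc m)). on_obj (rdx n Fs) (on_obj (all_fun R m) X)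
        = on_obj (all_fun R n) (on_obj (rdx (Suc n) (ups n Fs)) X)) \<and>
      (\<forall>X \<in> Obj (fib (Suc m)). on_arr (rdx (Suc n) (ups n Fs)) (all_counit R m X)
        = all_counit R n (on_obj (rdx (Suc n) (ups n Fs)) X))"
    using ssp f(1) times_omega_ctx[OF Fs] unfolding split_simple_products_def Let_def
    by (auto simp: f(2,3) ctx_products_def[THEN arg_cong[where f = xOmega]])
  have X: "(Suc m, T) \<in> Obj (fib (Suc m))" using T by (simp add: Obj_fib)
  show "rsubst R n (rall m T) Fs = rall n (rsubst R (Suc n) T (ups n Fs))"
    using bspec[OF conjunct1[OF BC] X] by (simp add: all_fun_obj[OF T] all_fun_obj[OF T'] rdx_obj)
  show "rwhisker R (Suc n) (counit m T) (ups n Fs) = counit n (rsubst R (Suc n) T (ups n Fs))"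
    using bspec[OF conjunct2[OF BC] X]
    by (simp add: rdx_obj all_counit_vert[OF T] all_counit_vert[OF T'] rdx_arr[OF
        is_relnat_counit[OF T] relfuns_ups[OF Fs]]
      vert_inject)
qed

text \<open>Both composites in the square formed by \<open>Fs\<close>, \<open>ups n Fs\<close> and
  the two weakenings are the list of weakened entries of \<open>Fs\<close>.\<close>

lemma rsubst_ups_weak:
  assumes F: "is_relfun R m F" and Fs: "relfuns n m Fs"
  shows "rsubst R (Suc n) (weak m F) (ups n Fs) = weak n (rsubst R n F Fs)"
    "map (\<lambda>G. rsubst R (Suc n) G (ups n Fs)) (wks m) = map (weak n) Fs"
proof -
  note up = relfuns_ups[OF Fs]
  show e: "map (\<lambda>G. rsubst R (Suc n) G (ups n Fs)) (wks m) = map (weak n) Fs"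
    using relfunsD(1)[OF Fs] rsubst_rproj[OF up] by (intro nth_equalityI) (auto simp: ups_def
        nth_append)
  show "rsubst R (Suc n) (weak m F) (ups n Fs) = weak n (rsubst R n F Fs)"
    unfolding rsubst_rsubst[OF F relfuns_wks up] rsubst_rsubst[OF F Fs relfuns_wks] e ..
qed

lemma rwhisker_ups_wk:
  assumes \<eta>: "is_relnat R m \<eta>" and Fs: "relfuns n m Fs"
  shows "rwhisker R (Suc n) (wk m \<eta>) (ups n Fs) = wk n (rwhisker R n \<eta> Fs)"
  unfolding rwhisker_rwhisker[OF \<eta> relfuns_wks relfuns_ups[OF Fs]] rwhisker_rwhisker[OF \<eta> Fs
      relfuns_wks]
    rsubst_ups_weak(2)[OF relnatD(1)[OF \<eta>] Fs] ..

text \<open>Both naturality laws hold because transposes are determined by their composites with the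
    counit.\<close>

lemma tlam_rcomp:
  assumes H: "is_relfun R n H" and \<eta>: "is_relnat R (Suc n) \<eta>" "rdom \<eta> = weak n H"
    and \<theta>: "is_relnat R n \<theta>" "rdom \<theta> = K" "rcod \<theta> = H"
  shows "tlam n K (rcomp R \<eta> (wk n \<theta>)) = rcomp R (tlam n H \<eta>) \<theta>"
proof -
  note l = is_relnat_tlam[OF H \<eta>] tlam_sel[OF H \<eta>] and T = relnatD(2)[OF \<eta>(1)]
    and c = is_relnat_counit[OF relnatD(2)[OF \<eta>(1)]] counit_sel[OF relnatD(2)[OF \<eta>(1)]]
  have "rcomp R (counit n (rcod \<eta>)) (wk n (rcomp R (tlam n H \<eta>) \<theta>))
      = rcomp R (counit n (rcod \<eta>)) (rcomp R (wk n (tlam n H \<eta>)) (wk n \<theta>))"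
    using l \<theta> by (simp add: rwhisker_rcomp[OF relfuns_wks])
  also have "\<dots> = rcomp R (rcomp R (counit n (rcod \<eta>)) (wk n (tlam n H \<eta>))) (wk n \<theta>)"
    by (rule relnat_rcomp_assoc[symmetric]) (use l c \<theta> in \<open>simp_all add: is_relnat_wk\<close>)
  also have "\<dots> = rcomp R \<eta> (wk n \<theta>)" by (simp add: counit_tlam[OF H \<eta>])
  finally have "tlam n K (rcomp R \<eta> (wk n \<theta>)) = tlam n K (rcomp R (counit n (rcod \<eta>)) (wk n (rcomp
      R (tlam n H \<eta>) \<theta>)))"
    by simp
  also have "\<dots> = rcomp R (tlam n H \<eta>) \<theta>"
    by (rule tlam_counit[OF _ _ _ T]) (use l \<theta> in \<open>simp_all add: is_relnat_rcomp\<close>)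
  finally show ?thesis .
qed

lemma rwhisker_tlam:
  assumes H: "is_relfun R m H" and \<eta>: "is_relnat R (Suc m) \<eta>" "rdom \<eta> = weak m H" and Fs: "relfuns
      n m Fs"
  shows "rwhisker R n (tlam m H \<eta>) Fs = tlam n (rsubst R n H Fs) (rwhisker R (Suc n) \<eta> (ups n Fs))"
proof -
  note l = is_relnat_tlam[OF H \<eta>] tlam_sel[OF H \<eta>] and T = relnatD(2)[OF \<eta>(1)]
    and c = is_relnat_counit[OF relnatD(2)[OF \<eta>(1)]] counit_sel[OF relnatD(2)[OF \<eta>(1)]]
    and up = relfuns_ups[OF Fs]
  let ?T = "rsubst R (Suc n) (rcod \<eta>) (ups n Fs)"
  have "rcomp R (counit n ?T) (wk n (rwhisker R n (tlam m H \<eta>) Fs))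
      = rcomp R (rwhisker R (Suc n) (counit m (rcod \<eta>)) (ups n Fs)) (rwhisker R (Suc n) (wk m (tlam
          m H \<eta>)) (ups n Fs))"
    using rwhisker_counit[OF T Fs] rwhisker_ups_wk[OF l(1) Fs] by simp
  also have "\<dots> = rwhisker R (Suc n) (rcomp R (counit m (rcod \<eta>)) (wk m (tlam m H \<eta>))) (ups n Fs)"
    by (rule rwhisker_rcomp[OF up, symmetric]) (use l c in \<open>simp_all add: is_relnat_wk\<close>)
  also have "\<dots> = rwhisker R (Suc n) \<eta> (ups n Fs)" by (simp add: counit_tlam[OF H \<eta>])
  finally have "tlam n (rsubst R n H Fs) (rwhisker R (Suc n) \<eta> (ups n Fs))
      = tlam n (rsubst R n H Fs) (rcomp R (counit n ?T) (wk n (rwhisker R n (tlam m H \<eta>) Fs)))" by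
          simp
  also have "\<dots> = rwhisker R n (tlam m H \<eta>) Fs"
    by (rule tlam_counit[OF _ _ _ is_relfun_rsubst[OF T up]])
      (use l in \<open>simp_all add: is_relnat_rwhisker[OF _ Fs] rsubst_rall[OF T Fs]\<close>)
  finally show ?thesis by simp
qed

end

section \<open>Syntax of System F\<close>

lemma up_ren_comp: "up_ren \<rho> \<circ> up_ren \<rho>' = up_ren (\<rho> \<circ> \<rho>')"
  by (auto simp: up_ren_def fun_eq_iff split: nat.splits)

text \<open>The composition laws come in the order renaming/renaming, substitution/renaming,
  renaming/substitution, substitution/substitution: lifting a substitution under a binder weakens
  it, so the last two laws depend on earlier ones.\<close>

lemma ren_ty_ren_ty: "ren_ty \<rho> (ren_ty \<rho>' T) = ren_ty (\<rho> \<circ> \<rho>') T"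
  by (induction T arbitrary: \<rho> \<rho>') (simp_all add: up_ren_comp)

lemma up_sub_ty_up_ren: "up_sub_ty \<sigma> \<circ> up_ren \<rho> = up_sub_ty (\<sigma> \<circ> \<rho>)"
  by (auto simp: up_sub_ty_def up_ren_def fun_eq_iff split: nat.splits)

lemma sub_ty_ren_ty: "sub_ty \<sigma> (ren_ty \<rho> T) = sub_ty (\<sigma> \<circ> \<rho>) T"
  by (induction T arbitrary: \<sigma> \<rho>) (simp_all add: up_sub_ty_up_ren)

lemma ren_ty_up_sub_ty: "ren_ty (up_ren \<rho>) \<circ> up_sub_ty \<sigma> = up_sub_ty (ren_ty \<rho> \<circ> \<sigma>)"
proof
  have "up_ren \<rho> \<circ> Suc = Suc \<circ> \<rho>" by (auto simp: up_ren_def)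
  then show "(ren_ty (up_ren \<rho>) \<circ> up_sub_ty \<sigma>) i = up_sub_ty (ren_ty \<rho> \<circ> \<sigma>) i" for i
    by (cases i) (simp_all add: up_sub_ty_def ren_ty_ren_ty, simp add: up_ren_def)
qed

lemma ren_ty_sub_ty: "ren_ty \<rho> (sub_ty \<sigma> T) = sub_ty (ren_ty \<rho> \<circ> \<sigma>) T"
  by (induction T arbitrary: \<sigma> \<rho>) (simp_all add: ren_ty_up_sub_ty)

lemma sub_ty_up_sub_ty: "sub_ty (up_sub_ty \<sigma>) \<circ> up_sub_ty \<tau> = up_sub_ty (sub_ty \<sigma> \<circ> \<tau>)"
proof
  have "up_sub_ty \<sigma> \<circ> Suc = ren_ty Suc \<circ> \<sigma>" by (auto simp: up_sub_ty_def)
  then show "(sub_ty (up_sub_ty \<sigma>) \<circ> up_sub_ty \<tau>) i = up_sub_ty (sub_ty \<sigma> \<circ> \<tau>) i" for i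
    by (cases i) (simp_all add: sub_ty_ren_ty ren_ty_sub_ty up_sub_ty_def[of \<tau>] up_sub_ty_def[of
        "sub_ty \<sigma> \<circ> \<tau>"],
      simp add: up_sub_ty_def)
qed

lemma sub_ty_sub_ty: "sub_ty \<sigma> (sub_ty \<tau> T) = sub_ty (sub_ty \<sigma> \<circ> \<tau>) T"
  by (induction T arbitrary: \<sigma> \<tau>) (simp_all add: sub_ty_up_sub_ty)

lemma ren_ty_eq_sub_ty: "ren_ty \<rho> T = sub_ty (\<lambda>i. TVar (\<rho> i)) T"
proof (induction T arbitrary: \<rho>)
  case (All T)
  have "(\<lambda>i. TVar (up_ren \<rho> i)) = up_sub_ty (\<lambda>i. TVar (\<rho> i))"
    by (auto simp: up_ren_def up_sub_ty_def fun_eq_iff split: nat.splits)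
  then show ?case using All by simp
qed simp_all

lemma sub_ty_TVar [simp]: "sub_ty TVar T = T"
proof (induction T)
  case (All T)
  have "up_sub_ty TVar = TVar"
    by (auto simp: up_sub_ty_def fun_eq_iff split: nat.splits)
  then show ?case using All by simp
qed simp_all

lemma inst_ty_weaken_ty [simp]: "inst_ty (weaken_ty T) S = T"
proof -
  have "case_nat S TVar \<circ> Suc = TVar" by auto
  then show ?thesis by (simp add: sub_ty_ren_ty)
qed

lemma sub_ty_inst_ty: "sub_ty \<sigma> (inst_ty T S) = inst_ty (sub_ty (up_sub_ty \<sigma>) T) (sub_ty \<sigma> S)"
proof -
  have "(sub_ty \<sigma> \<circ> case_nat S TVar) i = (sub_ty (case_nat (sub_ty \<sigma> S) TVar) \<circ> up_sub_ty \<sigma>) i" for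
      i
    by (cases i) (simp_all add: up_sub_ty_def)
  then have "sub_ty \<sigma> \<circ> case_nat S TVar = sub_ty (case_nat (sub_ty \<sigma> S) TVar) \<circ> up_sub_ty \<sigma>" by
      blast
  then show ?thesis by (simp add: sub_ty_sub_ty)
qed

lemma sub_ty_up_weaken_ty: "sub_ty (up_sub_ty \<sigma>) (weaken_ty T) = weaken_ty (sub_ty \<sigma> T)"
proof -
  have "up_sub_ty \<sigma> \<circ> Suc = ren_ty Suc \<circ> \<sigma>" by (auto simp: up_sub_ty_def)
  then show ?thesis by (simp add: sub_ty_ren_ty ren_ty_sub_ty)
qed

text \<open>The type equation behind the eta rule of type abstraction: the body of a weakened
  quantified type, instantiated at the new variable, is the original body.\<close>

lemma inst_ty_up_weaken: "inst_ty (sub_ty (up_sub_ty (\<lambda>i. TVar (Suc i))) T) (TVar 0) = T"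
proof -
  have "(sub_ty (case_nat (TVar 0) TVar) \<circ> up_sub_ty (\<lambda>i. TVar (Suc i))) i = TVar i" for i
    by (cases i) (simp_all add: up_sub_ty_def)
  then have "sub_ty (case_nat (TVar 0) TVar) \<circ> up_sub_ty (\<lambda>i. TVar (Suc i)) = TVar" by blast
  then show ?thesis by (simp add: sub_ty_sub_ty)
qed

section \<open>Well-formedness and typing\<close>

lemma wf_ty_ren_ty: "(\<And>i. \<rho> i < n \<longleftrightarrow> i < m) \<Longrightarrow> wf_ty n (ren_ty \<rho> T) \<longleftrightarrow> wf_ty m T"
proof (induction T arbitrary: \<rho> n m)
  case (All T)
  have "up_ren \<rho> i < Suc n \<longleftrightarrow> i < Suc m" for i
    using All.prems by (cases i) (auto simp: up_ren_def)
  then show ?case using All.IH by simp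
qed auto

text \<open>Weakening also reflects well-formedness, which is why \<open>wf_ty_ren_ty\<close> has an
  equivalence as premise. \<open>typing_wf\<close> relies on it: a derivation checks its context
  only at variables, and the result has to be carried back out of \<open>t_tlam\<close>.\<close>

lemma wf_ty_weaken_ty [simp]: "wf_ty (Suc n) (weaken_ty T) \<longleftrightarrow> wf_ty n T"
  by (rule wf_ty_ren_ty) simp

definition wf_sub :: "nat \<Rightarrow> (nat \<Rightarrow> ty) \<Rightarrow> nat \<Rightarrow> bool" where
  "wf_sub n \<sigma> m \<longleftrightarrow> (\<forall>i<m. wf_ty n (\<sigma> i))"

abbreviation wf_ctx :: "nat \<Rightarrow> ty list \<Rightarrow> bool" where
  "wf_ctx n \<Delta> \<equiv> \<forall>S \<in> set \<Delta>. wf_ty n S"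

lemma wf_sub_up: "wf_sub n \<sigma> m \<Longrightarrow> wf_sub (Suc n) (up_sub_ty \<sigma>) (Suc m)"
  by (auto simp: wf_sub_def up_sub_ty_def split: nat.splits)

lemma wf_ty_sub_ty: "\<lbrakk>wf_ty m T; wf_sub n \<sigma> m\<rbrakk> \<Longrightarrow> wf_ty n (sub_ty \<sigma> T)"
  by (induction T arbitrary: n m \<sigma>) (auto simp: wf_sub_up, auto simp: wf_sub_def)

lemma wf_sub_inst: "wf_ty n S \<Longrightarrow> wf_sub n (case_nat S TVar) (Suc n)"
  by (auto simp: wf_sub_def split: nat.splits)

lemma wf_sub_weaken: "wf_sub (Suc n) (\<lambda>i. TVar (Suc i)) n"
  by (simp add: wf_sub_def)

lemma map_up_sub_weaken_ty:
  "map weaken_ty (map (sub_ty \<sigma>) \<Delta>) = map (sub_ty (up_sub_ty \<sigma>)) (map weaken_ty \<Delta>)"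
  by (simp add: sub_ty_up_weaken_ty)

lemma map_weaken_ty_eq: "map weaken_ty \<Delta> = map (sub_ty (\<lambda>i. TVar (Suc i))) \<Delta>"
  by (simp add: ren_ty_eq_sub_ty)

lemma map_inst_weaken_ty: "map (\<lambda>T. inst_ty T S) (map weaken_ty \<Delta>) = \<Delta>"
  by (simp add: map_idI)

lemma typing_wf: "typing n \<Delta> t T \<Longrightarrow> wf_ctx n \<Delta> \<and> wf_ty n T"
proof (induction rule: typing.induct)
  case (t_tapp n \<Delta> t T S)
  then show ?case using wf_ty_sub_ty[OF _ wf_sub_inst] by simp
qed auto

lemma typing_the_ty: "typing n \<Delta> t T \<Longrightarrow> the_ty \<Delta> t = T"
  by (induction rule: typing.induct) simp_all

lemma typing_sub_ty_tm:
  "\<lbrakk>typing m \<Delta> t T; wf_sub n \<sigma> m\<rbrakk> \<Longrightarrow> typing n (map (sub_ty \<sigma>) \<Delta>) (sub_ty_tm \<sigma> t) (sub_ty \<sigma> T)"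
proof (induction arbitrary: n \<sigma> rule: typing.induct)
  case (t_var \<Delta> m i)
  then have "typing n (map (sub_ty \<sigma>) \<Delta>) (Var i) (map (sub_ty \<sigma>) \<Delta> ! i)"
    by (intro typing.t_var) (auto intro: wf_ty_sub_ty)
  then show ?case using t_var by simp
next
  case (t_tlam m \<Delta> t T)
  then have "typing (Suc n) (map weaken_ty (map (sub_ty \<sigma>) \<Delta>)) (sub_ty_tm (up_sub_ty \<sigma>) t) (sub_ty
      (up_sub_ty \<sigma>) T)"
    unfolding map_up_sub_weaken_ty by (simp add: wf_sub_up)
  then show ?case by (auto intro: typing.t_tlam)
next
  case (t_tapp m \<Delta> t T S)
  have "typing n (map (sub_ty \<sigma>) \<Delta>) (sub_ty_tm \<sigma> t) (All (sub_ty (up_sub_ty \<sigma>) T))" using t_tapp by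
      simp
  then have "typing n (map (sub_ty \<sigma>) \<Delta>) (TApp (sub_ty_tm \<sigma> t) (sub_ty \<sigma> S)) (inst_ty (sub_ty
      (up_sub_ty \<sigma>) T) (sub_ty \<sigma> S))"
    using t_tapp wf_ty_sub_ty by (intro typing.t_tapp) auto
  then show ?case by (simp add: sub_ty_inst_ty)
next
  case (t_app m \<Delta> t S T u)
  then show ?case using typing.t_app[of n "map (sub_ty \<sigma>) \<Delta>" _ "sub_ty \<sigma> S"] by simp
qed (auto intro: typing.intros)

lemma typing_weaken_ty_tm:
  assumes "typing n \<Delta> t T"
  shows "typing (Suc n) (map weaken_ty \<Delta>) (weaken_ty_tm t) (weaken_ty T)"
  unfolding map_weaken_ty_eq ren_ty_eq_sub_ty using typing_sub_ty_tm[OF assms wf_sub_weaken] .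

definition wf_ren :: "ty list \<Rightarrow> (nat \<Rightarrow> nat) \<Rightarrow> ty list \<Rightarrow> bool" where
  "wf_ren \<Delta>' \<rho> \<Delta> \<longleftrightarrow> (\<forall>i<length \<Delta>. \<rho> i < length \<Delta>' \<and> \<Delta>' ! \<rho> i = \<Delta> ! i)"

lemma wf_ren_up: "wf_ren \<Delta>' \<rho> \<Delta> \<Longrightarrow> wf_ren (S # \<Delta>') (up_ren \<rho>) (S # \<Delta>)"
  by (auto simp: wf_ren_def up_ren_def split: nat.splits)

lemma wf_ren_map: "wf_ren \<Delta>' \<rho> \<Delta> \<Longrightarrow> wf_ren (map f \<Delta>') \<rho> (map f \<Delta>)"
  by (auto simp: wf_ren_def)

lemma wf_ren_Suc: "wf_ren (S # \<Delta>) Suc \<Delta>"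
  by (auto simp: wf_ren_def)

lemma typing_ren_tm:
  "\<lbrakk>typing n \<Delta> t T; wf_ctx n \<Delta>'; wf_ren \<Delta>' \<rho> \<Delta>\<rbrakk> \<Longrightarrow> typing n \<Delta>' (ren_tm \<rho> t) T"
proof (induction arbitrary: \<Delta>' \<rho> rule: typing.induct)
  case (t_var \<Delta> n i)
  then show ?case using typing.t_var[of \<Delta>' n "\<rho> i"] by (simp add: wf_ren_def)
next
  case (t_lam n S \<Delta> t T)
  have "typing n (S # \<Delta>') (ren_tm (up_ren \<rho>) t) T"
    using t_lam typing_wf[OF t_lam(1)] by (simp add: wf_ren_up)
  then show ?case by (simp add: typing.t_lam)
next
  case (t_tlam n \<Delta> t T)
  have "typing (Suc n) (map weaken_ty \<Delta>') (ren_tm \<rho> t) T"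
    using t_tlam by (intro t_tlam.IH) (auto intro: wf_ren_map)
  then show ?case by (simp add: typing.t_tlam)
next
  case (t_app n \<Delta> t S T u)
  then show ?case using typing.t_app[of n \<Delta>' _ S] by simp
qed (auto intro: typing.intros)

definition typed_sub :: "nat \<Rightarrow> ty list \<Rightarrow> (nat \<Rightarrow> tm) \<Rightarrow> ty list \<Rightarrow> bool" where
  "typed_sub n \<Delta>' \<sigma> \<Delta> \<longleftrightarrow> (\<forall>i<length \<Delta>. typing n \<Delta>' (\<sigma> i) (\<Delta> ! i))"

lemma typed_sub_up:
  assumes "typed_sub n \<Delta>' \<sigma> \<Delta>" "wf_ctx n (S # \<Delta>')"
  shows "typed_sub n (S # \<Delta>') (up_sub_tm \<sigma>) (S # \<Delta>)"
  unfolding typed_sub_def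
proof (intro allI impI)
  fix i assume i: "i < length (S # \<Delta>)"
  have v: "typing n (S # \<Delta>') (Var 0) S"
    using typing.t_var[of "S # \<Delta>'" n 0] assms(2) by simp
  show "typing n (S # \<Delta>') (up_sub_tm \<sigma> i) ((S # \<Delta>) ! i)"
    using i assms v typing_ren_tm[OF _ assms(2) wf_ren_Suc]
    by (cases i) (auto simp: up_sub_tm_def typed_sub_def)
qed

lemma typed_sub_weaken:
  "typed_sub n \<Delta>' \<sigma> \<Delta> \<Longrightarrow> typed_sub (Suc n) (map weaken_ty \<Delta>') (\<lambda>i. weaken_ty_tm (\<sigma> i)) (map
      weaken_ty \<Delta>)"
  by (simp add: typed_sub_def typing_weaken_ty_tm)

lemma typing_sub_tm:
  "\<lbrakk>typing n \<Delta> t T; wf_ctx n \<Delta>'; typed_sub n \<Delta>' \<sigma> \<Delta>\<rbrakk> \<Longrightarrow> typing n \<Delta>' (sub_tm \<sigma> t) T"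
proof (induction arbitrary: \<Delta>' \<sigma> rule: typing.induct)
  case (t_lam n S \<Delta> t T)
  have "typing n (S # \<Delta>') (sub_tm (up_sub_tm \<sigma>) t) T"
    using t_lam typing_wf[OF t_lam(1)] by (simp add: typed_sub_up)
  then show ?case by (simp add: typing.t_lam)
next
  case (t_tlam n \<Delta> t T)
  have "typing (Suc n) (map weaken_ty \<Delta>') (sub_tm (\<lambda>i. weaken_ty_tm (\<sigma> i)) t) T"
    using t_tlam by (intro t_tlam.IH) (auto intro: typed_sub_weaken)
  then show ?case by (simp add: typing.t_tlam)
next
  case (t_app n \<Delta> t S T u)
  then show ?case using typing.t_app[of n \<Delta>' _ S] by simp
qed (auto intro: typing.intros simp: typed_sub_def)

lemma typed_sub_inst:
  assumes "typing n \<Delta> u S"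
  shows "typed_sub n \<Delta> (case_nat u Var) (S # \<Delta>)"
  using assms typing_wf[OF assms]
  by (auto simp: typed_sub_def less_Suc_eq_0_disj intro: typing.t_var)

lemma typing_eta:
  assumes "typing n \<Delta> t (Fun S T)"
  shows "typing n (S # \<Delta>) (ren_tm Suc t) (Fun S T)" "typing n (S # \<Delta>) (Var 0) S"
proof -
  have wf: "wf_ctx n (S # \<Delta>)" using typing_wf[OF assms] by simp
  show "typing n (S # \<Delta>) (ren_tm Suc t) (Fun S T)"
    by (rule typing_ren_tm[OF assms wf wf_ren_Suc])
  show "typing n (S # \<Delta>) (Var 0) S"
    using typing.t_var[of "S # \<Delta>" n 0] wf by simp
qed

lemma typing_teta:
  assumes "typing n \<Delta> t (All T)"
  shows "typing (Suc n) (map weaken_ty \<Delta>) (weaken_ty_tm t) (All (sub_ty (up_sub_ty (\<lambda>i. TVar (Suc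
      i))) T))"
  using typing_sub_ty_tm[OF assms wf_sub_weaken] unfolding map_weaken_ty_eq by simp

lemma typing_tbeta:
  assumes "typing (Suc n) (map weaken_ty \<Delta>) t T" "wf_ty n S"
  shows "typing n \<Delta> (sub_ty_tm (case_nat S TVar) t) (inst_ty T S)"
  using typing_sub_ty_tm[OF assms(1) wf_sub_inst[OF assms(2)]] unfolding map_inst_weaken_ty .

text \<open>The interpretation consults \<open>the_ty\<close>, so soundness of the congruence rules
  depends on both sides having the same type.\<close>

lemma beta_eta_typing: "beta_eta n \<Delta> s t T \<Longrightarrow> typing n \<Delta> s T \<and> typing n \<Delta> t T"
proof (induction rule: beta_eta.induct)
  case (e_beta n S \<Delta> t T u)
  then show ?case
    using typing_wf[OF e_beta(2)] typing_sub_tm[OF e_beta(1) _ typed_sub_inst[OF e_beta(2)]]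
    by (auto intro: typing.intros)
next
  case (e_eta n \<Delta> t S T)
  then show ?case using typing_eta[OF e_eta] by (auto intro: typing.intros)
next
  case (e_tbeta n \<Delta> t T S)
  then show ?case using typing_tbeta by (auto intro: typing.intros)
next
  case (e_teta n \<Delta> t T)
  have "typing (Suc n) (map weaken_ty \<Delta>) (TApp (weaken_ty_tm t) (TVar 0)) T"
    using typing.t_tapp[OF typing_teta[OF e_teta], of "TVar 0"] by (simp add: inst_ty_up_weaken)
  then show ?case using e_teta by (auto intro: typing.t_tlam)
qed (auto intro: typing.intros)

section \<open>Semantic substitution\<close>

context model
begin

section \<open>Types under renaming and substitution\<close>

lemma ty_int_All: "ty_int R n (All T) = rall n (ty_int R (Suc n) T)"
  by (simp add: rall_def)

lemma is_relfun_ty_int: "wf_ty n T \<Longrightarrow> is_relfun R n (ty_int R n T)"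
  by (induction T arbitrary: n)
    (simp_all add: is_relfun_rproj is_relfun_rexp ty_int_All is_relfun_rall del: ty_int.simps(3))

text \<open>A type substitution as a context map. Index 0 denotes the innermost variable, which is
  the last projection, so the list runs backwards through the indices.\<close>

definition tys :: "nat \<Rightarrow> (nat \<Rightarrow> ty) \<Rightarrow> nat \<Rightarrow> ('o, 'a) relfun list" where
  "tys n \<sigma> m = map (\<lambda>i. ty_int R n (\<sigma> (m - Suc i))) [0..<m]"

lemma relfuns_tys: "wf_sub n \<sigma> m \<Longrightarrow> relfuns n m (tys n \<sigma> m)"
  by (auto simp: relfuns_def tys_def wf_sub_def intro: is_relfun_ty_int)

lemma rsubst_TVar_tys:
  assumes "wf_sub n \<sigma> m" "i < m"
  shows "rsubst R n (ty_int R m (TVar i)) (tys n \<sigma> m) = ty_int R n (\<sigma> i)"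
  using rsubst_rproj[OF relfuns_tys[OF assms(1)], of "m - Suc i"] assms(2) by (simp add: tys_def)

text \<open>Stated for any \<tau> that behaves like a lifting, because renamings need it before the
  meaning of weakened types is known.\<close>

lemma tys_up:
  assumes "\<And>i. i < m \<Longrightarrow> ty_int R (Suc n) (\<tau> (Suc i)) = weak n (ty_int R n (\<sigma> i))" "\<tau> 0 = TVar 0"
  shows "tys (Suc n) \<tau> (Suc m) = ups n (tys n \<sigma> m)"
proof (rule nth_equalityI)
  fix i assume "i < length (tys (Suc n) \<tau> (Suc m))"
  then consider "i < m" | "i = m" by (force simp: tys_def)
  then show "tys (Suc n) \<tau> (Suc m) ! i = ups n (tys n \<sigma> m) ! i"
  proof cases
    case 1
    \<comment> \<open>Entry \<open>i\<close> of the longer list belongs to the index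
      \<open>m - i\<close>, which must be seen to be a successor for the premise on \<tau> to
      apply.\<close>
    then have "m - i = Suc (m - Suc i)" by simp
    with 1 assms show ?thesis by (simp add: tys_def ups_def nth_append del: upt_Suc)
  next
    case 2
    then show ?thesis using assms by (simp add: tys_def ups_def nth_append del: upt_Suc)
  qed
qed (simp add: tys_def ups_def)

text \<open>Renaming precedes substitution: lifting a substitution under a quantifier weakens its
  entries, and the meaning of weakening is an instance of this lemma.\<close>

lemma ty_int_ren_ty:
  "\<lbrakk>wf_ty m T; \<And>i. i < m \<Longrightarrow> \<rho> i < n\<rbrakk> \<Longrightarrow>
    ty_int R n (ren_ty \<rho> T) = rsubst R n (ty_int R m T) (tys n (\<lambda>i. TVar (\<rho> i)) m)"
proof (induction T arbitrary: m n \<rho>)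
  case (TVar i)
  then have "wf_sub n (\<lambda>i. TVar (\<rho> i)) m" by (simp add: wf_sub_def)
  from rsubst_TVar_tys[OF this, of i] show ?case using TVar by simp
next
  case (Fun S T)
  then have "wf_sub n (\<lambda>i. TVar (\<rho> i)) m" by (simp add: wf_sub_def)
  then show ?case
    using Fun.prems Fun.IH[of m \<rho> n] by (simp add: rsubst_rexp[OF relfuns_tys] is_relfun_ty_int)
next
  case (All T)
  have w: "wf_sub n (\<lambda>i. TVar (\<rho> i)) m" using All by (simp add: wf_sub_def)
  have "tys (Suc n) (\<lambda>i. TVar (up_ren \<rho> i)) (Suc m) = ups n (tys n (\<lambda>i. TVar (\<rho> i)) m)"
  proof (rule tys_up)
    fix i assume "i < m"
    then have "\<rho> i < n" using All by simp
    then show "ty_int R (Suc n) (TVar (up_ren \<rho> (Suc i))) = weak n (ty_int R n (TVar (\<rho> i)))"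
      using rsubst_rproj[OF relfuns_wks, of "n - Suc (\<rho> i)"] by (simp add: up_ren_def)
  qed (simp add: up_ren_def)
  moreover have "up_ren \<rho> i < Suc n" if "i < Suc m" for i
    using that All by (cases i) (auto simp: up_ren_def)
  ultimately show ?case
    using All.prems All.IH[of "Suc m" "up_ren \<rho>" "Suc n"] rsubst_rall[OF _ relfuns_tys[OF w]]
    by (simp add: ty_int_All is_relfun_ty_int del: ty_int.simps(3))
qed

lemma tys_weaken: "tys (Suc n) (\<lambda>i. TVar (Suc i)) n = wks n"
  by (rule nth_equalityI) (auto simp: tys_def)

lemma ty_int_weaken_ty: "wf_ty n T \<Longrightarrow> ty_int R (Suc n) (weaken_ty T) = weak n (ty_int R n T)"
  using ty_int_ren_ty[of n T Suc "Suc n"] by (simp add: tys_weaken)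

lemma tys_up_sub_ty: "wf_sub n \<sigma> m \<Longrightarrow> tys (Suc n) (up_sub_ty \<sigma>) (Suc m) = ups n (tys n \<sigma> m)"
  by (rule tys_up) (auto simp: up_sub_ty_def ty_int_weaken_ty wf_sub_def)

text \<open>At a quantifier the lifted substitution becomes \<open>ups\<close> by
  \<open>tys_up_sub_ty\<close>, and stability of quantification in the form
  \<open>rsubst_rall\<close> closes the case.\<close>

lemma ty_int_sub_ty:
  "\<lbrakk>wf_ty m T; wf_sub n \<sigma> m\<rbrakk> \<Longrightarrow> ty_int R n (sub_ty \<sigma> T) = rsubst R n (ty_int R m T) (tys n \<sigma> m)"
proof (induction T arbitrary: m n \<sigma>)
  case (TVar i)
  then show ?case using rsubst_TVar_tys[of n \<sigma> m i] by simp
next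
  case (Fun S T)
  show ?case
    using Fun.prems Fun.IH(1)[of m n \<sigma>] Fun.IH(2)[of m n \<sigma>]
    by (simp add: rsubst_rexp[OF relfuns_tys] is_relfun_ty_int)
next
  case (All T)
  show ?case
    using All.prems All.IH[of "Suc m" "Suc n" "up_sub_ty \<sigma>"] rsubst_rall[OF _ relfuns_tys[OF
        All.prems(2)]]
    by (simp add: ty_int_All is_relfun_ty_int wf_sub_up tys_up_sub_ty del: ty_int.simps(3))
qed

lemma tys_inst: "tys n (case_nat S TVar) (Suc n) = ids n @ [ty_int R n S]"
proof (rule nth_equalityI)
  fix i assume "i < length (tys n (case_nat S TVar) (Suc n))"
  then consider "i < n" | "i = n" by (force simp: tys_def)
  then show "tys n (case_nat S TVar) (Suc n) ! i = (ids n @ [ty_int R n S]) ! i"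
  proof cases
    case 1
    then have "n - i = Suc (n - Suc i)" by simp
    with 1 show ?thesis by (simp add: tys_def nth_append del: upt_Suc)
  qed (simp add: tys_def nth_append del: upt_Suc)
qed (simp add: tys_def)

section \<open>Contexts, variables and terms under type substitution\<close>

lemma is_relfun_ctx_int: "wf_ctx n \<Delta> \<Longrightarrow> is_relfun R n (ctx_int R n \<Delta>)"
  by (induction \<Delta>) (simp_all add: is_relfun_rone is_relfun_rprod is_relfun_ty_int)

lemma ctx_int_sub_ty:
  assumes "wf_sub n \<sigma> m"
  shows "wf_ctx m \<Delta> \<Longrightarrow> ctx_int R n (map (sub_ty \<sigma>) \<Delta>) = rsubst R n (ctx_int R m \<Delta>) (tys n \<sigma> m)"
  by (induction \<Delta>)
    (simp_all add: assms rsubst_rone[OF relfuns_tys] rsubst_rprod[OF relfuns_tys] is_relfun_ctx_int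
        is_relfun_ty_int
      ty_int_sub_ty[OF _ assms])

lemma ctx_int_weaken_ty: "wf_ctx n \<Delta> \<Longrightarrow> ctx_int R (Suc n) (map weaken_ty \<Delta>) = weak n (ctx_int R n \<Delta>)"
  unfolding map_weaken_ty_eq ctx_int_sub_ty[OF wf_sub_weaken] tys_weaken ..

lemma var_int_in:
  "\<lbrakk>wf_ctx n \<Delta>; i < length \<Delta>\<rbrakk> \<Longrightarrow> is_relnat R n (var_int R n \<Delta> i) \<and>
    rdom (var_int R n \<Delta> i) = ctx_int R n \<Delta> \<and> rcod (var_int R n \<Delta> i) = ty_int R n (\<Delta> ! i)"
proof (induction \<Delta> arbitrary: i)
  case (Cons S \<Delta>)
  note [simp] = is_relfun_ctx_int is_relfun_ty_int is_relnat_rfst is_relnat_rsnd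
  show ?case
  proof (cases i)
    case 0
    then show ?thesis using Cons by simp
  next
    case (Suc j)
    then show ?thesis using Cons by (auto intro: is_relnat_rcomp)
  qed
qed simp

lemma var_int_sub_ty:
  assumes \<sigma>: "wf_sub n \<sigma> m"
  shows "\<lbrakk>wf_ctx m \<Delta>; i < length \<Delta>\<rbrakk> \<Longrightarrow>
    var_int R n (map (sub_ty \<sigma>) \<Delta>) i = rwhisker R n (var_int R m \<Delta> i) (tys n \<sigma> m)"
proof (induction \<Delta> arbitrary: i)
  case (Cons S \<Delta>)
  note [simp] = is_relfun_ctx_int is_relfun_ty_int is_relnat_rfst is_relnat_rsnd ctx_int_sub_ty[OF
      \<sigma>] ty_int_sub_ty[OF _ \<sigma>]
    rwhisker_rfst[OF relfuns_tys[OF \<sigma>]] rwhisker_rsnd[OF relfuns_tys[OF \<sigma>]] rwhisker_rcomp[OF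
        relfuns_tys[OF \<sigma>]]
  show ?case
  proof (cases i)
    case 0
    then show ?thesis using Cons by simp
  next
    case (Suc j)
    then show ?thesis using Cons var_int_in[of \<Delta> m j] by simp
  qed
qed simp

text \<open>Translates the defining clause, a composite of vertical arrows of
  \<open>IntCat R\<close>, into a transpose of natural transformations.\<close>

lemma tm_int_TLam:
  assumes "wf_ctx n \<Delta>" "is_relnat R (Suc n) (tm_int R (Suc n) (map weaken_ty \<Delta>) t)"
  shows "tm_int R n \<Delta> (TLam t) = tlam n (ctx_int R n \<Delta>) (tm_int R (Suc n) (map weaken_ty \<Delta>) t)"
  using assms is_relfun_ctx_int[OF assms(1)]
  by (simp add: all_fun_arr all_unit_vert Comp_vert is_relnat_rall_map tlam_def)

lemma tm_int_TApp:
  assumes "typing n \<Delta> t (All T)"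
  shows "tm_int R n \<Delta> (TApp t S) = rcomp R (rwhisker R n (counit n (ty_int R (Suc n) T)) (ids n @
      [ty_int R n S])) (tm_int R n \<Delta> t)"
  using typing_the_ty[OF assms] by (simp add: counit_def)

lemma relfuns_inst: "is_relfun R n F \<Longrightarrow> relfuns n (Suc n) (ids n @ [F])"
  using relfuns_ids[of n] by (auto simp: relfuns_def)

lemma map_inst_wks: "is_relfun R n F \<Longrightarrow> map (\<lambda>G. rsubst R n G (ids n @ [F])) (wks n) = ids n"
  using rsubst_rproj[OF relfuns_inst] by (intro nth_equalityI) (auto simp: nth_append)

text \<open>Weakening followed by instantiation is the identity, so the weakened entries return
  unchanged and only the last projection is replaced.\<close>

lemma map_inst_ups:
  assumes Es: "relfuns n m Es" and F: "is_relfun R n F"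
  shows "map (\<lambda>G. rsubst R n G (ids n @ [F])) (ups n Es) = Es @ [F]"
proof -
  note i = relfuns_inst[OF F] and w = map_inst_wks[OF F]
  have "rsubst R n (weak n E) (ids n @ [F]) = E" if "E \<in> set Es" for E
  proof -
    have E: "is_relfun R n E" using that Es by (auto simp: relfuns_def)
    show ?thesis unfolding rsubst_rsubst[OF E relfuns_wks i] w by (rule rsubst_ids[OF E])
  qed
  moreover have "rsubst R n (rproj R (Suc n) n) (ids n @ [F]) = F"
    using rsubst_rproj[OF i, of n] by (simp add: nth_append)
  ultimately show "map (\<lambda>G. rsubst R n G (ids n @ [F])) (ups n Es) = Es @ [F]"
    by (simp add: ups_def map_idI)
qed

text \<open>The source is \<open>rall n T\<close> itself because instantiating a weakened functor
  has no effect.\<close>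

lemma tapp_in:
  assumes T: "is_relfun R (Suc n) T" and F: "is_relfun R n F"
  shows "is_relnat R n (rwhisker R n (counit n T) (ids n @ [F]))"
    "rdom (rwhisker R n (counit n T) (ids n @ [F])) = rall n T"
    "rcod (rwhisker R n (counit n T) (ids n @ [F])) = rsubst R n T (ids n @ [F])"
proof -
  note i = relfuns_inst[OF F]
  show "is_relnat R n (rwhisker R n (counit n T) (ids n @ [F]))"
    by (rule is_relnat_rwhisker[OF is_relnat_counit[OF T] i])
  show "rdom (rwhisker R n (counit n T) (ids n @ [F])) = rall n T"
    unfolding rwhisker_sel counit_sel[OF T] rsubst_rsubst[OF is_relfun_rall[OF T] relfuns_wks i]
        map_inst_wks[OF F]
    by (rule rsubst_ids[OF is_relfun_rall[OF T]])
  show "rcod (rwhisker R n (counit n T) (ids n @ [F])) = rsubst R n T (ids n @ [F])"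
    by (simp add: counit_sel[OF T])
qed

lemma tm_int_in:
  "typing n \<Delta> t T \<Longrightarrow> is_relnat R n (tm_int R n \<Delta> t) \<and> rdom (tm_int R n \<Delta> t) = ctx_int R n \<Delta> \<and>
    rcod (tm_int R n \<Delta> t) = ty_int R n T"
proof (induction rule: typing.induct)
  case (t_var \<Delta> n i)
  then show ?case using var_int_in by simp
next
  case (t_lam n S \<Delta> t T)
  then show ?case
    using typing_wf[OF t_lam(1)] typing_the_ty[OF t_lam(1)]
    by (simp add: is_relnat_rcurry is_relfun_ctx_int is_relfun_ty_int)
next
  case (t_app n \<Delta> t S T u)
  have "wf_ty n S" "wf_ty n T" using typing_wf[OF t_app(1)] by simp_all
  then have "is_relnat R n (reval R n (ty_int R n S) (ty_int R n T))" by (simp add: is_relnat_reval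
      is_relfun_ty_int)
  moreover have "is_relnat R n (rpair R n (tm_int R n \<Delta> t) (tm_int R n \<Delta> u))"
    using t_app by (intro is_relnat_rpair) simp_all
  ultimately show ?case
    using t_app typing_the_ty[OF t_app(1)] by (auto intro!: is_relnat_rcomp)
next
  case (t_tlam n \<Delta> t T)
  have wf: "wf_ctx n \<Delta>" using typing_wf[OF t_tlam(1)] by simp
  note t = t_tlam.IH[unfolded ctx_int_weaken_ty[OF wf]]
  show ?case
    using t is_relnat_tlam[OF is_relfun_ctx_int[OF wf]] tlam_sel[OF is_relfun_ctx_int[OF wf]]
    by (simp add: tm_int_TLam[OF wf] ty_int_All del: tm_int.simps ty_int.simps)
next
  case (t_tapp n \<Delta> t T S)
  have T: "is_relfun R (Suc n) (ty_int R (Suc n) T)" and S: "is_relfun R n (ty_int R n S)"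
    and wf: "wf_ty (Suc n) T"
    using typing_wf[OF t_tapp(1)] t_tapp(2) by (simp_all add: is_relfun_ty_int)
  show ?case
    unfolding tm_int_TApp[OF t_tapp(1)] ty_int_sub_ty[OF wf wf_sub_inst[OF t_tapp(2)]] tys_inst
    using tapp_in[OF T S] t_tapp by (simp add: is_relnat_rcomp ty_int_All del: ty_int.simps)
qed

text \<open>Whiskering is a strict cartesian closed functor that also commutes with transposes and
  counits, so it follows the structure of terms. The substitution lemma for types identifies the
  sources and targets of the two sides.\<close>

lemma tm_int_sub_ty_tm:
  "\<lbrakk>typing m \<Delta> t T; wf_sub n \<sigma> m\<rbrakk> \<Longrightarrow>
    tm_int R n (map (sub_ty \<sigma>) \<Delta>) (sub_ty_tm \<sigma> t) = rwhisker R n (tm_int R m \<Delta> t) (tys n \<sigma> m)"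
proof (induction arbitrary: n \<sigma> rule: typing.induct)
  case (t_var \<Delta> m i)
  then show ?case by (simp add: var_int_sub_ty)
next
  case (t_lam m S \<Delta> t T)
  note wf = typing_wf[OF t_lam(1)] and t = tm_int_in[OF t_lam(1)] and rel = relfuns_tys[OF
      t_lam.prems]
  have ty: "the_ty (sub_ty \<sigma> S # map (sub_ty \<sigma>) \<Delta>) (sub_ty_tm \<sigma> t) = sub_ty \<sigma> T"
    using typing_the_ty[OF typing_sub_ty_tm[OF t_lam(1) t_lam.prems]] by simp
  have "tm_int R n (map (sub_ty \<sigma>) \<Delta>) (sub_ty_tm \<sigma> (Lam S t))
      = rcurry R n (rsubst R n (ctx_int R m \<Delta>) (tys n \<sigma> m)) (rsubst R n (ty_int R m S) (tys n \<sigma> m))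
          (rsubst R n (ty_int R m T) (tys n \<sigma> m)) (rwhisker R n (tm_int R m (S # \<Delta>) t) (tys n \<sigma> m))"
    using wf t_lam.IH[OF t_lam.prems] t_lam.prems by (simp add: ty ctx_int_sub_ty ty_int_sub_ty[of
        m _ n \<sigma>])
  also have "\<dots> = rwhisker R n (rcurry R m (ctx_int R m \<Delta>) (ty_int R m S) (ty_int R m T) (tm_int R m
      (S # \<Delta>) t)) (tys n \<sigma> m)"
    using wf t by (intro rwhisker_rcurry[OF rel, symmetric]) (simp_all add: is_relfun_ctx_int
        is_relfun_ty_int)
  finally show ?case using typing_the_ty[OF t_lam(1)] by simp
next
  case (t_app m \<Delta> t S T u)
  note wf = typing_wf[OF t_app(1)] and t = tm_int_in[OF t_app(1)] and u = tm_int_in[OF t_app(2)]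
    and rel = relfuns_tys[OF t_app.prems]
  have ty: "the_ty (map (sub_ty \<sigma>) \<Delta>) (sub_ty_tm \<sigma> t) = Fun (sub_ty \<sigma> S) (sub_ty \<sigma> T)"
    using typing_the_ty[OF typing_sub_ty_tm[OF t_app(1) t_app.prems]] by simp
  have S: "is_relfun R m (ty_int R m S)" "is_relfun R m (ty_int R m T)"
    using wf by (simp_all add: is_relfun_ty_int)
  have p: "is_relnat R m (rpair R m (tm_int R m \<Delta> t) (tm_int R m \<Delta> u))"
    using t u by (simp add: is_relnat_rpair)
  show ?case
    using wf t u S p t_app.IH(1)[OF t_app.prems] t_app.IH(2)[OF t_app.prems] t_app.prems
        typing_the_ty[OF t_app(1)]
    by (simp add: ty ty_int_sub_ty[of m _ n \<sigma>] rwhisker_rcomp[OF rel] rwhisker_rpair[OF rel]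
        rwhisker_reval[OF rel]
        is_relnat_reval)
next
  case (t_tlam m \<Delta> t T)
  note t = tm_int_in[OF t_tlam(1)] and rel = relfuns_tys[OF t_tlam.prems]
  have wf: "wf_ctx m \<Delta>" using typing_wf[OF t_tlam(1)] by simp
  have wf': "wf_ctx n (map (sub_ty \<sigma>) \<Delta>)" using wf t_tlam.prems by (auto intro: wf_ty_sub_ty)
  have IH: "tm_int R (Suc n) (map weaken_ty (map (sub_ty \<sigma>) \<Delta>)) (sub_ty_tm (up_sub_ty \<sigma>) t)
      = rwhisker R (Suc n) (tm_int R (Suc m) (map weaken_ty \<Delta>) t) (ups n (tys n \<sigma> m))"
    unfolding map_up_sub_weaken_ty t_tlam.IH[OF wf_sub_up[OF t_tlam.prems]] tys_up_sub_ty[OF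
        t_tlam.prems] ..
  have r: "is_relnat R (Suc n) (tm_int R (Suc n) (map weaken_ty (map (sub_ty \<sigma>) \<Delta>)) (sub_ty_tm
      (up_sub_ty \<sigma>) t))"
    unfolding IH using t by (intro is_relnat_rwhisker[OF _ relfuns_ups[OF rel]]) simp
  have d: "rdom (tm_int R (Suc m) (map weaken_ty \<Delta>) t) = weak m (ctx_int R m \<Delta>)"
    using t by (simp only: ctx_int_weaken_ty[OF wf])
  have "tm_int R n (map (sub_ty \<sigma>) \<Delta>) (sub_ty_tm \<sigma> (TLam t)) = tlam n (rsubst R n (ctx_int R m \<Delta>)
      (tys n \<sigma> m))
      (rwhisker R (Suc n) (tm_int R (Suc m) (map weaken_ty \<Delta>) t) (ups n (tys n \<sigma> m)))"
    unfolding sub_ty_tm.simps tm_int_TLam[OF wf' r] IH ctx_int_sub_ty[OF t_tlam.prems wf] ..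
  also have "\<dots> = rwhisker R n (tlam m (ctx_int R m \<Delta>) (tm_int R (Suc m) (map weaken_ty \<Delta>) t)) (tys
      n \<sigma> m)"
    using t by (intro rwhisker_tlam[symmetric, OF is_relfun_ctx_int[OF wf] _ d rel]) simp
  also have "tlam m (ctx_int R m \<Delta>) (tm_int R (Suc m) (map weaken_ty \<Delta>) t) = tm_int R m \<Delta> (TLam t)"
    using t by (intro tm_int_TLam[OF wf, symmetric]) simp
  finally show ?case .
next
  case (t_tapp m \<Delta> t T S)
  note t = tm_int_in[OF t_tapp(1)] and rel = relfuns_tys[OF t_tapp.prems]
  have wfT: "wf_ty (Suc m) T" using typing_wf[OF t_tapp(1)] by simp
  have T: "is_relfun R (Suc m) (ty_int R (Suc m) T)" and S: "is_relfun R m (ty_int R m S)"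
    using wfT t_tapp(2) by (simp_all add: is_relfun_ty_int)
  have S': "is_relfun R n (ty_int R n (sub_ty \<sigma> S))"
    using t_tapp by (intro is_relfun_ty_int wf_ty_sub_ty)
  have t': "typing n (map (sub_ty \<sigma>) \<Delta>) (sub_ty_tm \<sigma> t) (All (sub_ty (up_sub_ty \<sigma>) T))"
    using typing_sub_ty_tm[OF t_tapp(1) t_tapp.prems] by simp
  let ?E = "tys n \<sigma> m" and ?c = "counit m (ty_int R (Suc m) T)"
  \<comment> \<open>Both sides are the counit whiskered along the same context map: lifting the
    substitution and then instantiating with the substituted type agrees with instantiating first
    and substituting afterwards.\<close>
  have "rwhisker R n (counit n (ty_int R (Suc n) (sub_ty (up_sub_ty \<sigma>) T))) (ids n @ [ty_int R n
      (sub_ty \<sigma> S)])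
      = rwhisker R n (rwhisker R (Suc n) ?c (ups n ?E)) (ids n @ [ty_int R n (sub_ty \<sigma> S)])"
    using wfT t_tapp.prems by (simp add: ty_int_sub_ty[OF wfT wf_sub_up] tys_up_sub_ty
        rwhisker_counit[OF T rel])
  also have "\<dots> = rwhisker R n ?c (?E @ [ty_int R n (sub_ty \<sigma> S)])"
    unfolding rwhisker_rwhisker[OF is_relnat_counit[OF T] relfuns_ups[OF rel] relfuns_inst[OF S']]
        map_inst_ups[OF rel S'] ..
  also have "?E @ [ty_int R n (sub_ty \<sigma> S)] = map (\<lambda>F. rsubst R n F ?E) (ids m @ [ty_int R m S])"
    using rsubst_rproj[OF rel] relfunsD(1)[OF rel] ty_int_sub_ty[OF t_tapp(2) t_tapp.prems]
    by (intro nth_equalityI) (auto simp: nth_append)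
  also have "rwhisker R n ?c \<dots> = rwhisker R n (rwhisker R m ?c (ids m @ [ty_int R m S])) ?E"
    by (rule rwhisker_rwhisker[OF is_relnat_counit[OF T] relfuns_inst[OF S] rel, symmetric])
  finally have e: "rwhisker R n (counit n (ty_int R (Suc n) (sub_ty (up_sub_ty \<sigma>) T))) (ids n @
      [ty_int R n (sub_ty \<sigma> S)])
      = rwhisker R n (rwhisker R m ?c (ids m @ [ty_int R m S])) ?E" .
  show ?case
    unfolding sub_ty_tm.simps tm_int_TApp[OF t'] tm_int_TApp[OF t_tapp(1)] e t_tapp.IH[OF
        t_tapp.prems]
    using t tapp_in[OF T S] by (intro rwhisker_rcomp[OF rel, symmetric]) (simp_all add: ty_int_All
        del: ty_int.simps)
qed

lemma tm_int_weaken_ty_tm: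
  assumes "typing n \<Delta> t T"
  shows "tm_int R (Suc n) (map weaken_ty \<Delta>) (weaken_ty_tm t) = wk n (tm_int R n \<Delta> t)"
  using tm_int_sub_ty_tm[OF assms wf_sub_weaken] unfolding map_weaken_ty_eq tys_weaken .

lemma var_int_weaken_ty:
  assumes "wf_ctx n \<Delta>" "i < length \<Delta>"
  shows "var_int R (Suc n) (map weaken_ty \<Delta>) i = wk n (var_int R n \<Delta> i)"
  using var_int_sub_ty[OF wf_sub_weaken assms] unfolding map_weaken_ty_eq tys_weaken .

section \<open>Terms composed with maps between context interpretations\<close>

definition ctx_map :: "nat \<Rightarrow> ty list \<Rightarrow> ty list \<Rightarrow> ('o, 'a) relnat \<Rightarrow> bool" where
  "ctx_map n \<Delta>' \<Delta> \<theta> \<longleftrightarrow> is_relnat R n \<theta> \<and> rdom \<theta> = ctx_int R n \<Delta>' \<and> rcod \<theta> = ctx_int R n \<Delta>"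

text \<open>The semantic counterpart of \<open>up_ren\<close> and of
  \<open>up_sub_tm\<close>.\<close>

definition ctx_up :: "nat \<Rightarrow> ty list \<Rightarrow> ty \<Rightarrow> ('o, 'a) relnat \<Rightarrow> ('o, 'a) relnat" where
  "ctx_up n \<Delta>' S \<theta> = pmap (fcc n) \<theta> (rid R (ty_int R n S))"

context
  fixes n \<Delta>' \<Delta> \<theta>
  assumes \<theta>: "ctx_map n \<Delta>' \<Delta> \<theta>" and wf: "wf_ctx n \<Delta>'" "wf_ctx n \<Delta>"
begin

interpretation cc: ccc "fcc n" by (rule ccc_fcc)

private lemma \<theta>D: "is_relnat R n \<theta>" "rdom \<theta> = ctx_int R n \<Delta>'" "rcod \<theta> = ctx_int R n \<Delta>"
  using \<theta> by (simp_all add: ctx_map_def)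

private lemmas ctxs = is_relfun_ctx_int[OF wf(1)] is_relfun_ctx_int[OF wf(2)]

lemma ctx_map_weaken: "ctx_map (Suc n) (map weaken_ty \<Delta>') (map weaken_ty \<Delta>) (wk n \<theta>)"
  using \<theta>D by (simp add: ctx_map_def is_relnat_wk ctx_int_weaken_ty wf)

lemma ctx_map_up:
  assumes "wf_ty n S"
  shows "ctx_map n (S # \<Delta>') (S # \<Delta>) (ctx_up n \<Delta>' S \<theta>)"
  using \<theta>D cc.pmap_in[of \<theta> "rid R (ty_int R n S)"] cc.Dom_pmap[of \<theta> "rid R (ty_int R n S)"]
    cc.Cod_pmap[of \<theta> "rid R (ty_int R n S)"] is_relnat_rid[OF is_relfun_ty_int[OF assms]]
  by (simp add: ctx_map_def ctx_up_def fcc_sel)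

lemma rsnd_ctx_up:
  assumes "wf_ty n S"
  shows "rcomp R (rsnd R n (ctx_int R n \<Delta>) (ty_int R n S)) (ctx_up n \<Delta>' S \<theta>) = rsnd R n (ctx_int R
      n \<Delta>') (ty_int R n S)"
  using \<theta>D ctxs is_relfun_ty_int[OF assms] is_relnat_rid[OF is_relfun_ty_int[OF assms]]
      is_relnat_rsnd
    cc.psnd_pmap[of \<theta> "rid R (ty_int R n S)" "ctx_int R n \<Delta>" "ty_int R n S"]
  by (simp add: ctx_up_def fcc_sel relnat_rcomp_rid[of n])

lemma rfst_ctx_up:
  assumes "wf_ty n S"
  shows "rcomp R (rfst R n (ctx_int R n \<Delta>) (ty_int R n S)) (ctx_up n \<Delta>' S \<theta>)
    = rcomp R \<theta> (rfst R n (ctx_int R n \<Delta>') (ty_int R n S))"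
  using \<theta>D ctxs is_relfun_ty_int[OF assms] is_relnat_rid[OF is_relfun_ty_int[OF assms]]
    cc.pfst_pmap[of \<theta> "rid R (ty_int R n S)" "ctx_int R n \<Delta>" "ty_int R n S"]
  by (simp add: ctx_up_def fcc_sel)

text \<open>The family \<open>x\<close> stands for the interpretations of renamed variables or of
  substituted terms, so that both inductions can use the lemma.\<close>

lemma var_int_ctx_up:
  assumes S: "wf_ty n S" and x: "\<And>i. i < length \<Delta> \<Longrightarrow> x i = rcomp R (var_int R n \<Delta> i) \<theta>" and i: "i <
      length \<Delta>"
  shows "rcomp R (var_int R n (S # \<Delta>) (Suc i)) (ctx_up n \<Delta>' S \<theta>)
    = rcomp R (x i) (rfst R n (ctx_int R n \<Delta>') (ty_int R n S))"
proof -
  note v = var_int_in[OF wf(2) i] and up = ctx_map_up[OF S, unfolded ctx_map_def]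
  have f: "is_relnat R n (rfst R n (ctx_int R n \<Delta>) (ty_int R n S))"
    "is_relnat R n (rfst R n (ctx_int R n \<Delta>') (ty_int R n S))"
    using ctxs is_relfun_ty_int[OF S] by (simp_all add: is_relnat_rfst)
  have "rcomp R (var_int R n (S # \<Delta>) (Suc i)) (ctx_up n \<Delta>' S \<theta>)
      = rcomp R (var_int R n \<Delta> i) (rcomp R (rfst R n (ctx_int R n \<Delta>) (ty_int R n S)) (ctx_up n \<Delta>' S
          \<theta>))"
    unfolding var_int.simps by (rule relnat_rcomp_assoc[of n]) (use v up f in simp_all)
  also have "\<dots> = rcomp R (rcomp R (var_int R n \<Delta> i) \<theta>) (rfst R n (ctx_int R n \<Delta>') (ty_int R n S))"
    unfolding rfst_ctx_up[OF S] by (rule relnat_rcomp_assoc[of n, symmetric]) (use v f \<theta>D in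
        simp_all)
  finally show ?thesis using x[OF i] by simp
qed

text \<open>Naturality of transposition in the context. This lemma and its analogues for the other
  term constructors are the inductive steps common to renaming and substitution; all that relates
  the two terms is the premise \<open>eq\<close> and their typing.\<close>

lemma tm_int_Lam_comp:
  assumes t: "typing n (S # \<Delta>) t T" and t': "typing n (S # \<Delta>') t' T"
    and eq: "tm_int R n (S # \<Delta>') t' = rcomp R (tm_int R n (S # \<Delta>) t) (ctx_up n \<Delta>' S \<theta>)"
  shows "tm_int R n \<Delta>' (Lam S t') = rcomp R (tm_int R n \<Delta> (Lam S t)) \<theta>"
proof -
  have S: "is_relfun R n (ty_int R n S)" using typing_wf[OF t] by (simp add: is_relfun_ty_int)
  show ?thesis
    using cc.cur_comp[of "tm_int R n (S # \<Delta>) t" "ctx_int R n \<Delta>" "ty_int R n S" "ty_int R n T" \<theta>]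
      tm_int_in[OF t] ctxs S \<theta>D eq typing_the_ty[OF t] typing_the_ty[OF t']
    by (simp add: fcc_sel ctx_up_def)
qed

lemma tm_int_App_comp:
  assumes t: "typing n \<Delta> t (Fun S T)" and t': "typing n \<Delta>' t' (Fun S T)" and u: "typing n \<Delta> u S"
      and u': "typing n \<Delta>' u' S"
    and eq: "tm_int R n \<Delta>' t' = rcomp R (tm_int R n \<Delta> t) \<theta>" "tm_int R n \<Delta>' u' = rcomp R (tm_int R n
        \<Delta> u) \<theta>"
  shows "tm_int R n \<Delta>' (App t' u') = rcomp R (tm_int R n \<Delta> (App t u)) \<theta>"
proof -
  have S: "is_relfun R n (ty_int R n S)" "is_relfun R n (ty_int R n T)"
    using typing_wf[OF t] by (simp_all add: is_relfun_ty_int)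
  have p: "is_relnat R n (rpair R n (tm_int R n \<Delta> t) (tm_int R n \<Delta> u))"
    using tm_int_in[OF t] tm_int_in[OF u] by (simp add: is_relnat_rpair)
  have "rpair R n (tm_int R n \<Delta>' t') (tm_int R n \<Delta>' u') = rcomp R (rpair R n (tm_int R n \<Delta> t)
      (tm_int R n \<Delta> u)) \<theta>"
    using cc.ppair_comp[of "tm_int R n \<Delta> t" "tm_int R n \<Delta> u" \<theta>] tm_int_in[OF t] tm_int_in[OF u] \<theta>D
    by (simp add: fcc_sel eq)
  moreover have "rcomp R (rcomp R (reval R n (ty_int R n S) (ty_int R n T)) (rpair R n (tm_int R n
      \<Delta> t) (tm_int R n \<Delta> u))) \<theta>
      = rcomp R (reval R n (ty_int R n S) (ty_int R n T)) (rcomp R (rpair R n (tm_int R n \<Delta> t)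
          (tm_int R n \<Delta> u)) \<theta>)"
    by (rule relnat_rcomp_assoc) (use tm_int_in[OF t] tm_int_in[OF u] \<theta>D p is_relnat_reval[OF S] in
        simp_all)
  ultimately show ?thesis
    using typing_the_ty[OF t] typing_the_ty[OF t'] by simp
qed

lemma tm_int_TLam_comp:
  assumes t: "typing (Suc n) (map weaken_ty \<Delta>) t T" and t': "typing (Suc n) (map weaken_ty \<Delta>') t' T"
    and eq: "tm_int R (Suc n) (map weaken_ty \<Delta>') t' = rcomp R (tm_int R (Suc n) (map weaken_ty \<Delta>)
        t) (wk n \<theta>)"
  shows "tm_int R n \<Delta>' (TLam t') = rcomp R (tm_int R n \<Delta> (TLam t)) \<theta>"
proof -
  note tD = tm_int_in[OF t, unfolded ctx_int_weaken_ty[OF wf(2)]]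
  show ?thesis
    using tD tm_int_in[OF t'] \<theta>D tlam_rcomp[OF ctxs(2), of "tm_int R (Suc n) (map weaken_ty \<Delta>) t" \<theta>
        "ctx_int R n \<Delta>'"]
    by (simp add: tm_int_TLam wf eq[symmetric] del: tm_int.simps)
qed

lemma tm_int_TApp_comp:
  assumes t: "typing n \<Delta> t (All T)" and t': "typing n \<Delta>' t' (All T)" and S: "wf_ty n S"
    and eq: "tm_int R n \<Delta>' t' = rcomp R (tm_int R n \<Delta> t) \<theta>"
  shows "tm_int R n \<Delta>' (TApp t' S) = rcomp R (tm_int R n \<Delta> (TApp t S)) \<theta>"
proof -
  have T: "is_relfun R (Suc n) (ty_int R (Suc n) T)" using typing_wf[OF t] by (simp add:
      is_relfun_ty_int)
  show ?thesis
    unfolding tm_int_TApp[OF t] tm_int_TApp[OF t'] eq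
    by (rule relnat_rcomp_assoc[symmetric])
      (use tm_int_in[OF t] \<theta>D tapp_in[OF T is_relfun_ty_int[OF S]] in \<open>simp_all add: ty_int_All
          del: ty_int.simps\<close>)
qed

end

text \<open>Lets the hypothesis on variables pass under a type abstraction, since whiskering
  preserves composition.\<close>

lemma var_int_wk_comp:
  assumes "ctx_map n \<Delta>' \<Delta> \<theta>" "wf_ctx n \<Delta>" "i < length \<Delta>"
  shows "rcomp R (var_int R (Suc n) (map weaken_ty \<Delta>) i) (wk n \<theta>) = wk n (rcomp R (var_int R n \<Delta> i)
      \<theta>)"
  using assms var_int_in[OF assms(2,3)]
  by (simp add: ctx_map_def var_int_weaken_ty rwhisker_rcomp[OF relfuns_wks])

text \<open>Needed before substitution, because lifting a term substitution under a binder renames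
  its entries along \<open>Suc\<close>.\<close>

lemma tm_int_ren_tm:
  "\<lbrakk>typing n \<Delta> t T; wf_ctx n \<Delta>'; wf_ren \<Delta>' \<rho> \<Delta>; ctx_map n \<Delta>' \<Delta> \<theta>;
    \<And>i. i < length \<Delta> \<Longrightarrow> var_int R n \<Delta>' (\<rho> i) = rcomp R (var_int R n \<Delta> i) \<theta>\<rbrakk> \<Longrightarrow>
    tm_int R n \<Delta>' (ren_tm \<rho> t) = rcomp R (tm_int R n \<Delta> t) \<theta>"
proof (induction arbitrary: \<Delta>' \<rho> \<theta> rule: typing.induct)
  case (t_var \<Delta> n i)
  then show ?case by simp
next
  case (t_lam n S \<Delta> t T)
  have S: "wf_ty n S" and wf: "wf_ctx n \<Delta>" "wf_ctx n (S # \<Delta>')"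
    using typing_wf[OF t_lam(1)] t_lam.prems(1) by simp_all
  have "tm_int R n (S # \<Delta>') (ren_tm (up_ren \<rho>) t) = rcomp R (tm_int R n (S # \<Delta>) t) (ctx_up n \<Delta>' S
      \<theta>)"
  proof (rule t_lam.IH[OF wf(2) wf_ren_up[OF t_lam.prems(2)] ctx_map_up[OF t_lam.prems(3,1) wf(1)
      S]])
    fix i assume "i < length (S # \<Delta>)"
    then show "var_int R n (S # \<Delta>') (up_ren \<rho> i) = rcomp R (var_int R n (S # \<Delta>) i) (ctx_up n \<Delta>' S
        \<theta>)"
      using rsnd_ctx_up[OF t_lam.prems(3,1) wf(1) S]
        var_int_ctx_up[OF t_lam.prems(3,1) wf(1) S, of "\<lambda>i. var_int R n \<Delta>' (\<rho> i)"] t_lam.prems(4)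
      by (cases i) (simp_all add: up_ren_def)
  qed
  then show ?case
    unfolding ren_tm.simps
    by (rule tm_int_Lam_comp[OF t_lam.prems(3,1) wf(1) t_lam(1) typing_ren_tm[OF t_lam(1) wf(2)
        wf_ren_up[OF t_lam.prems(2)]]])
next
  case (t_app n \<Delta> t S T u)
  have wf: "wf_ctx n \<Delta>" using typing_wf[OF t_app(1)] by simp
  show ?case
    unfolding ren_tm.simps
    by (rule tm_int_App_comp[OF t_app.prems(3,1) wf t_app(1) typing_ren_tm[OF t_app(1)
        t_app.prems(1,2)]
          t_app(2) typing_ren_tm[OF t_app(2) t_app.prems(1,2)] t_app.IH(1)[OF t_app.prems]
              t_app.IH(2)[OF t_app.prems]])
next
  case (t_tlam n \<Delta> t T)
  have wf: "wf_ctx n \<Delta>" "wf_ctx (Suc n) (map weaken_ty \<Delta>')" using typing_wf[OF t_tlam(1)]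
      t_tlam.prems(1) by simp_all
  have r: "wf_ren (map weaken_ty \<Delta>') \<rho> (map weaken_ty \<Delta>)" by (rule wf_ren_map[OF t_tlam.prems(2)])
  have "tm_int R (Suc n) (map weaken_ty \<Delta>') (ren_tm \<rho> t) = rcomp R (tm_int R (Suc n) (map weaken_ty
      \<Delta>) t) (wk n \<theta>)"
  proof (rule t_tlam.IH[OF wf(2) r ctx_map_weaken[OF t_tlam.prems(3,1) wf(1)]])
    fix i assume i: "i < length (map weaken_ty \<Delta>)"
    then have "\<rho> i < length \<Delta>'" using t_tlam.prems(2) by (simp add: wf_ren_def)
    then show "var_int R (Suc n) (map weaken_ty \<Delta>') (\<rho> i) = rcomp R (var_int R (Suc n) (map
        weaken_ty \<Delta>) i) (wk n \<theta>)"
      using i var_int_wk_comp[OF t_tlam.prems(3) wf(1)] var_int_weaken_ty[OF t_tlam.prems(1)]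
          t_tlam.prems(4) by simp
  qed
  then show ?case
    unfolding ren_tm.simps
    by (rule tm_int_TLam_comp[OF t_tlam.prems(3,1) wf(1) t_tlam(1) typing_ren_tm[OF t_tlam(1) wf(2)
        r]])
next
  case (t_tapp n \<Delta> t T S)
  have wf: "wf_ctx n \<Delta>" using typing_wf[OF t_tapp(1)] by simp
  show ?case
    unfolding ren_tm.simps
    by (rule tm_int_TApp_comp[OF t_tapp.prems(3,1) wf t_tapp(1) typing_ren_tm[OF t_tapp(1)
        t_tapp.prems(1,2)] t_tapp(2)
          t_tapp.IH[OF t_tapp.prems]])
qed

text \<open>The first projection agrees with the renaming \<open>Suc\<close> on variables by the
  very definition of \<open>var_int\<close>.\<close>

lemma tm_int_ren_Suc:
  assumes t: "typing n \<Delta> t T" and S: "wf_ty n S"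
  shows "tm_int R n (S # \<Delta>) (ren_tm Suc t) = rcomp R (tm_int R n \<Delta> t) (rfst R n (ctx_int R n \<Delta>)
      (ty_int R n S))"
proof (rule tm_int_ren_tm[OF t _ wf_ren_Suc])
  have wf: "wf_ctx n \<Delta>" using typing_wf[OF t] by simp
  then show "wf_ctx n (S # \<Delta>)" using S by simp
  show "ctx_map n (S # \<Delta>) \<Delta> (rfst R n (ctx_int R n \<Delta>) (ty_int R n S))"
    by (simp add: ctx_map_def is_relnat_rfst is_relfun_ctx_int[OF wf] is_relfun_ty_int[OF S])
qed simp

lemma tm_int_sub_tm:
  "\<lbrakk>typing n \<Delta> t T; wf_ctx n \<Delta>'; typed_sub n \<Delta>' \<sigma> \<Delta>; ctx_map n \<Delta>' \<Delta> \<theta>;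
    \<And>i. i < length \<Delta> \<Longrightarrow> tm_int R n \<Delta>' (\<sigma> i) = rcomp R (var_int R n \<Delta> i) \<theta>\<rbrakk> \<Longrightarrow>
    tm_int R n \<Delta>' (sub_tm \<sigma> t) = rcomp R (tm_int R n \<Delta> t) \<theta>"
proof (induction arbitrary: \<Delta>' \<sigma> \<theta> rule: typing.induct)
  case (t_var \<Delta> n i)
  then show ?case by simp
next
  case (t_lam n S \<Delta> t T)
  have S: "wf_ty n S" and wf: "wf_ctx n \<Delta>" "wf_ctx n (S # \<Delta>')"
    using typing_wf[OF t_lam(1)] t_lam.prems(1) by simp_all
  note \<sigma> = typed_sub_up[OF t_lam.prems(2) wf(2)]
  have "tm_int R n (S # \<Delta>') (sub_tm (up_sub_tm \<sigma>) t) = rcomp R (tm_int R n (S # \<Delta>) t) (ctx_up n \<Delta>'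
      S \<theta>)"
  proof (rule t_lam.IH[OF wf(2) \<sigma> ctx_map_up[OF t_lam.prems(3,1) wf(1) S]])
    fix i assume i: "i < length (S # \<Delta>)"
    show "tm_int R n (S # \<Delta>') (up_sub_tm \<sigma> i) = rcomp R (var_int R n (S # \<Delta>) i) (ctx_up n \<Delta>' S \<theta>)"
    proof (cases i)
      case 0
      then show ?thesis
        using rsnd_ctx_up[OF t_lam.prems(3,1) wf(1) S] by (simp add: up_sub_tm_def)
    next
      case (Suc j)
      then have "typing n \<Delta>' (\<sigma> j) (\<Delta> ! j)" using i t_lam.prems(2) by (simp add: typed_sub_def)
      from tm_int_ren_Suc[OF this S] show ?thesis
        using i Suc var_int_ctx_up[OF t_lam.prems(3,1) wf(1) S, of "\<lambda>i. tm_int R n \<Delta>' (\<sigma> i)" j]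
            t_lam.prems(4)
        by (simp add: up_sub_tm_def)
    qed
  qed
  then show ?case
    unfolding sub_tm.simps
    by (rule tm_int_Lam_comp[OF t_lam.prems(3,1) wf(1) t_lam(1) typing_sub_tm[OF t_lam(1) wf(2) \<sigma>]])
next
  case (t_app n \<Delta> t S T u)
  have wf: "wf_ctx n \<Delta>" using typing_wf[OF t_app(1)] by simp
  show ?case
    unfolding sub_tm.simps
    by (rule tm_int_App_comp[OF t_app.prems(3,1) wf t_app(1) typing_sub_tm[OF t_app(1)
        t_app.prems(1,2)]
          t_app(2) typing_sub_tm[OF t_app(2) t_app.prems(1,2)] t_app.IH(1)[OF t_app.prems]
              t_app.IH(2)[OF t_app.prems]])
next
  case (t_tlam n \<Delta> t T)
  have wf: "wf_ctx n \<Delta>" "wf_ctx (Suc n) (map weaken_ty \<Delta>')" using typing_wf[OF t_tlam(1)]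
      t_tlam.prems(1) by simp_all
  note \<sigma> = typed_sub_weaken[OF t_tlam.prems(2)]
  have "tm_int R (Suc n) (map weaken_ty \<Delta>') (sub_tm (\<lambda>i. weaken_ty_tm (\<sigma> i)) t)
      = rcomp R (tm_int R (Suc n) (map weaken_ty \<Delta>) t) (wk n \<theta>)"
  proof (rule t_tlam.IH[OF wf(2) \<sigma> ctx_map_weaken[OF t_tlam.prems(3,1) wf(1)]])
    fix i assume i: "i < length (map weaken_ty \<Delta>)"
    then have "typing n \<Delta>' (\<sigma> i) (\<Delta> ! i)" using t_tlam.prems(2) by (simp add: typed_sub_def)
    \<comment> \<open>Under a type abstraction the substituted terms are weakened in their types; by
      the result on type substitution this is whiskering along \<open>wks n\<close>.\<close>
    from tm_int_weaken_ty_tm[OF this]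
    show "tm_int R (Suc n) (map weaken_ty \<Delta>') (weaken_ty_tm (\<sigma> i))
        = rcomp R (var_int R (Suc n) (map weaken_ty \<Delta>) i) (wk n \<theta>)"
      using i var_int_wk_comp[OF t_tlam.prems(3) wf(1)] t_tlam.prems(4) by simp
  qed
  then show ?case
    unfolding sub_tm.simps
    by (rule tm_int_TLam_comp[OF t_tlam.prems(3,1) wf(1) t_tlam(1) typing_sub_tm[OF t_tlam(1) wf(2)
        \<sigma>]])
next
  case (t_tapp n \<Delta> t T S)
  have wf: "wf_ctx n \<Delta>" using typing_wf[OF t_tapp(1)] by simp
  show ?case
    unfolding sub_tm.simps
    by (rule tm_int_TApp_comp[OF t_tapp.prems(3,1) wf t_tapp(1) typing_sub_tm[OF t_tapp(1)
        t_tapp.prems(1,2)] t_tapp(2)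
          t_tapp.IH[OF t_tapp.prems]])
qed

section \<open>Soundness\<close>

lemma tm_int_beta:
  assumes t: "typing n (S # \<Delta>) t T" and u: "typing n \<Delta> u S"
  shows "tm_int R n \<Delta> (App (Lam S t) u) = tm_int R n \<Delta> (sub_tm (case_nat u Var) t)"
proof -
  interpret cc: ccc "fcc n" by (rule ccc_fcc)
  have wf: "wf_ctx n \<Delta>" "wf_ty n S" using typing_wf[OF t] by simp_all
  note G = is_relfun_ctx_int[OF wf(1)] and SR = is_relfun_ty_int[OF wf(2)]
    and tD = tm_int_in[OF t] and uD = tm_int_in[OF u]
  let ?G = "ctx_int R n \<Delta>" and ?S = "ty_int R n S" and ?u = "tm_int R n \<Delta> u"
  \<comment> \<open>The map of contexts that realises the substitution: the identity of the old
    context paired with the argument.\<close>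
  define \<theta> where "\<theta> = rpair R n (rid R ?G) ?u"
  have p: "is_relnat R n \<theta>" "rdom \<theta> = ?G" "rcod \<theta> = rprod R n ?G ?S"
    unfolding \<theta>_def using is_relnat_rpair[OF is_relnat_rid[OF G], of ?u] uD by simp_all
  have s: "rcomp R (rsnd R n ?G ?S) \<theta> = ?u" "rcomp R (rfst R n ?G ?S) \<theta> = rid R ?G"
    unfolding \<theta>_def
    using cc.psnd_ppair[of "rid R ?G" ?u ?G ?S] cc.pfst_ppair[of "rid R ?G" ?u ?G ?S] uD
        is_relnat_rid[OF G]
    by (simp_all add: fcc_sel)
  have "tm_int R n \<Delta> (sub_tm (case_nat u Var) t) = rcomp R (tm_int R n (S # \<Delta>) t) \<theta>"
  proof (rule tm_int_sub_tm[OF t wf(1) typed_sub_inst[OF u]])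
    show "ctx_map n \<Delta> (S # \<Delta>) \<theta>" using p by (simp add: ctx_map_def)
    fix i assume i: "i < length (S # \<Delta>)"
    show "tm_int R n \<Delta> (case_nat u Var i) = rcomp R (var_int R n (S # \<Delta>) i) \<theta>"
    proof (cases i)
      case (Suc j)
      note v = var_int_in[OF wf(1), of j]
      have "rcomp R (rcomp R (var_int R n \<Delta> j) (rfst R n ?G ?S)) \<theta> = rcomp R (var_int R n \<Delta> j)
          (rcomp R (rfst R n ?G ?S) \<theta>)"
        by (rule relnat_rcomp_assoc[of n]) (use i Suc v p is_relnat_rfst[OF G SR] in simp_all)
      then show ?thesis using i Suc v s relnat_rcomp_rid[of n "var_int R n \<Delta> j" ?G] by simp
    qed (simp add: s)
  qed
  \<comment> \<open>\<open>evl_cur_ppair\<close> expects a transpose composed with a map, so the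
    identity of the context is inserted.\<close>
  moreover have "rcurry R n ?G ?S (ty_int R n T) (tm_int R n (S # \<Delta>) t) = rcomp R (rcurry R n ?G ?S
      (ty_int R n T) (tm_int R n (S # \<Delta>) t)) (rid R ?G)"
    by (rule relnat_rcomp_rid(1)[of n, symmetric]) (use tD G SR in \<open>simp_all add: is_relnat_rcurry\<close>)
  ultimately show ?thesis
    using cc.evl_cur_ppair[of "tm_int R n (S # \<Delta>) t" ?G ?S "ty_int R n T" "rid R ?G" ?u] tD uD G SR
        is_relnat_rid[OF G]
      typing_the_ty[OF t]
    by (simp add: fcc_sel \<theta>_def)
qed

lemma tm_int_eta:
  assumes t: "typing n \<Delta> t (Fun S T)"
  shows "tm_int R n \<Delta> (Lam S (App (ren_tm Suc t) (Var 0))) = tm_int R n \<Delta> t"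
proof -
  interpret cc: ccc "fcc n" by (rule ccc_fcc)
  have wf: "wf_ctx n \<Delta>" "wf_ty n S" "wf_ty n T" using typing_wf[OF t] by simp_all
  note G = is_relfun_ctx_int[OF wf(1)] and SR = is_relfun_ty_int[OF wf(2)] and TR =
      is_relfun_ty_int[OF wf(3)]
    and tD = tm_int_in[OF t]
  let ?G = "ctx_int R n \<Delta>" and ?S = "ty_int R n S" and ?T = "ty_int R n T" and ?t = "tm_int R n \<Delta> t"
  \<comment> \<open>The body of the eta expansion evaluates the product map of \<open>?t\<close>
    with an identity, so its transpose is \<open>?t\<close> by \<open>cur_eta\<close>.\<close>
  have "rpair R n (rcomp R ?t (rfst R n ?G ?S)) (rsnd R n ?G ?S) = pmap (fcc n) ?t (rid R ?S)"
    using tD relnat_rcomp_rid(2)[OF is_relnat_rsnd[OF G SR]] by (simp add: pmap_def fcc_sel)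
  then show ?thesis
    using cc.cur_eta[of ?t ?S ?T ?G] tD SR TR typing_the_ty[OF typing_eta(1)[OF t]]
        tm_int_ren_Suc[OF t wf(2)]
    by (simp add: fcc_sel)
qed

text \<open>Once both factors of the type application stand under one whiskering, they cancel by
  \<open>counit_tlam\<close>, and the whiskering of the remaining body is a type substitution by
  \<open>tm_int_sub_ty_tm\<close>.\<close>

lemma tm_int_tbeta:
  assumes t: "typing (Suc n) (map weaken_ty \<Delta>) t T" and S: "wf_ty n S"
  shows "tm_int R n \<Delta> (TApp (TLam t) S) = tm_int R n \<Delta> (sub_ty_tm (case_nat S TVar) t)"
proof -
  have wf: "wf_ctx n \<Delta>" using typing_wf[OF t] by simp
  note G = is_relfun_ctx_int[OF wf] and SR = is_relfun_ty_int[OF S] and tD = tm_int_in[OF t,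
      unfolded ctx_int_weaken_ty[OF wf]]
  have TR: "is_relfun R (Suc n) (ty_int R (Suc n) T)" using typing_wf[OF t] by (simp add:
      is_relfun_ty_int)
  note i = relfuns_inst[OF SR]
  let ?t = "tm_int R (Suc n) (map weaken_ty \<Delta>) t" and ?G = "ctx_int R n \<Delta>" and ?i = "ids n @
      [ty_int R n S]"
    and ?c = "counit n (ty_int R (Suc n) T)"
  have l: "is_relnat R n (tlam n ?G ?t)" "rdom (tlam n ?G ?t) = ?G" "rcod (tlam n ?G ?t) = rall n
      (ty_int R (Suc n) T)"
    using is_relnat_tlam[OF G] tlam_sel[OF G] tD by simp_all
  \<comment> \<open>Instantiation after weakening is the identity; read backwards, this brings the
    transpose under the same whiskering as the counit.\<close>
  have "rwhisker R n (wk n (tlam n ?G ?t)) ?i = tlam n ?G ?t"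
    unfolding rwhisker_rwhisker[OF l(1) relfuns_wks i] map_inst_wks[OF SR] by (rule rwhisker_ids[OF
        l(1)])
  then have "tm_int R n \<Delta> (TApp (TLam t) S) = rcomp R (rwhisker R n ?c ?i) (rwhisker R n (wk n
      (tlam n ?G ?t)) ?i)"
    unfolding tm_int_TApp[OF typing.t_tlam[OF t]] using tm_int_TLam[OF wf] tD by simp
  also have "\<dots> = rwhisker R n (rcomp R ?c (wk n (tlam n ?G ?t))) ?i"
    by (rule rwhisker_rcomp[OF i, symmetric]) (simp_all add: is_relnat_counit[OF TR] counit_sel[OF
        TR] l is_relnat_wk)
  also have "rcomp R ?c (wk n (tlam n ?G ?t)) = ?t"
    using counit_tlam[OF G, of ?t] tD by simp
  also have "rwhisker R n ?t ?i = tm_int R n (map (\<lambda>T. inst_ty T S) (map weaken_ty \<Delta>)) (sub_ty_tm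
      (case_nat S TVar) t)"
    using tm_int_sub_ty_tm[OF t wf_sub_inst[OF S]] by (simp only: tys_inst)
  finally show ?thesis unfolding map_inst_weaken_ty .
qed

text \<open>The counit at the weakened type, instantiated at the new variable, is the original
  counit, so the claim becomes the law \<open>tlam_counit\<close> of the adjunction.\<close>

lemma tm_int_teta:
  assumes t: "typing n \<Delta> t (All T)"
  shows "tm_int R n \<Delta> (TLam (TApp (weaken_ty_tm t) (TVar 0))) = tm_int R n \<Delta> t"
proof -
  have wf: "wf_ctx n \<Delta>" and wfT: "wf_ty (Suc n) T" using typing_wf[OF t] by simp_all
  note G = is_relfun_ctx_int[OF wf] and TR = is_relfun_ty_int[OF wfT] and tD = tm_int_in[OF t]
    and t' = typing_teta[OF t]
  let ?p = "rproj R (Suc n) n" and ?c = "counit n (ty_int R (Suc n) T)" and ?t = "tm_int R n \<Delta> t"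
  have P: "is_relfun R (Suc n) ?p" by (simp add: is_relfun_rproj)
  have "ty_int R (Suc (Suc n)) (sub_ty (up_sub_ty (\<lambda>i. TVar (Suc i))) T)
      = rsubst R (Suc (Suc n)) (ty_int R (Suc n) T) (ups (Suc n) (wks n))"
    using ty_int_sub_ty[OF wfT wf_sub_up[OF wf_sub_weaken]] tys_up_sub_ty[OF wf_sub_weaken]
        tys_weaken by simp
  then have "rwhisker R (Suc n) (counit (Suc n) (ty_int R (Suc (Suc n)) (sub_ty (up_sub_ty (\<lambda>i.
      TVar (Suc i))) T))) (ids (Suc n) @ [?p])
      = rwhisker R (Suc n) (rwhisker R (Suc (Suc n)) ?c (ups (Suc n) (wks n))) (ids (Suc n) @ [?p])"
    by (simp only: rwhisker_counit[OF TR relfuns_wks])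
  also have "\<dots> = rwhisker R (Suc n) ?c (wks n @ [?p])"
    unfolding rwhisker_rwhisker[OF is_relnat_counit[OF TR] relfuns_ups[OF relfuns_wks]
        relfuns_inst[OF P]]
      map_inst_ups[OF relfuns_wks P] ..
  \<comment> \<open>Weakening extended by the last projection is the identity context map.\<close>
  also have "wks n @ [?p] = ids (Suc n)" by simp
  also have "rwhisker R (Suc n) ?c (ids (Suc n)) = ?c" by (rule rwhisker_ids[OF is_relnat_counit[OF
      TR]])
  finally have "tm_int R (Suc n) (map weaken_ty \<Delta>) (TApp (weaken_ty_tm t) (TVar 0)) = rcomp R ?c
      (wk n ?t)"
    unfolding tm_int_TApp[OF t'] tm_int_weaken_ty_tm[OF t] by simp
  moreover have "is_relnat R (Suc n) (rcomp R ?c (wk n ?t))"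
    using tD is_relnat_counit[OF TR] counit_sel[OF TR]
    by (intro is_relnat_rcomp) (simp_all add: is_relnat_wk ty_int_All del: ty_int.simps)
  ultimately have "tm_int R n \<Delta> (TLam (TApp (weaken_ty_tm t) (TVar 0))) = tlam n (ctx_int R n \<Delta>)
      (rcomp R ?c (wk n ?t))"
    using tm_int_TLam[OF wf, of "TApp (weaken_ty_tm t) (TVar 0)"] by simp
  also have "\<dots> = ?t"
    by (rule tlam_counit[OF _ _ _ TR]) (use tD in \<open>simp_all add: ty_int_All del: ty_int.simps\<close>)
  finally show ?thesis .
qed

text \<open>The congruence rules need care because the interpretation branches on
  \<open>the_ty\<close>; by \<open>beta_eta_typing\<close> and uniqueness of types both sides take
  the same branch.\<close>

lemma tm_int_sound: "beta_eta n \<Delta> s t T \<Longrightarrow> tm_int R n \<Delta> s = tm_int R n \<Delta> t"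
proof (induction rule: beta_eta.induct)
  case (e_lam n S \<Delta> s t T)
  then show ?case using beta_eta_typing[OF e_lam(1), THEN conjunct1, THEN typing_the_ty]
      beta_eta_typing[OF e_lam(1), THEN conjunct2, THEN typing_the_ty] by simp
next
  case (e_app n \<Delta> s t S T u v)
  then show ?case using beta_eta_typing[OF e_app(1), THEN conjunct1, THEN typing_the_ty]
      beta_eta_typing[OF e_app(1), THEN conjunct2, THEN typing_the_ty] by simp
next
  case (e_tapp n \<Delta> s t T S)
  then show ?case using beta_eta_typing[OF e_tapp(1), THEN conjunct1, THEN typing_the_ty]
      beta_eta_typing[OF e_tapp(1), THEN conjunct2, THEN typing_the_ty] by simp
qed (simp_all add: tm_int_beta tm_int_eta tm_int_tbeta tm_int_teta del: tm_int.simps, simp_all)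

end

text \<open>Objects and arrows of \<open>FunCat R n\<close> are by definition the face map- and
  degeneracy-preserving functors and natural transformations, so membership in
  \<open>FunCat R n\<close> expresses the claims about types and terms.\<close>

theorem theorem27:
  fixes R :: "('o, 'a) model_data"
  assumes "parametric_model R"
  shows "(\<forall>n T. wf_ty n T \<longrightarrow> ty_int R n T \<in> Obj (FunCat R n)) \<and>
    (\<forall>n \<Delta> t T. typing n \<Delta> t T \<longrightarrow>
       tm_int R n \<Delta> t \<in> hom (FunCat R n) (ctx_int R n \<Delta>) (ty_int R n T)) \<and>
    (\<forall>n \<Delta> s t T. beta_eta n \<Delta> s t T \<longrightarrow> tm_int R n \<Delta> s = tm_int R n \<Delta> t)"
proof -
  interpret model R by unfold_locales (rule assms)
  show ?thesis
    using is_relfun_ty_int tm_int_in tm_int_sound by (auto simp: hom_FunCat) (simp add: FunCat_def)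
qed

end
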